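(* Let $j$ be a QS flow on $\mathsf A$. Let $Y$ be a locally uniformly bounded multiplier cocycle for $j$ and suppose that the associated QS cocycle $k:=(j_t(\cdot)Y_t)_{t\ge0}$ satisfies the condition $$\limsup_{t\to0^+}t^{-1/2}\Big\{\|k_{t,\varepsilon}-\iota^{\mathsf A}_{\mathcal F,\varepsilon}\|_{\rm cb}+\|k^\dagger_{t,\varepsilon}-\iota^{\mathsf A}_{\mathcal F,\varepsilon}\|_{\rm cb}\Big\}<\infty\qquad(\varepsilon\in\mathcal E).$$ Then $Y=Y^{j,F}$ for a unique operator $F\in B(\widehat{\mathsf k})\,\overline\otimes\,\mathsf A$.
   Context: All Hilbert spaces are complex, with inner products linear in the second argument. $\mathsf A$ is a von Neumann algebra acting faithfully on a Hilbert space $\mathfrak h$; $\mathsf k$ is a Hilbert space and $\widehat{\mathsf k}:=\mathbb C\oplus\mathsf k$; $\widehat c:=(1,c)$ for $c\in\mathsf k$, $\widehat f(s):=\widehat{f(s)}$. $\underline\otimes$ and $\overline\otimes$ denote algebraic and ultraweak tensor products. $\Delta:=\begin{bmatrix}0&0\\0&I_{\mathsf k}\end{bmatrix}\in B(\widehat{\mathsf k})$, $\Delta^\perp:=I-\Delta$; their ampliations are denoted in the same way. Fock space: for a subinterval $J$ of $\mathbb R_+$, $\mathcal F_J$ is the symmetric Fock space over $L^2(J;\mathsf k)$, $\mathsf N_J:=B(\mathcal F_J)$, $I_J$ is the identity on $\mathcal F_J$; subscripts are omitted for $J=\mathbb R_+$; $\mathcal F=\mathcal F_{[0,t[}\otimes\mathcal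 F_{[t,\infty[}$. $\mathbb S$ is the space of right-continuous step functions in $L^2(\mathbb R_+;\mathsf k)$; $f_J$ equals $f$ on $J$ and $0$ elsewhere; $\varpi(f):=e^{-\|f\|^2/2}\big((n!)^{-1/2}f^{\otimes n}\big)_{n\ge0}$; $\mathcal E$ is the linear span of $\{\varpi(f):f\in\mathbb S\}$. $E_u$ denotes $|u\rangle$ tensored with identity operators (e.g. for $\varepsilon\in\mathcal E$, $E_\varepsilon:\mathfrak h\to\mathfrak h\otimes\mathcal F$, $v\mapsto v\otimes\varepsilon$) and $E^u:=(E_u)^*$. Processes: an (operator) process on $\mathfrak h$ is a family $X=(X_t)_{t\ge0}$ of (possibly unbounded) operators on $\mathfrak h\otimes\mathcal F$ with domain $\mathfrak h\underline\otimes\mathcal E$ that is weakly measurable in $t$ and adapted: $E^{\varpi(f)}X_tE_{\varpi(g)}=\langle\varpi(f_{[t,\infty[}),\varpi(g_{[t,\infty[})\rangle E^{\varpi(f_{[0,t[})}X_tE_{\varpi(g_{[0,t[})}$ for $f,g\in\mathbb S$; it is a process in $\mathsf A$ if $E^{\varpi(f)}X_tE_{\varpi(g)}\in\mathsf A$ for all $f,g,t$, and is bounded if each $X_t$ is bounded (then identified with its extension to $\mathfrak h\otimes\mathcal F$); it is locally uniformly bounded if $\sup_{t\le T}\|X_t\|<\infty$ for all $T$. A (mapping) process on $\mathsf A$ is a family $k=(k_t)_{t\ge0}$ of linear maps on $\mathsf A$ with $(k_t(a))_{t\ge0}$ a process in $\mathsf A$ for each $a$. If $k$ is normal and completely bounded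 (i.e. each $k_t$ is), then $k_r(a)=k_{r)}(a)\otimes I_{[r,\infty[}$ with $k_{r)}:\mathsf A\to\mathsf A\overline\otimes\mathsf N_{[0,r[}$; put $\widehat k_r:=k_{r)}\overline\otimes\operatorname{id}_{\mathsf N_{[r,\infty[}}$ and $\widetilde k_t:=\operatorname{id}_{B(\widehat{\mathsf k})}\overline\otimes k_t$. Let $T_r:\mathcal F\to\mathcal F_{[r,\infty[}$ be the unitary with $\varpi(f)\mapsto\varpi(f_r)$, $f_r(s)=f(s-r)$, and $\sigma_r:\mathsf A\overline\otimes\mathsf N\to\mathsf A\overline\otimes\mathsf N_{[r,\infty[}$ the normal *-isomorphism with $a\otimes z\mapsto a\otimes T_rzT_r^*$. $k$ is a QS cocycle if $k_0=\iota^{\mathsf A}_{\mathcal F}$, where $\iota^{\mathsf A}_{\mathcal F}(a)=a\otimes I_{\mathcal F}$, and $k_{r+t}=\widehat k_r\circ\sigma_r\circ k_t$ for all $r,t\ge0$; it is a QS flow if moreover it is pointwise ultraweakly continuous in $t$, *-homomorphic and unital. For the QS flow $j$ put $J_t:=\widehat\jmath_t\circ\sigma_t$, a semigroup of normal unital *-endomorphisms of $\mathsf A\overline\otimes\mathsf N$. A multiplier cocycle for $j$ is a bounded process $Y$ in $\mathsf A$ with $Y_0=I_{\mathfrak h\otimes\mathcal F}$ and $Y_{s+t}=J_s(Y_t)Y_s$ for all $s,t\ge0$. For $\varepsilon\in\mathcal E$: $\iota^{\mathsf A}_{\mathcal F,\varepsilon}:=\iota^{\mathsf A}_{\mathcal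 F}(\cdot)E_\varepsilon$, $k_{t,\varepsilon}:=k_t(\cdot)E_\varepsilon$, $k_t^\dagger(a):=k_t(a^* )^*$ and $k^\dagger_{t,\varepsilon}:=k_t^\dagger(\cdot)E_\varepsilon$ (maps from $\mathsf A$ to $B(\mathfrak h;\mathfrak h\otimes\mathcal F)$). QS integrals: for an operator process $X$, $\widetilde X_t:=I_{\widehat{\mathsf k}}\underline\otimes X_t$. $\widehat\nabla_s$ is the linear operator with domain $\mathfrak h\underline\otimes\mathcal E$, $\widehat\nabla_s(u\varpi(f))=\widehat f(s)u\varpi(f)$. A family $G=(G_t)_{t\ge0}$ of operators on $\widehat{\mathsf k}\otimes\mathfrak h\otimes\mathcal F$ is QS integrable if, for all $\zeta\in\mathfrak h\underline\otimes\mathcal E$: $\widehat\nabla_t\zeta\in\operatorname{Dom}G_t$ for all $t$; $s\mapsto\Delta^\perp G_s\widehat\nabla_s\zeta$ is locally integrable; $s\mapsto\Delta G_s\widehat\nabla_s\zeta$ is locally square-integrable; and $E^{\varpi(f)}G_t\widehat\nabla_tE_{\varpi(g)}=\langle\varpi(f_{[t,\infty[}),\varpi(g_{[t,\infty[})\rangle E^{\widehat f(t)\varpi(f_{[0,t[})}G_tE_{\widehat g(t)\varpi(g_{[0,t[})}$ for $f,g\in\mathbb S$. Its QS integral is the continuous operator process determined by $\langle\zeta',\int_0^tG_s\,d\Lambda_s\,\zeta\rangle=\int_0^t\langle\widehat\nabla_s\zeta',G_s\widehat\nabla_s\zeta\rangle\,ds$ for $\zeta,\zeta'\in\mathfrak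 h\underline\otimes\mathcal E$. Perturbation processes: for $F\in B(\widehat{\mathsf k})\overline\otimes\mathsf A$, $Y^{j,F}$ denotes the unique strong solution of $Y_0=I$, $dY_t=\widetilde\jmath_t(F)\widetilde Y_t\,d\Lambda_t$, i.e. the unique operator process $Y$ such that $(\widetilde\jmath_t(F)\widetilde Y_t)_{t\ge0}$ is QS integrable and $Y_t=I+\int_0^t\widetilde\jmath_s(F)\widetilde Y_s\,d\Lambda_s$ for all $t$ (it exists for every $F$). *)

theory Defs
  imports "HOL-Analysis.Analysis" "HOL-Combinatorics.Permutations"
begin

section \<open>Positive semidefinite kernels\<close>

definition psd :: "'i set \<Rightarrow> ('i \<Rightarrow> 'i \<Rightarrow> complex) \<Rightarrow> bool"
  where "psd I K \<longleftrightarrow> (\<forall>i\<in>I. \<forall>j\<in>I. K i j = cnj (K j i)) \<and>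
    (\<forall>c. 0 \<le> Re (\<Sum>i\<in>I. \<Sum>j\<in>I. cnj (c i) * c j * K i j))"

lemma psdD1: "psd I K \<Longrightarrow> i \<in> I \<Longrightarrow> j \<in> I \<Longrightarrow> K i j = cnj (K j i)"
  unfolding psd_def by blast

lemma psdD2: "psd I K \<Longrightarrow> 0 \<le> Re (\<Sum>i\<in>I. \<Sum>j\<in>I. cnj (c i) * c j * K i j)"
  unfolding psd_def by blast

lemma psd_insert_form:
  fixes K :: "'i \<Rightarrow> 'i \<Rightarrow> complex"
  assumes fin: "finite J" and p: "p \<notin> J" and K: "psd (insert p J) K"
    and s: "s = (\<Sum>j\<in>J. d j * K p j)"
  shows "0 \<le> Re ((\<Sum>i\<in>J. \<Sum>j\<in>J. cnj (d i) * d j * K i j) + e * cnj s + cnj e * s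
    + cnj e * e * K p p)"
proof -
  define c where "c = d(p := e)"
  have cJ: "c i = d i" if "i \<in> J" for i using that p by (auto simp: c_def)
  have cp: "c p = e" by (simp add: c_def)
  have s': "cnj s = (\<Sum>i\<in>J. cnj (d i) * K i p)"
    unfolding s by (auto simp: intro!: sum.cong psdD1[OF K, symmetric])
  have "(\<Sum>i\<in>insert p J. \<Sum>j\<in>insert p J. cnj (c i) * c j * K i j)
    = (\<Sum>i\<in>J. \<Sum>j\<in>J. cnj (d i) * d j * K i j) + e * cnj s + cnj e * s + cnj e * e * K p p"
    unfolding s' unfolding s using fin p
    by (simp add: cp sum.distrib sum_distrib_left cJ algebra_simps cong: sum.cong)
  with psdD2[OF K, of c] show ?thesis by simp
qed

lemma psd_subset:
  assumes "psd J K" "I \<subseteq> J" "finite J"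
  shows "psd I K"
proof -
  have "0 \<le> Re (\<Sum>i\<in>I. \<Sum>j\<in>I. cnj (c i) * c j * K i j)" for c
  proof -
    define d where "d i = (if i \<in> I then c i else 0)" for i
    have "(\<Sum>i\<in>J. \<Sum>j\<in>J. cnj (d i) * d j * K i j) = (\<Sum>i\<in>I. \<Sum>j\<in>I. cnj (c i) * c j * K i j)"
    proof (rule sum.mono_neutral_cong_right)
      show "(\<Sum>j\<in>J. cnj (d x) * d j * K x j) = (\<Sum>j\<in>I. cnj (c x) * c j * K x j)"
        if "x \<in> I" for x
        by (rule sum.mono_neutral_cong_right) (use assms that in \<open>auto simp: d_def\<close>)
    qed (use assms in \<open>auto simp: d_def\<close>)
    with psdD2[OF assms(1), of d] show ?thesis by simp
  qed
  with assms show ?thesis unfolding psd_def by blast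
qed

lemma psd_gram:
  assumes "finite I" "psd I K"
  shows "\<exists>(n::nat) v. \<forall>i\<in>I. \<forall>j\<in>I. K i j = (\<Sum>a<n. cnj (v a i) * v a j)"
  using assms
proof (induction I arbitrary: K rule: finite_induct)
  case empty
  then show ?case by auto
next
  case (insert p J)
  note K = insert.prems
  have ne: "x \<noteq> p" if "x \<in> J" for x
    using insert.hyps that by auto
  have diag: "Im (K p p) = 0"
    using arg_cong[OF psdD1[OF K, of p p], of Im] by simp
  have diag0: "0 \<le> Re (K p p)"
    using psd_insert_form[OF insert.hyps K refl, of "\<lambda>_. 0" 1] by simp
  define k where "k = Re (K p p)"
  have Kpp: "K p p = of_real k" using diag by (simp add: k_def complex_eq_iff)
  have herm: "K i j = cnj (K j i)" if "i \<in> insert p J" "j \<in> insert p J" for i j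
    using psdD1[OF K that] .
  show ?case
  proof (cases "k = 0")
    case True
    have z: "K p q = 0" if q: "q \<in> J" for q
    proof -
      define d :: "'a \<Rightarrow> complex" where "d j = (if j = q then 1 else 0)" for j
      have s: "(\<Sum>j\<in>J. d j * K p j) = K p q"
        using insert.hyps q by (subst sum.cong[OF refl, where h = "\<lambda>j. if j = q then K p q else 0"])
          (auto simp: d_def)
      define B where "B = Re (\<Sum>i\<in>J. \<Sum>j\<in>J. cnj (d i) * d j * K i j)"
      have "0 \<le> B - 2 * t * (cmod (K p q))\<^sup>2" for t :: real
      proof -
        have *: "K p q * cnj (K p q) = of_real ((cmod (K p q))\<^sup>2)"
          by (simp add: complex_norm_square[symmetric])
        have "Re (- of_real t * K p q * cnj (K p q)) = - t * (cmod (K p q))\<^sup>2"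
          unfolding mult.assoc * by simp
        then show ?thesis
        using psd_insert_form[OF insert.hyps K refl, of d "- of_real t * K p q"]
        unfolding s Kpp True by (simp add: B_def algebra_simps)
      qed
      from this[of "(B + 1) / (2 * (cmod (K p q))\<^sup>2)"] show ?thesis
        by (cases "K p q = 0") (simp_all add: field_simps)
    qed
    have "psd J K" by (rule psd_subset[OF K]) (use insert.hyps in auto)
    from insert.IH[OF this] obtain n :: nat and v where
      v: "\<And>i j. i \<in> J \<Longrightarrow> j \<in> J \<Longrightarrow> K i j = (\<Sum>a<n. cnj (v a i) * v a j)" by blast
    define w where "w a = (v a)(p := 0)" for a
    have z': "K q p = 0" if "q \<in> J" for q
      by (subst herm) (use that z in auto)
    have "K i j = (\<Sum>a<n. cnj (w a i) * w a j)" if "i \<in> insert p J" "j \<in> insert p J" for i j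
      using that z z' v Kpp True insert.hyps
      by (auto simp: w_def ne)
    then show ?thesis by blast
  next
    case False
    with diag0 have k: "k > 0" by (simp add: k_def)
    define L where "L i j = K i j - K i p * K p j / of_real k" for i j
    have "psd J L"
      unfolding psd_def
    proof (intro conjI ballI allI)
      show "L i j = cnj (L j i)" if "i \<in> J" "j \<in> J" for i j
        using herm[of i j] herm[of i p] herm[of p j] that by (simp add: L_def)
      show "0 \<le> Re (\<Sum>i\<in>J. \<Sum>j\<in>J. cnj (d i) * d j * L i j)" for d
      proof -
        define s where "s = (\<Sum>j\<in>J. d j * K p j)"
        have s': "cnj s = (\<Sum>i\<in>J. cnj (d i) * K i p)"
          unfolding s_def by (auto simp: intro!: sum.cong herm[symmetric])
        have "(\<Sum>i\<in>J. \<Sum>j\<in>J. cnj (d i) * d j * L i j)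
          = (\<Sum>i\<in>J. \<Sum>j\<in>J. cnj (d i) * d j * K i j)
            - (\<Sum>i\<in>J. \<Sum>j\<in>J. (cnj (d i) * K i p) * (d j * K p j)) / of_real k"
          by (simp add: L_def sum_subtractf sum_divide_distrib algebra_simps)
        also have "(\<Sum>i\<in>J. \<Sum>j\<in>J. (cnj (d i) * K i p) * (d j * K p j)) = cnj s * s"
          unfolding s' unfolding s_def by (simp add: sum_product)
        finally have eq: "(\<Sum>i\<in>J. \<Sum>j\<in>J. cnj (d i) * d j * L i j)
          = (\<Sum>i\<in>J. \<Sum>j\<in>J. cnj (d i) * d j * K i j) - cnj s * s / of_real k" .
        have "(\<Sum>i\<in>J. \<Sum>j\<in>J. cnj (d i) * d j * K i j) + (- s / of_real k) * cnj s
          + cnj (- s / of_real k) * s + cnj (- s / of_real k) * (- s / of_real k) * K p p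
          = (\<Sum>i\<in>J. \<Sum>j\<in>J. cnj (d i) * d j * L i j)"
          unfolding eq Kpp using k by (simp add: field_simps)
        with psd_insert_form[OF insert.hyps K s_def, of "- s / of_real k"]
        show ?thesis by (simp only:)
      qed
    qed
    from insert.IH[OF this] obtain n :: nat and v where
      v: "\<And>i j. i \<in> J \<Longrightarrow> j \<in> J \<Longrightarrow> L i j = (\<Sum>a<n. cnj (v a i) * v a j)" by blast
    define w where "w a = (if a = n then (\<lambda>j. K p j / of_real (sqrt k)) else (v a)(p := 0))" for a
    have sq: "complex_of_real (sqrt k) * complex_of_real (sqrt k) = of_real k"
      using k by (simp flip: of_real_mult)
    have "K i j = (\<Sum>a<Suc n. cnj (w a i) * w a j)" if ij: "i \<in> insert p J" "j \<in> insert p J" for i j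
    proof -
      have "cnj (w n i) * w n j = cnj (K p i) * K p j / of_real k"
        by (simp add: w_def sq)
      also have "cnj (K p i) = K i p" using herm[of i p] ij by simp
      finally have 1: "cnj (w n i) * w n j = K i p * K p j / of_real k" .
      have "(\<Sum>a<n. cnj (w a i) * w a j) = (\<Sum>a<n. cnj (((v a)(p := 0)) i) * ((v a)(p := 0)) j)"
        by (intro sum.cong) (auto simp: w_def)
      also have "\<dots> = L i j"
        using ij v insert.hyps k by (auto simp: L_def Kpp ne)
      finally show ?thesis by (simp add: 1) (simp add: L_def)
    qed
    then show ?thesis by blast
  qed
qed

lemma psd_mult:
  assumes "finite I" "psd I K" "psd I L"
  shows "psd I (\<lambda>i j. K i j * L i j)"
proof -
  obtain n :: nat and v where
    v: "\<And>i j. i \<in> I \<Longrightarrow> j \<in> I \<Longrightarrow> K i j = (\<Sum>a<n. cnj (v a i) * v a j)"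
    using psd_gram[OF assms(1,2)] by blast
  have "0 \<le> Re (\<Sum>i\<in>I. \<Sum>j\<in>I. cnj (c i) * c j * (K i j * L i j))" for c
  proof -
    have "(\<Sum>i\<in>I. \<Sum>j\<in>I. cnj (c i) * c j * (K i j * L i j))
      = (\<Sum>i\<in>I. \<Sum>j\<in>I. \<Sum>a<n. cnj (v a i * c i) * (v a j * c j) * L i j)"
      by (intro sum.cong refl) (simp add: v sum_distrib_left sum_distrib_right algebra_simps)
    also have "\<dots> = (\<Sum>a<n. \<Sum>i\<in>I. \<Sum>j\<in>I. cnj (v a i * c i) * (v a j * c j) * L i j)"
      by (subst sum.swap[of _ "{..<n}"]) (intro sum.cong refl sum.swap)
    also have "Re \<dots> = (\<Sum>a<n. Re (\<Sum>i\<in>I. \<Sum>j\<in>I. cnj (v a i * c i) * (v a j * c j) * L i j))"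
      by simp
    also have "\<dots> \<ge> 0"
      by (intro sum_nonneg psdD2[OF assms(3)])
    finally show ?thesis .
  qed
  moreover have "K i j * L i j = cnj (K j i * L j i)" if "i \<in> I" "j \<in> I" for i j
    using psdD1[OF assms(2) that] psdD1[OF assms(3) that] by simp
  ultimately show ?thesis unfolding psd_def by blast
qed

lemma psd_prod:
  assumes "finite I" "finite B" "\<And>b. b \<in> B \<Longrightarrow> psd I (K b)"
  shows "psd I (\<lambda>i j. \<Prod>b\<in>B. K b i j)"
  using assms(2,3)
proof (induction B rule: finite_induct)
  case empty
  have "Re (\<Sum>i\<in>I. \<Sum>j\<in>I. cnj (c i) * c j) \<ge> 0" for c
  proof -
    have "(\<Sum>i\<in>I. \<Sum>j\<in>I. cnj (c i) * c j) = cnj (\<Sum>j\<in>I. c j) * (\<Sum>j\<in>I. c j)"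
      by (simp add: sum_product)
    also have "Re \<dots> \<ge> 0"
      by (subst mult.commute, subst complex_norm_square[symmetric]) simp
    finally show ?thesis .
  qed
  then show ?case by (simp add: psd_def)
next
  case (insert b B)
  then show ?case using assms(1) by (simp add: psd_mult)
qed

section \<open>Complex Hilbert spaces\<close>

class scaleC =
  fixes scaleC :: "complex \<Rightarrow> 'a \<Rightarrow> 'a"  (infixr \<open>*\<^sub>C\<close> 75)

class chilbert = banach + scaleC +
  fixes cinner :: "'a \<Rightarrow> 'a \<Rightarrow> complex"
  assumes scaleC_add_right: "c *\<^sub>C (x + y) = c *\<^sub>C x + c *\<^sub>C y"
    and scaleC_add_left: "(c + d) *\<^sub>C x = c *\<^sub>C x + d *\<^sub>C x"
    and scaleC_scaleC: "c *\<^sub>C d *\<^sub>C x = (c * d) *\<^sub>C x"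
    and scaleR_scaleC: "r *\<^sub>R x = complex_of_real r *\<^sub>C x"
    and cinner_commute: "cinner x y = cnj (cinner y x)"
    and cinner_add_right: "cinner x (y + z) = cinner x y + cinner x z"
    and cinner_scaleC_right: "cinner x (c *\<^sub>C y) = c * cinner x y"
    and norm_cinner: "complex_of_real ((norm x)\<^sup>2) = cinner x x"

lemma cinner_add_left: "cinner (x + y) z = cinner x z + cinner (y :: 'a::chilbert) z"
  by (metis cinner_add_right cinner_commute complex_cnj_add)

lemma cinner_scaleC_left: "cinner (c *\<^sub>C x) y = cnj c * cinner (x :: 'a::chilbert) y"
  by (metis cinner_commute cinner_scaleC_right complex_cnj_mult)

lemma cinner_zero_right [simp]: "cinner x (0 :: 'a::chilbert) = 0"
  using cinner_add_right[of x 0 0] by simp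

lemma cinner_zero_left [simp]: "cinner (0 :: 'a::chilbert) x = 0"
  using cinner_add_left[of 0 0 x] by simp

lemma cinner_sum_right: "cinner x (\<Sum>i\<in>I. f i) = (\<Sum>i\<in>I. cinner x (f i :: 'a::chilbert))"
  by (induction I rule: infinite_finite_induct) (auto simp: cinner_add_right)

lemma cinner_sum_left: "cinner (\<Sum>i\<in>I. f i) x = (\<Sum>i\<in>I. cinner (f i :: 'a::chilbert) x)"
  by (induction I rule: infinite_finite_induct) (auto simp: cinner_add_left)

lemma psd_cinner: "psd I (\<lambda>i j. cinner (x i) (x j :: 'a::chilbert))"
proof -
  have "0 \<le> Re (\<Sum>i\<in>I. \<Sum>j\<in>I. cnj (c i) * c j * cinner (x i) (x j))" for c
  proof -
    have "(\<Sum>i\<in>I. \<Sum>j\<in>I. cnj (c i) * c j * cinner (x i) (x j))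
      = cinner (\<Sum>i\<in>I. c i *\<^sub>C x i) (\<Sum>j\<in>I. c j *\<^sub>C x j)"
      unfolding cinner_sum_left
      by (simp add: cinner_sum_right cinner_scaleC_left cinner_scaleC_right
        sum_distrib_left mult.assoc mult.left_commute)
    then show ?thesis by (simp flip: norm_cinner)
  qed
  then show ?thesis unfolding psd_def using cinner_commute by blast
qed

instantiation complex :: chilbert
begin
definition scaleC_complex :: "complex \<Rightarrow> complex \<Rightarrow> complex" where "scaleC_complex c x = c * x"
definition cinner_complex :: "complex \<Rightarrow> complex \<Rightarrow> complex" where "cinner_complex x y = cnj x * y"
instance
proof
  show "complex_of_real ((norm x)\<^sup>2) = cinner x x" for x :: complex
    by (simp only: cinner_complex_def complex_norm_square mult.commute)
qed (auto simp: scaleC_complex_def cinner_complex_def algebra_simps scaleR_conv_of_real)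
end

instantiation prod :: (chilbert, chilbert) chilbert
begin
definition scaleC_prod :: "complex \<Rightarrow> 'a \<times> 'b \<Rightarrow> 'a \<times> 'b"
  where "scaleC_prod c x = (c *\<^sub>C fst x, c *\<^sub>C snd x)"
definition cinner_prod :: "'a \<times> 'b \<Rightarrow> 'a \<times> 'b \<Rightarrow> complex"
  where "cinner_prod x y = cinner (fst x) (fst y) + cinner (snd x) (snd y)"
instance
proof
  show "cinner x y = cnj (cinner y x)" for x y :: "'a \<times> 'b"
    unfolding cinner_prod_def complex_cnj_add by (metis cinner_commute)
  show "complex_of_real ((norm x)\<^sup>2) = cinner x x" for x :: "'a \<times> 'b"
    by (simp add: cinner_prod_def norm_prod_def flip: norm_cinner)
qed (auto simp: scaleC_prod_def cinner_prod_def scaleC_add_right scaleC_add_left scaleC_scaleC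
  cinner_add_right cinner_scaleC_right scaleR_prod_def scaleR_scaleC algebra_simps)
end

section \<open>The Hilbert space of a positive semidefinite kernel\<close>

text \<open>
  \<open>'a hilb\<close> is the separated completion of the free complex vector space over \<open>'a\<close> for the
  semi-inner product determined by \<open>kern\<close> on generators. A formal linear combination is a list of
  coefficient-generator pairs, and a vector \<open>\<psi>\<close> is stored as the function sending a generator
  \<open>x\<close> to the inner product of \<open>x\<close> with \<open>\<psi>\<close>. The facts \<open>cinner_vec_of\<close> and \<open>closure_combos\<close> below
  say that the generators have the prescribed inner products and that their span is dense.
\<close>

class pos_kernel =
  fixes kern :: "'a \<Rightarrow> 'a \<Rightarrow> complex"
  assumes psd_kern: "psd {..<n::nat} (\<lambda>i j. kern (x i) (x j))"

lemma kern_commute: "kern x y = cnj (kern y (x :: 'a::pos_kernel))"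
proof -
  have "psd {..<2::nat} (\<lambda>i j. kern ((\<lambda>i. if i = 0 then x else y) i) ((\<lambda>i. if i = 0 then x else y) j))"
    by (rule psd_kern)
  from psdD1[OF this, of 0 1] show ?thesis by simp
qed

definition form :: "(complex \<times> 'a::pos_kernel) list \<Rightarrow> (complex \<times> 'a) list \<Rightarrow> complex"
  where "form a b = (\<Sum>p\<leftarrow>a. \<Sum>q\<leftarrow>b. cnj (fst p) * fst q * kern (snd p) (snd q))"

definition scl :: "complex \<Rightarrow> (complex \<times> 'a) list \<Rightarrow> (complex \<times> 'a) list"
  where "scl z a = map (\<lambda>p. (z * fst p, snd p)) a"

lemma form_append_left: "form (a @ a') b = form a b + form a' b"
  by (simp add: form_def)

lemma form_append_right: "form a (b @ b') = form a b + form a b'"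
  by (induction a) (auto simp: form_def)

lemma form_scl_right: "form a (scl z b) = z * form a b"
proof (induction a)
  case (Cons p a)
  have "(\<Sum>q\<leftarrow>scl z b. cnj (fst p) * fst q * kern (snd p) (snd q))
    = z * (\<Sum>q\<leftarrow>b. cnj (fst p) * fst q * kern (snd p) (snd q))"
    by (induction b) (auto simp: scl_def algebra_simps)
  with Cons show ?case by (simp add: form_def algebra_simps)
qed (simp add: form_def)

lemma form_cnj: "form a b = cnj (form b a)"
proof -
  have nil: "form [] b = 0" "form b [] = 0" for b :: "(complex \<times> 'a) list"
    by (auto simp: form_def sum_list_0)
  have sing: "form [p] [q] = cnj (form [q] [p])" for p q :: "complex \<times> 'a"
    using kern_commute[of "snd p" "snd q"] by (simp add: form_def)
  have one: "form [p] b = cnj (form b [p])" for p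
  proof (induction b)
    case (Cons q b)
    then show ?case
      using form_append_left[of "[q]" b "[p]"] form_append_right[of "[p]" "[q]" b] sing[of p q]
      by simp
  qed (simp add: nil)
  show ?thesis
  proof (induction a)
    case (Cons p a)
    then show ?case
      using form_append_left[of "[p]" a b] form_append_right[of b "[p]" a] one[of p]
      by simp
  qed (simp add: nil)
qed

lemma form_scl_left: "form (scl z a) b = cnj z * form a b"
  by (metis form_cnj form_scl_right complex_cnj_mult)

lemma form_self: "0 \<le> Re (form a a)" "Im (form a a) = 0"
proof -
  have "form a a = (\<Sum>i\<in>{..<length a}. \<Sum>j\<in>{..<length a}.
    cnj (fst (a ! i)) * fst (a ! j) * kern (snd (a ! i)) (snd (a ! j)))"
    unfolding form_def by (simp add: sum_list_sum_nth atLeast0LessThan)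
  then show "0 \<le> Re (form a a)"
    using psdD2[OF psd_kern[where n = "length a" and x = "\<lambda>i. snd (a ! i)"], of "\<lambda>i. fst (a ! i)"]
    by simp
  show "Im (form a a) = 0"
    using arg_cong[OF form_cnj[of a a], of Im] by simp
qed

definition seminorm :: "(complex \<times> 'a::pos_kernel) list \<Rightarrow> real"
  where "seminorm a = sqrt (Re (form a a))"

definition sdiff :: "(complex \<times> 'a) list \<Rightarrow> (complex \<times> 'a) list \<Rightarrow> (complex \<times> 'a) list"
  where "sdiff a b = a @ scl (-1) b"

lemmas form_simps = form_append_left form_append_right form_scl_left form_scl_right

lemma form_sdiff: "form (sdiff a b) c = form a c - form b c"
  "form c (sdiff a b) = form c a - form c b"
  by (auto simp: sdiff_def form_simps)

lemma form_self_seminorm: "form a a = complex_of_real ((seminorm a)\<^sup>2)"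
  using form_self[of a] by (simp add: seminorm_def complex_eq_iff)

lemma seminorm_ge0 [simp]: "0 \<le> seminorm a"
  using form_self[of a] by (simp add: seminorm_def)

lemma form_CS: "cmod (form a b) \<le> seminorm a * seminorm b"
proof -
  have key: "0 \<le> (seminorm a)\<^sup>2 * t\<^sup>2 - 2 * t * (cmod (form a b))\<^sup>2 + (cmod (form a b))\<^sup>2 * (seminorm b)\<^sup>2"
    for t :: real
  proof -
    define w where "w = form a b"
    have ba: "form b a = cnj w" by (simp add: w_def form_cnj[of b a])
    have "form (scl (of_real t) a @ scl (- cnj w) b) (scl (of_real t) a @ scl (- cnj w) b)
      = of_real ((seminorm a)\<^sup>2) * of_real (t\<^sup>2) - 2 * of_real t * (w * cnj w)
        + (w * cnj w) * of_real ((seminorm b)\<^sup>2)"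
      by (simp add: form_simps ba form_self_seminorm[of a] form_self_seminorm[of b] flip: w_def)
        (simp add: algebra_simps power2_eq_square)
    also have "\<dots> = of_real ((seminorm a)\<^sup>2 * t\<^sup>2 - 2 * t * (cmod w)\<^sup>2 + (cmod w)\<^sup>2 * (seminorm b)\<^sup>2)"
      by (simp flip: complex_norm_square)
    finally show ?thesis
      using form_self(1)[of "scl (of_real t) a @ scl (- cnj w) b"] by (simp add: w_def)
  qed
  define w where "w = (cmod (form a b))\<^sup>2"
  have "w \<le> (seminorm a)\<^sup>2 * (seminorm b)\<^sup>2"
  proof (cases "seminorm a = 0")
    case True
    have "w = 0"
    proof (rule ccontr)
      assume "w \<noteq> 0"
      then have "w > 0" by (simp add: w_def)
      with key[of "(seminorm b)\<^sup>2"] key[of "(seminorm b)\<^sup>2 + 1"] True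
      have "0 \<le> w * ((seminorm b)\<^sup>2 - 2 * ((seminorm b)\<^sup>2 + 1))"
        by (simp add: w_def algebra_simps)
      with \<open>w > 0\<close> have "0 \<le> (seminorm b)\<^sup>2 - 2 * ((seminorm b)\<^sup>2 + 1)"
        by (simp add: zero_le_mult_iff)
      moreover have "0 \<le> q \<Longrightarrow> \<not> 0 \<le> q - 2 * (q + 1)" for q :: real
        by simp
      ultimately show False using zero_le_power2 by blast
    qed
    then show ?thesis by simp
  next
    case False
    define k where "k = (seminorm a)\<^sup>2"
    have k: "k > 0" using False by (simp add: k_def)
    have "0 \<le> k * (w / k)\<^sup>2 - 2 * (w / k) * w + w * (seminorm b)\<^sup>2"
      using key[of "w / k"] by (simp add: w_def k_def)
    also have "\<dots> = w * ((seminorm b)\<^sup>2 - w / k)"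
      using k by (simp add: field_simps power2_eq_square)
    finally have "w = 0 \<or> w / k \<le> (seminorm b)\<^sup>2"
      using zero_le_power2[of "cmod (form a b)"] by (auto simp: zero_le_mult_iff w_def)
    then show ?thesis
      using k by (auto simp: k_def[symmetric] field_simps)
  qed
  then have "(cmod (form a b))\<^sup>2 \<le> (seminorm a * seminorm b)\<^sup>2"
    by (simp add: w_def power_mult_distrib)
  then show ?thesis by (rule power2_le_imp_le) simp
qed

lemma seminorm_append: "seminorm (a @ b) \<le> seminorm a + seminorm b"
proof -
  have "(seminorm (a @ b))\<^sup>2 = Re (form (a @ b) (a @ b))"
    by (simp add: seminorm_def form_self)
  also have "\<dots> = (seminorm a)\<^sup>2 + (seminorm b)\<^sup>2 + 2 * Re (form a b)"
    using form_cnj[of b a] by (simp add: form_simps form_self_seminorm[of a] form_self_seminorm[of b])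
  also have "\<dots> \<le> (seminorm a + seminorm b)\<^sup>2"
    using form_CS[of a b] complex_Re_le_cmod[of "form a b"]
    by (simp add: power2_sum)
  finally show ?thesis by (rule power2_le_imp_le) simp
qed

lemma seminorm_scl: "seminorm (scl z a) = cmod z * seminorm a"
proof -
  have "form (scl z a) (scl z a) = of_real ((cmod z * seminorm a)\<^sup>2)"
    by (simp add: form_simps form_self_seminorm[of a] power_mult_distrib mult.assoc[symmetric]
      complex_norm_square del: of_real_power)
  then show ?thesis by (simp add: seminorm_def abs_mult form_self)
qed

lemma seminorm_sdiff_triangle: "seminorm (sdiff a c) \<le> seminorm (sdiff a b) + seminorm (sdiff b c)"
proof -
  have "form (sdiff a b @ sdiff b c) (sdiff a b @ sdiff b c) = form (sdiff a c) (sdiff a c)"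
    by (simp add: form_simps form_sdiff)
  then have "seminorm (sdiff a c) = seminorm (sdiff a b @ sdiff b c)"
    by (simp add: seminorm_def)
  then show ?thesis using seminorm_append by simp
qed

lemma seminorm_sdiff_commute: "seminorm (sdiff a b) = seminorm (sdiff b a)"
  by (simp add: seminorm_def form_sdiff)

lemma seminorm_le_sdiff: "seminorm a \<le> seminorm (sdiff a b) + seminorm b"
proof -
  have "form (sdiff a b @ b) (sdiff a b @ b) = form a a"
    by (simp add: form_simps form_sdiff)
  then have "seminorm a = seminorm (sdiff a b @ b)"
    by (simp add: seminorm_def)
  then show ?thesis using seminorm_append by simp
qed

definition sCauchy :: "(nat \<Rightarrow> (complex \<times> 'a::pos_kernel) list) \<Rightarrow> bool"
  where "sCauchy X \<longleftrightarrow> (\<forall>e>0. \<exists>N. \<forall>m\<ge>N. \<forall>n\<ge>N. seminorm (sdiff (X m) (X n)) < e)"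

lemma sCauchy_bounded:
  assumes "sCauchy X"
  obtains B where "B > 0" "\<And>n. seminorm (X n) \<le> B"
proof -
  obtain N where N: "\<And>m n. m \<ge> N \<Longrightarrow> n \<ge> N \<Longrightarrow> seminorm (sdiff (X m) (X n)) < 1"
    using assms unfolding sCauchy_def by (metis zero_less_one)
  define B where "B = 1 + seminorm (X N) + (\<Sum>n<N. seminorm (X n))"
  have nn: "0 \<le> (\<Sum>n<N. seminorm (X n))" by (intro sum_nonneg) simp
  have "seminorm (X n) \<le> B" for n
  proof (cases "n < N")
    case True
    then have "seminorm (X n) \<le> (\<Sum>n<N. seminorm (X n))"
      by (intro member_le_sum) auto
    then show ?thesis by (simp add: B_def add_increasing)
  next
    case False
    then have "seminorm (X n) \<le> 1 + seminorm (X N)"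
      using N[of n N] seminorm_le_sdiff[of "X n" "X N"] by simp
    then show ?thesis using nn by (simp add: B_def)
  qed
  moreover have "B > 0" using nn by (simp add: B_def add_pos_nonneg)
  ultimately show ?thesis using that by blast
qed

lemma sCauchy_append:
  assumes "sCauchy X" "sCauchy Y"
  shows "sCauchy (\<lambda>n. X n @ Y n)"
  unfolding sCauchy_def
proof (intro allI impI)
  fix e :: real assume "e > 0"
  obtain N where N: "\<And>m n. m \<ge> N \<Longrightarrow> n \<ge> N \<Longrightarrow> seminorm (sdiff (X m) (X n)) < e / 2"
    using assms(1) \<open>e > 0\<close> unfolding sCauchy_def by (meson half_gt_zero)
  obtain N' where N': "\<And>m n. m \<ge> N' \<Longrightarrow> n \<ge> N' \<Longrightarrow> seminorm (sdiff (Y m) (Y n)) < e / 2"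
    using assms(2) \<open>e > 0\<close> unfolding sCauchy_def by (meson half_gt_zero)
  have "seminorm (sdiff (X m @ Y m) (X n @ Y n))
      = seminorm (sdiff (X m) (X n) @ sdiff (Y m) (Y n))" for m n
    by (simp add: seminorm_def form_sdiff form_simps)
  also have "seminorm (sdiff (X m) (X n) @ sdiff (Y m) (Y n)) < e"
    if "m \<ge> max N N'" "n \<ge> max N N'" for m n
    using seminorm_append[of "sdiff (X m) (X n)" "sdiff (Y m) (Y n)"] N[of m n] N'[of m n] that
    by simp
  finally show "\<exists>N. \<forall>m\<ge>N. \<forall>n\<ge>N. seminorm (sdiff (X m @ Y m) (X n @ Y n)) < e"
    by blast
qed

lemma sCauchy_scl:
  assumes "sCauchy X"
  shows "sCauchy (\<lambda>n. scl z (X n))"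
  unfolding sCauchy_def
proof (intro allI impI)
  fix e :: real assume "e > 0"
  then have "e / (cmod z + 1) > 0" by (simp add: add_nonneg_pos)
  then obtain N where N: "\<And>m n. m \<ge> N \<Longrightarrow> n \<ge> N \<Longrightarrow> seminorm (sdiff (X m) (X n)) < e / (cmod z + 1)"
    using assms unfolding sCauchy_def by metis
  have "seminorm (sdiff (scl z (X m)) (scl z (X n))) < e" if "m \<ge> N" "n \<ge> N" for m n
  proof -
    have "form (sdiff (scl z (X m)) (scl z (X n))) (sdiff (scl z (X m)) (scl z (X n)))
      = form (scl z (sdiff (X m) (X n))) (scl z (sdiff (X m) (X n)))"
      by (simp add: form_sdiff form_simps algebra_simps)
    then have "seminorm (sdiff (scl z (X m)) (scl z (X n))) = seminorm (scl z (sdiff (X m) (X n)))"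
      by (simp only: seminorm_def)
    also have "\<dots> = cmod z * seminorm (sdiff (X m) (X n))"
      by (rule seminorm_scl)
    also have "\<dots> \<le> (cmod z + 1) * seminorm (sdiff (X m) (X n))"
      by (simp add: mult_right_mono)
    also have "\<dots> < e"
      using N[OF that] by (simp add: pos_less_divide_eq add_nonneg_pos mult.commute)
    finally show ?thesis .
  qed
  then show "\<exists>N. \<forall>m\<ge>N. \<forall>n\<ge>N. seminorm (sdiff (scl z (X m)) (scl z (X n))) < e"
    by blast
qed

lemma sCauchy_const: "sCauchy (\<lambda>_. a)"
proof -
  have "seminorm (sdiff a a) = 0" by (simp add: seminorm_def form_sdiff)
  then show ?thesis by (simp add: sCauchy_def)
qed

lemma form_convergent:
  assumes "sCauchy X" "sCauchy Y"
  shows "convergent (\<lambda>n. form (X n) (Y n))"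
  unfolding Cauchy_convergent_iff[symmetric]
proof (rule metric_CauchyI)
  fix e :: real assume e: "e > 0"
  obtain A where A: "A > 0" "\<And>n. seminorm (X n) \<le> A" using sCauchy_bounded[OF assms(1)] by metis
  obtain B where B: "B > 0" "\<And>n. seminorm (Y n) \<le> B" using sCauchy_bounded[OF assms(2)] by metis
  obtain N where N: "\<And>m n. m \<ge> N \<Longrightarrow> n \<ge> N \<Longrightarrow> seminorm (sdiff (X m) (X n)) < e / (2 * B)"
    using assms(1) e B unfolding sCauchy_def by (meson divide_pos_pos mult_pos_pos zero_less_numeral)
  obtain N' where N': "\<And>m n. m \<ge> N' \<Longrightarrow> n \<ge> N' \<Longrightarrow> seminorm (sdiff (Y m) (Y n)) < e / (2 * A)"
    using assms(2) e A unfolding sCauchy_def by (meson divide_pos_pos mult_pos_pos zero_less_numeral)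
  have "dist (form (X m) (Y m)) (form (X n) (Y n)) < e" if mn: "m \<ge> max N N'" "n \<ge> max N N'" for m n
  proof -
    have "form (X m) (Y m) - form (X n) (Y n)
        = form (sdiff (X m) (X n)) (Y m) + form (X n) (sdiff (Y m) (Y n))"
      by (simp add: form_sdiff)
    then have "dist (form (X m) (Y m)) (form (X n) (Y n))
        \<le> seminorm (sdiff (X m) (X n)) * seminorm (Y m) + seminorm (X n) * seminorm (sdiff (Y m) (Y n))"
      unfolding dist_norm by (simp only:) (intro norm_triangle_le add_mono form_CS)
    also have "\<dots> \<le> seminorm (sdiff (X m) (X n)) * B + A * seminorm (sdiff (Y m) (Y n))"
      using A B by (intro add_mono mult_mono) auto
    also have "\<dots> < e / 2 + e / 2"
      using N[of m n] N'[of m n] mn A(1) B(1)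
      by (intro add_strict_mono) (auto simp: field_simps)
    finally show ?thesis by simp
  qed
  then show "\<exists>M. \<forall>m\<ge>M. \<forall>n\<ge>M. dist (form (X m) (Y m)) (form (X n) (Y n)) < e" by blast
qed

definition represents :: "(nat \<Rightarrow> (complex \<times> 'a::pos_kernel) list) \<Rightarrow> ('a \<Rightarrow> complex) \<Rightarrow> bool"
  where "represents X \<psi> \<longleftrightarrow> sCauchy X \<and> (\<forall>x. (\<lambda>n. form [(1, x)] (X n)) \<longlonglongrightarrow> \<psi> x)"

lemma represents_form:
  assumes "represents X \<psi>"
  shows "(\<lambda>n. form a (X n)) \<longlonglongrightarrow> (\<Sum>p\<leftarrow>a. cnj (fst p) * \<psi> (snd p))"
proof (induction a)
  case (Cons p a)
  have "form (p # a) (X n) = cnj (fst p) * form [(1, snd p)] (X n) + form a (X n)" for n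
    using form_append_left[of "[p]" a "X n"] form_scl_left[of "fst p" "[(1, snd p)]" "X n"]
    by (simp add: scl_def)
  moreover have "(\<lambda>n. cnj (fst p) * form [(1, snd p)] (X n) + form a (X n))
     \<longlonglongrightarrow> cnj (fst p) * \<psi> (snd p) + (\<Sum>p\<leftarrow>a. cnj (fst p) * \<psi> (snd p))"
    using assms by (intro tendsto_intros Cons) (auto simp: represents_def)
  ultimately show ?case by simp
qed (simp add: form_def)

lemma represents_zero_seminorm:
  assumes "represents X (\<lambda>_. 0)"
  shows "(\<lambda>n. seminorm (X n)) \<longlonglongrightarrow> 0"
proof -
  have C: "sCauchy X" using assms by (simp add: represents_def)
  obtain A where A: "A > 0" "\<And>n. seminorm (X n) \<le> A" using sCauchy_bounded[OF C] by metis
  obtain l where l: "(\<lambda>n. form (X n) (X n)) \<longlonglongrightarrow> l"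
    using form_convergent[OF C C] by (auto simp: convergent_def)
  have "cmod l \<le> e" if e: "e > 0" for e
  proof -
    obtain N where N: "\<And>m n. m \<ge> N \<Longrightarrow> n \<ge> N \<Longrightarrow> seminorm (sdiff (X m) (X n)) < e / A"
      using C e A unfolding sCauchy_def by (meson divide_pos_pos)
    have "(\<lambda>n. form (X N) (X n)) \<longlonglongrightarrow> 0"
      using represents_form[OF assms, of "X N"] by (simp add: sum_list_0)
    with l have "(\<lambda>n. form (X n) (X n) - form (X N) (X n)) \<longlonglongrightarrow> l"
      using tendsto_diff by fastforce
    moreover have "cmod (form (X n) (X n) - form (X N) (X n)) \<le> e" if "n \<ge> N" for n
    proof -
      have "cmod (form (sdiff (X n) (X N)) (X n)) \<le> seminorm (sdiff (X n) (X N)) * seminorm (X n)"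
        by (rule form_CS)
      also have "\<dots> \<le> e / A * A"
        using N[of n N] A that e by (intro mult_mono) (auto intro: less_imp_le)
      finally show ?thesis using A by (simp add: form_sdiff)
    qed
    ultimately show ?thesis
      by (intro Lim_norm_ubound[where net = sequentially]) (auto simp: eventually_sequentially)
  qed
  then have "l = 0"
    by (metis norm_le_zero_iff dense_ge)
  with l have "(\<lambda>n. Re (form (X n) (X n))) \<longlonglongrightarrow> 0"
    using tendsto_Re by fastforce
  then have "(\<lambda>n. sqrt (Re (form (X n) (X n)))) \<longlonglongrightarrow> sqrt 0"
    by (rule tendsto_real_sqrt)
  then show ?thesis by (simp add: seminorm_def)
qed

lemma represents_append:
  assumes "represents X \<psi>" "represents Y \<phi>"
  shows "represents (\<lambda>n. X n @ Y n) (\<lambda>x. \<psi> x + \<phi> x)"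
  using assms unfolding represents_def
  by (auto intro!: sCauchy_append tendsto_add simp: form_simps)

lemma represents_scl:
  assumes "represents X \<psi>"
  shows "represents (\<lambda>n. scl z (X n)) (\<lambda>x. z * \<psi> x)"
  using assms unfolding represents_def
  by (auto intro!: sCauchy_scl tendsto_mult simp: form_simps)

lemma represents_const: "represents (\<lambda>_. a) (\<lambda>x. form [(1, x)] a)"
  by (simp add: represents_def sCauchy_const)

typedef (overloaded) ('a::pos_kernel) hilb = "{\<psi> :: 'a \<Rightarrow> complex. \<exists>X. represents X \<psi>}"
  using represents_const by blast

setup_lifting type_definition_hilb

lift_definition combo :: "(complex \<times> 'a::pos_kernel) list \<Rightarrow> 'a hilb"
  is "\<lambda>a x. form [(1, x)] a"
  using represents_const by blast

definition vec_of :: "'a::pos_kernel \<Rightarrow> 'a hilb"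
  where "vec_of x = combo [(1, x)]"

instantiation hilb :: (pos_kernel) "{zero, plus, minus, uminus, scaleC, scaleR}"
begin
lift_definition zero_hilb :: "'a hilb" is "\<lambda>_. 0"
  using represents_const[of "[]"] by (auto simp: form_def)
lift_definition plus_hilb :: "'a hilb \<Rightarrow> 'a hilb \<Rightarrow> 'a hilb" is "\<lambda>\<psi> \<phi> x. \<psi> x + \<phi> x"
  using represents_append by blast
lift_definition scaleC_hilb :: "complex \<Rightarrow> 'a hilb \<Rightarrow> 'a hilb" is "\<lambda>z \<psi> x. z * \<psi> x"
  using represents_scl by blast
definition uminus_hilb :: "'a hilb \<Rightarrow> 'a hilb" where "uminus_hilb \<psi> = (-1) *\<^sub>C \<psi>"
definition minus_hilb :: "'a hilb \<Rightarrow> 'a hilb \<Rightarrow> 'a hilb" where "minus_hilb \<psi> \<phi> = \<psi> + (-1) *\<^sub>C \<phi>"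
definition scaleR_hilb :: "real \<Rightarrow> 'a hilb \<Rightarrow> 'a hilb" where "scaleR_hilb r \<psi> = complex_of_real r *\<^sub>C \<psi>"
instance ..
end

instance hilb :: (pos_kernel) real_vector
  by intro_classes (((unfold uminus_hilb_def minus_hilb_def scaleR_hilb_def)?;
    transfer; simp add: algebra_simps fun_eq_iff)+)

definition rep_seq :: "'a::pos_kernel hilb \<Rightarrow> nat \<Rightarrow> (complex \<times> 'a) list"
  where "rep_seq \<psi> = (SOME X. represents X (Rep_hilb \<psi>))"

lemma rep_seq: "represents (rep_seq \<psi>) (Rep_hilb \<psi>)"
  unfolding rep_seq_def by (rule someI_ex[of "\<lambda>X. represents X (Rep_hilb \<psi>)"]) (use Rep_hilb[of \<psi>] in simp)

definition ip_hilb :: "'a::pos_kernel hilb \<Rightarrow> 'a hilb \<Rightarrow> complex"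
  where "ip_hilb \<psi> \<phi> = lim (\<lambda>n. form (rep_seq \<psi> n) (rep_seq \<phi> n))"

lemma represents_diff:
  assumes "represents X \<psi>" "represents X' \<psi>"
  shows "(\<lambda>n. seminorm (sdiff (X n) (X' n))) \<longlonglongrightarrow> 0"
  using represents_append[OF assms(1) represents_scl[OF assms(2), of "-1"]]
  by (intro represents_zero_seminorm) (simp add: sdiff_def)

lemma ip_hilb_unique_aux:
  assumes "represents X \<psi>" "represents X' \<psi>" "represents Y \<phi>"
    and "(\<lambda>n. form (X n) (Y n)) \<longlonglongrightarrow> l"
  shows "(\<lambda>n. form (X' n) (Y n)) \<longlonglongrightarrow> l"
proof -
  have "sCauchy Y" using assms by (simp add: represents_def)
  then obtain B where B: "B > 0" "\<And>n. seminorm (Y n) \<le> B" using sCauchy_bounded by metis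
  have "(\<lambda>n. form (sdiff (X n) (X' n)) (Y n)) \<longlonglongrightarrow> 0"
  proof (rule Lim_null_comparison)
    show "\<forall>\<^sub>F n in sequentially. norm (form (sdiff (X n) (X' n)) (Y n))
        \<le> seminorm (sdiff (X n) (X' n)) * B"
      by (intro always_eventually allI order_trans[OF form_CS] mult_left_mono B(2)) simp
    show "(\<lambda>n. seminorm (sdiff (X n) (X' n)) * B) \<longlonglongrightarrow> 0"
      using tendsto_mult_right[OF represents_diff[OF assms(1,2)], of B] by simp
  qed
  from tendsto_diff[OF assms(4) this] show ?thesis
    by (simp add: form_sdiff)
qed

lemma ip_hilb:
  assumes "represents X (Rep_hilb \<psi>)" "represents Y (Rep_hilb \<phi>)"
  shows "(\<lambda>n. form (X n) (Y n)) \<longlonglongrightarrow> ip_hilb \<psi> \<phi>"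
proof -
  have "convergent (\<lambda>n. form (rep_seq \<psi> n) (rep_seq \<phi> n))"
    using rep_seq by (intro form_convergent) (auto simp: represents_def)
  then have "(\<lambda>n. form (rep_seq \<psi> n) (rep_seq \<phi> n)) \<longlonglongrightarrow> ip_hilb \<psi> \<phi>"
    unfolding ip_hilb_def by (simp add: convergent_LIMSEQ_iff)
  then have "(\<lambda>n. form (X n) (rep_seq \<phi> n)) \<longlonglongrightarrow> ip_hilb \<psi> \<phi>"
    by (rule ip_hilb_unique_aux[OF rep_seq assms(1) rep_seq])
  then have "(\<lambda>n. cnj (form (X n) (rep_seq \<phi> n))) \<longlonglongrightarrow> cnj (ip_hilb \<psi> \<phi>)"
    by (rule tendsto_cnj)
  then have "(\<lambda>n. form (rep_seq \<phi> n) (X n)) \<longlonglongrightarrow> cnj (ip_hilb \<psi> \<phi>)"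
    by (simp flip: form_cnj)
  then have "(\<lambda>n. form (Y n) (X n)) \<longlonglongrightarrow> cnj (ip_hilb \<psi> \<phi>)"
    by (rule ip_hilb_unique_aux[OF rep_seq assms(2,1)])
  then have "(\<lambda>n. cnj (form (Y n) (X n))) \<longlonglongrightarrow> cnj (cnj (ip_hilb \<psi> \<phi>))"
    by (rule tendsto_cnj)
  then show ?thesis
    by (simp flip: form_cnj)
qed

definition nrm_hilb :: "'a::pos_kernel hilb \<Rightarrow> real"
  where "nrm_hilb \<psi> = sqrt (Re (ip_hilb \<psi> \<psi>))"

lemma nrm_hilb:
  assumes "represents X (Rep_hilb \<psi>)"
  shows "(\<lambda>n. seminorm (X n)) \<longlonglongrightarrow> nrm_hilb \<psi>"
  unfolding seminorm_def nrm_hilb_def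
  by (intro tendsto_real_sqrt tendsto_Re ip_hilb assms)

lemma represents_plus:
  "represents X (Rep_hilb \<psi>) \<Longrightarrow> represents Y (Rep_hilb \<phi>) \<Longrightarrow>
    represents (\<lambda>n. X n @ Y n) (Rep_hilb (\<psi> + \<phi>))"
  using represents_append by (simp add: plus_hilb.rep_eq)

lemma represents_scaleC:
  "represents X (Rep_hilb \<psi>) \<Longrightarrow> represents (\<lambda>n. scl z (X n)) (Rep_hilb (z *\<^sub>C \<psi>))"
  using represents_scl by (simp add: scaleC_hilb.rep_eq)

lemma represents_minus:
  "represents X (Rep_hilb \<psi>) \<Longrightarrow> represents Y (Rep_hilb \<phi>) \<Longrightarrow>
    represents (\<lambda>n. sdiff (X n) (Y n)) (Rep_hilb (\<psi> - \<phi>))"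
  unfolding sdiff_def minus_hilb_def by (intro represents_plus represents_scaleC)

lemma represents_combo: "represents (\<lambda>_. a) (Rep_hilb (combo a))"
  using represents_const by (simp add: combo.rep_eq)

lemma nrm_hilb_zero: "nrm_hilb \<psi> = 0 \<longleftrightarrow> \<psi> = 0"
proof
  assume "nrm_hilb \<psi> = 0"
  then have z: "(\<lambda>n. seminorm (rep_seq \<psi> n)) \<longlonglongrightarrow> 0"
    using nrm_hilb[OF rep_seq, of \<psi>] by simp
  have "Rep_hilb \<psi> x = 0" for x
  proof (rule LIMSEQ_unique)
    show "(\<lambda>n. form [(1, x)] (rep_seq \<psi> n)) \<longlonglongrightarrow> Rep_hilb \<psi> x"
      using rep_seq[of \<psi>] by (simp add: represents_def)
    show "(\<lambda>n. form [(1, x)] (rep_seq \<psi> n)) \<longlonglongrightarrow> 0"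
    proof (rule Lim_null_comparison)
      show "\<forall>\<^sub>F n in sequentially. norm (form [(1, x)] (rep_seq \<psi> n))
          \<le> seminorm [(1, x)] * seminorm (rep_seq \<psi> n)"
        by (intro always_eventually allI form_CS)
      show "(\<lambda>n. seminorm [(1, x)] * seminorm (rep_seq \<psi> n)) \<longlonglongrightarrow> 0"
        using tendsto_mult_left[OF z, of "seminorm [(1, x)]"] by simp
    qed
  qed
  then show "\<psi> = 0"
    by (simp add: Rep_hilb_inject[symmetric] zero_hilb.rep_eq fun_eq_iff)
next
  assume "\<psi> = 0"
  then have "represents (\<lambda>_. []) (Rep_hilb \<psi>)"
    using represents_const[of "[]"] by (simp add: zero_hilb.rep_eq form_def)
  from nrm_hilb[OF this] show "nrm_hilb \<psi> = 0"
    by (simp add: seminorm_def form_def LIMSEQ_const_iff)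
qed

lemma nrm_hilb_triangle: "nrm_hilb (\<psi> + \<phi>) \<le> nrm_hilb \<psi> + nrm_hilb \<phi>"
  by (rule LIMSEQ_le[OF nrm_hilb[OF represents_plus[OF rep_seq rep_seq]]
      tendsto_add[OF nrm_hilb[OF rep_seq] nrm_hilb[OF rep_seq]]])
    (auto simp: seminorm_append)

lemma nrm_hilb_scaleC: "nrm_hilb (z *\<^sub>C \<psi>) = cmod z * nrm_hilb \<psi>"
  by (rule LIMSEQ_unique[OF nrm_hilb[OF represents_scaleC[OF rep_seq]]])
    (unfold seminorm_scl, intro tendsto_mult_left nrm_hilb rep_seq)

instantiation hilb :: (pos_kernel) real_normed_vector
begin
definition norm_hilb :: "'a hilb \<Rightarrow> real" where "norm_hilb = nrm_hilb"
definition dist_hilb :: "'a hilb \<Rightarrow> 'a hilb \<Rightarrow> real" where "dist_hilb \<psi> \<phi> = norm (\<psi> - \<phi>)"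
definition sgn_hilb :: "'a hilb \<Rightarrow> 'a hilb" where "sgn_hilb \<psi> = inverse (norm \<psi>) *\<^sub>R \<psi>"
definition uniformity_hilb :: "('a hilb \<times> 'a hilb) filter"
  where "uniformity_hilb = (INF e\<in>{0<..}. principal {(x, y). dist x y < e})"
definition open_hilb :: "'a hilb set \<Rightarrow> bool"
  where "open_hilb U = (\<forall>x\<in>U. eventually (\<lambda>(x', y). x' = x \<longrightarrow> y \<in> U) uniformity)"
instance
  by standard (auto simp: norm_hilb_def dist_hilb_def sgn_hilb_def uniformity_hilb_def open_hilb_def
    nrm_hilb_zero nrm_hilb_triangle scaleR_hilb_def nrm_hilb_scaleC)
end

lemma norm_combo: "norm (combo a) = seminorm a"
  using nrm_hilb[OF represents_combo, of a] by (simp add: norm_hilb_def LIMSEQ_const_iff)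

lemma combo_minus: "combo a - combo b = combo (sdiff a b)"
  using represents_minus[OF represents_combo[of a] represents_combo[of b]] 
  by (auto simp: Rep_hilb_inject[symmetric] combo.rep_eq represents_def LIMSEQ_const_iff fun_eq_iff)

lemma combo_tendsto:
  assumes X: "represents X (Rep_hilb \<psi>)"
  shows "(\<lambda>n. combo (X n)) \<longlonglongrightarrow> \<psi>"
proof (rule metric_LIMSEQ_I)
  fix e :: real assume e: "e > 0"
  have C: "sCauchy X" using X by (simp add: represents_def)
  then obtain N where N: "\<And>m n. m \<ge> N \<Longrightarrow> n \<ge> N \<Longrightarrow> seminorm (sdiff (X m) (X n)) < e / 2"
    using e unfolding sCauchy_def by (meson half_gt_zero)
  have "dist (combo (X n)) \<psi> < e" if n: "n \<ge> N" for n
  proof -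
    have "(\<lambda>m. seminorm (sdiff (X n) (X m))) \<longlonglongrightarrow> norm (combo (X n) - \<psi>)"
      unfolding norm_hilb_def by (rule nrm_hilb[OF represents_minus[OF represents_combo X]])
    then have "norm (combo (X n) - \<psi>) \<le> e / 2"
      by (rule LIMSEQ_le_const2) (use N n in \<open>auto intro!: exI[of _ N] less_imp_le\<close>)
    with e show ?thesis by (simp add: dist_norm)
  qed
  then show "\<exists>N. \<forall>n\<ge>N. dist (combo (X n)) \<psi> < e" by blast
qed

instance hilb :: (pos_kernel) banach
proof
  fix \<Psi> :: "nat \<Rightarrow> 'a hilb" assume C: "Cauchy \<Psi>"
  have "\<exists>a. dist (combo a) (\<Psi> m) < inverse (real (Suc m))" for m
    using metric_LIMSEQ_D[OF combo_tendsto[OF rep_seq[of "\<Psi> m"]], of "inverse (real (Suc m))"]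
    by (auto simp: less_imp_le)
  then obtain Y where Y: "\<And>m. dist (combo (Y m)) (\<Psi> m) < inverse (real (Suc m))" by metis
  have to0: "(\<lambda>m. dist (combo (Y m)) (\<Psi> m)) \<longlonglongrightarrow> 0"
    by (rule tendsto_sandwich[OF _ _ tendsto_const LIMSEQ_inverse_real_of_nat])
      (use Y in \<open>auto intro!: always_eventually less_imp_le\<close>)
  have "sCauchy Y"
    unfolding sCauchy_def
  proof (intro allI impI)
    fix e :: real assume e: "e > 0"
    obtain N where N: "\<And>m n. m \<ge> N \<Longrightarrow> n \<ge> N \<Longrightarrow> dist (\<Psi> m) (\<Psi> n) < e / 3"
      using metric_CauchyD[OF C, of "e / 3"] e by auto
    obtain N' where N': "\<And>m. m \<ge> N' \<Longrightarrow> dist (combo (Y m)) (\<Psi> m) < e / 3"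
      using metric_LIMSEQ_D[OF to0, of "e / 3"] e by auto
    have "seminorm (sdiff (Y m) (Y n)) < e" if "m \<ge> max N N'" "n \<ge> max N N'" for m n
    proof -
      have "seminorm (sdiff (Y m) (Y n)) = dist (combo (Y m)) (combo (Y n))"
        by (simp add: dist_norm combo_minus norm_combo)
      also have "\<dots> \<le> dist (combo (Y m)) (\<Psi> m) + dist (\<Psi> m) (\<Psi> n) + dist (combo (Y n)) (\<Psi> n)"
        by (smt (verit) dist_commute dist_triangle)
      also have "\<dots> < e" using N[of m n] N'[of m] N'[of n] that by simp
      finally show ?thesis .
    qed
    then show "\<exists>N. \<forall>m\<ge>N. \<forall>n\<ge>N. seminorm (sdiff (Y m) (Y n)) < e" by blast
  qed
  then have R: "represents Y (\<lambda>x. lim (\<lambda>n. form [(1, x)] (Y n)))"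
    unfolding represents_def
    using form_convergent[OF sCauchy_const] by (auto simp: convergent_LIMSEQ_iff)
  define \<psi> where "\<psi> = Abs_hilb (\<lambda>x. lim (\<lambda>n. form [(1, x)] (Y n)))"
  have "represents Y (Rep_hilb \<psi>)"
    using R unfolding \<psi>_def by (subst Abs_hilb_inverse) auto
  then have "(\<lambda>m. combo (Y m)) \<longlonglongrightarrow> \<psi>" by (rule combo_tendsto)
  moreover have "(\<lambda>m. combo (Y m) - \<Psi> m) \<longlonglongrightarrow> 0"
    using to0 by (simp add: dist_norm tendsto_norm_zero_iff)
  ultimately have "(\<lambda>m. combo (Y m) - (combo (Y m) - \<Psi> m)) \<longlonglongrightarrow> \<psi> - 0"
    by (rule tendsto_diff)
  then show "convergent \<Psi>" by (auto simp: convergent_def)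
qed

instantiation hilb :: (pos_kernel) chilbert
begin
definition cinner_hilb :: "'a hilb \<Rightarrow> 'a hilb \<Rightarrow> complex" where "cinner_hilb = ip_hilb"
instance
proof
  fix x y z :: "'a hilb" and c d :: complex
  show "c *\<^sub>C (x + y) = c *\<^sub>C x + c *\<^sub>C y"
    by transfer (simp add: algebra_simps)
  show "(c + d) *\<^sub>C x = c *\<^sub>C x + d *\<^sub>C x"
    by transfer (simp add: algebra_simps)
  show "c *\<^sub>C d *\<^sub>C x = (c * d) *\<^sub>C x"
    by transfer (simp add: algebra_simps)
  show "r *\<^sub>R x = complex_of_real r *\<^sub>C x" for r
    by (simp add: scaleR_hilb_def)
  show "cinner x y = cnj (cinner y x)"
  proof (rule LIMSEQ_unique)
    show "(\<lambda>n. form (rep_seq x n) (rep_seq y n)) \<longlonglongrightarrow> cinner x y"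
      unfolding cinner_hilb_def by (intro ip_hilb rep_seq)
    show "(\<lambda>n. form (rep_seq x n) (rep_seq y n)) \<longlonglongrightarrow> cnj (cinner y x)"
      unfolding cinner_hilb_def form_cnj[of "rep_seq x _"] by (intro tendsto_cnj ip_hilb rep_seq)
  qed
  show "cinner x (y + z) = cinner x y + cinner x z"
  proof (rule LIMSEQ_unique)
    show "(\<lambda>n. form (rep_seq x n) (rep_seq y n @ rep_seq z n)) \<longlonglongrightarrow> cinner x (y + z)"
      unfolding cinner_hilb_def by (intro ip_hilb rep_seq represents_plus)
    show "(\<lambda>n. form (rep_seq x n) (rep_seq y n @ rep_seq z n)) \<longlonglongrightarrow> cinner x y + cinner x z"
      unfolding cinner_hilb_def form_append_right by (intro tendsto_add ip_hilb rep_seq)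
  qed
  show "cinner x (c *\<^sub>C y) = c * cinner x y"
  proof (rule LIMSEQ_unique)
    show "(\<lambda>n. form (rep_seq x n) (scl c (rep_seq y n))) \<longlonglongrightarrow> cinner x (c *\<^sub>C y)"
      unfolding cinner_hilb_def by (intro ip_hilb rep_seq represents_scaleC)
    show "(\<lambda>n. form (rep_seq x n) (scl c (rep_seq y n))) \<longlonglongrightarrow> c * cinner x y"
      unfolding cinner_hilb_def form_scl_right by (intro tendsto_mult_left ip_hilb rep_seq)
  qed
  show "complex_of_real ((norm x)\<^sup>2) = cinner x x"
  proof (rule LIMSEQ_unique)
    show "(\<lambda>n. form (rep_seq x n) (rep_seq x n)) \<longlonglongrightarrow> cinner x x"
      unfolding cinner_hilb_def by (intro ip_hilb rep_seq)
    show "(\<lambda>n. form (rep_seq x n) (rep_seq x n)) \<longlonglongrightarrow> complex_of_real ((norm x)\<^sup>2)"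
      unfolding form_self_seminorm norm_hilb_def
      by (intro tendsto_of_real tendsto_power nrm_hilb rep_seq)
  qed
qed
end

lemma cinner_combo: "cinner (combo a) (combo b) = form a b"
  using ip_hilb[OF represents_combo represents_combo, of a b]
  by (simp add: cinner_hilb_def LIMSEQ_const_iff)

lemma cinner_vec_of: "cinner (vec_of x) (vec_of y) = kern x y"
  by (simp add: vec_of_def cinner_combo form_def)

section \<open>Hilbert space tensor products\<close>

text \<open>The completion of the algebraic tensor product.\<close>

datatype ('a, 'b) pre_tensor = Pre_tensor 'a 'b

instantiation pre_tensor :: (chilbert, chilbert) pos_kernel
begin
fun kern_pre_tensor :: "('a, 'b) pre_tensor \<Rightarrow> ('a, 'b) pre_tensor \<Rightarrow> complex"
  where "kern_pre_tensor (Pre_tensor u x) (Pre_tensor v y) = cinner u v * cinner x y"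
instance
proof
  fix n :: nat and t :: "nat \<Rightarrow> ('a, 'b) pre_tensor"
  obtain u x where t: "t = (\<lambda>i. Pre_tensor (u i) (x i))"
    by (metis pre_tensor.exhaust that[of "\<lambda>i. case t i of Pre_tensor a b \<Rightarrow> a"
      "\<lambda>i. case t i of Pre_tensor a b \<Rightarrow> b"] pre_tensor.case)
  show "psd {..<n} (\<lambda>i j. kern (t i) (t j))"
    unfolding t by (simp add: psd_mult psd_cinner)
qed
end

type_synonym ('a, 'b) tensor = "('a, 'b) pre_tensor hilb"

definition tens :: "'a::chilbert \<Rightarrow> 'b::chilbert \<Rightarrow> ('a, 'b) tensor"  (infixr \<open>\<otimes>\<close> 76)
  where "u \<otimes> x = vec_of (Pre_tensor u x)"

lemma cinner_tens: "cinner (u \<otimes> x) (v \<otimes> y) = cinner u v * cinner x y"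
  by (simp add: tens_def cinner_vec_of)

lemma discriminant:
  fixes w :: real
  assumes "\<And>t. 0 \<le> a * t\<^sup>2 - 2 * t * w + b" "0 \<le> a"
  shows "w\<^sup>2 \<le> a * b"
proof (cases "a = 0")
  case True
  have "w = 0"
    using assms(1)[of "(b + 1) / (2 * w)"] True by (cases "w = 0") (auto simp: field_simps)
  then show ?thesis using True by simp
next
  case False
  then show ?thesis using assms(1)[of "w / a"] assms(2) by (simp add: field_simps power2_eq_square)
qed

lemma cinner_CS: "cmod (cinner x y) \<le> norm x * norm (y :: 'a::chilbert)"
proof -
  define w where "w = cmod (cinner x y)"
  obtain u where u: "cmod u = 1" "cinner x (u *\<^sub>C y) = of_real w"
  proof (cases "cinner x y = 0")
    case True
    then show ?thesis using that[of 1] by (simp add: w_def cinner_scaleC_right)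
  next
    case False
    define u where "u = of_real w / cinner x y"
    have "cmod u = 1" "cinner x (u *\<^sub>C y) = of_real w"
      using False by (simp_all add: u_def w_def norm_divide cinner_scaleC_right)
    then show ?thesis using that by blast
  qed
  define z where "z = u *\<^sub>C y"
  have nz: "(norm z)\<^sup>2 = (norm y)\<^sup>2"
  proof -
    have "complex_of_real ((norm z)\<^sup>2) = (u * cnj u) * complex_of_real ((norm y)\<^sup>2)"
      unfolding norm_cinner by (simp add: z_def cinner_scaleC_right cinner_scaleC_left)
    also have "u * cnj u = 1" using u(1) by (simp flip: complex_norm_square)
    finally show ?thesis by (simp only: mult_1 of_real_eq_iff)
  qed
  have zx: "cinner z x = of_real w"
    using u(2) by (subst cinner_commute) (simp add: z_def)
  have "0 \<le> (norm x)\<^sup>2 * t\<^sup>2 - 2 * t * w + (norm y)\<^sup>2" for t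
  proof -
    have "complex_of_real ((norm (z + of_real (- t) *\<^sub>C x))\<^sup>2)
      = of_real ((norm z)\<^sup>2) - of_real t * cinner z x - of_real t * cinner x z
        + of_real (t\<^sup>2) * of_real ((norm x)\<^sup>2)"
      unfolding norm_cinner
      by (simp add: cinner_add_left cinner_add_right cinner_scaleC_left cinner_scaleC_right
        algebra_simps power2_eq_square)
    also have "\<dots> = of_real ((norm x)\<^sup>2 * t\<^sup>2 - 2 * t * w + (norm y)\<^sup>2)"
      using u(2) by (simp add: zx nz flip: z_def)
    finally have "(norm (z + of_real (- t) *\<^sub>C x))\<^sup>2 = (norm x)\<^sup>2 * t\<^sup>2 - 2 * t * w + (norm y)\<^sup>2"
      by (simp only: of_real_eq_iff)
    then show ?thesis by (metis zero_le_power2)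
  qed
  then have "w\<^sup>2 \<le> (norm x)\<^sup>2 * (norm y)\<^sup>2"
    by (rule discriminant) simp
  then have "w\<^sup>2 \<le> (norm x * norm y)\<^sup>2"
    by (simp add: power_mult_distrib)
  then show ?thesis unfolding w_def by (rule power2_le_imp_le) simp
qed

lemma bounded_bilinear_cinner: "bounded_bilinear (cinner :: 'a::chilbert \<Rightarrow> 'a \<Rightarrow> complex)"
proof
  show "\<exists>K. \<forall>a b. norm (cinner a (b :: 'a)) \<le> norm a * norm b * K"
    using cinner_CS by (intro exI[of _ 1]) auto
qed (auto simp: cinner_add_left cinner_add_right scaleR_scaleC cinner_scaleC_left cinner_scaleC_right
  scaleC_complex_def)

section \<open>Symmetric Fock space\<close>

text \<open>
  Strong (Bochner) measurability is needed because the library's Bochner integral asks for a second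
  countable codomain, whereas no Hilbert space here is assumed separable.
\<close>

definition strongly_measurable :: "'a measure \<Rightarrow> ('a \<Rightarrow> 'b::metric_space) \<Rightarrow> bool"
  where "strongly_measurable M f \<longleftrightarrow>
    (\<exists>s. (\<forall>n. simple_function M (s n)) \<and> (AE x in M. (\<lambda>n. s n x) \<longlonglongrightarrow> f x))"

lemma borel_measurable_AE_lim:
  fixes f :: "real \<Rightarrow> 'b::euclidean_space"
  assumes S: "S \<in> sets lebesgue" and g: "\<And>n. g n \<in> borel_measurable (lebesgue_on S)"
    and lim: "AE x in lebesgue_on S. (\<lambda>n. g n x) \<longlonglongrightarrow> f x"
  shows "f \<in> borel_measurable (lebesgue_on S)"
proof -
  have m: "(\<lambda>x. lim (\<lambda>n. if x \<in> S then g n x else 0)) \<in> borel_measurable lebesgue"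
    using g S by (intro borel_measurable_lim_metric) (simp add: borel_measurable_if)
  have "(\<lambda>x. if x \<in> S then f x else 0) \<in> borel_measurable lebesgue"
  proof (rule borel_measurable_AE[OF m])
    show "AE x in lebesgue. lim (\<lambda>n. if x \<in> S then g n x else 0) = (if x \<in> S then f x else 0)"
      using lim S by (auto simp: AE_restrict_space_iff elim!: eventually_mono intro!: limI)
  qed
  then show ?thesis using S by (simp add: borel_measurable_if)
qed

lemma strongly_measurable_cinner:
  fixes S :: "real set"
  assumes S: "S \<in> sets lebesgue"
    and f: "strongly_measurable (lebesgue_on S) f" and g: "strongly_measurable (lebesgue_on S) g"
  shows "(\<lambda>s. cinner (f s) (g s :: 'a::chilbert)) \<in> borel_measurable (lebesgue_on S)"
proof -
  obtain u v where u: "\<And>n. simple_function (lebesgue_on S) (u n)"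
      "AE x in lebesgue_on S. (\<lambda>n. u n x) \<longlonglongrightarrow> f x"
    and v: "\<And>n. simple_function (lebesgue_on S) (v n)"
      "AE x in lebesgue_on S. (\<lambda>n. v n x) \<longlonglongrightarrow> g x"
    using f g unfolding strongly_measurable_def by blast
  show ?thesis
  proof (rule borel_measurable_AE_lim[OF S])
    show "(\<lambda>x. cinner (u n x) (v n x)) \<in> borel_measurable (lebesgue_on S)" for n
      by (rule borel_measurable_simple_function, rule simple_function_compose2[OF u(1) v(1)])
    show "AE x in lebesgue_on S. (\<lambda>n. cinner (u n x) (v n x)) \<longlonglongrightarrow> cinner (f x) (g x)"
      using u(2) v(2) by eventually_elim (rule bounded_bilinear.tendsto[OF bounded_bilinear_cinner])
  qed
qed

text \<open>
  The square-integrable functions of which \<open>L\<^sup>2(\<real>\<^sub>+; k)\<close> consists. They are not identified almost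
  everywhere (and may take any values on the negative half-line, which is ignored): the separated
  completion below only sees \<open>l2_inner\<close>, and so makes these identifications.
\<close>

typedef (overloaded) ('k::chilbert) sqint =
  "{f :: real \<Rightarrow> 'k. strongly_measurable (lebesgue_on {0..}) f \<and>
    (\<integral>\<^sup>+s. ennreal ((norm (f s))\<^sup>2) \<partial>lebesgue_on {0..}) < \<infinity>}"
proof
  have "simple_function (lebesgue_on {0..}) (\<lambda>_. 0 :: 'k)" by simp
  then show "(\<lambda>_. 0) \<in> {f :: real \<Rightarrow> 'k. strongly_measurable (lebesgue_on {0..}) f \<and>
    (\<integral>\<^sup>+s. ennreal ((norm (f s))\<^sup>2) \<partial>lebesgue_on {0..}) < \<infinity>}"
    by (auto simp: strongly_measurable_def)
qed

definition l2_inner :: "'k::chilbert sqint \<Rightarrow> 'k sqint \<Rightarrow> complex"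
  where "l2_inner f g = (LINT s|lebesgue_on {0..}. cinner (Rep_sqint f s) (Rep_sqint g s))"

lemma half_line_sets: "{0::real..} \<in> sets lebesgue"
  by simp

lemma integrable_cinner_sqint:
  "integrable (lebesgue_on {0..}) (\<lambda>s. cinner (Rep_sqint f s) (Rep_sqint g s))"
proof (rule Bochner_Integration.integrable_bound)
  have sq: "integrable (lebesgue_on {0..}) (\<lambda>s. (norm (Rep_sqint f s))\<^sup>2)" for f :: "'a sqint"
  proof (rule integrableI_bounded)
    have "(\<lambda>s. Re (cinner (Rep_sqint f s) (Rep_sqint f s))) \<in> borel_measurable (lebesgue_on {0..})"
      using Rep_sqint[of f] by (intro measurable_compose[OF _ borel_measurable_Re] strongly_measurable_cinner half_line_sets) auto
    then show "(\<lambda>s. (norm (Rep_sqint f s))\<^sup>2) \<in> borel_measurable (lebesgue_on {0..})"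
      by (simp flip: norm_cinner)
    show "(\<integral>\<^sup>+s. ennreal (norm ((norm (Rep_sqint f s))\<^sup>2)) \<partial>lebesgue_on {0..}) < \<infinity>"
      using Rep_sqint[of f] by simp
  qed
  show "integrable (lebesgue_on {0..}) (\<lambda>s. (norm (Rep_sqint f s))\<^sup>2 + (norm (Rep_sqint g s))\<^sup>2)"
    by (intro Bochner_Integration.integrable_add sq)
  show "(\<lambda>s. cinner (Rep_sqint f s) (Rep_sqint g s)) \<in> borel_measurable (lebesgue_on {0..})"
    using Rep_sqint[of f] Rep_sqint[of g] by (intro strongly_measurable_cinner half_line_sets) auto
  show "AE s in lebesgue_on {0..}. norm (cinner (Rep_sqint f s) (Rep_sqint g s))
      \<le> norm ((norm (Rep_sqint f s))\<^sup>2 + (norm (Rep_sqint g s))\<^sup>2)"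
  proof (rule AE_I2)
    fix s
    have "cmod (cinner (Rep_sqint f s) (Rep_sqint g s)) \<le> norm (Rep_sqint f s) * norm (Rep_sqint g s)"
      by (rule cinner_CS)
    also have "a * b \<le> a\<^sup>2 + b\<^sup>2" if "a \<ge> 0" "b \<ge> 0" for a b :: real
      using sum_squares_bound[of a b] mult_nonneg_nonneg[OF that] by linarith
    from this[of "norm (Rep_sqint f s)" "norm (Rep_sqint g s)"]
    have "norm (Rep_sqint f s) * norm (Rep_sqint g s)
        \<le> norm ((norm (Rep_sqint f s))\<^sup>2 + (norm (Rep_sqint g s))\<^sup>2)" by simp
    finally show "norm (cinner (Rep_sqint f s) (Rep_sqint g s))
        \<le> norm ((norm (Rep_sqint f s))\<^sup>2 + (norm (Rep_sqint g s))\<^sup>2)" .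
  qed
qed

lemma psd_l2_inner:
  fixes f :: "'i \<Rightarrow> 'k::chilbert sqint"
  shows "psd I (\<lambda>i j. l2_inner (f i) (f j))"
proof -
  have herm: "l2_inner f g = cnj (l2_inner g f)" for f g :: "'k sqint"
    unfolding l2_inner_def by (subst cinner_commute) (rule Bochner_Integration.integral_cnj)
  have "0 \<le> Re (\<Sum>i\<in>I. \<Sum>j\<in>I. cnj (c i) * c j * l2_inner (f i) (f j))" for c
  proof -
    let ?h = "\<lambda>s. \<Sum>i\<in>I. \<Sum>j\<in>I. cnj (c i) * c j * cinner (Rep_sqint (f i) s) (Rep_sqint (f j) s)"
    have "(\<Sum>i\<in>I. \<Sum>j\<in>I. cnj (c i) * c j * l2_inner (f i) (f j)) = (LINT s|lebesgue_on {0..}. ?h s)"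
      unfolding l2_inner_def
      by (simp add: integrable_cinner_sqint Bochner_Integration.integral_sum)
    also have "Re \<dots> = (LINT s|lebesgue_on {0..}. Re (?h s))"
      by (rule integral_Re[symmetric]) (simp add: integrable_cinner_sqint)
    also have "\<dots> \<ge> 0"
      by (intro Bochner_Integration.integral_nonneg psdD2[OF psd_cinner])
    finally show ?thesis .
  qed
  then show ?thesis unfolding psd_def using herm by blast
qed

text \<open>
  \<open>Sym [f\<^sub>1, \<dots>, f\<^sub>n]\<close> generates the orthogonal projection of \<open>f\<^sub>1 \<otimes> \<dots> \<otimes> f\<^sub>n\<close> onto the symmetric tensors,
  whence the factor \<open>1 / n!\<close> in the kernel; words of different lengths are orthogonal. In particular
  \<open>Sym (replicate n f)\<close> is the \<open>n\<close>-th tensor power of \<open>f\<close>, see \<open>cinner_power\<close>.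
\<close>

typedef (overloaded) ('k::chilbert) sym_word = "UNIV :: 'k sqint list set"
  morphisms letters Sym ..

lemma psd_cong:
  assumes "\<And>i j. i \<in> I \<Longrightarrow> j \<in> I \<Longrightarrow> K i j = L i j" "psd I L"
  shows "psd I K"
proof -
  have "0 \<le> Re (\<Sum>i\<in>I. \<Sum>j\<in>I. cnj (c i) * c j * K i j)" for c
  proof -
    have "(\<Sum>i\<in>I. \<Sum>j\<in>I. cnj (c i) * c j * K i j) = (\<Sum>i\<in>I. \<Sum>j\<in>I. cnj (c i) * c j * L i j)"
      by (intro sum.cong refl) (simp add: assms(1))
    then show ?thesis using psdD2[OF assms(2), of c] by (simp only:)
  qed
  moreover have "K i j = cnj (K j i)" if "i \<in> I" "j \<in> I" for i j
    using psdD1[OF assms(2) that] assms(1) that by simp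
  ultimately show ?thesis
    unfolding psd_def by blast
qed

lemma psd_blocks:
  assumes I: "finite I" and blocks: "\<And>m. psd {i \<in> I. l i = m} K"
    and off: "\<And>i j. i \<in> I \<Longrightarrow> j \<in> I \<Longrightarrow> l i \<noteq> l j \<Longrightarrow> K i j = 0"
  shows "psd I K"
  unfolding psd_def
proof (intro conjI ballI allI)
  fix i j assume "i \<in> I" "j \<in> I"
  then show "K i j = cnj (K j i)"
    using psdD1[OF blocks[of "l i"], of i j] off[of i j] off[of j i] by (cases "l i = l j") auto
next
  fix c
  have "(\<Sum>i\<in>I. \<Sum>j\<in>I. cnj (c i) * c j * K i j)
    = (\<Sum>m\<in>l ` I. \<Sum>i\<in>{i \<in> I. l i = m}. \<Sum>j\<in>I. cnj (c i) * c j * K i j)"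
    by (rule sum.image_gen[OF I])
  also have "\<dots> = (\<Sum>m\<in>l ` I. \<Sum>i\<in>{i \<in> I. l i = m}. \<Sum>j\<in>{i \<in> I. l i = m}. cnj (c i) * c j * K i j)"
    by (rule sum.cong[OF refl], rule sum.cong[OF refl], rule sum.mono_neutral_right) (auto simp: I, metis off)
  also have "Re \<dots> = (\<Sum>m\<in>l ` I. Re (\<Sum>i\<in>{i \<in> I. l i = m}. \<Sum>j\<in>{i \<in> I. l i = m}. cnj (c i) * c j * K i j))"
    by simp
  also have "\<dots> \<ge> 0"
    by (intro sum_nonneg psdD2[OF blocks])
  finally show "0 \<le> Re (\<Sum>i\<in>I. \<Sum>j\<in>I. cnj (c i) * c j * K i j)" .
qed

lemma psd_permanent:
  fixes f :: "'i \<Rightarrow> nat \<Rightarrow> 'x" and G :: "'x \<Rightarrow> 'x \<Rightarrow> complex"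
  assumes I: "finite I" and G: "\<And>(J :: ('i \<times> (nat \<Rightarrow> nat)) set) h. psd J (\<lambda>i j. G (h i) (h j))"
  shows "psd I (\<lambda>i j. (\<Sum>\<pi> | \<pi> permutes {..<n}. \<Prod>b<n. G (f i b) (f j (\<pi> b))) / fact n)"
proof -
  define P where "P = {\<pi>. \<pi> permutes {..<n}}"
  have finP: "finite P" by (simp add: P_def finite_permutations)
  have cardP: "card P = fact n" by (simp add: P_def card_permutations)
  define K where "K i j = (\<Sum>\<pi>\<in>P. \<Prod>b<n. G (f i b) (f j (\<pi> b)))" for i j
  define L where "L p q = (\<Prod>b<n. G (f (fst p) (snd p b)) (f (fst q) (snd q b)))"
    for p q :: "'i \<times> (nat \<Rightarrow> nat)"
  have L: "psd (I \<times> P) L"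
    unfolding L_def using I finP by (intro psd_prod G) auto
  have key: "(\<Sum>\<tau>\<in>P. L (i, \<sigma>) (j, \<tau>)) = K i j" if "\<sigma> \<in> P" for i j \<sigma>
  proof -
    have \<sigma>: "\<sigma> permutes {..<n}" using that by (simp add: P_def)
    have "(\<Sum>\<tau>\<in>P. L (i, \<sigma>) (j, \<tau>)) = (\<Sum>\<tau>\<in>P. L (i, \<sigma>) (j, \<tau> \<circ> \<sigma>))"
      unfolding P_def by (rule sum_permutations_compose_right[OF \<sigma>])
    also have "\<dots> = K i j"
      unfolding K_def
    proof (intro sum.cong refl)
      fix \<tau> show "L (i, \<sigma>) (j, \<tau> \<circ> \<sigma>) = (\<Prod>b<n. G (f i b) (f j (\<tau> b)))"
        unfolding L_def by (subst prod.permute[OF \<sigma>]) (simp add: o_def)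
    qed
    finally show ?thesis .
  qed
  have "psd I (\<lambda>i j. K i j / fact n)"
    unfolding psd_def
  proof (intro conjI ballI allI)
    fix i j assume ij: "i \<in> I" "j \<in> I"
    have "of_nat (card P) * K i j = (\<Sum>\<sigma>\<in>P. \<Sum>\<tau>\<in>P. L (i, \<sigma>) (j, \<tau>))"
      by (simp add: key)
    also have "\<dots> = (\<Sum>\<sigma>\<in>P. \<Sum>\<tau>\<in>P. cnj (L (j, \<tau>) (i, \<sigma>)))"
      using ij by (intro sum.cong refl psdD1[OF L]) auto
    also have "\<dots> = cnj (\<Sum>\<tau>\<in>P. \<Sum>\<sigma>\<in>P. L (j, \<tau>) (i, \<sigma>))"
      by (subst sum.swap) simp
    also have "\<dots> = cnj (of_nat (card P) * K j i)"
      by (simp add: key)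
    finally show "K i j / fact n = cnj (K j i / fact n)"
      by (simp add: cardP)
  next
    fix c
    define Q where "Q = (\<Sum>i\<in>I. \<Sum>j\<in>I. cnj (c i) * c j * K i j)"
    have "(\<Sum>p\<in>I \<times> P. \<Sum>q\<in>I \<times> P. cnj (c (fst p)) * c (fst q) * L p q)
      = (\<Sum>i\<in>I. \<Sum>\<sigma>\<in>P. \<Sum>j\<in>I. \<Sum>\<tau>\<in>P. cnj (c i) * c j * L (i, \<sigma>) (j, \<tau>))"
      by (simp add: sum.cartesian_product' )
    also have "\<dots> = (\<Sum>i\<in>I. \<Sum>\<sigma>\<in>P. \<Sum>j\<in>I. cnj (c i) * c j * K i j)"
      by (intro sum.cong refl) (simp add: key flip: sum_distrib_left)
    also have "\<dots> = of_nat (card P) * Q"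
      by (simp add: Q_def sum_distrib_left)
    finally have "0 \<le> Re (of_nat (card P) * Q)"
      using psdD2[OF L, of "\<lambda>p. c (fst p)"] by simp
    then have "0 \<le> Re Q"
      using fact_gt_zero[where 'a = real, of n] by (auto simp: cardP zero_le_mult_iff)
    moreover have "(\<Sum>i\<in>I. \<Sum>j\<in>I. cnj (c i) * c j * (K i j / fact n)) = Q / of_real (fact n)"
      by (simp add: Q_def sum_divide_distrib)
    ultimately show "0 \<le> Re (\<Sum>i\<in>I. \<Sum>j\<in>I. cnj (c i) * c j * (K i j / fact n))"
      by (simp del: of_real_fact)
  qed
  then show ?thesis by (simp add: K_def P_def)
qed

instantiation sym_word :: (chilbert) pos_kernel
begin
definition kern_sym_word :: "'a sym_word \<Rightarrow> 'a sym_word \<Rightarrow> complex"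
  where "kern_sym_word v w =
    (let fs = letters v; gs = letters w; n = length fs in
     if length gs = n
     then (\<Sum>\<pi> | \<pi> permutes {..<n}. \<Prod>i<n. l2_inner (fs ! i) (gs ! \<pi> i)) / fact n
     else 0)"
instance
proof
  fix n :: nat and t :: "nat \<Rightarrow> 'a sym_word"
  define x where "x i = letters (t i)" for i
  show "psd {..<n} (\<lambda>i j. kern (t i) (t j))"
  proof (rule psd_blocks[where l = "\<lambda>i. length (x i)"])
    fix m
    have *: "psd {i \<in> {..<n}. length (x i) = m} (\<lambda>i j. (\<Sum>\<pi> | \<pi> permutes {..<m}.
        \<Prod>b<m. l2_inner (x i ! b) (x j ! \<pi> b)) / fact m)"
      by (rule psd_permanent[where f = "\<lambda>i b. x i ! b"]) (auto intro: psd_l2_inner)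
    show "psd {i \<in> {..<n}. length (x i) = m} (\<lambda>i j. kern (t i) (t j))"
      by (rule psd_cong[OF _ *]) (auto simp: kern_sym_word_def Let_def x_def)
  qed (auto simp: kern_sym_word_def Let_def x_def)
qed
end

type_synonym 'k fock = "'k sym_word hilb"

lemma Rep_vec_of: "Rep_hilb (vec_of x) y = kern y x"
  by (simp add: vec_of_def combo.rep_eq form_def)

lemma tensor_eqI:
  assumes "\<And>v y. Rep_hilb \<psi> (Pre_tensor v y) = Rep_hilb \<phi> (Pre_tensor v y)"
  shows "\<psi> = \<phi>"
proof -
  have "Rep_hilb \<psi> p = Rep_hilb \<phi> p" for p
    using assms by (cases p) simp
  then show ?thesis by (simp add: Rep_hilb_inject[symmetric] fun_eq_iff)
qed

lemma tens_add_left: "(u + v) \<otimes> x = u \<otimes> x + v \<otimes> x"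
  and tens_add_right: "u \<otimes> (x + y) = u \<otimes> x + u \<otimes> y"
  and tens_scaleC_left: "(c *\<^sub>C u) \<otimes> x = c *\<^sub>C (u \<otimes> x)"
  and tens_scaleC_right: "u \<otimes> (c *\<^sub>C x) = c *\<^sub>C (u \<otimes> x)"
  by (auto intro!: tensor_eqI simp: tens_def Rep_vec_of plus_hilb.rep_eq scaleC_hilb.rep_eq
    cinner_add_right cinner_scaleC_right algebra_simps)

lemma norm_tens: "norm (u \<otimes> x) = norm u * norm x"
proof -
  have "complex_of_real ((norm (u \<otimes> x))\<^sup>2) = complex_of_real ((norm u * norm x)\<^sup>2)"
    unfolding norm_cinner cinner_tens by (simp add: power_mult_distrib flip: norm_cinner)
  then have "(norm (u \<otimes> x))\<^sup>2 = (norm u * norm x)\<^sup>2"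
    by (simp only: of_real_eq_iff)
  then show ?thesis by (simp add: power2_eq_iff_nonneg)
qed

lemma norm_scaleC: "norm (c *\<^sub>C x) = cmod c * norm (x :: 'a::chilbert)"
proof -
  have "complex_of_real ((norm (c *\<^sub>C x))\<^sup>2) = (c * cnj c) * complex_of_real ((norm x)\<^sup>2)"
    unfolding norm_cinner by (simp add: cinner_scaleC_left cinner_scaleC_right)
  also have "\<dots> = complex_of_real ((cmod c * norm x)\<^sup>2)"
    by (simp add: power_mult_distrib flip: complex_norm_square)
  finally have "(norm (c *\<^sub>C x))\<^sup>2 = (cmod c * norm x)\<^sup>2"
    by (simp only: of_real_eq_iff)
  then show ?thesis by (simp add: power2_eq_iff_nonneg)
qed

lemma bounded_linear_scaleC: "bounded_linear (\<lambda>x :: 'a::chilbert. c *\<^sub>C x)"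
  by (rule bounded_linear_intro[where K = "cmod c"])
    (auto simp: scaleC_add_right scaleR_scaleC scaleC_scaleC norm_scaleC mult.commute)

lemma bounded_linear_tens_left: "bounded_linear (\<lambda>u. u \<otimes> x)"
  by (rule bounded_linear_intro[where K = "norm x"])
    (auto simp: tens_add_left scaleR_scaleC tens_scaleC_left norm_tens)

lemma closure_combos: "closure (range combo) = UNIV"
proof -
  have "\<psi> \<in> closure (range combo)" for \<psi> :: "'a hilb"
    unfolding closure_sequential
    by (rule exI[of _ "\<lambda>n. combo (rep_seq \<psi> n)"]) (simp add: combo_tendsto rep_seq)
  then show ?thesis by auto
qed

section \<open>Bounded operators and von Neumann algebras\<close>

text \<open>
  The type of bounded \<^emph>\<open>real\<close>-linear maps is used with its norm and composition; the complex-linear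
  ones form the set \<open>bops\<close>, i.e. \<open>B(H; K)\<close>. Adjoints and the other operators
  given by definite descriptions are determined by their values on total sets.
\<close>

instantiation blinfun :: (real_normed_vector, chilbert) scaleC
begin
lift_definition scaleC_blinfun :: "complex \<Rightarrow> 'a \<Rightarrow>\<^sub>L 'b \<Rightarrow> 'a \<Rightarrow>\<^sub>L 'b" is "\<lambda>c T x. c *\<^sub>C T x"
  by (rule bounded_linear_compose[OF bounded_linear_scaleC])
instance ..
end

definition cspan :: "'a::{ab_group_add, scaleC} set \<Rightarrow> 'a set"
  where "cspan = module.span scaleC"

definition clinear_on :: "'a::{plus, scaleC} set \<Rightarrow> ('a \<Rightarrow> 'b::{plus, scaleC}) \<Rightarrow> bool"
  where "clinear_on D L \<longleftrightarrow> (\<forall>x\<in>D. \<forall>y\<in>D. L (x + y) = L x + L y) \<and> (\<forall>c. \<forall>x\<in>D. L (c *\<^sub>C x) = c *\<^sub>C L x)"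

definition bops :: "('a::chilbert \<Rightarrow>\<^sub>L 'b::chilbert) set"
  where "bops = {T. clinear_on UNIV (blinfun_apply T)}"

definition adj :: "('a::chilbert \<Rightarrow>\<^sub>L 'b::chilbert) \<Rightarrow> 'b \<Rightarrow>\<^sub>L 'a"
  where "adj T = (THE S :: 'b \<Rightarrow>\<^sub>L 'a. \<forall>x y. cinner (S x) y = cinner x (T y))"

definition commutant :: "('a::chilbert \<Rightarrow>\<^sub>L 'a) set \<Rightarrow> ('a \<Rightarrow>\<^sub>L 'a) set"
  where "commutant A = {T \<in> bops. \<forall>a\<in>A. T o\<^sub>L a = a o\<^sub>L T}"

definition von_neumann_algebra :: "('a::chilbert \<Rightarrow>\<^sub>L 'a) set \<Rightarrow> bool"
  where "von_neumann_algebra A \<longleftrightarrow>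
    A \<subseteq> bops \<and> (\<forall>a\<in>A. adj a \<in> A) \<and> commutant (commutant A) = A"

definition ultraweak :: "('a::chilbert \<Rightarrow>\<^sub>L 'b::chilbert) topology"
  where "ultraweak = subtopology (topology_generated_by
    {{T :: 'a \<Rightarrow>\<^sub>L 'b. (\<Sum>n. cinner (x n) (T (y n))) \<in> U} | x y U.
      summable (\<lambda>n. (norm (x n))\<^sup>2) \<and> summable (\<lambda>n. (norm (y n))\<^sup>2) \<and> open U}) bops"

definition normal_linear :: "('a::chilbert \<Rightarrow>\<^sub>L 'b::chilbert) set \<Rightarrow>
    (('a \<Rightarrow>\<^sub>L 'b) \<Rightarrow> ('c::chilbert \<Rightarrow>\<^sub>L 'd::chilbert)) \<Rightarrow> bool"
  where "normal_linear M \<Phi> \<longleftrightarrow>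
    clinear_on M \<Phi> \<and> continuous_map (subtopology ultraweak M) ultraweak \<Phi>"

definition op_tensor :: "('a::chilbert \<Rightarrow>\<^sub>L 'b::chilbert) \<Rightarrow> ('c::chilbert \<Rightarrow>\<^sub>L 'd::chilbert) \<Rightarrow>
    ('a, 'c) tensor \<Rightarrow>\<^sub>L ('b, 'd) tensor"  (infixr \<open>\<otimes>\<^sub>o\<close> 76)
  where "S \<otimes>\<^sub>o T = (THE R :: ('a, 'c) tensor \<Rightarrow>\<^sub>L ('b, 'd) tensor. R \<in> bops \<and> (\<forall>u x. R (u \<otimes> x) = S u \<otimes> T x))"

definition vn_tensor :: "('a::chilbert \<Rightarrow>\<^sub>L 'a) set \<Rightarrow> ('b::chilbert \<Rightarrow>\<^sub>L 'b) set \<Rightarrow>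
    (('a, 'b) tensor \<Rightarrow>\<^sub>L ('a, 'b) tensor) set"
  where "vn_tensor M N = ultraweak closure_of (cspan {a \<otimes>\<^sub>o b | a b. a \<in> M \<and> b \<in> N})"

text \<open>
  The norm of an operator matrix acting between \<open>n\<close>-fold direct sums, and the supremum of the norms of
  the matrix liftings of \<open>\<Phi>\<close> (possibly infinite).
\<close>

definition matrix_norm :: "nat \<Rightarrow> (nat \<Rightarrow> nat \<Rightarrow> 'a::chilbert \<Rightarrow>\<^sub>L 'b::chilbert) \<Rightarrow> ereal"
  where "matrix_norm n T = (SUP \<xi>\<in>{\<xi>. (\<Sum>j<n. (norm (\<xi> j))\<^sup>2) \<le> 1}.
    ereal (sqrt (\<Sum>i<n. (norm (\<Sum>j<n. T i j (\<xi> j)))\<^sup>2)))"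

definition cb_norm :: "('a::chilbert \<Rightarrow>\<^sub>L 'b::chilbert) set \<Rightarrow>
    (('a \<Rightarrow>\<^sub>L 'b) \<Rightarrow> ('c::chilbert \<Rightarrow>\<^sub>L 'd::chilbert)) \<Rightarrow> ereal"
  where "cb_norm M \<Phi> = (SUP n. SUP a\<in>{a. (\<forall>i<n. \<forall>j<n. a i j \<in> M) \<and> matrix_norm n a \<le> 1}.
    matrix_norm n (\<lambda>i j. \<Phi> (a i j)))"

text \<open>\<open>tens_ket x\<close> is \<open>E\<^sub>x\<close>, and its adjoint is \<open>E\<^sup>x\<close>.\<close>

lift_definition tens_ket :: "'b::chilbert \<Rightarrow> 'a::chilbert \<Rightarrow>\<^sub>L ('a, 'b) tensor" is "\<lambda>x u. u \<otimes> x"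
  by (rule bounded_linear_tens_left)

section \<open>Exponential vectors\<close>

text \<open>
  Right-continuous step functions, extended by zero to the negative half-line, so that their values
  at points (as opposed to almost everywhere) are meaningful.
\<close>

definition step_funs :: "(real \<Rightarrow> 'k::chilbert) set"
  where "step_funs = {f. \<exists>(n::nat) a b c. (\<forall>i<n. 0 \<le> a i) \<and>
    f = (\<lambda>s. \<Sum>i<n. if a i \<le> s \<and> s < b i then c i else 0)}"

definition restr :: "real set \<Rightarrow> (real \<Rightarrow> 'k::chilbert) \<Rightarrow> real \<Rightarrow> 'k"
  where "restr J f s = (if s \<in> J then f s else 0)"

definition expv :: "(real \<Rightarrow> 'k::chilbert) \<Rightarrow> 'k fock"  (\<open>\<varpi>\<close>)
  where "\<varpi> f = exp (- (LINT s|lebesgue_on {0..}. (norm (f s))\<^sup>2) / 2) *\<^sub>R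
    (\<Sum>n. (1 / sqrt (fact n)) *\<^sub>R vec_of (Sym (replicate n (Abs_sqint f))))"

lemma step_fun_simple:
  assumes "f \<in> step_funs" "S \<in> sets lebesgue"
  shows "simple_function (lebesgue_on S) f"
proof -
  obtain n :: nat and a b c where f: "f = (\<lambda>s. \<Sum>i<n. if a i \<le> s \<and> s < b i then c i else 0)"
    using assms(1) by (auto simp: step_funs_def)
  show ?thesis
    unfolding f
  proof (induction n)
    case (Suc n)
    have "simple_function (lebesgue_on S) (\<lambda>s. if s \<in> {a n..<b n} then c n else 0)"
    proof (rule simple_function_If_set)
      show "{a n..<b n} \<inter> space (lebesgue_on S) \<in> sets (lebesgue_on S)"
        using assms(2) by (auto simp: sets_restrict_space)
    qed auto
    from simple_function_compose2[OF Suc this, of "(+)"] show ?case by simp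
  qed simp
qed

lemma step_fun_sqint:
  assumes "f \<in> step_funs"
  shows "strongly_measurable (lebesgue_on {0..}) f"
    and "(\<integral>\<^sup>+s. ennreal ((norm (f s))\<^sup>2) \<partial>lebesgue_on {0..}) < \<infinity>"
proof -
  have simp: "simple_function (lebesgue_on {0..}) f"
    by (rule step_fun_simple[OF assms]) simp
  then show "strongly_measurable (lebesgue_on {0..}) f"
    unfolding strongly_measurable_def by (intro exI[of _ "\<lambda>_. f"]) auto
  obtain n :: nat and a b c where f: "f = (\<lambda>s. \<Sum>i<n. if a i \<le> s \<and> s < b i then c i else 0)"
    using assms by (auto simp: step_funs_def)
  define C where "C = (\<Sum>i<n. norm (c i))"
  have bd: "norm (f s) \<le> C" for s
    unfolding f C_def by (rule order_trans[OF norm_sum sum_mono]) auto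
  define B where "B = (\<Sum>i<n. \<bar>b i\<bar>)"
  have supp: "f s = 0" if "s > B" for s
  proof -
    have "\<bar>b i\<bar> \<le> B" if "i < n" for i
      unfolding B_def using that by (intro member_le_sum) auto
    then show ?thesis unfolding f using that by (force intro!: sum.neutral)
  qed
  have "(\<integral>\<^sup>+s. ennreal ((norm (f s))\<^sup>2) \<partial>lebesgue_on {0..})
    \<le> (\<integral>\<^sup>+s. ennreal (C\<^sup>2) * indicator {0..B} s \<partial>lebesgue_on {0..})"
  proof (rule nn_integral_mono)
    fix s :: real assume "s \<in> space (lebesgue_on {0..})"
    then have "s \<ge> 0" by simp
    moreover have "(norm (f s))\<^sup>2 \<le> C\<^sup>2" by (rule power_mono[OF bd]) simp
    ultimately show "ennreal ((norm (f s))\<^sup>2) \<le> ennreal (C\<^sup>2) * indicator {0..B} s"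
      by (cases "s > B") (auto simp: supp ennreal_leI)
  qed
  also have "\<dots> = ennreal (C\<^sup>2) * emeasure (lebesgue_on {0..}) {0..B}"
    by (intro nn_integral_cmult_indicator) (auto simp: sets_restrict_space)
  also have "emeasure (lebesgue_on {0..}) {0..B} = emeasure lebesgue {0..B}"
    by (rule emeasure_restrict_space) auto
  also have "ennreal (C\<^sup>2) * \<dots> < \<infinity>"
    by (simp add: emeasure_lborel_Icc_eq ennreal_mult_less_top)
  finally show "(\<integral>\<^sup>+s. ennreal ((norm (f s))\<^sup>2) \<partial>lebesgue_on {0..}) < \<infinity>" .
qed

lemma Rep_Abs_step_fun: "f \<in> step_funs \<Longrightarrow> Rep_sqint (Abs_sqint f) = f"
  by (rule Abs_sqint_inverse) (use step_fun_sqint in blast)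

lemma summable_power_sqrt_fact: "summable (\<lambda>n. (a::real) ^ n / sqrt (fact n))" if "a \<ge> 0" for a
proof (rule summable_ratio_test[of "1/2" "nat \<lceil>4 * a\<^sup>2\<rceil>"])
  fix n assume n: "nat \<lceil>4 * a\<^sup>2\<rceil> \<le> n"
  have "(2 * a)\<^sup>2 \<le> real (Suc n)" using n by (simp add: power_mult_distrib)
  then have "2 * a \<le> sqrt (real (Suc n))" by (rule real_le_rsqrt)
  then have "a / sqrt (real (Suc n)) \<le> 1/2" by (simp add: field_simps)
  then have "a / sqrt (real (Suc n)) * (a ^ n / sqrt (fact n)) \<le> 1/2 * (a ^ n / sqrt (fact n))"
    using that by (intro mult_right_mono) auto
  moreover have "a / sqrt (real (Suc n)) * (a ^ n / sqrt (fact n)) = a ^ Suc n / sqrt (fact (Suc n))"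
    by (simp add: real_sqrt_mult)
  moreover have "0 \<le> a ^ Suc n / sqrt (fact (Suc n))" "0 \<le> a ^ n / sqrt (fact n)"
    using that by simp_all
  ultimately show "norm (a ^ Suc n / sqrt (fact (Suc n))) \<le> 1/2 * norm (a ^ n / sqrt (fact n))"
    by (simp only: real_norm_def abs_of_nonneg)
qed simp

lemma cinner_power:
  "cinner (vec_of (Sym (replicate m f))) (vec_of (Sym (replicate n g))) = (if m = n then l2_inner f g ^ n else 0)"
proof (cases "m = n")
  case True
  have "(\<Prod>i<n. l2_inner (replicate n f ! i) (replicate n g ! \<pi> i)) = l2_inner f g ^ n"
    if "\<pi> permutes {..<n}" for \<pi>
  proof -
    have "replicate n g ! \<pi> i = g" if "i < n" for i
      using permutes_in_image[OF \<open>\<pi> permutes {..<n}\<close>, of i] that by simp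
    then show ?thesis by simp
  qed
  with True show ?thesis
    by (simp add: cinner_vec_of kern_sym_word_def Let_def Sym_inverse card_permutations)
next
  case False
  then show ?thesis by (simp add: cinner_vec_of kern_sym_word_def Let_def Sym_inverse)
qed

lemma sums_expv:
  "summable (\<lambda>n. (1 / sqrt (fact n)) *\<^sub>R vec_of (Sym (replicate n f)))"
proof (rule summable_norm_cancel)
  have "complex_of_real ((norm (vec_of (Sym (replicate n f))))\<^sup>2) = l2_inner f f ^ n" for n
    unfolding norm_cinner cinner_power by simp
  then have "cmod (l2_inner f f ^ n) = (norm (vec_of (Sym (replicate n f))))\<^sup>2" for n
    by (metis norm_of_real abs_of_nonneg zero_le_power2)
  then have "norm (vec_of (Sym (replicate n f))) = sqrt (cmod (l2_inner f f)) ^ n" for n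
    by (metis norm_ge_zero norm_power real_sqrt_power real_sqrt_unique)
  then show "summable (\<lambda>n. norm ((1 / sqrt (fact n)) *\<^sub>R vec_of (Sym (replicate n f))))"
    using summable_power_sqrt_fact[of "sqrt (cmod (l2_inner f f))"] by simp
qed

lemma cinner_expv:
  assumes "f \<in> step_funs" "g \<in> step_funs"
  shows "cinner (\<varpi> f) (\<varpi> g) = exp (
    - complex_of_real (LINT s|lebesgue_on {0..}. (norm (f s))\<^sup>2) / 2
    - complex_of_real (LINT s|lebesgue_on {0..}. (norm (g s))\<^sup>2) / 2
    + (LINT s|lebesgue_on {0..}. cinner (f s) (g s)))"
proof -
  define v where "v h n = (1 / sqrt (fact n)) *\<^sub>R vec_of (Sym (replicate n (Abs_sqint h)))"
    for h :: "real \<Rightarrow> 'a" and n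
  define z where "z = (LINT s|lebesgue_on {0..}. cinner (f s) (g s))"
  note cb = bounded_bilinear_cinner[where 'a = "'a fock"]
  have z: "l2_inner (Abs_sqint f) (Abs_sqint g) = z"
    by (simp add: l2_inner_def z_def Rep_Abs_step_fun assms)
  have "complex_of_real (sqrt (fact n)) * complex_of_real (sqrt (fact n)) = fact n" for n
    by (simp flip: of_real_mult)
  then have inv: "inverse (complex_of_real (sqrt (fact n))) * inverse (complex_of_real (sqrt (fact n)))
      = inverse (fact n)" for n
    by (simp flip: inverse_mult_distrib)
  have vv: "cinner (v f m) (v g n) = (if n = m then z ^ n /\<^sub>R fact n else 0)" for m n
    by (auto simp: v_def bounded_bilinear.scaleR_left[OF cb] bounded_bilinear.scaleR_right[OF cb]
      cinner_power z divide_inverse_commute scaleR_conv_of_real inv)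
  have sm: "v h sums (\<Sum>n. v h n)" for h
    unfolding v_def by (intro summable_sums sums_expv)
  have row: "cinner (v f m) (\<Sum>n. v g n) = z ^ m /\<^sub>R fact m" for m
  proof (rule sums_unique2)
    show "(\<lambda>n. cinner (v f m) (v g n)) sums cinner (v f m) (\<Sum>n. v g n)"
      by (rule bounded_linear.sums[OF bounded_bilinear.bounded_linear_right[OF cb] sm])
    show "(\<lambda>n. cinner (v f m) (v g n)) sums (z ^ m /\<^sub>R fact m)"
      unfolding vv by (rule sums_single)
  qed
  have "cinner (\<Sum>m. v f m) (\<Sum>n. v g n) = exp z"
  proof (rule sums_unique2)
    show "(\<lambda>m. cinner (v f m) (\<Sum>n. v g n)) sums cinner (\<Sum>m. v f m) (\<Sum>n. v g n)"
      by (rule bounded_linear.sums[OF bounded_bilinear.bounded_linear_left[OF cb] sm])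
    show "(\<lambda>m. cinner (v f m) (\<Sum>n. v g n)) sums exp z"
      unfolding row by (rule exp_converges)
  qed
  moreover have "exp (- complex_of_real p / 2 - complex_of_real q / 2 + z)
      = of_real (exp (- p / 2)) * (of_real (exp (- q / 2)) * exp z)" for p q
    by (simp add: mult_exp_exp algebra_simps flip: exp_of_real)
  ultimately show ?thesis
    unfolding expv_def v_def[symmetric] z_def[symmetric]
    by (simp add: bounded_bilinear.scaleR_left[OF cb] bounded_bilinear.scaleR_right[OF cb]
      scaleR_conv_of_real mult.left_commute)
qed

definition exp_space :: "'k::chilbert fock set"
  where "exp_space = cspan (\<varpi> ` step_funs)"

text \<open>
  The symmetric Fock space over \<open>L\<^sup>2(J; k)\<close>, as a closed subspace of the one over \<open>L\<^sup>2(\<real>\<^sub>+; k)\<close>.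
  Accordingly an operator on it is represented by its extension by zero to the orthogonal complement,
  and its identity operator by \<open>fock_proj J\<close>. The same convention is used after tensoring
  with \<open>h\<close>.
\<close>

definition fock_on :: "real set \<Rightarrow> 'k::chilbert fock set"
  where "fock_on J = closure (cspan {vec_of (Sym fs) | fs. \<forall>f\<in>set fs. \<forall>s. s \<notin> J \<longrightarrow> Rep_sqint f s = 0})"

definition fock_proj :: "real set \<Rightarrow> 'k::chilbert fock \<Rightarrow>\<^sub>L 'k fock"
  where "fock_proj J = (THE P :: 'k fock \<Rightarrow>\<^sub>L 'k fock. P \<in> bops \<and> P o\<^sub>L P = P \<and> adj P = P \<and>
    range P = fock_on J)"

definition fock_ops :: "real set \<Rightarrow> ('k::chilbert fock \<Rightarrow>\<^sub>L 'k fock) set"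
  where "fock_ops J = {z \<in> bops. fock_proj J o\<^sub>L z o\<^sub>L fock_proj J = z}"

definition fock_shift :: "real \<Rightarrow> 'k::chilbert fock \<Rightarrow>\<^sub>L 'k fock"
  where "fock_shift r = (THE T :: 'k fock \<Rightarrow>\<^sub>L 'k fock. T \<in> bops \<and>
    (\<forall>f\<in>step_funs. T (\<varpi> f) = \<varpi> (\<lambda>s. f (s - r))))"

text \<open>
  The identification of \<open>F\<close> with the tensor product of its parts before and after \<open>r\<close>, as an isometry of
  \<open>h \<otimes> F\<close> into \<open>(h \<otimes> F) \<otimes> F\<close> with range \<open>(h \<otimes> F\<^sub>[\<^sub>0\<^sub>,\<^sub>r\<^sub>[) \<otimes> F\<^sub>[\<^sub>r\<^sub>,\<^sub>\<infinity>\<^sub>[\<close>; thus \<open>join_at r X z\<close> is \<open>X \<otimes> z\<close>, and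
  \<open>past r X\<close> is the operator whose ampliation \<open>past r X \<otimes> I\<^sub>[\<^sub>r\<^sub>,\<^sub>\<infinity>\<^sub>[\<close> is \<open>X\<close>.
\<close>

definition split_at :: "real \<Rightarrow> ('h::chilbert, 'k::chilbert fock) tensor \<Rightarrow>\<^sub>L
    (('h, 'k fock) tensor, 'k fock) tensor"
  where "split_at r = (THE U :: ('h, 'k fock) tensor \<Rightarrow>\<^sub>L (('h, 'k fock) tensor, 'k fock) tensor.
    U \<in> bops \<and> (\<forall>u. \<forall>f\<in>step_funs.
      U (u \<otimes> \<varpi> f) = (u \<otimes> \<varpi> (restr {0..<r} f)) \<otimes> \<varpi> (restr {r..} f)))"

definition join_at :: "real \<Rightarrow> (('h::chilbert, 'k::chilbert fock) tensor \<Rightarrow>\<^sub>L ('h, 'k fock) tensor) \<Rightarrow>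
    ('k fock \<Rightarrow>\<^sub>L 'k fock) \<Rightarrow> ('h, 'k fock) tensor \<Rightarrow>\<^sub>L ('h, 'k fock) tensor"
  where "join_at r X z = adj (split_at r) o\<^sub>L (X \<otimes>\<^sub>o z) o\<^sub>L split_at r"

definition past :: "real \<Rightarrow> (('h::chilbert, 'k::chilbert fock) tensor \<Rightarrow>\<^sub>L ('h, 'k fock) tensor) \<Rightarrow>
    ('h, 'k fock) tensor \<Rightarrow>\<^sub>L ('h, 'k fock) tensor"
  where "past r X = (THE Z. Z \<in> bops \<and>
    (id_blinfun \<otimes>\<^sub>o fock_proj {0..<r}) o\<^sub>L Z o\<^sub>L (id_blinfun \<otimes>\<^sub>o fock_proj {0..<r}) = Z \<and>
    X = join_at r Z (fock_proj {r..}))"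

definition shift_map :: "real \<Rightarrow> (('h::chilbert, 'k::chilbert fock) tensor \<Rightarrow>\<^sub>L ('h, 'k fock) tensor) \<Rightarrow>
    ('h, 'k fock) tensor \<Rightarrow>\<^sub>L ('h, 'k fock) tensor"  (\<open>\<sigma>\<close>)
  where "\<sigma> r T = (id_blinfun \<otimes>\<^sub>o fock_shift r) o\<^sub>L T o\<^sub>L adj (id_blinfun \<otimes>\<^sub>o fock_shift r)"

section \<open>Processes, cocycles and flows\<close>

definition exp_dom :: "('h::chilbert, 'k::chilbert fock) tensor set"
  where "exp_dom = cspan {u \<otimes> \<epsilon> | u \<epsilon>. \<epsilon> \<in> exp_space}"

type_synonym ('h, 'k) op_family = "real \<Rightarrow> ('h, 'k fock) tensor \<Rightarrow> ('h, 'k fock) tensor"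

type_synonym ('h, 'k) bop_family = "real \<Rightarrow> ('h, 'k fock) tensor \<Rightarrow>\<^sub>L ('h, 'k fock) tensor"

text \<open>
  An operator with domain \<open>exp_dom\<close> is a function in \<open>extensional exp_dom\<close>, so that equality of such
  functions is equality of operators. Values of families at negative times are irrelevant throughout.
\<close>

definition op_process :: "('h::chilbert, 'k::chilbert) op_family \<Rightarrow> bool"
  where "op_process X \<longleftrightarrow>
    (\<forall>t\<ge>0. X t \<in> extensional exp_dom \<and> clinear_on exp_dom (X t)) \<and>
    (\<forall>\<zeta>\<in>exp_dom. \<forall>\<eta>. (\<lambda>t. cinner \<eta> (X t \<zeta>)) \<in> borel_measurable (lebesgue_on {0..})) \<and>
    (\<forall>t\<ge>0. \<forall>f\<in>step_funs. \<forall>g\<in>step_funs. \<forall>u v.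
      cinner (u \<otimes> \<varpi> f) (X t (v \<otimes> \<varpi> g)) =
      cinner (\<varpi> (restr {t..} f)) (\<varpi> (restr {t..} g)) *
      cinner (u \<otimes> \<varpi> (restr {0..<t} f)) (X t (v \<otimes> \<varpi> (restr {0..<t} g))))"

definition as_process :: "('h::chilbert, 'k::chilbert) bop_family \<Rightarrow> ('h, 'k) op_family"
  where "as_process Y t = restrict (blinfun_apply (Y t)) exp_dom"

definition bounded_process_in :: "('h::chilbert \<Rightarrow>\<^sub>L 'h) set \<Rightarrow> ('h, 'k::chilbert) bop_family \<Rightarrow> bool"
  where "bounded_process_in A Y \<longleftrightarrow> (\<forall>t\<ge>0. Y t \<in> bops) \<and> op_process (as_process Y) \<and>
    (\<forall>t\<ge>0. \<forall>f\<in>step_funs. \<forall>g\<in>step_funs.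
      adj (tens_ket (\<varpi> f)) o\<^sub>L Y t o\<^sub>L tens_ket (\<varpi> g) \<in> A)"

definition locally_uniformly_bounded :: "('h::chilbert, 'k::chilbert) bop_family \<Rightarrow> bool"
  where "locally_uniformly_bounded Y \<longleftrightarrow> (\<forall>T. bdd_above ((\<lambda>t. norm (Y t)) ` {0..T}))"

type_synonym ('h, 'k) map_family =
  "real \<Rightarrow> ('h \<Rightarrow>\<^sub>L 'h) \<Rightarrow> ('h, 'k fock) tensor \<Rightarrow>\<^sub>L ('h, 'k fock) tensor"

definition ampl_map :: "('h::chilbert \<Rightarrow>\<^sub>L 'h) \<Rightarrow> ('h, 'k::chilbert fock) tensor \<Rightarrow>\<^sub>L ('h, 'k fock) tensor"  (\<open>\<iota>\<close>)
  where "\<iota> a = a \<otimes>\<^sub>o id_blinfun"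

text \<open>
  \<open>k\<^sub>r\<^sub>) \<otimes> id\<close> on \<open>A \<otimes> N\<^sub>[\<^sub>r\<^sub>,\<^sub>\<infinity>\<^sub>[\<close> and \<open>id \<otimes> k\<^sub>t\<close> on \<open>B(\<complex> \<oplus> k) \<otimes> A\<close> (ultraweak tensor products), as the normal linear
  maps with the appropriate values on elementary tensors.
\<close>

definition hat_map :: "('h::chilbert \<Rightarrow>\<^sub>L 'h) set \<Rightarrow> ('h, 'k::chilbert) map_family \<Rightarrow> real \<Rightarrow>
    (('h, 'k fock) tensor \<Rightarrow>\<^sub>L ('h, 'k fock) tensor) \<Rightarrow> ('h, 'k fock) tensor \<Rightarrow>\<^sub>L ('h, 'k fock) tensor"
  where "hat_map A k r = (THE \<Phi>.
    \<Phi> \<in> extensional (vn_tensor A (fock_ops {r..})) \<and>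
    normal_linear (vn_tensor A (fock_ops {r..})) \<Phi> \<and>
    (\<forall>a\<in>A. \<forall>z\<in>fock_ops {r..}. \<Phi> (a \<otimes>\<^sub>o z) = join_at r (past r (k r a)) z))"

definition tilde_map :: "('h::chilbert \<Rightarrow>\<^sub>L 'h) set \<Rightarrow> ('h, 'k::chilbert) map_family \<Rightarrow> real \<Rightarrow>
    ((complex \<times> 'k, 'h) tensor \<Rightarrow>\<^sub>L (complex \<times> 'k, 'h) tensor) \<Rightarrow>
    (complex \<times> 'k, ('h, 'k fock) tensor) tensor \<Rightarrow>\<^sub>L (complex \<times> 'k, ('h, 'k fock) tensor) tensor"
  where "tilde_map A k t = (THE \<Phi>.
    \<Phi> \<in> extensional (vn_tensor bops A) \<and>
    normal_linear (vn_tensor bops A) \<Phi> \<and>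
    (\<forall>x\<in>bops. \<forall>a\<in>A. \<Phi> (x \<otimes>\<^sub>o a) = x \<otimes>\<^sub>o k t a))"

definition QS_cocycle :: "('h::chilbert \<Rightarrow>\<^sub>L 'h) set \<Rightarrow> ('h, 'k::chilbert) map_family \<Rightarrow> bool"
  where "QS_cocycle A k \<longleftrightarrow>
    (\<forall>a\<in>A. bounded_process_in A (\<lambda>t. k t a)) \<and>
    (\<forall>t\<ge>0. normal_linear A (k t) \<and> cb_norm A (k t) < \<infinity>) \<and>
    (\<forall>a\<in>A. k 0 a = \<iota> a) \<and>
    (\<forall>r\<ge>0. \<forall>t\<ge>0. \<forall>a\<in>A. k (r + t) a = hat_map A k r (\<sigma> r (k t a)))"

definition QS_flow :: "('h::chilbert \<Rightarrow>\<^sub>L 'h) set \<Rightarrow> ('h, 'k::chilbert) map_family \<Rightarrow> bool"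
  where "QS_flow A j \<longleftrightarrow> QS_cocycle A j \<and>
    (\<forall>a\<in>A. continuous_map (top_of_set {0..}) ultraweak (\<lambda>t. j t a)) \<and>
    (\<forall>t\<ge>0. \<forall>a\<in>A. \<forall>b\<in>A. j t (a o\<^sub>L b) = j t a o\<^sub>L j t b) \<and>
    (\<forall>t\<ge>0. \<forall>a\<in>A. j t (adj a) = adj (j t a)) \<and>
    (\<forall>t\<ge>0. j t id_blinfun = id_blinfun)"

definition flow_semigroup :: "('h::chilbert \<Rightarrow>\<^sub>L 'h) set \<Rightarrow> ('h, 'k::chilbert) map_family \<Rightarrow> real \<Rightarrow>
    (('h, 'k fock) tensor \<Rightarrow>\<^sub>L ('h, 'k fock) tensor) \<Rightarrow> ('h, 'k fock) tensor \<Rightarrow>\<^sub>L ('h, 'k fock) tensor"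
  where "flow_semigroup A j t T = hat_map A j t (\<sigma> t T)"

definition multiplier_cocycle :: "('h::chilbert \<Rightarrow>\<^sub>L 'h) set \<Rightarrow> ('h, 'k::chilbert) map_family \<Rightarrow>
    ('h, 'k) bop_family \<Rightarrow> bool"
  where "multiplier_cocycle A j Y \<longleftrightarrow> bounded_process_in A Y \<and> Y 0 = id_blinfun \<and>
    (\<forall>s\<ge>0. \<forall>t\<ge>0. Y (s + t) = flow_semigroup A j s (Y t) o\<^sub>L Y s)"

definition assoc_cocycle :: "('h::chilbert, 'k::chilbert) map_family \<Rightarrow> ('h, 'k) bop_family \<Rightarrow>
    ('h, 'k) map_family"
  where "assoc_cocycle j Y t a = j t a o\<^sub>L Y t"

definition dagger :: "('h::chilbert, 'k::chilbert) map_family \<Rightarrow> ('h, 'k) map_family"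
  where "dagger k t a = adj (k t (adj a))"

definition ket_map :: "(('h::chilbert \<Rightarrow>\<^sub>L 'h) \<Rightarrow> ('h, 'k::chilbert fock) tensor \<Rightarrow>\<^sub>L ('h, 'k fock) tensor) \<Rightarrow>
    'k fock \<Rightarrow> ('h \<Rightarrow>\<^sub>L 'h) \<Rightarrow> 'h \<Rightarrow>\<^sub>L ('h, 'k fock) tensor"
  where "ket_map \<phi> \<epsilon> a = \<phi> a o\<^sub>L tens_ket \<epsilon>"

section \<open>Quantum stochastic integrals\<close>

definition Delta :: "(complex \<times> 'k::chilbert) \<Rightarrow>\<^sub>L (complex \<times> 'k)"
  where "Delta = Blinfun (\<lambda>x. (0, snd x))"

definition nabla :: "real \<Rightarrow> ('h::chilbert, 'k::chilbert fock) tensor \<Rightarrow>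
    (complex \<times> 'k, ('h, 'k fock) tensor) tensor"
  where "nabla s = (THE L. L \<in> extensional exp_dom \<and> clinear_on exp_dom L \<and>
    (\<forall>u. \<forall>f\<in>step_funs. L (u \<otimes> \<varpi> f) = (1, f s) \<otimes> u \<otimes> \<varpi> f))"

definition locally_integrable :: "(real \<Rightarrow> 'a::chilbert) \<Rightarrow> bool"
  where "locally_integrable g \<longleftrightarrow> (\<forall>T. strongly_measurable (lebesgue_on {0..T}) g \<and>
    (\<integral>\<^sup>+s. ennreal (norm (g s)) \<partial>lebesgue_on {0..T}) < \<infinity>)"

definition locally_square_integrable :: "(real \<Rightarrow> 'a::chilbert) \<Rightarrow> bool"
  where "locally_square_integrable g \<longleftrightarrow> (\<forall>T. strongly_measurable (lebesgue_on {0..T}) g \<and>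
    (\<integral>\<^sup>+s. ennreal ((norm (g s))\<^sup>2) \<partial>lebesgue_on {0..T}) < \<infinity>)"

type_synonym ('h, 'k) integrand =
  "real \<Rightarrow> (complex \<times> 'k, ('h, 'k fock) tensor) tensor \<Rightarrow> (complex \<times> 'k, ('h, 'k fock) tensor) tensor"

text \<open>
  \<open>D t\<close> is the domain of \<open>G t\<close>. In the adaptedness condition both sides are understood as
  compressions to \<open>h\<close>, i.e. by \<open>u \<mapsto> (1, f t) \<otimes> u \<otimes> \<epsilon>\<close> on the left and \<open>v \<mapsto> (1, g t) \<otimes> v \<otimes> \<epsilon>'\<close> on the right.
\<close>

definition QS_integrable :: "(real \<Rightarrow> (complex \<times> 'k::chilbert, ('h::chilbert, 'k fock) tensor) tensor set) \<Rightarrow>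
    ('h, 'k) integrand \<Rightarrow> bool"
  where "QS_integrable D G \<longleftrightarrow>
    (\<forall>\<zeta>\<in>exp_dom.
      (\<forall>t\<ge>0. nabla t \<zeta> \<in> D t) \<and>
      locally_integrable (\<lambda>s. ((id_blinfun - Delta) \<otimes>\<^sub>o id_blinfun) (G s (nabla s \<zeta>))) \<and>
      locally_square_integrable (\<lambda>s. (Delta \<otimes>\<^sub>o id_blinfun) (G s (nabla s \<zeta>)))) \<and>
    (\<forall>t\<ge>0. \<forall>f\<in>step_funs. \<forall>g\<in>step_funs. \<forall>u v.
      cinner ((1, f t) \<otimes> u \<otimes> \<varpi> f) (G t ((1, g t) \<otimes> v \<otimes> \<varpi> g)) =
      cinner (\<varpi> (restr {t..} f)) (\<varpi> (restr {t..} g)) *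
      cinner ((1, f t) \<otimes> u \<otimes> \<varpi> (restr {0..<t} f)) (G t ((1, g t) \<otimes> v \<otimes> \<varpi> (restr {0..<t} g))))"

definition is_QS_integral :: "('h::chilbert, 'k::chilbert) integrand \<Rightarrow> ('h, 'k) op_family \<Rightarrow> bool"
  where "is_QS_integral G X \<longleftrightarrow> op_process X \<and>
    (\<forall>\<zeta>\<in>exp_dom. continuous_on {0..} (\<lambda>t. X t \<zeta>)) \<and>
    (\<forall>t\<ge>0. \<forall>\<zeta>'\<in>exp_dom. \<forall>\<zeta>\<in>exp_dom.
      cinner \<zeta>' (X t \<zeta>) = (LINT s|lebesgue_on {0..t}. cinner (nabla s \<zeta>') (G s (nabla s \<zeta>))))"

definition hat_dom :: "(complex \<times> 'k::chilbert, ('h::chilbert, 'k fock) tensor) tensor set"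
  where "hat_dom = cspan {c \<otimes> \<zeta> | c \<zeta>. \<zeta> \<in> exp_dom}"

definition tilde_op :: "(('h::chilbert, 'k::chilbert fock) tensor \<Rightarrow> ('h, 'k fock) tensor) \<Rightarrow>
    (complex \<times> 'k, ('h, 'k fock) tensor) tensor \<Rightarrow> (complex \<times> 'k, ('h, 'k fock) tensor) tensor"
  where "tilde_op X = (THE L. L \<in> extensional hat_dom \<and> clinear_on hat_dom L \<and>
    (\<forall>c. \<forall>\<zeta>\<in>exp_dom. L (c \<otimes> \<zeta>) = c \<otimes> X \<zeta>))"

definition strong_solution :: "('h::chilbert \<Rightarrow>\<^sub>L 'h) set \<Rightarrow> ('h, 'k::chilbert) map_family \<Rightarrow>
    ((complex \<times> 'k, 'h) tensor \<Rightarrow>\<^sub>L (complex \<times> 'k, 'h) tensor) \<Rightarrow> ('h, 'k) op_family \<Rightarrow> bool"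
  where "strong_solution A j F Z \<longleftrightarrow> op_process Z \<and>
    (let G = \<lambda>s \<xi>. tilde_map A j s F (tilde_op (Z s) \<xi>) in
      QS_integrable (\<lambda>_. hat_dom) G \<and>
      (\<exists>X. is_QS_integral G X \<and> (\<forall>t\<ge>0. \<forall>\<zeta>\<in>exp_dom. Z t \<zeta> = \<zeta> + X t \<zeta>)))"

text \<open>
  \<open>Z\<close> is the process \<open>Y\<^sup>j\<^sup>,\<^sup>F\<close>, the unique strong solution of \<open>dY = \<dots> d\<Lambda>\<close>, \<open>Y\<^sub>0 = I\<close>. Both existence and
  uniqueness are part of the predicate, so that it does not depend on a choice when they are unknown.
\<close>

definition is_perturbation_process :: "('h::chilbert \<Rightarrow>\<^sub>L 'h) set \<Rightarrow> ('h, 'k::chilbert) map_family \<Rightarrow>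
    ((complex \<times> 'k, 'h) tensor \<Rightarrow>\<^sub>L (complex \<times> 'k, 'h) tensor) \<Rightarrow> ('h, 'k) op_family \<Rightarrow> bool"
  where "is_perturbation_process A j F Z \<longleftrightarrow> strong_solution A j F Z \<and>
    (\<forall>Z'. strong_solution A j F Z' \<longrightarrow> (\<forall>t\<ge>0. Z' t = Z t))"

end

(*
  Normal unital homomorphisms are spatial, so j implements each t-ampliation concretely. For c, d in k the maps
  Q_t(a) = <E(c 1_[0,t[), k_t(a) E(d 1_[0,t[)> form a semigroup on A, whose distance to the identity is O(sqrt t) by
  the growth condition; a norm continuous semigroup has a bounded generator, and G(c,d), the generator at 1, is the
  derivative of the matrix element of Y at 0. The growth condition bounds the form ((1,c) u, (1,d) v) |-> <u, G(c,d) v>,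
  whence F. By the cocycle identity the matrix elements of Y satisfy the integral equation for F. For uniqueness of its
  solution, the part of z seen by the noise after s (conditioned on the future) has a squared norm whose derivative is the
  squared noise integrand, as in the Clark-Ocone formula; this yields a Gronwall estimate with bounded test vectors z.
*)
theory Submission
  imports Defs
begin

text \<open>Several obstacles shape the proof. \<open>hat_map\<close> and \<open>tilde_map\<close>
  are definite descriptions of normal maps, so nothing can be computed before a normal extension is
  exhibited; spatial implementation writes them as compressions of amplifications, which are normal
  at sight and whose intertwining relation gives the algebra. No space is assumed separable: nets of
  finite-rank projections replace sequences, and integrands are treated as functions with finitely
  many discontinuities. The growth condition has order sqrt t only, and it concerns columns
  \<open>k t a oo tens_ket \<epsilon>\<close>, not the norm of \<open>k t a\<close>; estimates
  therefore keep a column on the right, and the semigroup law has to raise order 1/2 to order 1. The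
  perturbation process includes uniqueness among all strong solutions, bounded or not; what is known
  of such a solution is its continuity at one vector u \<otimes> \<varpi> g at a time. Hence the
  noise is estimated on the other side of the inner product, where test vectors of norm at most 1
  are available.\<close>

notation blinfun_compose (infixl "oo" 55)
notation op_tensor (infixr "ox" 76)
type_notation blinfun ("(_ =>L /_)" [22, 21] 21)
notation tendsto (infixr "--->" 55)
notation LIMSEQ ("((_)/ ----> (_))" [60, 60] 60)
no_notation fps_compose (infixl "oo" 55)
no_notation matrix_matrix_mult (infixl "**" 70)
abbreviation tens_exp (infixr "**" 76) where "u ** f \<equiv> u \<otimes> \<varpi> f"
abbreviation "idL \<equiv> id_blinfun"
abbreviation "ampl T \<equiv> T \<otimes>\<^sub>o id_blinfun"
abbreviation "ip \<equiv> cinner"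
abbreviation "bop T \<equiv> T \<in> bops"
abbreviation "step f \<equiv> f \<in> step_funs"
type_synonym ('h, 'k) hf = "('h, 'k fock) tensor"

section \<open>Complex Hilbert spaces and their operators\<close>

lemma scaleC_one [simp]: "1 *\<^sub>C x = (x :: 'a::chilbert)"
 using scaleR_scaleC[of 1 x] by simp

interpretation CV: module "scaleC :: complex => 'a => 'a::chilbert"
 by unfold_locales (auto simp: scaleC_add_right scaleC_add_left scaleC_scaleC)

interpretation CB: module "scaleC :: complex => ('a::real_normed_vector =>L 'b::chilbert) => _"
 by unfold_locales (auto simp: scaleC_add_right scaleC_add_left scaleC_scaleC blinfun.add_left
  scaleC_blinfun.rep_eq intro!: blinfun_eqI)

text \<open>Each name bundles two facts: number 1 is for vectors of a Hilbert space, number 2 for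
  operators into one, whose type carries \<open>scaleC\<close> but is not itself a Hilbert
  space.\<close>

lemmas cspan_base = CV.span_base[folded cspan_def] CB.span_base[folded cspan_def]
lemmas cspan_zero = CV.span_zero[folded cspan_def] CB.span_zero[folded cspan_def]
lemmas cspan_add = CV.span_add[folded cspan_def] CB.span_add[folded cspan_def]
lemmas cspan_scale = CV.span_scale[folded cspan_def] CB.span_scale[folded cspan_def]
lemmas cspan_sum = CV.span_sum[folded cspan_def] CB.span_sum[folded cspan_def]
lemmas cspan_mono = CV.span_mono[folded cspan_def] CB.span_mono[folded cspan_def]
lemmas subspace_cspan = CV.subspace_span[folded cspan_def] CB.subspace_span[folded cspan_def]

lemma cspan_induct [consumes 1, case_names base zero add scale]:
 fixes x :: "'a::chilbert"
 assumes x: "x \<in> cspan S" and "!!x. x \<in> S ==> P x" "P 0"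
  and "!!x y. x \<in> cspan S ==> y \<in> cspan S ==> P x ==> P y ==> P (x + y)" 
  and "!!c x. x \<in> cspan S ==> P x ==> P (c *\<^sub>C x)"
 shows "P x"
proof -
 have "x \<in> cspan S & P x"
  using x[unfolded cspan_def]
  by (rule CV.span_induct) (use assms cspan_base(1)[of _ S] cspan_zero(1)[of S] cspan_add(1)[of _ S]
    cspan_scale(1)[of _ S] in \<open>auto simp: CV.subspace_def cspan_def\<close>)
 then show ?thesis ..
qed

lemma cspan_blinfun_induct [consumes 1, case_names base zero add scale]:
 fixes x :: "'a::real_normed_vector =>L 'b::chilbert"
 assumes x: "x \<in> cspan S" and "!!x. x \<in> S ==> P x" "P 0"
  and "!!x y. x \<in> cspan S ==> y \<in> cspan S ==> P x ==> P y ==> P (x + y)" 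
  and "!!c x. x \<in> cspan S ==> P x ==> P (c *\<^sub>C x)"
 shows "P x"
proof -
 have "x \<in> cspan S & P x"
  using x[unfolded cspan_def]
  by (rule CB.span_induct) (use assms cspan_base(2)[of _ S] cspan_zero(2)[of S] cspan_add(2)[of _ S]
    cspan_scale(2)[of _ S] in \<open>auto simp: CB.subspace_def cspan_def\<close>)
 then show ?thesis ..
qed

text \<open>Coefficients are absorbed into the generators, so that linear combinations become plain
  sums over \<open>{..<n}\<close>, the form in which the kernel estimates for tensors are
  applied.\<close>

lemma cspan_closed_scale_sum:
 fixes x :: "'a::chilbert"
 assumes "x \<in> cspan S" and S: "!!c x. x \<in> S ==> c *\<^sub>C x \<in> S"
 shows "EX (n::nat) y. (ALL i<n. y i \<in> S) & x = (\<Sum>i<n. y i)"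
 using assms(1)
proof (induction rule: cspan_induct)
 case (base x)
 then show ?case by (intro exI[of _ 1] exI[of _ "%_. x"]) simp
next
 case zero
 then show ?case by (intro exI[of _ 0]) simp
next
 case (add x y)
 then obtain n m :: nat and u v where u: "ALL i<n. u i \<in> S" "x = (\<Sum>i<n. u i)"
  and v: "ALL i<m. v i \<in> S" "y = (\<Sum>i<m. v i)" by blast
 define w where "w i = (if i < n then u i else v (i - n))" for i
 have "(\<Sum>i<n+m. w i) = (\<Sum>i<n. w i) + (\<Sum>i\<in>{n..<n+m}. w i)"
  using sum.atLeastLessThan_concat[of 0 n "n + m" w] by (simp add: lessThan_atLeast0)
 also have "(\<Sum>i\<in>{n..<n+m}. w i) = (\<Sum>i<m. v i)"
  by (rule sum.reindex_bij_witness[of _ "%i. i + n" "%i. i - n"]) (auto simp: w_def)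
 finally have "x + y = (\<Sum>i<n+m. w i)" using u v by (simp add: w_def)
 moreover have "ALL i<n+m. w i \<in> S" using u v by (auto simp: w_def)
 ultimately show ?case by blast
next
 case (scale c x)
 then obtain n :: nat and u where u: "ALL i<n. u i \<in> S" "x = (\<Sum>i<n. u i)" by blast
 then have "c *\<^sub>C x = (\<Sum>i<n. c *\<^sub>C u i)" by (simp add: CV.scale_sum_right)
 with u S show ?case by (intro exI[of _ n] exI[of _ "%i. c *\<^sub>C u i"]) auto
qed

lemma cinner_minus_right: "ip x (- y) = - ip x (y :: 'a::chilbert)"
 using cinner_add_right[of x y "- y"] by (simp add: add_eq_0_iff)

lemma cinner_minus_left: "ip (- x) y = - ip x (y :: 'a::chilbert)"
 using cinner_add_left[of x "- x" y] by (simp add: add_eq_0_iff)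

lemma cinner_diff_right: "ip x (y - z) = ip x y - ip x (z :: 'a::chilbert)"
 by (simp add: cinner_add_right cinner_minus_right diff_conv_add_uminus del: add_uminus_conv_diff)

lemma cinner_diff_left: "ip (x - y) z = ip x z - ip y (z :: 'a::chilbert)"
 by (simp add: cinner_add_left cinner_minus_left diff_conv_add_uminus del: add_uminus_conv_diff)

lemmas cinner_simps = cinner_add_left cinner_add_right cinner_diff_left cinner_diff_right
 cinner_scaleC_left cinner_scaleC_right

lemma cinner_self: "ip x x = complex_of_real ((norm (x :: 'a::chilbert))\<^sup>2)"
 by (rule norm_cinner[symmetric])

lemma norm_sq_cinner: "(norm (x :: 'a::chilbert))\<^sup>2 = Re (ip x x)"
 by (simp flip: norm_cinner)

lemma cinner_self_zero [simp]: "ip x x = 0 \<longleftrightarrow> x = (0 :: 'a::chilbert)"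
 by (simp flip: norm_cinner)

lemma cinner_ext: "(!!z. ip z x = ip z y) ==> x = (y :: 'a::chilbert)"
 using cinner_self_zero[of "x - y"] by (simp add: cinner_diff_right)

lemma norm_le_cinner:
 assumes "!!z. cmod (ip z x) <= C * norm z" "0 <= C"
 shows "norm (x :: 'a::chilbert) <= C"
proof (cases "x = 0")
 case False
 have "norm x * norm x <= C * norm x"
  using assms(1)[of x] by (simp add: cinner_self power2_eq_square norm_mult)
 with False show ?thesis by simp
qed (use assms in simp)

lemma norm_add_sq: "(norm (x + y))\<^sup>2 = (norm x)\<^sup>2 + (norm y)\<^sup>2 + 2 * Re (ip x (y :: 'a::chilbert))"
 unfolding norm_sq_cinner by (simp add: cinner_simps cinner_commute[of y x])

lemma norm_diff_sq: "(norm (x - y))\<^sup>2 = (norm x)\<^sup>2 + (norm y)\<^sup>2 - 2 * Re (ip x (y :: 'a::chilbert))"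
 unfolding norm_sq_cinner by (simp add: cinner_simps cinner_commute[of y x])

lemma continuous_on_cinner [continuous_intros]:
 "continuous_on S f ==> continuous_on S g ==> continuous_on S (%x. ip (f x) (g x :: 'a::chilbert))"
 by (rule bounded_bilinear.continuous_on[OF bounded_bilinear_cinner])

lemmas tendsto_cinner [tendsto_intros] = bounded_bilinear.tendsto[OF bounded_bilinear_cinner]
lemmas tendsto_scaleC [tendsto_intros] = bounded_linear.tendsto[OF bounded_linear_scaleC]

lemma closed_orthogonal: "closed {x. ip z (x :: 'a::chilbert) = w}"
 by (intro closed_Collect_eq continuous_intros)

lemma subspace_closure:
 fixes M :: "'a::chilbert set"
 assumes "CV.subspace M"
 shows "CV.subspace (closure M)"
proof (rule CV.subspaceI)
 show "0 \<in> closure M" using CV.subspace_0[OF assms] closure_subset by blast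
 show "x + y \<in> closure M" if xy: "x \<in> closure M" "y \<in> closure M" for x y
 proof -
  obtain u v where "ALL n. u n \<in> M" "u ----> x" "ALL n. v n \<in> M" "v ----> y"
   using xy unfolding closure_sequential by blast
  then show ?thesis unfolding closure_sequential
   by (intro exI[of _ "%n. u n + v n"]) (auto intro: tendsto_add CV.subspace_add[OF assms])
 qed
 show "c *\<^sub>C x \<in> closure M" if x: "x \<in> closure M" for c x
 proof -
  obtain u where "ALL n. u n \<in> M" "u ----> x" using x unfolding closure_sequential by blast
  then show ?thesis unfolding closure_sequential
   by (intro exI[of _ "%n. c *\<^sub>C u n"]) (auto intro: tendsto_scaleC CV.subspace_scale[OF assms])
 qed
qed

section \<open>Orthogonal projections and total sets\<close>

lemma projection_exists:
 fixes M :: "'a::chilbert set"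
 assumes M: "CV.subspace M" "closed M"
 shows "EX m:M. ALL y:M. ip y (x - m) = 0"
proof -
 have ne: "M ~= {}" using CV.subspace_0[OF M(1)] by blast
 define d where "d = infdist x M"
 have d0: "d >= 0" by (simp add: d_def infdist_nonneg)
 have dle: "d <= norm (x - y)" if "y \<in> M" for y
  unfolding d_def using infdist_le[OF that] by (simp add: dist_norm)
 have "EX y:M. dist x y < d + inverse (real (Suc n))" for n
 proof -
  have "(INF a\<in>M. dist x a) < d + inverse (real (Suc n))"
   using ne by (simp add: d_def infdist_def)
  then show ?thesis using ne by (subst (asm) cINF_less_iff) (auto intro: bdd_belowI[where m = 0])
 qed
 then obtain y where y: "!!n. y n \<in> M" "!!n. norm (x - y n) < d + inverse (real (Suc n))"
  unfolding dist_norm by metis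
 have lim: "(%n. norm (x - y n)) ----> d"
 proof (rule tendsto_sandwich[of "%_. d"])
  show "(%n. d + inverse (real (Suc n))) ----> d"
   using tendsto_add[OF tendsto_const LIMSEQ_inverse_real_of_nat, of d] by simp
  show "\<forall>\<^sub>F n in sequentially. norm (x - y n) <= d + inverse (real (Suc n))"
   using y(2) by (intro always_eventually allI less_imp_le)
  show "\<forall>\<^sub>F n in sequentially. d <= norm (x - y n)"
   using y(1) dle by (intro always_eventually allI) blast
 qed simp
 \<comment> \<open>Parallelogram identity: the midpoint \<open>p\<close> lies in \<open>M\<close>,
   hence at distance at least \<open>d\<close> from \<open>x\<close>, which forces the minimising
   sequence to be Cauchy.\<close>
 have par: "(norm (y m - y n))\<^sup>2 <= 2 * (norm (x - y m))\<^sup>2 + 2 * (norm (x - y n))\<^sup>2 - 4 * d\<^sup>2" for m n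
 proof -
  define p where "p = (1/2) *\<^sub>R (y m + y n)"
  have "p \<in> M"
   unfolding p_def scaleR_scaleC using y by (intro CV.subspace_scale CV.subspace_add M)
  then have "d\<^sup>2 <= (norm (x - p))\<^sup>2" using dle d0 by (intro power_mono) auto
  also have "x - p = (1/2) *\<^sub>R ((x - y m) + (x - y n))"
   by (simp add: p_def algebra_simps flip: scaleR_2)
  finally have "4 * d\<^sup>2 <= (norm ((x - y m) + (x - y n)))\<^sup>2"
   by (simp add: power_mult_distrib power_divide)
  moreover have "(norm (y m - y n))\<^sup>2 = (norm ((x - y n) - (x - y m)))\<^sup>2" by simp
  ultimately show ?thesis
   unfolding norm_add_sq norm_diff_sq by (simp add: cinner_commute[of "x - y n"])
 qed
 have "Cauchy y"
 proof (rule metric_CauchyI)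
  fix e :: real assume e: "e > 0"
  have "(%n. (norm (x - y n))\<^sup>2) ----> d\<^sup>2" by (intro tendsto_power lim)
  from order_tendstoD(2)[OF this, of "d\<^sup>2 + e\<^sup>2 / 4"] e obtain N where
   N: "!!n. n >= N ==> (norm (x - y n))\<^sup>2 < d\<^sup>2 + e\<^sup>2 / 4"
   by (auto simp: eventually_sequentially)
  have "dist (y m) (y n) < e" if "m >= N" "n >= N" for m n
  proof -
   have "(norm (y m - y n))\<^sup>2 < e\<^sup>2" using par[of m n] N[OF that(1)] N[OF that(2)] by simp
   then show ?thesis using e unfolding dist_norm by (intro power2_less_imp_less[of _ e]) auto
  qed
  then show "EX N. ALL m>=N. ALL n>=N. dist (y m) (y n) < e" by blast
 qed
 then obtain p where p: "y ----> p" using Cauchy_convergent convergent_def by blast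
 have pM: "p \<in> M" using closed_sequentially[OF M(2)] y(1) p by blast
 have "norm (x - p) = d"
  by (rule LIMSEQ_unique[OF _ lim]) (intro tendsto_intros p)
 have "ip z (x - p) = 0" if z: "z \<in> M" for z
 proof -
  define w where "w = ip z (x - p)"
  \<comment> \<open>Moving \<open>p\<close> by the multiple \<open>of_real t * w\<close> of
    \<open>z\<close> cannot decrease the distance; the resulting quadratic in \<open>t\<close> has
    no constant term, so its linear coefficient vanishes.\<close>
  have "0 <= ((norm z)\<^sup>2 * (cmod w)\<^sup>2) * t\<^sup>2 - 2 * t * (cmod w)\<^sup>2 + 0" for t :: real
  proof -
   define q where "q = (of_real t * w) *\<^sub>C z"
   have "p + q \<in> M" unfolding q_def using z pM by (intro CV.subspace_add CV.subspace_scale M)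
   then have "d\<^sup>2 <= (norm ((x - p) - q))\<^sup>2"
    using dle[of "p + q"] d0 by (intro power_mono) (auto simp: algebra_simps)
   also have "... = d\<^sup>2 + (norm q)\<^sup>2 - 2 * Re (ip q (x - p))"
    unfolding norm_diff_sq[of "x - p" q] \<open>norm (x - p) = d\<close>
    by (simp add: cinner_commute[of q "x - p"])
   also have "ip q (x - p) = of_real t * (cnj w * w)" by (simp add: q_def cinner_scaleC_left w_def)
   also have "cnj w * w = of_real ((cmod w)\<^sup>2)" using complex_norm_square[of w] by (simp add: mult.commute)
   finally show ?thesis by (simp add: q_def norm_scaleC norm_mult power_mult_distrib mult_ac)
  qed
  from discriminant[OF this] have "((cmod w)\<^sup>2)\<^sup>2 <= 0" by simp
  then show ?thesis by (simp add: w_def)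
 qed
 with pM show ?thesis by blast
qed

lemma closure_cspan_UNIV_iff:
 fixes S :: "'a::chilbert set"
 shows "closure (cspan S) = UNIV \<longleftrightarrow> (ALL z. (ALL x:S. ip x z = 0) --> z = 0)"
proof
 assume U: "closure (cspan S) = UNIV"
 show "ALL z. (ALL x:S. ip x z = 0) --> z = 0"
 proof (intro allI impI)
  fix z assume z: "ALL x:S. ip x z = 0"
  have "cspan S <= {x. ip z x = 0}"
  proof
   fix x assume "x \<in> cspan S"
   then show "x \<in> {x. ip z x = 0}"
    by (induction rule: cspan_induct) (use z in \<open>auto simp: cinner_simps cinner_commute[of z]\<close>)
  qed
  then have "closure (cspan S) <= {x. ip z x = 0}"
   by (rule closure_minimal) (rule closed_orthogonal)
  with U have "z \<in> {x. ip z x = 0}" by blast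
  then show "z = 0" by simp
 qed
next
 assume *: "ALL z. (ALL x:S. ip x z = 0) --> z = 0"
 have "x \<in> closure (cspan S)" for x
 proof -
  obtain m where m: "m \<in> closure (cspan S)" "ALL y:closure (cspan S). ip y (x - m) = 0"
   using projection_exists[of "closure (cspan S)" x] subspace_closure subspace_cspan(1) by blast
  have "S <= closure (cspan S)" using cspan_base(1) closure_subset by fastforce
  with m * have "x - m = 0" by blast
  with m show ?thesis by simp
 qed
 then show "closure (cspan S) = UNIV" by auto
qed

lemma total_ext:
 fixes z :: "'a::chilbert"
 assumes "closure (cspan S) = UNIV" "!!x. x \<in> S ==> ip x z = ip x z'"
 shows "z = z'"
 using assms(2) assms(1)[unfolded closure_cspan_UNIV_iff, rule_format, of "z - z'"]
 by (simp add: cinner_diff_right)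

lemma cinner_cspan_zero:
 fixes x z :: "'a::chilbert"
 assumes "x \<in> closure (cspan S)" "!!y. y \<in> S ==> ip y z = 0"
 shows "ip x z = 0"
proof -
 have "cspan S <= {x. ip z x = 0}"
 proof
  fix x assume "x \<in> cspan S"
  then show "x \<in> {x. ip z x = 0}"
   by (induction rule: cspan_induct) (use assms(2) in \<open>auto simp: cinner_simps cinner_commute[of z]\<close>)
 qed
 then have "closure (cspan S) <= {x. ip z x = 0}"
  by (rule closure_minimal) (rule closed_orthogonal)
 with assms(1) show ?thesis by (auto simp: cinner_commute[of x])
qed

subsection \<open>Bounded operators\<close>

lemma bopsI:
 "(!!x y. blinfun_apply T (x + y) = T x + T y) ==> (!!c x. T (c *\<^sub>C x) = c *\<^sub>C T x) ==> bop T"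
 by (auto simp: bops_def clinear_on_def)

lemma bops_scaleC: "bop T ==> blinfun_apply T (c *\<^sub>C x) = c *\<^sub>C T x"
 by (auto simp: bops_def clinear_on_def)

lemma bops_id [simp, intro]: "bop idL"
 by (rule bopsI) auto

lemma bops_zero [simp, intro]: "0 \<in> bops"
 by (rule bopsI) auto

lemma bops_compose [simp, intro]: "bop S ==> bop T ==> S oo T \<in> bops"
 by (rule bopsI) (auto simp: blinfun.add_right bops_scaleC)

lemma bops_add [simp, intro]: "bop S ==> bop T ==> S + T \<in> bops"
 by (rule bopsI) (auto simp: blinfun.add_right blinfun.add_left bops_scaleC scaleC_add_right)

lemma bops_diff [simp, intro]: "bop S ==> bop T ==> S - T \<in> bops"
 by (rule bopsI) (auto simp: blinfun.add_right blinfun.diff_left bops_scaleC CV.scale_right_diff_distrib)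

lemma scaleC_blinfun_apply [simp]: "blinfun_apply (c *\<^sub>C T) x = c *\<^sub>C T x"
 by (simp add: scaleC_blinfun.rep_eq)

lemma bops_scale [simp, intro]: "bop T ==> c *\<^sub>C T \<in> bops"
 by (rule bopsI) (auto simp: blinfun.add_right bops_scaleC scaleC_add_right scaleC_scaleC mult.commute)

lemma scaleR_scaleC_blinfun: "r *\<^sub>R T = complex_of_real r *\<^sub>C (T :: 'a::real_normed_vector =>L 'b::chilbert)"
 by (rule blinfun_eqI) (simp add: blinfun.scaleR_left scaleR_scaleC)

lemma bops_sum [intro]: "(!!i. i \<in> I ==> T i \<in> bops) ==> bop (\<Sum>i\<in>I. T i)"
 by (induction I rule: infinite_finite_induct) auto

lemma norm_scaleC_blinfun: "norm (c *\<^sub>C T) = cmod c * norm (T :: 'a::real_normed_vector =>L 'b::chilbert)"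
proof (cases "c = 0")
 case False
 have le: "norm (c *\<^sub>C T) <= cmod c * norm T" for c :: complex and T :: "'a =>L 'b"
  by (rule norm_blinfun_bound)
   (auto simp: norm_scaleC mult.assoc intro!: mult_left_mono norm_blinfun)
 have "norm T = norm (inverse c *\<^sub>C c *\<^sub>C T)" using False by (simp add: CB.scale_scale)
 also have "... <= cmod (inverse c) * norm (c *\<^sub>C T)" by (rule le)
 finally have "cmod c * norm T <= norm (c *\<^sub>C T)" using False by (simp add: norm_inverse field_simps norm_divide)
 with le[of c T] show ?thesis by simp
qed simp

lemma bops_eq_on_total:
 assumes "bop S" "bop T" "closure (cspan D) = UNIV" "!!x. x \<in> D ==> blinfun_apply S x = T x"
 shows "S = T"
proof -
 have "cspan D <= {x. S x = T x}"
 proof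
  fix x assume "x \<in> cspan D"
  then show "x \<in> {x. S x = T x}"
   by (induction rule: cspan_induct) (use assms in \<open>auto simp: blinfun.add_right bops_scaleC\<close>)
 qed
 moreover have "closed {x. S x = T x}" by (intro closed_Collect_eq continuous_intros)
 ultimately have "closure (cspan D) <= {x. S x = T x}" by (rule closure_minimal)
 with assms(3) show ?thesis by (auto intro!: blinfun_eqI)
qed

lemma compose_assoc: "(R oo S) oo T = R oo (S oo T)"
 by (rule blinfun_eqI) simp

lemma compose_id [simp]: "T oo idL = T" "idL oo T = T"
 by (auto intro: blinfun_eqI)

section \<open>Riesz representation and adjoints\<close>

lemma riesz:
 fixes f :: "'a::chilbert =>L complex"
 assumes f: "bop f"
 shows "EX z. ALL x. f x = ip z x"
proof -
 define M where "M = {x. f x = 0}"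
 have M: "CV.subspace M" "closed M"
  unfolding M_def by (auto intro!: CV.subspaceI closed_Collect_eq continuous_intros
   simp: blinfun.add_right bops_scaleC[OF f])
 show ?thesis
 proof (cases "M = UNIV")
  case True
  then show ?thesis by (intro exI[of _ 0]) (auto simp: M_def)
 next
  case False
  then obtain x where x: "x \<notin> M" by auto
  obtain m where m: "m \<in> M" "ALL y:M. ip y (x - m) = 0" using projection_exists[OF M] by blast
  define w where "w = x - m"
  have w: "f w ~= 0" using x m by (auto simp: w_def M_def blinfun.diff_right)
  then have w0: "w ~= 0" by auto
  define z where "z = (cnj (f w) / ip w w) *\<^sub>C w"
  have "f y = ip z y" for y
  proof -
   have "f w *\<^sub>C y - f y *\<^sub>C w \<in> M"
    by (simp add: M_def blinfun.diff_right bops_scaleC[OF f] scaleC_complex_def mult.commute)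
   then have "ip w (f w *\<^sub>C y - f y *\<^sub>C w) = 0"
    using m(2) unfolding w_def by (metis cinner_commute complex_cnj_zero)
   then have "f w * ip w y = f y * ip w w" by (simp add: cinner_simps)
   moreover have "cnj (ip w w) = ip w w" by (metis cinner_commute)
   ultimately show ?thesis using w0 by (simp add: z_def cinner_scaleC_left field_simps)
  qed
  then show ?thesis by blast
 qed
qed

lemma adj_exists:
 fixes T :: "'a::chilbert =>L 'b::chilbert"
 assumes T: "bop T"
 shows "EX S :: 'b =>L 'a. ALL x y. ip (S x) y = ip x (T y)"
proof -
 have "EX z. ALL y. ip z y = ip x (T y)" for x
 proof -
  have bl: "bounded_linear (%y. ip x (T y))"
   by (rule bounded_linear_compose[OF bounded_bilinear.bounded_linear_right[OF bounded_bilinear_cinner]])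
    (rule blinfun.bounded_linear_right)
  have "Blinfun (%y. ip x (T y)) \<in> bops"
   by (rule bopsI) (auto simp: bounded_linear_Blinfun_apply[OF bl] blinfun.add_right
    bops_scaleC[OF T] cinner_simps scaleC_complex_def)
  from riesz[OF this] show ?thesis by (auto simp: bounded_linear_Blinfun_apply[OF bl])
 qed
 then obtain S where S: "!!x y. ip (S x) y = ip x (T y)" by metis
 have S': "ip y (S x) = ip (T y) x" for x y
  using S[of x y] by (metis cinner_commute)
 have "bounded_linear S"
 proof (rule bounded_linear_intro[where K = "norm T"])
  show "S (x + y) = S x + S y" for x y by (rule cinner_ext) (simp add: S' cinner_simps)
  show "S (r *\<^sub>R x) = r *\<^sub>R S x" for r x
   by (rule cinner_ext) (simp add: S' cinner_simps scaleR_scaleC)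
  show "norm (S x) <= norm x * norm T" for x
  proof (rule norm_le_cinner)
   fix z
   have "cmod (ip z (S x)) <= norm (T z) * norm x" unfolding S' by (rule cinner_CS)
   also have "... <= (norm T * norm z) * norm x" by (intro mult_right_mono norm_blinfun) simp
   finally show "cmod (ip z (S x)) <= norm x * norm T * norm z" by (simp add: mult_ac)
  qed simp
 qed
 then show ?thesis by (intro exI[of _ "Blinfun S"]) (simp add: bounded_linear_Blinfun_apply S)
qed

lemma cinner_adj_left: "bop T ==> ip (blinfun_apply (adj T) x) y = ip x (T y)"
proof -
 assume T: "bop T"
 have "EX! S. ALL x y. ip (blinfun_apply S x) y = ip x (T y)"
 proof (rule ex_ex1I[OF adj_exists[OF T]])
  fix S S' assume *: "ALL x y. ip (blinfun_apply S x) y = ip x (T y)"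
   "ALL x y. ip (blinfun_apply S' x) y = ip x (T y)"
  show "S = S'"
   by (rule blinfun_eqI, rule cinner_ext, subst (1 2) cinner_commute) (simp add: *)
 qed
 from theI'[OF this] show ?thesis by (simp add: adj_def)
qed

lemma cinner_adj_right: "bop T ==> ip y (blinfun_apply (adj T) x) = ip (T y) x"
 using cinner_adj_left[of T x y] by (metis cinner_commute[of y "adj T x"] cinner_commute[of "T y" x])

lemma adj_eqI: 
 assumes "bop T" "!!x y. ip (blinfun_apply S x) y = ip x (T y)"
 shows "adj T = S"
proof (rule blinfun_eqI, rule cinner_ext)
 show "ip z (adj T x) = ip z (S x)" for z x
  using assms(2)[of x z] by (subst cinner_commute[of z "S x"]) (simp add: cinner_adj_right assms(1) cinner_commute[of "T z"])
qed

lemma bops_adj [simp, intro]: "bop T ==> adj T \<in> bops"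
 by (rule bopsI; rule cinner_ext) (auto simp: cinner_adj_right cinner_simps)

lemma adj_adj [simp]: "bop T ==> adj (adj T) = T"
 by (rule adj_eqI) (auto simp: cinner_adj_right)

lemma adj_compose: "bop S ==> bop T ==> adj (S oo T) = adj T oo adj S"
 by (rule adj_eqI) (auto simp: cinner_adj_left)

lemma adj_id [simp]: "adj idL = idL"
 by (rule adj_eqI) auto

lemma adj_diff: "bop S ==> bop T ==> adj (S - T) = adj S - adj T"
 by (rule adj_eqI) (auto simp: cinner_adj_left blinfun.diff_left cinner_simps)

lemma norm_adj_le: "bop T ==> norm (adj T) <= norm T"
proof (rule norm_blinfun_bound)
 assume T: "bop T"
 fix x
 show "norm (adj T x) <= norm T * norm x"
 proof (rule norm_le_cinner)
  fix z
  have "cmod (ip z (adj T x)) <= norm (T z) * norm x"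
   unfolding cinner_adj_right[OF T] by (rule cinner_CS)
  also have "... <= (norm T * norm z) * norm x" by (intro mult_right_mono norm_blinfun) simp
  finally show "cmod (ip z (adj T x)) <= norm T * norm x * norm z" by (simp add: mult_ac)
 qed simp
qed simp

lemma norm_adj: "bop T ==> norm (adj T) = norm T"
 using norm_adj_le[of T] norm_adj_le[of "adj T"] by simp

lemma bops_eqI:
 assumes S: "bop S" and T: "bop T" 
  and D: "closure (cspan D) = UNIV" and E: "closure (cspan E) = UNIV"
  and eq: "!!x y. x \<in> D ==> y \<in> E ==> ip x (blinfun_apply S y) = ip x (T y)"
 shows "S = T"
 by (rule bops_eq_on_total[OF S T E], rule total_ext[OF D], rule eq)

subsection \<open>Constructing operators\<close>

text \<open>
 A map given on a set of vectors is a set of pairs \<open>S\<close>; the norm bound on its span makes the closure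
 of the span the graph of an operator on a closed subspace, which is extended by zero.
\<close>

lemma graph_extension:
 fixes S :: "('a::chilbert \<times> 'b::chilbert) set"
 assumes b: "!!p. p \<in> cspan S ==> norm (snd p) <= C * norm (fst p)" and C: "0 <= C"
 shows "EX T:bops. (ALL p:S. blinfun_apply T (fst p) = snd p) & norm T <= C &
  (ALL z. (ALL p:S. ip (fst p) z = 0) --> T z = 0)"
proof -
 define G where "G = closure (cspan S)"
 have subG: "CV.subspace G" unfolding G_def by (intro subspace_closure subspace_cspan)
 have "closed {p :: 'a \<times> 'b. norm (snd p) <= C * norm (fst p)}"
  by (intro closed_Collect_le continuous_intros)
 then have "G <= {p. norm (snd p) <= C * norm (fst p)}"
  unfolding G_def by (rule closure_minimal[rotated]) (use b in auto)
 then have bG: "norm (snd p) <= C * norm (fst p)" if "p \<in> G" for p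
  using that by auto
 define M where "M = fst ` G"
 have subM: "CV.subspace M"
 proof (rule CV.subspaceI)
  show "0 \<in> M" using CV.subspace_0[OF subG] unfolding M_def by force
  show "x + y \<in> M" if xy: "x \<in> M" "y \<in> M" for x y
  proof -
   obtain p q where "p \<in> G" "q \<in> G" "x = fst p" "y = fst q" using xy by (auto simp: M_def)
   then show ?thesis using CV.subspace_add[OF subG, of p q] unfolding M_def
    by (intro image_eqI[of _ _ "p + q"]) auto
  qed
  show "c *\<^sub>C x \<in> M" if x: "x \<in> M" for c x
  proof -
   obtain p where "p \<in> G" "x = fst p" using x by (auto simp: M_def)
   then show ?thesis using CV.subspace_scale[OF subG, of p c] unfolding M_def
    by (intro image_eqI[of _ _ "c *\<^sub>C p"]) (auto simp: scaleC_prod_def)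
  qed
 qed
 \<comment> \<open>The first projection is bounded below on the closed graph \<open>G\<close>, with
   constant \<open>1 / (1 + C)\<close>, so the domain \<open>M\<close> inherits completeness from
   \<open>G\<close>.\<close>
 have "complete M"
  unfolding M_def
 proof (rule complete_isometric_image[of "1 / (1 + C)"])
  show "0 < 1 / (1 + C)" using C by simp
  show "subspace G"
   using CV.subspace_0[OF subG] CV.subspace_add[OF subG] CV.subspace_scale[OF subG] by (intro subspaceI) (simp_all add: scaleR_scaleC)
  show "ALL p:G. 1 / (1 + C) * norm p <= norm (fst p)"
  proof
   fix p assume "p \<in> G"
   then have "norm p <= (1 + C) * norm (fst p)"
    using bG[of p] norm_Pair_le[of "fst p" "snd p"] by (simp add: distrib_right)
   then show "1 / (1 + C) * norm p <= norm (fst p)" using C by (simp add: pos_divide_le_eq mult.commute)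
  qed
  show "complete G" by (simp add: G_def complete_eq_closed)
 qed (rule bounded_linear_fst)
 then have "closed M" by (rule complete_imp_closed)
 have uniq: "z = z'" if "(m, z) \<in> G" "(m, z') \<in> G" for m z z'
  using bG[OF CV.subspace_diff[OF subG that]] by simp
 have "EX m z. (m, z) \<in> G & (ALL y:M. ip y (x - m) = 0)" for x
  using projection_exists[OF subM \<open>closed M\<close>, of x] unfolding M_def by force
 then obtain m T where mT: "!!x. (m x, T x) \<in> G" "!!x y. y \<in> M ==> ip y (x - m x) = 0" by metis
 have mM: "m x \<in> M" for x using mT(1)[of x] unfolding M_def by force
 have key: "T x = z" if z: "(n, z) \<in> G" "!!y. y \<in> M ==> ip y (x - n) = 0" for x n z
 proof -
  have "n \<in> M" using z(1) unfolding M_def by force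
  then have "m x - n \<in> M" using mM CV.subspace_diff[OF subM] by blast
  then have "ip (m x - n) ((x - n) - (x - m x)) = 0"
   using z(2)[of "m x - n"] mT(2)[of "m x - n" x] by (simp only: cinner_diff_right[of _ "x - n"]) simp
  then have "m x = n" by simp
  with uniq[of n "T x" z] z(1) mT(1)[of x] show ?thesis by simp
 qed
 have nm: "norm (m x) <= norm x" for x
 proof -
  have "(norm x)\<^sup>2 = (norm (m x + (x - m x)))\<^sup>2" by simp
  also have "... = (norm (m x))\<^sup>2 + (norm (x - m x))\<^sup>2"
   unfolding norm_add_sq using mT(2)[OF mM[of x], of x] by simp
  finally have "(norm (m x))\<^sup>2 <= (norm x)\<^sup>2" by simp
  then show ?thesis by (rule power2_le_imp_le) simp
 qed
 have add: "T (x + y) = T x + T y" for x y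
 proof (rule key)
  show "(m x + m y, T x + T y) \<in> G"
   using CV.subspace_add[OF subG mT(1)[of x] mT(1)[of y]] by simp
  show "ip z (x + y - (m x + m y)) = 0" if "z \<in> M" for z
   using mT(2)[OF that] by (simp add: cinner_simps)
 qed
 have scale: "T (c *\<^sub>C x) = c *\<^sub>C T x" for c x
 proof (rule key)
  show "(c *\<^sub>C m x, c *\<^sub>C T x) \<in> G"
   using CV.subspace_scale[OF subG mT(1)[of x], of c] by (simp add: scaleC_prod_def)
  show "ip z (c *\<^sub>C x - c *\<^sub>C m x) = 0" if "z \<in> M" for z
   using mT(2)[OF that] by (simp add: cinner_scaleC_right flip: CV.scale_right_diff_distrib)
 qed
 have le: "norm (T x) <= C * norm x" for x
 proof -
  have "norm (T x) <= C * norm (m x)" using bG[OF mT(1)[of x]] by simp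
  also have "... <= C * norm x" using nm C by (intro mult_left_mono) auto
  finally show ?thesis .
 qed
 have bl: "bounded_linear T"
  by (rule bounded_linear_intro[where K = C]) (auto simp: add scale scaleR_scaleC mult.commute le)
 show ?thesis
 proof (intro bexI[of _ "Blinfun T"] conjI ballI allI impI)
  show "Blinfun T \<in> bops" by (rule bopsI) (auto simp: bounded_linear_Blinfun_apply[OF bl] add scale)
  show "Blinfun T (fst p) = snd p" if "p \<in> S" for p
   unfolding bounded_linear_Blinfun_apply[OF bl]
   by (rule key[of "fst p"]) (use that cspan_base(1)[of p S] closure_subset[of "cspan S"] in \<open>auto simp: G_def\<close>)
  show "norm (Blinfun T) <= C"
   by (rule norm_blinfun_bound[OF C]) (simp add: bounded_linear_Blinfun_apply[OF bl] le)
  show "Blinfun T z = 0" if z: "ALL p:S. ip (fst p) z = 0" for z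
   unfolding bounded_linear_Blinfun_apply[OF bl]
  proof (rule key[of 0])
   show "(0, 0) \<in> G" using CV.subspace_0[OF subG] by (simp add: zero_prod_def)
   show "ip y (z - 0) = 0" if y: "y \<in> M" for y
   proof -
    obtain p where p: "p \<in> closure (cspan S)" "y = fst p" using y by (auto simp: M_def G_def)
    have "ip p (z, 0) = 0"
     by (rule cinner_cspan_zero[OF p(1)]) (use z in \<open>auto simp: cinner_prod_def\<close>)
    then show ?thesis using p by (simp add: cinner_prod_def)
   qed
  qed
 qed
qed

text \<open>Equal Gram kernels make the pairing preserve inner products on the span, one argument at
  a time; linear relations among the \<open>x i\<close> are then respected automatically. Most
  isometries below are obtained in this way.\<close>

lemma isometry_extension:
 fixes x :: "'i => 'a::chilbert" and y :: "'i => 'b::chilbert"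
 assumes ip: "!!i j. i \<in> I ==> j \<in> I ==> ip (y i) (y j) = ip (x i) (x j)"
  and tot: "closure (cspan (x ` I)) = UNIV"
 shows "EX T:bops. (ALL i:I. blinfun_apply T (x i) = y i) & (ALL u v. ip (T u) (T v) = ip u v)"
proof -
 define S where "S = (%i. (x i, y i)) ` I"
 have 1: "ip (snd p) (snd q) = ip (fst p) (fst q)" if "p \<in> cspan S" "q \<in> S" for p q
  using that(1) by (induction rule: cspan_induct)
   (use that(2) ip in \<open>auto simp: S_def cinner_simps scaleC_prod_def\<close>)
 have 2: "ip (snd p) (snd q) = ip (fst p) (fst q)" if "p \<in> cspan S" "q \<in> cspan S" for p q
  using that(2) by (induction rule: cspan_induct)
   (use 1[OF that(1)] in \<open>auto simp: cinner_simps scaleC_prod_def\<close>)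
 have "norm (snd p) = norm (fst p)" if "p \<in> cspan S" for p
  using 2[OF that that] unfolding cinner_self by (simp add: power2_eq_iff_nonneg flip: of_real_power)
 then have "EX T:bops. (ALL p:S. blinfun_apply T (fst p) = snd p) & norm T <= 1 &
  (ALL z. (ALL p:S. ip (fst p) z = 0) --> T z = 0)"
  by (intro graph_extension) auto
 then obtain T where T: "bop T" "!!i. i \<in> I ==> blinfun_apply T (x i) = y i"
  by (auto simp: S_def)
 have "adj T oo T = idL"
  by (rule bops_eqI[OF _ _ tot tot]) (use T ip in \<open>auto simp: cinner_adj_right\<close>)
 then have "ip (T u) (T v) = ip u v" for u v
  using cinner_adj_right[OF T(1), of u "T v"] by (metis blinfun_apply_blinfun_compose blinfun_apply_id_blinfun id_apply)
 with T show ?thesis by blast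
qed

text \<open>The bound is required on finite combinations because the families may be dependent. For
  fixed \<open>j\<close> it makes x i \<mapsto> cnj (s i j) a bounded functional, represented by a
  vector \<open>w j\<close>; used a second time, it makes y j \<mapsto> w j bounded.\<close>

lemma form_extension:
 fixes x :: "'i => 'a::chilbert" and y :: "'j => 'b::chilbert" and s :: "'i => 'j => complex"
 assumes b: "!!(m::nat) (n::nat) a i b j. cmod (\<Sum>k<m. \<Sum>l<n. cnj (a k) * b l * s (i k) (j l))
   <= C * norm (\<Sum>k<m. a k *\<^sub>C x (i k)) * norm (\<Sum>l<n. b l *\<^sub>C y (j l))"
  and C: "0 <= C" and tot: "closure (cspan (range x)) = UNIV"
 shows "EX T:bops. (ALL i j. ip (x i) (blinfun_apply T (y j)) = s i j) & norm T <= C"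
proof -
 have comb: "EX (n::nat) a i. p = (\<Sum>k<n. a k *\<^sub>C h (i k))" if p: "p \<in> cspan (range h)"
  for p :: "'z::chilbert" and h :: "'l => 'z"
 proof -
  have "p \<in> cspan {c *\<^sub>C h i | c i. True}"
   using p cspan_mono(1)[of "range h" "{c *\<^sub>C h i | c i. True}"]
   by (metis (mono_tags, lifting) mem_Collect_eq image_subset_iff rangeE scaleC_one subsetD subsetI)
  moreover have "c *\<^sub>C x \<in> {c *\<^sub>C h i | c i. True}" if "x \<in> {c *\<^sub>C h i | c i. True}" for c x
   using that by (force simp: scaleC_scaleC)
  ultimately obtain n :: nat and q where
   q: "ALL k<n. EX c i. q k = c *\<^sub>C h i" "p = (\<Sum>k<n. q k)"
   using cspan_closed_scale_sum[of p "{c *\<^sub>C h i | c i. True}"] by auto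
  then obtain a i where "!!k. k < n ==> q k = a k *\<^sub>C h (i k)" by metis
  with q(2) show ?thesis by (intro exI[of _ n] exI[of _ a] exI[of _ i]) simp
 qed
 have "EX w. ALL i. ip (x i) w = s i j" for j
 proof -
  define S where "S = range (%i. (x i, cnj (s i j)))"
  have "EX T:bops. (ALL p:S. blinfun_apply T (fst p) = snd p) & norm T <= C * norm (y j) &
   (ALL z. (ALL p:S. ip (fst p) z = 0) --> T z = 0)"
  proof (rule graph_extension)
   fix p assume "p \<in> cspan S"
   from comb[OF this[unfolded S_def]] obtain n :: nat and a i where
    p: "p = (\<Sum>k<n. a k *\<^sub>C (x (i k), cnj (s (i k) j)))" by blast
   have p1: "fst p = (\<Sum>k<n. a k *\<^sub>C x (i k))" unfolding p by (simp add: fst_sum scaleC_prod_def)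
   have "cnj (snd p) = (\<Sum>k<n. cnj (a k) * s (i k) j)"
    unfolding p by (simp add: snd_sum scaleC_prod_def scaleC_complex_def)
   moreover have "cmod (\<Sum>k<n. cnj (a k) * s (i k) j) <= C * norm (fst p) * norm (y j)"
    using b[where n = 1 and b = "%_. 1" and j = "%_. j"] unfolding p1 by simp
   ultimately show "norm (snd p) <= C * norm (y j) * norm (fst p)"
    by (metis complex_mod_cnj mult.assoc mult.commute)
  qed (use C in auto)
  then obtain T where T: "bop T" "!!i. blinfun_apply T (x i) = cnj (s i j)" by (auto simp: S_def)
  from riesz[OF T(1)] obtain z where "!!x. T x = ip z x" by blast
  then have "ip (x i) z = s i j" for i using T(2)[of i] cinner_commute[of "x i" z] by simp
  then show ?thesis by blast
 qed
 then obtain w where w: "!!i j. ip (x i) (w j) = s i j" by metis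
 define S where "S = range (%j. (y j, w j))"
 have "EX T:bops. (ALL p:S. blinfun_apply T (fst p) = snd p) & norm T <= C &
  (ALL z. (ALL p:S. ip (fst p) z = 0) --> T z = 0)"
 proof (rule graph_extension[OF _ C])
  fix p assume "p \<in> cspan S"
  from comb[OF this[unfolded S_def]] obtain n :: nat and c j where
   p: "p = (\<Sum>l<n. c l *\<^sub>C (y (j l), w (j l)))" by blast
  have p1: "fst p = (\<Sum>l<n. c l *\<^sub>C y (j l))" and p2: "snd p = (\<Sum>l<n. c l *\<^sub>C w (j l))"
   unfolding p by (auto simp: fst_sum snd_sum scaleC_prod_def)
  have cl: "closed {z. cmod (ip z (snd p)) <= C * norm (fst p) * norm z}"
   by (intro closed_Collect_le continuous_intros)
  have "cspan (range x) <= {z. cmod (ip z (snd p)) <= C * norm (fst p) * norm z}"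
  proof
   fix z assume "z \<in> cspan (range x)"
   from comb[OF this] obtain m :: nat and a i where z: "z = (\<Sum>k<m. a k *\<^sub>C x (i k))" by blast
   have "ip z (snd p) = (\<Sum>k<m. \<Sum>l<n. cnj (a k) * c l * s (i k) (j l))"
    unfolding z p2 cinner_sum_left
    by (simp add: cinner_sum_right cinner_simps w sum_distrib_left mult_ac)
   then show "z \<in> {z. cmod (ip z (snd p)) <= C * norm (fst p) * norm z}"
    using b[where m = m and n = n and a = a and b = c and i = i and j = j]
    by (simp add: p1 z mult_ac)
  qed
  with cl tot have "cmod (ip z (snd p)) <= C * norm (fst p) * norm z" for z
   using closure_minimal by blast
  then show "norm (snd p) <= C * norm (fst p)" by (rule norm_le_cinner) (use C in simp)
 qed
 then obtain T where "bop T" "!!j. blinfun_apply T (y j) = w j" "norm T <= C" by (auto simp: S_def)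
 then show ?thesis by (intro bexI[of _ T]) (auto simp: w)
qed

section \<open>Tensor products of operators\<close>

lemma total_vec_of: "closure (cspan (range (vec_of :: 'a::pos_kernel => _))) = UNIV"
proof -
 have "combo a \<in> cspan (range vec_of)" for a :: "(complex \<times> 'a) list"
 proof (induction a)
  case Nil
  have "combo [] = (0 :: 'a hilb)"
   by (simp add: Rep_hilb_inject[symmetric] combo.rep_eq zero_hilb.rep_eq form_def fun_eq_iff)
  then show ?case by (simp add: cspan_zero)
 next
  case (Cons p a)
  have "combo (p # a) = fst p *\<^sub>C vec_of (snd p) + combo a"
   using form_append_right[where b = "[p]" and b' = a]
   by (simp add: Rep_hilb_inject[symmetric] combo.rep_eq plus_hilb.rep_eq scaleC_hilb.rep_eq
    vec_of_def fun_eq_iff) (simp add: form_def)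
  with Cons show ?case by (simp add: cspan_add(1) cspan_scale(1) cspan_base(1))
 qed
 then have "closure (range combo) <= closure (cspan (range (vec_of :: 'a => _)))"
  by (intro closure_mono) auto
 then show ?thesis using closure_combos by blast
qed

lemma bounded_linear_tens_right: "bounded_linear (%x. u \<otimes> x)"
 by (rule bounded_linear_intro[where K = "norm u"])
  (auto simp: tens_add_right scaleR_scaleC tens_scaleC_right norm_tens mult.commute)

lift_definition left_ket :: "'a::chilbert => 'b::chilbert =>L ('a, 'b) tensor" is "%u x. u \<otimes> x"
 by (rule bounded_linear_tens_right)

lemmas tens_ket_apply [simp] = tens_ket.rep_eq
lemmas left_ket_apply [simp] = left_ket.rep_eq

lemma bops_tens_ket [simp, intro]: "tens_ket x \<in> bops"
 by (rule bopsI) (auto simp: tens_add_left tens_scaleC_left)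

lemma bops_left_ket [simp, intro]: "left_ket u \<in> bops"
 by (rule bopsI) (auto simp: tens_add_right tens_scaleC_right)

lemma tens_diff_left: "(u - v) \<otimes> x = u \<otimes> x - v \<otimes> x"
 and tens_diff_right: "u \<otimes> (x - y) = u \<otimes> x - u \<otimes> y"
 and tens_zero_left [simp]: "0 \<otimes> x = 0"
 and tens_zero_right [simp]: "u \<otimes> 0 = 0"
 and tens_sum_left: "(\<Sum>i\<in>I. f i) \<otimes> x = (\<Sum>i\<in>I. f i \<otimes> x)"
 and tens_sum_right: "u \<otimes> (\<Sum>i\<in>I. g i) = (\<Sum>i\<in>I. u \<otimes> g i)"
 using blinfun.diff_right[of "tens_ket x"] blinfun.diff_right[of "left_ket u"]
  blinfun.zero_right[of "tens_ket x"] blinfun.zero_right[of "left_ket u"]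
  blinfun.sum_right[of "tens_ket x" f I] blinfun.sum_right[of "left_ket u" g I] by auto

lemma adj_tens_ket [simp]: "adj (tens_ket x) (u \<otimes> y) = ip x y *\<^sub>C u"
 by (rule cinner_ext) (simp add: cinner_adj_right cinner_tens cinner_scaleC_right mult.commute)

lemma adj_left_ket [simp]: "adj (left_ket u) (v \<otimes> y) = ip u v *\<^sub>C y"
 by (rule cinner_ext) (simp add: cinner_adj_right cinner_tens cinner_scaleC_right)

lemma norm_tens_ket_le: "norm (tens_ket x) <= norm x"
 by (rule norm_blinfun_bound) (auto simp: norm_tens mult.commute)

lemma norm_left_ket_le: "norm (left_ket u) <= norm u"
 by (rule norm_blinfun_bound) (auto simp: norm_tens)

lemma total_tens_sets:
 fixes D :: "'a::chilbert set" and E :: "'b::chilbert set"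
 assumes D: "closure (cspan D) = UNIV" and E: "closure (cspan E) = UNIV"
 shows "closure (cspan {u \<otimes> x | u x. u \<in> D & x \<in> E}) = UNIV"
 unfolding closure_cspan_UNIV_iff
proof (intro allI impI)
 fix z assume z: "ALL w:{u \<otimes> x |u x. u \<in> D & x \<in> E}. ip w z = 0"
 have 1: "adj (tens_ket x) z = 0" if "x \<in> E" for x
  by (rule total_ext[OF D]) (use z that in \<open>force simp: cinner_adj_right\<close>)
 have 2: "adj (left_ket u) z = 0" for u
 proof (rule total_ext[OF E])
  fix x assume "x \<in> E"
  from 1[OF this] show "ip x (adj (left_ket u) z) = ip x 0"
   using cinner_adj_right[of "tens_ket x" u z] by (simp add: cinner_adj_right)
 qed
 have "ip (u \<otimes> x) z = 0" for u x
  using 2[of u] cinner_adj_right[of "left_ket u" x z] by simp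
 moreover have "range (vec_of :: ('a, 'b) pre_tensor => _) = {u \<otimes> x | u x. True}"
  unfolding tens_def by auto (metis pre_tensor.exhaust)
 ultimately show "z = 0"
  using closure_cspan_UNIV_iff[THEN iffD1, OF total_vec_of, rule_format, of z] by force
qed

lemma total_UNIV: "closure (cspan (UNIV :: 'a::chilbert set)) = UNIV"
 using cspan_base(1)[where S = UNIV] closure_subset by fastforce

lemma total_tens: "closure (cspan {u \<otimes> x | (u :: 'a::chilbert) (x :: 'b::chilbert). True}) = UNIV"
 using total_tens_sets[OF total_UNIV total_UNIV] by simp

lemma bops_tensor_eqI:
 assumes "bop S" "bop T" "!!u x. blinfun_apply S (u \<otimes> x) = T (u \<otimes> x)"
 shows "S = T"
 by (rule bops_eq_on_total[OF assms(1,2) total_tens]) (use assms(3) in auto)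

lemma bops_tensor_cinner_eqI:
 fixes S T :: "('a::chilbert, 'b::chilbert) tensor =>L ('c::chilbert, 'd::chilbert) tensor"
 assumes "bop S" "bop T"
  and "!!u x v y. ip (u \<otimes> x) (blinfun_apply S (v \<otimes> y)) = ip (u \<otimes> x) (T (v \<otimes> y))"
 shows "S = T"
 by (rule bops_eqI[OF assms(1,2) total_tens total_tens]) (use assms(3) in auto)

text \<open>Positivity of the defect of a bounded operator, put as a kernel to which Schur products
  apply.\<close>

lemma psd_defect:
 fixes S :: "'a::chilbert =>L 'b::chilbert"
 assumes S: "bop S"
 shows "psd I (%i j. of_real ((norm S)\<^sup>2) * ip (u i) (u j) - ip (S (u i)) (S (u j)))"
 unfolding psd_def
proof (intro conjI ballI allI)
 fix i j
 show "of_real ((norm S)\<^sup>2) * ip (u i) (u j) - ip (S (u i)) (S (u j)) =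
  cnj (of_real ((norm S)\<^sup>2) * ip (u j) (u i) - ip (S (u j)) (S (u i)))"
  using cinner_commute[of "u i" "u j"] cinner_commute[of "S (u i)" "S (u j)"] by simp
next
 fix c
 define v where "v = (\<Sum>i\<in>I. c i *\<^sub>C u i)"
 have Sv: "S v = (\<Sum>i\<in>I. c i *\<^sub>C S (u i))"
  by (simp add: v_def blinfun.sum_right bops_scaleC[OF S])
 have e: "ip (\<Sum>i\<in>I. c i *\<^sub>C w i) (\<Sum>i\<in>I. c i *\<^sub>C w i)
   = (\<Sum>i\<in>I. \<Sum>j\<in>I. cnj (c i) * c j * ip (w i) (w j))" for w :: "_ => 'z::chilbert"
  unfolding cinner_sum_left by (simp add: cinner_sum_right cinner_simps sum_distrib_left mult_ac)
 have "(\<Sum>i\<in>I. \<Sum>j\<in>I. cnj (c i) * c j *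
   (of_real ((norm S)\<^sup>2) * ip (u i) (u j) - ip (S (u i)) (S (u j))))
  = of_real ((norm S)\<^sup>2) * ip v v - ip (S v) (S v)"
  unfolding Sv unfolding v_def e by (simp add: right_diff_distrib sum_subtractf sum_distrib_left mult_ac)
 also have "... = of_real ((norm S * norm v)\<^sup>2 - (norm (S v))\<^sup>2)"
  by (simp add: cinner_self power_mult_distrib)
 also have "Re ... >= 0"
  using power_mono[OF norm_blinfun[of S v], of 2] by simp
 finally show "0 <= Re (\<Sum>i\<in>I. \<Sum>j\<in>I. cnj (c i) * c j *
   (of_real ((norm S)\<^sup>2) * ip (u i) (u j) - ip (S (u i)) (S (u j))))" .
qed

text \<open>With s and t the squared norms and a prime for the adjoint, s t - S'S \<otimes> T'T = t
  (s - S'S) \<otimes> 1 + S'S \<otimes> (t - T'T). Both terms are tensor products of positive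
  operators, whose positivity on finite sums of elementary tensors is the Schur product theorem
  \<open>psd_mult\<close>.\<close>

lemma op_tensor_exists:
 fixes S :: "'a::chilbert =>L 'b::chilbert" and T :: "'c::chilbert =>L 'd::chilbert"
 assumes S: "bop S" and T: "bop T"
 shows "EX R:bops. (ALL u x. blinfun_apply R (u \<otimes> x) = S u \<otimes> T x) & norm R <= norm S * norm T"
proof -
 define G where "G = {(u \<otimes> x, S u \<otimes> T x) | u x. True}"
 have "EX R:bops. (ALL p:G. blinfun_apply R (fst p) = snd p) & norm R <= norm S * norm T &
  (ALL z. (ALL p:G. ip (fst p) z = 0) --> R z = 0)"
 proof (rule graph_extension)
  fix p assume "p \<in> cspan G"
  moreover have "c *\<^sub>C q \<in> G" if "q \<in> G" for c q
  proof -
   obtain u x where "q = (u \<otimes> x, S u \<otimes> T x)" using \<open>q \<in> G\<close> by (auto simp: G_def)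
   then have "c *\<^sub>C q = ((c *\<^sub>C u) \<otimes> x, S (c *\<^sub>C u) \<otimes> T x)"
    by (simp add: scaleC_prod_def tens_scaleC_left bops_scaleC[OF S])
   then show ?thesis unfolding G_def by blast
  qed
  ultimately obtain n :: nat and q where q: "ALL i<n. q i \<in> G" "p = (\<Sum>i<n. q i)"
   using cspan_closed_scale_sum by blast
  then have "ALL i. EX u x. i < n --> q i = (u \<otimes> x, S u \<otimes> T x)" by (auto simp: G_def)
  then obtain u x where ux: "!!i. i < n ==> q i = (u i \<otimes> x i, S (u i) \<otimes> T (x i))" by metis
  define s t where "s = complex_of_real ((norm S)\<^sup>2)" and "t = complex_of_real ((norm T)\<^sup>2)"
  define K where "K i j = s * ip (u i) (u j) - ip (S (u i)) (S (u j))" for i j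
  define L where "L i j = t * ip (x i) (x j) - ip (T (x i)) (T (x j))" for i j
  have "psd {..<n} K" "psd {..<n} L"
   unfolding K_def L_def s_def t_def by (rule psd_defect S T)+
  then have 1: "psd {..<n} (%i j. K i j * ip (x i) (x j))"
   and 2: "psd {..<n} (%i j. ip (S (u i)) (S (u j)) * L i j)"
   by (auto intro!: psd_mult psd_cinner)
  have n1: "ip (fst p) (fst p) = (\<Sum>i<n. \<Sum>j<n. ip (u i) (u j) * ip (x i) (x j))"
   and n2: "ip (snd p) (snd p) = (\<Sum>i<n. \<Sum>j<n. ip (S (u i)) (S (u j)) * ip (T (x i)) (T (x j)))"
   unfolding q(2) fst_sum snd_sum cinner_sum_left unfolding cinner_sum_right
   by (simp_all add: ux cinner_tens)
  define A where "A = (\<Sum>i<n. \<Sum>j<n. K i j * ip (x i) (x j))"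
  define B where "B = (\<Sum>i<n. \<Sum>j<n. ip (S (u i)) (S (u j)) * L i j)"
  have nn: "0 <= Re A" "0 <= Re B"
   using psdD2[OF 1, of "%_. 1"] psdD2[OF 2, of "%_. 1"] by (simp_all add: A_def B_def)
  have "t * A + B = s * t * ip (fst p) (fst p) - ip (snd p) (snd p)"
   unfolding n1 n2 A_def B_def K_def L_def sum_distrib_left sum.distrib[symmetric]
    sum_subtractf[symmetric]
   by (intro sum.cong refl) (simp add: algebra_simps)
  also have "... = of_real ((norm S * norm T * norm (fst p))\<^sup>2 - (norm (snd p))\<^sup>2)"
   by (simp add: cinner_self s_def t_def power_mult_distrib)
  finally have "(norm T)\<^sup>2 * Re A + Re B = (norm S * norm T * norm (fst p))\<^sup>2 - (norm (snd p))\<^sup>2"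
   by (simp add: t_def complex_eq_iff del: of_real_power)
  moreover have "0 <= (norm T)\<^sup>2 * Re A" using nn(1) by simp
  ultimately have "(norm (snd p))\<^sup>2 <= (norm S * norm T * norm (fst p))\<^sup>2"
   using nn(2) by linarith
  then show "norm (snd p) <= norm S * norm T * norm (fst p)"
   by (rule power2_le_imp_le) simp
 qed simp
 then obtain R where R: "bop R" "ALL p:G. blinfun_apply R (fst p) = snd p" "norm R <= norm S * norm T"
  by blast
 have "blinfun_apply R (u \<otimes> x) = S u \<otimes> T x" for u x
  using R(2)[rule_format, of "(u \<otimes> x, S u \<otimes> T x)"] by (auto simp: G_def)
 with R show ?thesis by blast
qed

lemma op_tensor_eqI:
 assumes "bop R" "!!u x. blinfun_apply R (u \<otimes> x) = blinfun_apply S u \<otimes> blinfun_apply T x"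
 shows "S ox T = R"
 unfolding op_tensor_def
proof (rule the_equality)
 show "bop R & (ALL u x. blinfun_apply R (u \<otimes> x) = S u \<otimes> T x)" using assms by blast
 show "R' = R" if "bop R' & (ALL u x. blinfun_apply R' (u \<otimes> x) = S u \<otimes> T x)" for R'
  by (rule bops_tensor_eqI) (use that assms in auto)
qed

lemma
 assumes "bop S" "bop T"
 shows bops_op_tensor [simp, intro]: "S ox T \<in> bops"
  and op_tensor_apply [simp]: "blinfun_apply (S ox T) (u \<otimes> x) = S u \<otimes> T x"
  and norm_op_tensor_le: "norm (S ox T) <= norm S * norm T"
proof -
 obtain R where R: "bop R" "!!u x. blinfun_apply R (u \<otimes> x) = S u \<otimes> T x" "norm R <= norm S * norm T"
  using op_tensor_exists[OF assms] by blast
 with op_tensor_eqI[OF R(1,2)] show "S ox T \<in> bops" "(S ox T) (u \<otimes> x) = S u \<otimes> T x"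
  "norm (S ox T) <= norm S * norm T" by auto
qed

lemma adj_op_tensor: "bop S ==> bop T ==> adj (S ox T) = adj S ox adj T"
 by (rule bops_tensor_cinner_eqI) (auto simp: cinner_adj_right cinner_tens)

lemma op_tensor_compose: "bop S ==> bop T ==> bop S' ==> bop T' ==>
  (S ox T) oo (S' ox T') = (S oo S') ox (T oo T')"
 by (rule bops_tensor_eqI) auto

lemma op_tensor_id [simp]: "ampl idL = idL"
 by (rule op_tensor_eqI) auto

lemma op_tensor_add_left: "bop S ==> bop S' ==> bop T ==> (S + S') ox T = S ox T + S' ox T"
 by (rule op_tensor_eqI) (auto simp: blinfun.add_left tens_add_left)

lemma op_tensor_diff_left: "bop S ==> bop S' ==> bop T ==> (S - S') ox T = S ox T - S' ox T"
 by (rule op_tensor_eqI) (auto simp: blinfun.diff_left tens_diff_left)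

lemma op_tensor_scale_left: "bop S ==> bop T ==> (c *\<^sub>C S) ox T = c *\<^sub>C (S ox T)"
 by (rule op_tensor_eqI) (auto simp: tens_scaleC_left)

lemma op_tensor_zero_left [simp]: "bop T ==> 0 ox T = 0"
 by (rule op_tensor_eqI) auto

lemma op_tensor_sum_right:
 "bop S ==> (!!i. i \<in> I ==> T i \<in> bops) ==> S ox (\<Sum>i\<in>I. T i) = (\<Sum>i\<in>I. S ox T i)"
 by (rule op_tensor_eqI) (auto simp: blinfun.sum_left tens_sum_right)

lemma op_tensor_sum_left:
 "bop T ==> (!!i. i \<in> I ==> S i \<in> bops) ==> (\<Sum>i\<in>I. S i) ox T = (\<Sum>i\<in>I. S i ox T)"
 by (rule op_tensor_eqI) (auto simp: blinfun.sum_left tens_sum_left)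

lemma adj_compose_self:
 assumes "bop T" "!!u v. ip (blinfun_apply T u) (T v) = ip u v"
 shows "adj T oo T = idL"
 by (rule blinfun_eqI, rule cinner_ext) (simp add: cinner_adj_right assms)

lemma isometry_norm:
 assumes "!!u v. ip (blinfun_apply T u) (T v) = ip u v"
 shows "norm (T u) = norm u"
 using assms[of u u] by (simp add: cinner_self power2_eq_iff_nonneg del: of_real_power)

subsection \<open>Rearranging tensor factors\<close>

text \<open>All arrangements of three factors have the same Gram kernel, so
  \<open>isometry_extension\<close> applies.\<close>

lemma tens3_isometries:
 shows "EX T:bops. ALL (a::'a::chilbert) (b::'b::chilbert) (c::'c::chilbert). blinfun_apply T ((a \<otimes> b) \<otimes> c) = a \<otimes> (b \<otimes> c)"
  and "EX T:bops. ALL (a::'a::chilbert) (b::'b::chilbert) (c::'c::chilbert). blinfun_apply T (a \<otimes> (b \<otimes> c)) = (a \<otimes> b) \<otimes> c"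
  and "EX T:bops. ALL (a::'a::chilbert) (b::'b::chilbert) (c::'c::chilbert). blinfun_apply T ((a \<otimes> b) \<otimes> c) = (a \<otimes> c) \<otimes> b"
proof -
 have t1: "range (%(a, b, c). (a \<otimes> b) \<otimes> c) = {u \<otimes> x | u x. u \<in> {a \<otimes> b | a b. True} & x \<in> UNIV}"
  by (rule set_eqI, simp add: image_iff split_paired_Ex, blast)
 have t2: "range (%(a, b, c). a \<otimes> (b \<otimes> c)) = {u \<otimes> x | u x. u \<in> UNIV & x \<in> {a \<otimes> b | a b. True}}"
  by (rule set_eqI, simp add: image_iff split_paired_Ex, blast)
 have T1: "closure (cspan (range (%(a, b, c). ((a::'x::chilbert) \<otimes> (b::'y::chilbert)) \<otimes> (c::'z::chilbert)))) = UNIV"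
  unfolding t1 by (rule total_tens_sets[OF total_tens total_UNIV])
 have T2: "closure (cspan (range (%(a, b, c). (a::'x::chilbert) \<otimes> ((b::'y::chilbert) \<otimes> (c::'z::chilbert))))) = UNIV"
  unfolding t2 by (rule total_tens_sets[OF total_UNIV total_tens])
 show "EX T:bops. ALL (a::'a) (b::'b) (c::'c). blinfun_apply T ((a \<otimes> b) \<otimes> c) = a \<otimes> (b \<otimes> c)"
  using isometry_extension[OF _ T1, of "%(a, b, c). a \<otimes> (b \<otimes> c)"] by (simp add: cinner_tens mult_ac split_def Bex_def) blast
 show "EX T:bops. ALL (a::'a) (b::'b) (c::'c). blinfun_apply T (a \<otimes> (b \<otimes> c)) = (a \<otimes> b) \<otimes> c"
  using isometry_extension[OF _ T2, of "%(a, b, c). (a \<otimes> b) \<otimes> c"] by (simp add: cinner_tens mult_ac split_def Bex_def) blast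
 show "EX T:bops. ALL (a::'a) (b::'b) (c::'c). blinfun_apply T ((a \<otimes> b) \<otimes> c) = (a \<otimes> c) \<otimes> b"
  using isometry_extension[OF _ T1, of "%(a, b, c). (a \<otimes> c) \<otimes> b"] by (simp add: cinner_tens mult_ac split_def Bex_def) blast
qed

definition assoc :: "(('a::chilbert, 'b::chilbert) tensor, 'c::chilbert) tensor =>L ('a, ('b, 'c) tensor) tensor"
 where "assoc = (SOME T. bop T & (ALL a b c. blinfun_apply T ((a \<otimes> b) \<otimes> c) = a \<otimes> (b \<otimes> c)))"

definition flip :: "(('a::chilbert, 'b::chilbert) tensor, 'c::chilbert) tensor =>L (('a, 'c) tensor, 'b) tensor"
 where "flip = (SOME T. bop T & (ALL a b c. blinfun_apply T ((a \<otimes> b) \<otimes> c) = (a \<otimes> c) \<otimes> b))"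

lemma bops_assoc [simp, intro]: "bop assoc" and assoc_apply [simp]: "assoc ((a \<otimes> b) \<otimes> c) = a \<otimes> (b \<otimes> c)"
 using someI_ex[OF tens3_isometries(1)[unfolded Bex_def], folded assoc_def] by auto

lemma bops_flip [simp, intro]: "bop flip" and flip_apply [simp]: "flip ((a \<otimes> b) \<otimes> c) = (a \<otimes> c) \<otimes> b"
 using someI_ex[OF tens3_isometries(3)[unfolded Bex_def], folded flip_def] by auto

lemma bops_tensor3_eqI:
 fixes S :: "(('a::chilbert, 'b::chilbert) tensor, 'c::chilbert) tensor =>L 'd::chilbert"
 assumes "bop S" "bop T" "!!a b c. S ((a \<otimes> b) \<otimes> c) = T ((a \<otimes> b) \<otimes> c)"
 shows "S = T"
 by (rule bops_eq_on_total[OF assms(1,2) total_tens_sets[OF total_tens total_UNIV]]) (use assms(3) in auto)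

lemma bops_tensor3_right_eqI:
 fixes S :: "('a::chilbert, ('b::chilbert, 'c::chilbert) tensor) tensor =>L 'd::chilbert"
 assumes "bop S" "bop T" "!!a b c. S (a \<otimes> (b \<otimes> c)) = T (a \<otimes> (b \<otimes> c))"
 shows "S = T"
 by (rule bops_eq_on_total[OF assms(1,2) total_tens_sets[OF total_UNIV total_tens]]) (use assms(3) in auto)

lemma adj_assoc: "adj assoc (a \<otimes> (b \<otimes> c)) = (a \<otimes> b) \<otimes> c"
proof -
 obtain R :: "('a, ('b, 'c) tensor) tensor =>L (('a, 'b) tensor, 'c) tensor" where
  R: "bop R" "!!a b c. R (a \<otimes> (b \<otimes> c)) = (a \<otimes> b) \<otimes> c" using tens3_isometries(2) by blast
 have "adj assoc = R"
  by (rule bops_eqI[OF _ R(1) total_tens_sets[OF total_tens total_UNIV] total_tens_sets[OF total_UNIV total_tens]])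
   (auto simp: R(2) cinner_adj_right cinner_tens)
 then show ?thesis by (simp add: R(2))
qed

lemma adj_assoc_assoc [simp]: "adj assoc oo assoc = idL"
 by (rule bops_tensor3_eqI) (auto simp: adj_assoc)

lemma assoc_adj_assoc [simp]: "assoc oo adj assoc = idL"
 by (rule bops_tensor3_right_eqI) (auto simp: adj_assoc)

lemma adj_assoc_assoc_apply [simp]: "adj assoc (assoc x) = x"
 and assoc_adj_assoc_apply [simp]: "assoc (adj assoc y) = y"
 by (simp_all flip: blinfun_apply_blinfun_compose)

lemma adj_flip: "adj flip = flip"
 by (rule bops_eqI[OF _ _ total_tens_sets[OF total_tens total_UNIV] total_tens_sets[OF total_tens total_UNIV]])
  (auto simp: cinner_adj_right cinner_tens)

lemma flip_flip [simp]: "flip oo flip = idL"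
 by (rule bops_tensor3_eqI) auto

lemma flip_flip_apply [simp]: "flip (flip x) = x"
 by (simp flip: blinfun_apply_blinfun_compose)

subsection \<open>Orthonormal bases and finite-rank approximation\<close>

lift_definition ketbra :: "'a::chilbert => 'b::chilbert => 'b =>L 'a" is "%e f x. ip f x *\<^sub>C e"
proof (rule bounded_linear_intro)
 fix e :: 'a and f x y :: 'b and r :: real
 show "ip f (x + y) *\<^sub>C e = ip f x *\<^sub>C e + ip f y *\<^sub>C e"
  by (simp add: cinner_simps scaleC_add_left)
 show "ip f (r *\<^sub>R x) *\<^sub>C e = r *\<^sub>R ip f x *\<^sub>C e"
  by (simp add: cinner_simps scaleR_scaleC scaleC_scaleC)
 show "norm (ip f x *\<^sub>C e) <= norm x * (norm f * norm e)"
  using mult_right_mono[OF cinner_CS[of f x], of "norm e"] by (simp add: norm_scaleC mult_ac)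
qed

lemmas ketbra_apply [simp] = ketbra.rep_eq

lemma bops_ketbra [simp, intro]: "ketbra e f \<in> bops"
 by (rule bopsI) (auto simp: cinner_simps scaleC_add_left scaleC_scaleC)

definition onb :: "'a::chilbert set => bool"
 where "onb B \<longleftrightarrow> (ALL e:B. ALL f:B. ip e f = (if e = f then 1 else 0)) & closure (cspan B) = UNIV"

lemma onb_cinner: "onb B ==> e \<in> B ==> f \<in> B ==> ip e f = (if e = f then 1 else 0)"
 by (simp add: onb_def)

lemma exists_onb: "EX B :: 'a::chilbert set. onb B"
proof -
 define OS where "OS = {B :: 'a set. ALL e:B. ALL f:B. ip e f = (if e = f then 1 else 0)}"
 have "EX M:OS. ALL X:OS. M <= X --> X = M"
 proof (rule subset_Zorn')
  fix C assume C: "subset.chain OS C"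
  show "\<Union>C \<in> OS"
   unfolding OS_def
  proof (intro CollectI ballI)
   fix e f assume "e \<in> \<Union>C" "f \<in> \<Union>C"
   then obtain X Y where XY: "X \<in> C" "e \<in> X" "Y \<in> C" "f \<in> Y" by blast
   then have "X <= Y \<or> Y <= X" using C by (auto simp: subset_chain_def)
   then obtain Z where "Z \<in> C" "e \<in> Z" "f \<in> Z" using XY by blast
   moreover have "C <= OS" using C by (auto simp: subset_chain_def)
   ultimately show "ip e f = (if e = f then 1 else 0)" by (auto simp: OS_def)
  qed
 qed
 then obtain B where B: "B \<in> OS" "!!X. X \<in> OS ==> B <= X ==> X = B" by blast
 have "closure (cspan B) = UNIV"
  unfolding closure_cspan_UNIV_iff
 proof (intro allI impI, rule ccontr)
  fix z assume z: "ALL x:B. ip x z = 0" "z ~= 0"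
  define w where "w = complex_of_real (inverse (norm z)) *\<^sub>C z"
  have w1: "ip w w = 1"
   using z(2) by (simp add: w_def cinner_simps cinner_self power2_eq_square norm_scaleC norm_inverse flip: of_real_mult)
  have w0: "ip x w = 0" "ip w x = 0" if "x \<in> B" for x
   using z(1) that cinner_commute[of z x] by (auto simp: w_def cinner_simps)
  have "w \<notin> B" using w0 w1 by fastforce
  moreover have "insert w B \<in> OS" using B(1) w0 w1 \<open>w \<notin> B\<close> by (auto simp: OS_def)
  ultimately show False using B(2)[of "insert w B"] by blast
 qed
 with B(1) show ?thesis unfolding onb_def OS_def by blast
qed

definition fin_proj :: "'a::chilbert set => 'a =>L 'a"
 where "fin_proj S = (\<Sum>e\<in>S. ketbra e e)"

lemma bops_fin_proj [simp, intro]: "fin_proj S \<in> bops"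
 unfolding fin_proj_def by (rule bops_sum) simp

lemma adj_fin_proj: "adj (fin_proj S) = fin_proj S"
 by (rule adj_eqI) (auto simp: fin_proj_def blinfun.sum_left cinner_sum_left cinner_sum_right cinner_simps
  intro!: sum.cong, metis cinner_commute)

lemma fin_proj_onb:
 assumes B: "onb B" and S: "finite S" "S <= B"
 shows "fin_proj S oo fin_proj S = fin_proj S" and "norm (fin_proj S) <= 1"
proof -
 have "fin_proj S e = e" if "e \<in> S" for e
 proof -
  have "fin_proj S e = (\<Sum>f\<in>S. if f = e then e else 0)"
   unfolding fin_proj_def blinfun.sum_left using S that by (intro sum.cong) (auto simp: onb_cinner[OF B] subsetD)
  also have "... = e" using that S(1) by simp
  finally show ?thesis .
 qed
 note fixed = this
 have idem: "fin_proj S (fin_proj S x) = fin_proj S x" for x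
 proof -
  have x: "fin_proj S x = (\<Sum>e\<in>S. ip e x *\<^sub>C e)" by (simp add: fin_proj_def blinfun.sum_left)
  have "fin_proj S (fin_proj S x) = (\<Sum>e\<in>S. ip e x *\<^sub>C fin_proj S e)"
   unfolding x by (simp add: blinfun.sum_right bops_scaleC[OF bops_fin_proj])
  also have "... = fin_proj S x" unfolding x by (intro sum.cong) (auto simp: fixed)
  finally show ?thesis .
 qed
 then show "fin_proj S oo fin_proj S = fin_proj S" by (intro blinfun_eqI) simp
 show "norm (fin_proj S) <= 1"
 proof (rule norm_blinfun_bound)
  fix x
  have "complex_of_real ((norm (fin_proj S x))\<^sup>2) = ip x (fin_proj S x)"
   using cinner_adj_right[of "fin_proj S" x "fin_proj S x"]
   by (simp add: adj_fin_proj idem cinner_self del: of_real_power)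
  then have "(norm (fin_proj S x))\<^sup>2 <= norm x * norm (fin_proj S x)"
   using cinner_CS[of x "fin_proj S x"] by (metis norm_of_real abs_of_nonneg zero_le_power2)
  then show "norm (fin_proj S x) <= 1 * norm x"
   by (cases "fin_proj S x = 0") (auto simp: power2_eq_square)
 qed simp
qed

text \<open>A general filter, because the approximate units below are indexed by the finite subsets
  of a basis of arbitrary cardinality; the uniform bound carries convergence from a total set to all
  vectors.\<close>

lemma tendsto_on_total:
 fixes T :: "'i => 'a::chilbert =>L 'b::chilbert"
 assumes T: "\<forall>\<^sub>F i in F. T i \<in> bops & norm (T i) <= C" and T0: "bop T0"
  and D: "closure (cspan D) = UNIV" and lim: "!!x. x \<in> D ==> ((%i. T i x) ---> T0 x) F"
 shows "((%i. T i x) ---> T0 x) F"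
proof -
 have span: "((%i. T i y) ---> T0 y) F" if "y \<in> cspan D" for y
  using that
 proof (induction rule: cspan_induct)
  case (scale c y)
  have "((%i. c *\<^sub>C T i y) ---> T0 (c *\<^sub>C y)) F"
   using tendsto_scaleC[OF scale(2), of c] by (simp add: bops_scaleC[OF T0])
  then show ?case
   by (rule Lim_transform_eventually) (use T in \<open>auto elim!: eventually_mono simp: bops_scaleC\<close>)
 qed (auto simp: lim blinfun.add_right intro: tendsto_add)
 show ?thesis
 proof (rule tendstoI)
  fix e :: real assume e: "e > 0"
  define K where "K = \<bar>C\<bar> + norm T0 + 1"
  have K: "K > 0" by (simp add: K_def add_nonneg_pos)
  have "x \<in> closure (cspan D)" using D by simp
  then obtain y where y: "y \<in> cspan D" "dist y x < e / (2 * K)"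
   using e K by (metis closure_approachable divide_pos_pos mult_pos_pos zero_less_numeral)
  have "\<forall>\<^sub>F i in F. dist (T i y) (T0 y) < e / 2" using span[OF y(1)] e by (intro tendstoD) auto
  with T show "\<forall>\<^sub>F i in F. dist (T i x) (T0 x) < e"
  proof eventually_elim
   case (elim i)
   have "norm (T i x - T0 x) = norm (T i (x - y) + (T i y - T0 y) + T0 (y - x))"
    by (simp add: blinfun.diff_right)
   also have "... <= norm (T i (x - y)) + norm (T i y - T0 y) + norm (T0 (y - x))"
    by (intro norm_triangle_le add_mono order_refl norm_triangle_ineq)
   also have "... <= \<bar>C\<bar> * norm (x - y) + norm (T i y - T0 y) + norm T0 * norm (y - x)"
    using elim(1) by (intro add_mono order_refl norm_blinfun order_trans[OF norm_blinfun] mult_right_mono) auto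
   also have "... <= K * dist y x + dist (T i y) (T0 y)"
    by (simp add: K_def dist_norm norm_minus_commute[of x y] algebra_simps)
   also have "... < e" using y(2) elim(2) K by (simp add: field_simps)
   finally show ?case by (simp add: dist_norm)
  qed
 qed
qed

lemma fin_proj_tendsto:
 assumes B: "onb B"
 shows "((%S. fin_proj S x) ---> x) (finite_subsets_at_top B)"
proof -
 have ev: "\<forall>\<^sub>F S in finite_subsets_at_top B. finite S & S <= B"
  by (rule eventually_finite_subsets_at_top_weakI) auto
 have "((%S. fin_proj S x) ---> idL x) (finite_subsets_at_top B)"
 proof (rule tendsto_on_total[where C = 1 and D = B])
  show "\<forall>\<^sub>F S in finite_subsets_at_top B. fin_proj S \<in> bops & norm (fin_proj S) <= 1"
   using ev by eventually_elim (simp add: fin_proj_onb[OF B])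
  show "closure (cspan B) = UNIV" using B by (simp add: onb_def)
  show "((%S. fin_proj S e) ---> idL e) (finite_subsets_at_top B)" if e: "e \<in> B" for e
  proof (rule tendsto_eventually)
   have "\<forall>\<^sub>F S in finite_subsets_at_top B. finite S & {e} <= S & S <= B"
    using e unfolding eventually_finite_subsets_at_top by (intro exI[of _ "{e}"]) auto
   then show "\<forall>\<^sub>F S in finite_subsets_at_top B. fin_proj S e = idL e"
   proof eventually_elim
    case (elim S)
    have "fin_proj S e = (\<Sum>f\<in>S. if f = e then e else 0)"
     unfolding fin_proj_def blinfun.sum_left using elim e by (intro sum.cong) (auto simp: onb_cinner[OF B] subsetD)
    also have "... = e" using elim by simp
    finally show ?case by simp
   qed
  qed
 qed simp
 then show ?thesis by simp
qed

lemma tensor_proj_tendsto: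
 fixes \<xi> :: "('a::chilbert, 'b::chilbert) tensor" and B :: "'b set"
 assumes B: "onb B"
 shows "((%S. (idL ox fin_proj S) \<xi>) ---> \<xi>) (finite_subsets_at_top B)"
proof -
 have ev: "\<forall>\<^sub>F S in finite_subsets_at_top B. finite S & S <= B"
  by (rule eventually_finite_subsets_at_top_weakI) auto
 have "((%S. (idL ox fin_proj S) \<xi>) ---> idL \<xi>) (finite_subsets_at_top B)"
 proof (rule tendsto_on_total[where C = 1 and D = "{u \<otimes> x | (u::'a) (x::'b). True}"])
  show "\<forall>\<^sub>F S in finite_subsets_at_top B. (idL :: 'a =>L 'a) ox fin_proj S \<in> bops &
    norm ((idL :: 'a =>L 'a) ox fin_proj S) <= 1"
   using ev
  proof eventually_elim
   case (elim S)
   have "norm ((idL :: 'a =>L 'a) ox fin_proj S) <= norm (idL :: 'a =>L 'a) * norm (fin_proj S)"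
    by (rule norm_op_tensor_le) auto
   also have "... <= 1 * 1"
    using elim by (intro mult_mono norm_blinfun_id_le fin_proj_onb[OF B]) auto
   finally show ?case by simp
  qed
  show "((%S. (idL ox fin_proj S) z) ---> idL z) (finite_subsets_at_top B)"
   if "z \<in> {u \<otimes> x | (u::'a) (x::'b). True}" for z
   using that bounded_linear.tendsto[OF bounded_linear_tens_right fin_proj_tendsto[OF B]] by auto
 qed (simp, rule total_tens)
 then show ?thesis by simp
qed

lemma tensor_proj_tendsto_left:
 fixes \<xi> :: "('a::chilbert, 'b::chilbert) tensor" and B :: "'a set"
 assumes B: "onb B"
 shows "((%S. (ampl (fin_proj S)) \<xi>) ---> \<xi>) (finite_subsets_at_top B)"
proof -
 have ev: "\<forall>\<^sub>F S in finite_subsets_at_top B. finite S & S <= B"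
  by (rule eventually_finite_subsets_at_top_weakI) auto
 have "((%S. (ampl (fin_proj S)) \<xi>) ---> idL \<xi>) (finite_subsets_at_top B)"
 proof (rule tendsto_on_total[where C = 1 and D = "{u \<otimes> x | (u::'a) (x::'b). True}"])
  show "\<forall>\<^sub>F S in finite_subsets_at_top B. fin_proj S ox (idL :: 'b =>L 'b) \<in> bops &
    norm (fin_proj S ox (idL :: 'b =>L 'b)) <= 1"
   using ev
  proof eventually_elim
   case (elim S)
   have "norm (fin_proj S ox (idL :: 'b =>L 'b)) <= norm (fin_proj S) * norm (idL :: 'b =>L 'b)"
    by (rule norm_op_tensor_le) auto
   also have "... <= 1 * 1"
    using elim by (intro mult_mono norm_blinfun_id_le fin_proj_onb[OF B]) auto
   finally show ?case by simp
  qed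
  show "((%S. (ampl (fin_proj S)) z) ---> idL z) (finite_subsets_at_top B)"
   if "z \<in> {u \<otimes> x | (u::'a) (x::'b). True}" for z
   using that bounded_linear.tendsto[OF bounded_linear_tens_left fin_proj_tendsto[OF B]] by auto
 qed (simp, rule total_tens)
 then show ?thesis by simp
qed

lemma ketbra_ampl: "(idL ox ketbra e f) = tens_ket e oo adj (tens_ket f)"
 by (rule op_tensor_eqI) (auto simp: tens_scaleC_left tens_scaleC_right)

lemma ketbra_ampl_left: "ampl (ketbra e f) = left_ket e oo adj (left_ket f)"
 by (rule op_tensor_eqI) (auto simp: tens_scaleC_left tens_scaleC_right)

text \<open>Inserting the approximate unit \<open>idL ox fin_proj S\<close> on the right breaks a
  vector functional of an amplification into functionals of \<open>T\<close> itself, one for each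
  basis vector.\<close>

lemma slices_has_sum:
 fixes \<xi> \<eta> :: "('a::chilbert, 'b::chilbert) tensor" and T :: "'a =>L 'a"
 assumes B: "onb B" and T: "bop T"
 shows "((%e. ip (adj (tens_ket e) \<xi>) (T (adj (tens_ket e) \<eta>))) has_sum
  ip \<xi> (ampl T \<eta>)) B"
 unfolding has_sum_def
proof (rule Lim_transform_eventually)
 show "((%S. ip \<xi> (ampl T ((idL ox fin_proj S) \<eta>))) --->
   ip \<xi> (ampl T \<eta>)) (finite_subsets_at_top B)"
  by (intro tendsto_cinner tendsto_const blinfun.tendsto tensor_proj_tendsto B)
 show "\<forall>\<^sub>F S in finite_subsets_at_top B. ip \<xi> (ampl T ((idL ox fin_proj S) \<eta>)) =
   (\<Sum>e\<in>S. ip (adj (tens_ket e) \<xi>) (T (adj (tens_ket e) \<eta>)))"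
  by (rule eventually_finite_subsets_at_top_weakI)
   (simp add: fin_proj_def op_tensor_sum_right ketbra_ampl blinfun.sum_left blinfun.sum_right
    cinner_sum_right T cinner_adj_left)
qed

lemma slices_norm_has_sum:
 assumes B: "onb B"
 shows "((%e. (norm (adj (tens_ket e) \<xi>))\<^sup>2) has_sum (norm \<xi>)\<^sup>2) B"
 using has_sum_Re[OF slices_has_sum[OF B bops_id, of \<xi> \<xi>]] by (simp add: norm_sq_cinner)

section \<open>Square-summable sequences and the ultraweak topology\<close>

text \<open>\<open>'i ell2\<close> is the Hilbert space with orthonormal basis indexed by the type \<open>'i\<close>.\<close>

datatype 'i point = Point 'i

instantiation point :: (type) pos_kernel
begin
definition kern_point :: "'a point => 'a point => complex" where "kern_point x y = (if x = y then 1 else 0)"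
instance
proof
 fix n :: nat and x :: "nat => 'a point"
 show "psd {..<n} (%i j. kern (x i) (x j))"
 proof (rule psd_blocks[where l = x])
  fix m
  have "psd {i \<in> {..<n}. x i = m} (%i j. \<Prod>b\<in>({}::nat set). 1)"
   by (rule psd_prod) auto
  then show "psd {i \<in> {..<n}. x i = m} (%i j. kern (x i) (x j))"
   by (rule psd_cong[rotated]) (auto simp: kern_point_def)
 qed (auto simp: kern_point_def)
qed
end

type_synonym 'i ell2 = "'i point hilb"

definition unit_vec :: "'i => 'i ell2" where "unit_vec i = vec_of (Point i)"

lemma cinner_unit_vec [simp]: "ip (unit_vec i) (unit_vec j) = (if i = j then 1 else 0)"
 by (simp add: unit_vec_def cinner_vec_of kern_point_def)

lemma norm_unit_vec [simp]: "norm (unit_vec i) = 1"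
 using norm_sq_cinner[of "unit_vec i"] norm_ge_zero[of "unit_vec i"]
 by (simp add: power2_eq_1_iff del: norm_ge_zero)

lemma norm_sq_orthogonal_sum:
 fixes f :: "'i => 'a::chilbert"
 assumes "finite I" "!!i j. i \<in> I ==> j \<in> I ==> i ~= j ==> ip (f i) (f j) = 0"
 shows "(norm (\<Sum>i\<in>I. f i))\<^sup>2 = (\<Sum>i\<in>I. (norm (f i))\<^sup>2)"
 using assms
proof (induction I rule: finite_induct)
 case (insert i I)
 then have "ip (f i) (\<Sum>i\<in>I. f i) = 0" unfolding cinner_sum_right by (intro sum.neutral) auto
 with insert show ?case by (simp add: norm_add_sq)
qed simp

lemma summable_orthogonal:
 fixes f :: "nat => 'a::chilbert"
 assumes s: "summable (%n. (norm (f n))\<^sup>2)" and o: "!!i j. i ~= j ==> ip (f i) (f j) = 0"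
 shows "summable f"
 unfolding summable_Cauchy
proof (intro allI impI)
 fix e :: real assume e: "e > 0"
 then have "e\<^sup>2 > 0" by simp
 with s obtain N where N: "!!m n. m >= N ==> norm (\<Sum>k=m..<n. (norm (f k))\<^sup>2) < e\<^sup>2"
  unfolding summable_Cauchy by blast
 have "norm (sum f {m..<n}) < e" if "m >= N" for m n
 proof -
  have "(norm (sum f {m..<n}))\<^sup>2 = (\<Sum>k=m..<n. (norm (f k))\<^sup>2)"
   using o by (intro norm_sq_orthogonal_sum) auto
  also have "... < e\<^sup>2" using N[OF that, of n] by simp
  finally show ?thesis using e by (intro power2_less_imp_less[of _ e]) auto
 qed
 then show "EX N. ALL m>=N. ALL n. norm (sum f {m..<n}) < e" by blast
qed

text \<open>The two square-summable sequences that define an ultraweakly continuous functional are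
  packed into single vectors, labelled by an orthonormal sequence; the functional becomes a vector
  functional of an amplification of \<open>T\<close>.\<close>

lemma sequences_ampl:
 fixes x :: "nat => 'a::chilbert" and y :: "nat => 'b::chilbert"
 assumes x: "summable (%n. (norm (x n))\<^sup>2)" and y: "summable (%n. (norm (y n))\<^sup>2)" and T: "bop T"
 shows "(%n. ip (x n) (blinfun_apply T (y n))) sums
  ip (\<Sum>n. x n \<otimes> unit_vec n) (ampl T (\<Sum>n. y n \<otimes> unit_vec n))"
proof -
 have sm: "summable (%n. z n \<otimes> unit_vec n)" if "summable (%n. (norm (z n))\<^sup>2)" for z :: "nat => 'z::chilbert"
  using that by (intro summable_orthogonal) (auto simp: norm_tens cinner_tens)
 define \<xi> where "\<xi> = (\<Sum>n. x n \<otimes> unit_vec n)"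
 define \<eta> where "\<eta> = (\<Sum>n. y n \<otimes> unit_vec n)"
 have sx: "(%n. x n \<otimes> unit_vec n) sums \<xi>" and sy: "(%n. y n \<otimes> unit_vec n) sums \<eta>"
  unfolding \<xi>_def \<eta>_def by (intro summable_sums sm x y)+
 have "(%n. ip (x n) (blinfun_apply T (y n))) sums ip \<xi> (ampl T \<eta>)"
  unfolding sums_def
 proof (rule Lim_transform_eventually)
  show "(%n. ip (\<Sum>i<n. x i \<otimes> unit_vec i) (ampl T (\<Sum>i<n. y i \<otimes> unit_vec i)))
   ----> ip \<xi> (ampl T \<eta>)"
   using sx sy unfolding sums_def by (intro tendsto_cinner blinfun.tendsto tendsto_const)
  have "ip (\<Sum>i<n. x i \<otimes> unit_vec i) (ampl T (\<Sum>i<n. y i \<otimes> unit_vec i))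
   = (\<Sum>i<n. ip (x i) (blinfun_apply T (y i)))" for n
  proof -
   have "ip (\<Sum>i<n. x i \<otimes> unit_vec i) (ampl T (\<Sum>i<n. y i \<otimes> unit_vec i))
    = (\<Sum>i<n. \<Sum>j<n. if j = i then ip (x i) (T (y i)) else 0)"
    unfolding blinfun.sum_right cinner_sum_left unfolding cinner_sum_right
    by (intro sum.cong refl) (auto simp: T cinner_tens)
   then show ?thesis by simp
  qed
  then show "\<forall>\<^sub>F n in sequentially. ip (\<Sum>i<n. x i \<otimes> unit_vec i) (ampl T (\<Sum>i<n. y i \<otimes> unit_vec i))
   = (\<Sum>i<n. ip (x i) (blinfun_apply T (y i)))" by simp
 qed
 then show ?thesis unfolding \<xi>_def \<eta>_def .
qed

text \<open>The converse packing, for a second factor of any dimension: square-summability leaves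
  only countably many nonzero slices, which can be listed as sequences. The ultraweak topology is
  thereby the one given by vector functionals of amplifications, the form used from here on.\<close>

lemma ampl_sequences:
 fixes \<xi> \<eta> :: "('a::chilbert, 'b::chilbert) tensor"
 shows "EX x y. summable (%n. (norm (x n))\<^sup>2) & summable (%n. (norm (y n))\<^sup>2) &
  (ALL T:bops. (%n. ip (x n) (blinfun_apply T (y n))) sums ip \<xi> (ampl T \<eta>))"
proof -
 obtain B :: "'b set" where B: "onb B" using exists_onb by blast
 define p q where "p e = adj (tens_ket e) \<xi>" and "q e = adj (tens_ket e) \<eta>" for e
 have sp: "((%e. (norm (p e))\<^sup>2) has_sum (norm \<xi>)\<^sup>2) B" and sq: "((%e. (norm (q e))\<^sup>2) has_sum (norm \<eta>)\<^sup>2) B"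
  unfolding p_def q_def by (rule slices_norm_has_sum[OF B])+
 define C where "C = {e\<in>B. p e ~= 0} Un {e\<in>B. q e ~= 0}"
 have "countable {e\<in>B. (norm (p e))\<^sup>2 ~= 0}" "countable {e\<in>B. (norm (q e))\<^sup>2 ~= 0}"
  by (rule summable_countable_real has_sum_imp_summable, rule has_sum_imp_summable, rule sp sq)+
 then have C: "countable C" by (simp add: C_def)
 define N where "N = to_nat_on C ` C"
 have inj: "inj_on (to_nat_on C) C" using C by (rule inj_on_to_nat_on)
 define x y where "x n = (if n \<in> N then p (from_nat_into C n) else 0)"
  and "y n = (if n \<in> N then q (from_nat_into C n) else 0)" for n
 \<comment> \<open>Reindexing from the basis to the natural numbers; indices outside
   \<open>N\<close> contribute \<open>F 0 0 = 0\<close>.\<close>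
 have transfer: "(%n. F (x n) (y n)) sums s" if "((%e. F (p e) (q e)) has_sum s) B" "F 0 0 = 0"
  for F :: "'a => 'a => 'z::real_normed_vector" and s
 proof -
  have "((%e. F (p e) (q e)) has_sum s) C"
   using that by (subst has_sum_cong_neutral[where T = B and g = "%e. F (p e) (q e)"]) (auto simp: C_def)
  moreover have "F (p e) (q e) = ((%n. F (x n) (y n)) \<circ> to_nat_on C) e" if "e \<in> C" for e
   using that C by (simp add: x_def y_def N_def)
  ultimately have "((%n. F (x n) (y n)) \<circ> to_nat_on C has_sum s) C"
   by (subst has_sum_cong[where g = "%e. F (p e) (q e)"]) auto
  then have "((%n. F (x n) (y n)) has_sum s) N"
   unfolding N_def has_sum_reindex[OF inj] .
  then have "((%n. F (x n) (y n)) has_sum s) UNIV"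
   using that(2) by (subst has_sum_cong_neutral[where T = N and g = "%n. F (x n) (y n)"]) (auto simp: x_def y_def)
  then show ?thesis by (rule has_sum_imp_sums)
 qed
 have "(%n. ip (x n) (blinfun_apply T (y n))) sums ip \<xi> (ampl T \<eta>)" if "bop T" for T
  using transfer[OF slices_has_sum[OF B that, of \<xi> \<eta>, folded p_def q_def]] by simp
 moreover have "summable (%n. (norm (x n))\<^sup>2)" "summable (%n. (norm (y n))\<^sup>2)"
  using transfer[of "%x y. (norm x)\<^sup>2", OF sp] transfer[of "%x y. (norm y)\<^sup>2", OF sq]
  by (auto simp: sums_iff)
 ultimately show ?thesis by blast
qed

lemma topspace_ultraweak [simp]: "topspace ultraweak = (bops :: ('a::chilbert =>L 'b::chilbert) set)"
proof -
 have "T \<in> topspace (topology_generated_by {{T :: 'a =>L 'b. (\<Sum>n. ip (x n) (T (y n))) \<in> U} | x y U.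
   summable (%n. (norm (x n))\<^sup>2) & summable (%n. (norm (y n))\<^sup>2) & open U})" for T :: "'a =>L 'b"
  unfolding topology_generated_by_topspace
  by (rule UnionI[of UNIV]) (auto intro!: exI[of _ "%_. 0"] exI[of _ UNIV])
 then show ?thesis by (auto simp: ultraweak_def)
qed

lemma open_ampl:
 fixes \<xi> \<eta> :: "('a::chilbert, 'b::chilbert) tensor"
 assumes "open W"
 shows "openin ultraweak {T\<in>bops. ip \<xi> (ampl T \<eta>) \<in> W}"
proof -
 obtain x y where xy: "summable (%n. (norm (x n))\<^sup>2)" "summable (%n. (norm (y n))\<^sup>2)"
  "!!T. bop T ==> (%n. ip (x n) (blinfun_apply T (y n))) sums ip \<xi> (ampl T \<eta>)"
  using ampl_sequences[of \<xi> \<eta>] by blast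
 define V where "V = {T :: 'a =>L 'a. (\<Sum>n. ip (x n) (T (y n))) \<in> W}"
 have "{T\<in>bops. ip \<xi> (ampl T \<eta>) \<in> W} = V Int bops"
  using xy(3)[THEN sums_unique, symmetric] by (auto simp: V_def)
 moreover have "openin (topology_generated_by {{T :: 'a =>L 'a. (\<Sum>n. ip (x n) (T (y n))) \<in> U} | x y U.
   summable (%n. (norm (x n))\<^sup>2) & summable (%n. (norm (y n))\<^sup>2) & open U}) V"
  by (rule topology_generated_by_Basis) (use xy assms in \<open>auto simp: V_def\<close>)
 ultimately show ?thesis unfolding ultraweak_def openin_subtopology by blast
qed

lemma continuous_ampl:
 fixes \<xi> \<eta> :: "('a::chilbert, 'b::chilbert) tensor"
 shows "continuous_map ultraweak euclidean (%T. ip \<xi> (ampl T \<eta>))"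
 using open_ampl by (auto simp: continuous_map_def)

lemma continuous_vector_functional:
 "continuous_map ultraweak euclidean (%T :: 'a::chilbert =>L 'a. ip x (blinfun_apply T y))"
proof -
 have "continuous_map ultraweak euclidean (%T :: 'a =>L 'a. ip (x \<otimes> (1::complex)) (ampl T (y \<otimes> (1::complex))))"
  by (rule continuous_ampl)
 then show ?thesis
  by (rule continuous_map_eq) (auto simp: cinner_tens cinner_complex_def)
qed

text \<open>Induction over the generated topology; finitely many functionals with one common
  tolerance form a description stable under intersections.\<close>

lemma ultraweak_neighbourhood:
 fixes T :: "'a::chilbert =>L 'a"
 assumes U: "openin ultraweak U" "T \<in> U"
 shows "EX (P :: (('a, nat ell2) tensor \<times> ('a, nat ell2) tensor) set) \<delta>. finite P & \<delta> > 0 &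
  (ALL S:bops. (ALL p:P. cmod (ip (fst p) ((ampl (S - T)) (snd p))) < \<delta>) --> S \<in> U)"
proof -
 define \<G> where "\<G> = {{T :: 'a =>L 'a. (\<Sum>n. ip (x n) (T (y n))) \<in> U} | x y U.
   summable (%n. (norm (x n))\<^sup>2) & summable (%n. (norm (y n))\<^sup>2) & open U}"
 obtain V where V: "openin (topology_generated_by \<G>) V" "U = V Int bops"
  using U(1) unfolding ultraweak_def openin_subtopology \<G>_def by blast
 have T: "T \<in> V" "bop T" using U(2) V(2) by auto
 have "generate_topology_on \<G> V" using V(1) by (rule openin_topology_generated_by)
 then have "T \<in> V --> (EX (P :: (('a, nat ell2) tensor \<times> ('a, nat ell2) tensor) set) \<delta>. finite P & \<delta> > 0 &
  (ALL S:bops. (ALL p:P. cmod (ip (fst p) ((ampl (S - T)) (snd p))) < \<delta>) --> S \<in> V))"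
 proof induction
  case Empty
  then show ?case by simp
 next
  case (Int a b)
  show ?case
  proof
   assume "T \<in> a Int b"
   with Int obtain P Q :: "(('a, nat ell2) tensor \<times> ('a, nat ell2) tensor) set" and \<delta> \<epsilon>
    where "finite P" "\<delta> > 0" "finite Q" "\<epsilon> > 0"
    and "ALL S:bops. (ALL p:P. cmod (ip (fst p) ((ampl (S - T)) (snd p))) < \<delta>) --> S \<in> a"
    and "ALL S:bops. (ALL p:Q. cmod (ip (fst p) ((ampl (S - T)) (snd p))) < \<epsilon>) --> S \<in> b"
    by auto
   then show "EX (P :: (('a, nat ell2) tensor \<times> ('a, nat ell2) tensor) set) \<delta>. finite P & \<delta> > 0 &
    (ALL S:bops. (ALL p:P. cmod (ip (fst p) ((ampl (S - T)) (snd p))) < \<delta>) --> S \<in> a Int b)"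
    by (intro exI[of _ "P Un Q"] exI[of _ "min \<delta> \<epsilon>"]) auto
  qed
 next
  case (UN K)
  show ?case
  proof
   assume "T \<in> \<Union>K"
   then obtain k where k: "k \<in> K" "T \<in> k" by blast
   with UN(2)[OF k(1)] obtain P :: "(('a, nat ell2) tensor \<times> ('a, nat ell2) tensor) set" and \<delta>
    where "finite P" "\<delta> > 0"
    and "ALL S:bops. (ALL p:P. cmod (ip (fst p) ((ampl (S - T)) (snd p))) < \<delta>) --> S \<in> k"
    by auto
   with k(1) show "EX (P :: (('a, nat ell2) tensor \<times> ('a, nat ell2) tensor) set) \<delta>. finite P & \<delta> > 0 &
    (ALL S:bops. (ALL p:P. cmod (ip (fst p) ((ampl (S - T)) (snd p))) < \<delta>) --> S \<in> \<Union>K)"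
    by (intro exI[of _ P] exI[of _ \<delta>]) auto
  qed
 next
  case (Basis s)
  show ?case
  proof
   assume Ts: "T \<in> s"
   obtain x y W where xy: "summable (%n. (norm (x n))\<^sup>2)" "summable (%n. (norm (y n))\<^sup>2)" "open W"
    "s = {T :: 'a =>L 'a. (\<Sum>n. ip (x n) (T (y n))) \<in> W}"
    using Basis by (auto simp: \<G>_def)
   obtain \<xi> \<eta> :: "('a, nat ell2) tensor" where
    "!!T. bop T ==> (%n. ip (x n) (blinfun_apply T (y n))) sums ip \<xi> (ampl T \<eta>)"
    using sequences_ampl[OF xy(1,2)] by blast
   then have "(\<Sum>n. ip (x n) (blinfun_apply S (y n))) = ip \<xi> (ampl S \<eta>)" if "bop S" for S
    using that by (intro sums_unique[symmetric]) auto
   then have s: "S \<in> s \<longleftrightarrow> ip \<xi> (ampl S \<eta>) \<in> W" if "bop S" for S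
    using that by (simp add: xy(4))
   obtain \<delta> where d: "\<delta> > 0" "ball (ip \<xi> (ampl T \<eta>)) \<delta> <= W"
    using xy(3) s[OF T(2)] Ts openE by blast
   have "S \<in> s" if S: "bop S" "cmod (ip \<xi> ((ampl (S - T)) \<eta>)) < \<delta>" for S
   proof -
    have "dist (ip \<xi> (ampl T \<eta>)) (ip \<xi> (ampl S \<eta>)) < \<delta>"
     using S T by (simp add: dist_commute dist_norm op_tensor_diff_left blinfun.diff_left cinner_diff_right)
    with d s[OF S(1)] show ?thesis by auto
   qed
   with d(1) show "EX (P :: (('a, nat ell2) tensor \<times> ('a, nat ell2) tensor) set) \<delta>. finite P & \<delta> > 0 &
    (ALL S:bops. (ALL p:P. cmod (ip (fst p) ((ampl (S - T)) (snd p))) < \<delta>) --> S \<in> s)"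
    by (intro exI[of _ "{(\<xi>, \<eta>)}"] exI[of _ \<delta>]) auto
  qed
 qed
 with T(1) V(2) show ?thesis by blast
qed

lemma ultraweak_limit_closure:
 fixes G :: "'a::chilbert =>L 'a" and T :: "'i => 'a =>L 'a"
 assumes G: "bop G" and T: "\<forall>\<^sub>F i in F. T i \<in> M & T i \<in> bops" and F: "F ~= bot"
  and lim: "!!\<xi> \<eta> :: ('a, nat ell2) tensor. 
   ((%i. ip \<xi> ((ampl (T i)) \<eta>)) ---> ip \<xi> (ampl G \<eta>)) F"
 shows "G \<in> ultraweak closure_of M"
 unfolding in_closure_of
proof (intro conjI allI impI)
 show "G \<in> topspace ultraweak" using G by simp
 fix U assume U: "G \<in> U & openin ultraweak U"
 then obtain P :: "(('a, nat ell2) tensor \<times> ('a, nat ell2) tensor) set" and \<delta> where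
  P: "finite P" "\<delta> > 0"
  "!!S. bop S ==> (ALL p:P. cmod (ip (fst p) ((ampl (S - G)) (snd p))) < \<delta>) ==> S \<in> U"
  using ultraweak_neighbourhood[of U G] by blast
 have "\<forall>\<^sub>F i in F. ALL p:P. dist (ip (fst p) ((ampl (T i)) (snd p))) (ip (fst p) (ampl G (snd p))) < \<delta>"
  using P(1,2) lim by (intro eventually_ball_finite ballI tendstoD) auto
 with T have "\<forall>\<^sub>F i in F. T i \<in> M & T i \<in> U"
 proof eventually_elim
  case (elim i)
  then show ?case
   by (intro conjI P(3)) (auto simp: G dist_norm op_tensor_diff_left blinfun.diff_left cinner_diff_right)
 qed
 from eventually_happens'[OF F this] show "EX y. y \<in> M & y \<in> U" by blast
qed

text \<open>\<open>Q\<close> is an approximate unit of contractions. The outer \<open>L\<close>,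
  which \<open>G\<close> absorbs, puts each approximant back under the support constraint that
  membership in \<open>M\<close> may impose; with \<open>L = idL\<close> this is plain
  compression.\<close>

lemma closure_of_compressions:
 fixes G :: "'a::chilbert =>L 'a" and Q :: "'i => 'a =>L 'a"
 assumes G: "bop G" and F: "F ~= bot" and L: "bop L" "adj L = L" "G = L oo G oo L"
  and Q: "\<forall>\<^sub>F i in F. Q i \<in> bops & adj (Q i) = Q i & norm (Q i) <= 1 & L oo (Q i oo G oo Q i) oo L \<in> M"
  and lim: "!!x. ((%i. Q i x) ---> x) F"
 shows "G \<in> ultraweak closure_of M"
proof (rule ultraweak_limit_closure[OF G _ F])
 show "\<forall>\<^sub>F i in F. L oo (Q i oo G oo Q i) oo L \<in> M & L oo (Q i oo G oo Q i) oo L \<in> bops"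
  using Q by eventually_elim (auto simp: G L(1))
 fix \<xi> \<eta> :: "('a, nat ell2) tensor"
 have lim2: "((%i. (ampl (Q i)) z) ---> idL z) F" for z :: "('a, nat ell2) tensor"
 proof (rule tendsto_on_total[where C = 1, OF _ _ total_tens])
  show "\<forall>\<^sub>F i in F. Q i ox (idL :: nat ell2 =>L _) \<in> bops & norm (Q i ox (idL :: nat ell2 =>L _)) <= 1"
   using Q
  proof eventually_elim
   case (elim i)
   then have "norm (Q i ox (idL :: nat ell2 =>L _)) <= norm (Q i) * norm (idL :: nat ell2 =>L _)"
    by (intro norm_op_tensor_le) auto
   also have "... <= 1 * 1" using elim by (intro mult_mono norm_blinfun_id_le) auto
   finally show ?case using elim by auto
  qed
  show "((%i. (ampl (Q i)) z) ---> idL z) F" if zD: "z \<in> {u \<otimes> x |(u::'a) (x::nat ell2). True}" for z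
  proof -
   obtain u x where z: "z = u \<otimes> x" using zD by blast
   have "((%i. Q i u \<otimes> x) ---> u \<otimes> x) F" by (rule bounded_linear.tendsto[OF bounded_linear_tens_left lim])
   moreover have "\<forall>\<^sub>F i in F. Q i u \<otimes> x = (ampl (Q i)) (u \<otimes> x)"
    using Q by eventually_elim simp
   ultimately show ?thesis unfolding z by (auto intro: Lim_transform_eventually)
  qed
 qed simp
 show "((%i. ip \<xi> (((L oo (Q i oo G oo Q i) oo L) ox idL) \<eta>)) ---> ip \<xi> (ampl G \<eta>)) F"
 proof (rule Lim_transform_eventually)
  let ?L = "ampl L :: ('a, nat ell2) tensor =>L _" and ?G = "ampl G :: ('a, nat ell2) tensor =>L _"
  have "((%i. ip ((ampl (Q i)) (?L \<xi>)) (?G ((ampl (Q i)) (?L \<eta>)))) --->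
    ip (idL (?L \<xi>)) (?G (idL (?L \<eta>)))) F"
   by (intro tendsto_cinner blinfun.tendsto tendsto_const lim2)
  also have "ip (idL (?L \<xi>)) (?G (idL (?L \<eta>))) = ip \<xi> ((?L oo ?G oo ?L) \<eta>)"
   using cinner_adj_left[of ?L \<xi>] by (simp add: L(1,2) adj_op_tensor)
  also have "?L oo ?G oo ?L = ?G"
   by (simp add: op_tensor_compose L(1) G flip: L(3))
  finally show "((%i. ip ((ampl (Q i)) (?L \<xi>)) (?G ((ampl (Q i)) (?L \<eta>)))) --->
    ip \<xi> (?G \<eta>)) F" .
  show "\<forall>\<^sub>F i in F. ip ((ampl (Q i)) (?L \<xi>)) (?G ((ampl (Q i)) (?L \<eta>)))
   = ip \<xi> (((L oo (Q i oo G oo Q i) oo L) ox idL) \<eta>)"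
   using Q
  proof eventually_elim
   case (elim i)
   let ?Q = "ampl (Q i) :: ('a, nat ell2) tensor =>L _"
   have "ip \<xi> (((L oo (Q i oo G oo Q i) oo L) ox idL) \<eta>) = ip \<xi> ((?L oo (?Q oo ?G oo ?Q) oo ?L) \<eta>)"
    using elim by (simp add: op_tensor_compose L(1) G)
   also have "... = ip (?Q (?L \<xi>)) (?G (?Q (?L \<eta>)))"
    using cinner_adj_left[of ?L \<xi>] cinner_adj_left[of ?Q "?L \<xi>"] elim by (simp add: L(1,2) adj_op_tensor)
   finally show ?case by simp
  qed
 qed
qed

subsection \<open>Normal maps\<close>

lemma vn_tensor_bops: "T \<in> vn_tensor M N ==> bop T"
 unfolding vn_tensor_def using closure_of_subset_topspace[of ultraweak] by auto

lemma cspan_op_tensor_bops: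
 "M <= bops ==> N <= bops ==> cspan {a ox b | a b. a \<in> M & b \<in> N} <= bops"
proof
 fix T assume MN: "M <= bops" "N <= bops" and "T \<in> cspan {a ox b | a b. a \<in> M & b \<in> N}"
 from this(3) show "bop T" by (induction rule: cspan_blinfun_induct) (use MN in auto)
qed

lemma cspan_op_tensor_vn_tensor:
 "M <= bops ==> N <= bops ==> cspan {a ox b | a b. a \<in> M & b \<in> N} <= vn_tensor M N"
 unfolding vn_tensor_def by (rule closure_of_subset) (simp add: cspan_op_tensor_bops)

lemma vn_tensor_eqI:
 fixes f g :: "(('a::chilbert, 'b::chilbert) tensor =>L ('a, 'b) tensor) => complex"
 assumes MN: "M <= bops" "N <= bops" and T: "T \<in> vn_tensor M N"
  and f: "continuous_map (subtopology ultraweak (vn_tensor M N)) euclidean f" "clinear_on (vn_tensor M N) f"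
  and g: "continuous_map (subtopology ultraweak (vn_tensor M N)) euclidean g" "clinear_on (vn_tensor M N) g"
  and eq: "!!a b. a \<in> M ==> b \<in> N ==> f (a ox b) = g (a ox b)"
 shows "f T = g T"
proof (rule forall_in_closure_of_eq[OF _ _ f(1) g(1)])
 let ?S = "cspan {a ox b | a b. a \<in> M & b \<in> N}"
 note sub = subsetD[OF cspan_op_tensor_vn_tensor[OF MN]]
 show "T \<in> subtopology ultraweak (vn_tensor M N) closure_of ?S"
  using T cspan_op_tensor_vn_tensor[OF MN]
  by (subst closure_of_subtopology) (auto simp: vn_tensor_def Int_absorb1)
 fix S assume "S \<in> ?S"
 then show "f S = g S"
 proof (induction rule: cspan_blinfun_induct)
  case zero
  have "0 \<in> vn_tensor M N" by (rule sub) (rule cspan_zero)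
  then have "f ((0::complex) *\<^sub>C 0) = 0 *\<^sub>C f 0" "g ((0::complex) *\<^sub>C 0) = 0 *\<^sub>C g 0"
   using f(2) g(2) unfolding clinear_on_def by blast+
  then show ?case by (simp add: scaleC_complex_def)
 next
  case (add x y)
  then show ?case using f(2) g(2) sub by (simp add: clinear_on_def)
 next
  case (scale c x)
  then show ?case using f(2) g(2) sub by (simp add: clinear_on_def)
 qed (use eq in auto)
qed simp

lemma vn_tensor_ampl_eqI:
 fixes T :: "('a::chilbert, 'b::chilbert) tensor =>L ('a, 'b) tensor"
 assumes MN: "M <= bops" "N <= bops" and T: "T \<in> vn_tensor M N"
  and eq: "!!a b. a \<in> M ==> b \<in> N ==>
   ip \<xi> ((ampl (a ox b)) \<eta>) = ip \<xi>' ((ampl (a ox b)) \<eta>')"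
 shows "ip \<xi> (ampl T \<eta>) = ip \<xi>' (ampl T \<eta>')"
 by (rule vn_tensor_eqI[OF MN T])
  (auto intro!: continuous_map_from_subtopology continuous_ampl eq
   simp: clinear_on_def op_tensor_add_left op_tensor_scale_left vn_tensor_bops blinfun.add_left
    cinner_simps scaleC_complex_def)

lemma vn_tensor_cinner_eqI:
 fixes T :: "('a::chilbert, 'b::chilbert) tensor =>L ('a, 'b) tensor"
 assumes MN: "M <= bops" "N <= bops" and T: "T \<in> vn_tensor M N"
  and eq: "!!a b. a \<in> M ==> b \<in> N ==> ip \<xi> ((a ox b) \<eta>) = ip \<xi>' ((a ox b) \<eta>')"
 shows "ip \<xi> (blinfun_apply T \<eta>) = ip \<xi>' (T \<eta>')"
 by (rule vn_tensor_eqI[OF MN T])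
  (auto intro!: continuous_map_from_subtopology continuous_vector_functional eq
   simp: clinear_on_def blinfun.add_left cinner_simps scaleC_complex_def)

text \<open>A description by finitely many amplified functionals and a tolerance, so that sums and
  multiples in a closure can be treated by splitting the tolerance.\<close>

lemma closure_of_ultraweak_iff:
 fixes G :: "'a::chilbert =>L 'a"
 assumes M: "M <= bops"
 shows "G \<in> ultraweak closure_of M \<longleftrightarrow> G \<in> bops &
  (ALL (P :: (('a, nat ell2) tensor \<times> ('a, nat ell2) tensor) set) \<delta>. finite P --> \<delta> > 0 -->
   (EX S:M. ALL p:P. cmod (ip (fst p) ((ampl (S - G)) (snd p))) < \<delta>))" (is "?L \<longleftrightarrow> ?R")
proof
 assume L: ?L
 then have G: "bop G" by (auto simp: in_closure_of)
 moreover have "EX S:M. ALL p:P. cmod (ip (fst p) ((ampl (S - G)) (snd p))) < \<delta>"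
  if P: "finite P" "\<delta> > 0" for P :: "(('a, nat ell2) tensor \<times> ('a, nat ell2) tensor) set" and \<delta>
 proof -
  define V where "V p = {S\<in>bops. ip (fst p) (ampl S (snd p))
   \<in> ball (ip (fst p) (ampl G (snd p))) \<delta>}" for p :: "('a, nat ell2) tensor \<times> ('a, nat ell2) tensor"
  have "openin ultraweak (V p)" for p unfolding V_def by (rule open_ampl) simp
  then have "openin ultraweak ((\<Inter>p\<in>P. V p) Int topspace ultraweak)"
   using P(1) by (intro openin_INT)
  moreover have "G \<in> (\<Inter>p\<in>P. V p) Int topspace ultraweak" using G P by (auto simp: V_def)
  ultimately have "EX S. S \<in> M & S \<in> (\<Inter>p\<in>P. V p) Int topspace ultraweak"
   by (intro L[unfolded in_closure_of, THEN conjunct2, rule_format] conjI)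
  then obtain S where S: "S \<in> M" "!!p. p \<in> P ==> S \<in> V p" by auto
  have "cmod (ip (fst p) ((ampl (S - G)) (snd p))) < \<delta>" if "p \<in> P" for p
   using S(2)[OF that] G by (auto simp: V_def dist_norm op_tensor_diff_left blinfun.diff_left
    cinner_diff_right norm_minus_commute)
  with S(1) show ?thesis by blast
 qed
 ultimately show ?R by blast
next
 assume R: ?R
 show ?L
  unfolding in_closure_of
 proof (intro conjI allI impI)
  show "G \<in> topspace ultraweak" using R by simp
  fix U assume U: "G \<in> U & openin ultraweak U"
  then obtain P :: "(('a, nat ell2) tensor \<times> ('a, nat ell2) tensor) set" and \<delta> where
   P: "finite P" "\<delta> > 0"
   "!!S. bop S ==> (ALL p:P. cmod (ip (fst p) ((ampl (S - G)) (snd p))) < \<delta>) ==> S \<in> U"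
   using ultraweak_neighbourhood[of U G] by blast
  with R obtain S where "S \<in> M" "ALL p:P. cmod (ip (fst p) ((ampl (S - G)) (snd p))) < \<delta>" by blast
  with P(3) M show "EX y. y \<in> M & y \<in> U" by blast
 qed
qed

lemma closure_of_add:
 fixes S T :: "'a::chilbert =>L 'a"
 assumes M: "M <= bops" "!!x y. x \<in> M ==> y \<in> M ==> x + y \<in> M"
  and S: "S \<in> ultraweak closure_of M" and T: "T \<in> ultraweak closure_of M"
 shows "S + T \<in> ultraweak closure_of M"
 unfolding closure_of_ultraweak_iff[OF M(1)]
proof (intro conjI allI impI)
 have ST: "bop S" "bop T" using S T by (auto simp: in_closure_of)
 then show "S + T \<in> bops" by simp
 fix P :: "(('a, nat ell2) tensor \<times> ('a, nat ell2) tensor) set" and \<delta> :: real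
 assume P: "finite P" "\<delta> > 0"
 then obtain S' T' where S': "S' \<in> M" "ALL p:P. cmod (ip (fst p) ((ampl (S' - S)) (snd p))) < \<delta>/2"
  and T': "T' \<in> M" "ALL p:P. cmod (ip (fst p) ((ampl (T' - T)) (snd p))) < \<delta>/2"
  using S T unfolding closure_of_ultraweak_iff[OF M(1)] by (metis half_gt_zero)
 have "cmod (ip (fst p) (((S' + T' - (S + T)) ox idL) (snd p))) < \<delta>" if p: "p \<in> P" for p
 proof -
  have m: "bop S'" "bop T'" using S' T' M(1) by auto
  have "S' + T' - (S + T) = (S' - S) + (T' - T)" by simp
  then have "ip (fst p) (((S' + T' - (S + T)) ox idL) (snd p)) =
   ip (fst p) ((ampl (S' - S)) (snd p)) + ip (fst p) ((ampl (T' - T)) (snd p))"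
   by (simp only:) (subst op_tensor_add_left, use m ST in \<open>auto simp: blinfun.add_left cinner_add_right\<close>)
  also have "cmod ... < \<delta>/2 + \<delta>/2"
   using S'(2) T'(2) p by (intro norm_add_less) auto
  finally show ?thesis by simp
 qed
 with S'(1) T'(1) M(2) show "EX R:M. ALL p:P. cmod (ip (fst p) (((R - (S + T)) ox idL) (snd p))) < \<delta>"
  by blast
qed

lemma closure_of_scale:
 fixes S :: "'a::chilbert =>L 'a"
 assumes M: "M <= bops" "!!x. x \<in> M ==> c *\<^sub>C x \<in> M"
  and S: "S \<in> ultraweak closure_of M"
 shows "c *\<^sub>C S \<in> ultraweak closure_of M"
 unfolding closure_of_ultraweak_iff[OF M(1)]
proof (intro conjI allI impI)
 have ST: "bop S" using S by (auto simp: in_closure_of)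
 then show "c *\<^sub>C S \<in> bops" by simp
 fix P :: "(('a, nat ell2) tensor \<times> ('a, nat ell2) tensor) set" and \<delta> :: real
 assume P: "finite P" "\<delta> > 0"
 have c: "cmod c + 1 > 0" by (simp add: add_nonneg_pos)
 have "\<delta> / (cmod c + 1) > 0" using c P(2) by simp
 then obtain S' where S': "S' \<in> M" "ALL p:P. cmod (ip (fst p) ((ampl (S' - S)) (snd p))) < \<delta> / (cmod c + 1)"
  using S P(1) unfolding closure_of_ultraweak_iff[OF M(1)] by blast
 have "cmod (ip (fst p) ((ampl (c *\<^sub>C S' - c *\<^sub>C S)) (snd p))) < \<delta>" if p: "p \<in> P" for p
 proof -
  have m: "bop S'" using S' M(1) by auto
  define w where "w = ip (fst p) ((ampl (S' - S)) (snd p))"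
  have "c *\<^sub>C S' - c *\<^sub>C S = c *\<^sub>C (S' - S)" by (simp add: CB.scale_right_diff_distrib)
  then have "ip (fst p) ((ampl (c *\<^sub>C S' - c *\<^sub>C S)) (snd p)) = c * w"
   by (simp only:) (subst op_tensor_scale_left, use m ST in \<open>auto simp: w_def cinner_scaleC_right\<close>)
  then have "cmod (ip (fst p) ((ampl (c *\<^sub>C S' - c *\<^sub>C S)) (snd p))) = cmod c * cmod w"
   by (simp add: norm_mult)
  also have "... <= (cmod c + 1) * cmod w" by (intro mult_right_mono) auto
  also have "... < \<delta>" using S'(2) p c by (auto simp: w_def field_simps)
  finally show ?thesis .
 qed
 with S'(1) M(2) show "EX R:M. ALL p:P. cmod (ip (fst p) ((ampl (R - c *\<^sub>C S)) (snd p))) < \<delta>"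
  by blast
qed

lemma vn_tensor_add_scale:
 assumes "M <= bops" "N <= bops"
 shows "S \<in> vn_tensor M N ==> T \<in> vn_tensor M N ==> S + T \<in> vn_tensor M N"
  and "S \<in> vn_tensor M N ==> c *\<^sub>C S \<in> vn_tensor M N"
 using closure_of_add[OF cspan_op_tensor_bops[OF assms] cspan_add(2)]
  closure_of_scale[OF cspan_op_tensor_bops[OF assms] cspan_scale(2)]
 unfolding vn_tensor_def by blast+

text \<open>\<open>hat_map\<close> and \<open>tilde_map\<close> are definite descriptions of exactly
  this shape. Two normal maps with the same values on elementary tensors agree by ultraweak density,
  so any explicit normal candidate, cut down to the tensor product, is the described map.\<close>

lemma the_normal_extension:
 fixes \<Phi> :: "(('a::chilbert, 'b::chilbert) tensor =>L ('a, 'b) tensor) => 'c::chilbert =>L 'c"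
 assumes MN: "M <= bops" "N <= bops" and \<Phi>: "normal_linear (vn_tensor M N) \<Phi>"
  and val: "!!a b. a \<in> M ==> b \<in> N ==> \<Phi> (a ox b) = \<phi> a b"
 shows "(THE \<Psi>. \<Psi> \<in> extensional (vn_tensor M N) & normal_linear (vn_tensor M N) \<Psi> &
  (ALL a:M. ALL b:N. \<Psi> (a ox b) = \<phi> a b)) = restrict \<Phi> (vn_tensor M N)" (is "The ?P = ?R")
proof (rule the_equality)
 have mem: "a ox b \<in> vn_tensor M N" if "a \<in> M" "b \<in> N" for a b
  using cspan_op_tensor_vn_tensor[OF MN] cspan_base(2)[of "a ox b" "{a ox b | a b. a \<in> M & b \<in> N}"] that by blast
 show "?P ?R"
 proof (intro conjI ballI)
  have "continuous_map (subtopology ultraweak (vn_tensor M N)) ultraweak (restrict \<Phi> (vn_tensor M N))"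
   using \<Phi> unfolding normal_linear_def by (auto intro: continuous_map_eq)
  then show "normal_linear (vn_tensor M N) ?R"
   using \<Phi> vn_tensor_add_scale[OF MN] by (auto simp: normal_linear_def clinear_on_def)
 qed (use mem val in auto)
 show "\<Psi> = ?R" if \<Psi>: "?P \<Psi>" for \<Psi>
 proof (rule extensionalityI)
  fix T assume T: "T \<in> vn_tensor M N"
  have cont: "continuous_map (subtopology ultraweak (vn_tensor M N)) euclidean (%T. ip x (blinfun_apply (\<Theta> T) y))"
   and lin: "clinear_on (vn_tensor M N) (%T. ip x (blinfun_apply (\<Theta> T) y))"
   if "normal_linear (vn_tensor M N) \<Theta>" for \<Theta> and x y :: 'c
   using that continuous_map_compose[OF _ continuous_vector_functional, of _ \<Theta> x y]
   by (auto simp: normal_linear_def clinear_on_def o_def blinfun.add_left cinner_simps scaleC_complex_def)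
  have "ip x (blinfun_apply (\<Psi> T) y) = ip x (blinfun_apply (\<Phi> T) y)" for x y
   by (rule vn_tensor_eqI[OF MN T cont lin cont lin]) (use \<Psi> \<Phi> val in auto)
  then have "\<Psi> T = \<Phi> T" by (intro blinfun_eqI) (rule cinner_ext)
  with T show "\<Psi> T = ?R T" by simp
 qed (use \<Psi> in auto)
qed

lemma ampl_ampl:
 fixes T :: "'a::chilbert =>L 'd::chilbert"
 assumes "bop T"
 shows "(T ox (idL :: 'b::chilbert =>L _)) ox (idL :: 'c::chilbert =>L _) = adj assoc oo (ampl T) oo assoc"
proof -
 have eq: "ampl T oo assoc =
   assoc oo ((T ox (idL :: 'b =>L _)) ox (idL :: 'c =>L _))"
  by (rule bops_tensor3_eqI) (use assms in auto)
 have "ampl T (assoc x) = assoc ((ampl (ampl T)) x)" for x :: "(('a, 'b) tensor, 'c) tensor"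
  unfolding blinfun_apply_blinfun_compose[symmetric] eq ..
 then show ?thesis by (intro blinfun_eqI) simp
qed

text \<open>An ultraweak functional of the compression is a vector functional of a double
  amplification; moving \<open>X\<close> and \<open>Z\<close> to the vectors turns it into an
  ultraweak functional of \<open>T\<close>. Every spatially implemented map is therefore
  normal.\<close>

lemma normal_linear_compress:
 fixes X :: "('a::chilbert, 'k::chilbert) tensor =>L 'c::chilbert" and Z :: "'c =>L ('a, 'k) tensor"
 assumes X: "bop X" and Z: "bop Z" and M: "M <= bops"
 shows "normal_linear M (%T. X oo (ampl T) oo Z)"
 unfolding normal_linear_def
proof
 show "clinear_on M (%T. X oo (ampl T) oo Z)"
  unfolding clinear_on_def using M
  by (auto intro!: blinfun_eqI simp: subset_iff op_tensor_add_left op_tensor_scale_left blinfun.add_left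
   blinfun.add_right bops_scaleC[OF X])
 show "continuous_map (subtopology ultraweak M) ultraweak (%T. X oo (ampl T) oo Z)"
 proof (rule continuous_map_from_subtopology)
  show "continuous_map ultraweak ultraweak (%T. X oo (ampl T) oo Z)"
   unfolding ultraweak_def[where 'a = 'c] continuous_map_in_subtopology continuous_on_generated_topo_iff
  proof (intro conjI allI impI)
   fix U assume "U \<in> {{T :: 'c =>L 'c. (\<Sum>n. ip (x n) (T (y n))) \<in> U} |x y U.
    summable (%n. (norm (x n))\<^sup>2) & summable (%n. (norm (y n))\<^sup>2) & open U}"
   then obtain x y :: "nat => 'c" and W where xy: "summable (%n. (norm (x n))\<^sup>2)" "summable (%n. (norm (y n))\<^sup>2)" "open W"
    "U = {T. (\<Sum>n. ip (x n) (blinfun_apply T (y n))) \<in> W}" by blast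
   obtain \<xi> \<eta> :: "('c, nat ell2) tensor" where
    fn: "!!T. bop T ==> (%n. ip (x n) (blinfun_apply T (y n))) sums ip \<xi> (ampl T \<eta>)"
    using sequences_ampl[OF xy(1,2)] by blast
   define \<xi>' \<eta>' where "\<xi>' = assoc (adj (ampl X) \<xi>)" and "\<eta>' = assoc (ampl Z \<eta>)"
   have "ip \<xi> (((X oo (ampl T) oo Z) ox idL) \<eta>) = ip \<xi>' (ampl T \<eta>')"
    if T: "bop T" for T :: "'a =>L 'a"
   proof -
    have "(X oo (ampl T) oo Z) ox (idL :: nat ell2 =>L _)
     = ampl X oo (ampl (ampl T)) oo (ampl Z)"
     using X Z T by (simp add: op_tensor_compose)
    then show ?thesis
     using X Z T cinner_adj_left[of "ampl X" \<xi>, symmetric]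
     by (simp add: ampl_ampl \<xi>'_def \<eta>'_def cinner_adj_right)
   qed
   then have "(\<Sum>n. ip (x n) (blinfun_apply (X oo (ampl T) oo Z) (y n)))
     = ip \<xi>' (ampl T \<eta>')" if "bop T" for T
    using sums_unique[OF fn[of "X oo (ampl T) oo Z"]] X Z that by simp
   then have "(%T. X oo (ampl T) oo Z) -` U Int topspace ultraweak =
    {T\<in>bops. ip \<xi>' (ampl T \<eta>') \<in> W}"
    by (auto simp: xy(4))
   then show "openin ultraweak ((%T. X oo (ampl T) oo Z) -` U Int topspace ultraweak)"
    using open_ampl[OF xy(3)] by simp
  next
   show "(%T. X oo (ampl T) oo Z) ` topspace ultraweak <=
    \<Union> {{T :: 'c =>L 'c. (\<Sum>n. ip (x n) (T (y n))) \<in> U} |x y U.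
    summable (%n. (norm (x n))\<^sup>2) & summable (%n. (norm (y n))\<^sup>2) & open U}"
    by (rule subset_trans[OF subset_UNIV], rule Union_upper) (auto intro!: exI[of _ "%_. 0"] exI[of _ UNIV])
  qed (use X Z in auto)
 qed
qed

section \<open>Von Neumann algebras and normal homomorphisms\<close>

lemma vn_bops: "von_neumann_algebra A ==> a \<in> A ==> bop a"
 by (auto simp: von_neumann_algebra_def)

lemma vn_adj: "von_neumann_algebra A ==> a \<in> A ==> adj a \<in> A"
 by (auto simp: von_neumann_algebra_def)

lemma commutant_bops: "T \<in> commutant A ==> bop T"
 by (simp add: commutant_def)

lemma commutant_commute: "T \<in> commutant A ==> a \<in> A ==> T oo a = a oo T"
 by (simp add: commutant_def)

lemma vn_iff: "von_neumann_algebra A ==> a \<in> A \<longleftrightarrow> a \<in> bops & (ALL T:commutant A. a oo T = T oo a)"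
 unfolding von_neumann_algebra_def commutant_def[of "commutant A"] by blast

lemma commutant_adj:
 assumes A: "von_neumann_algebra A" and T: "T \<in> commutant A"
 shows "adj T \<in> commutant A"
proof -
 have "adj T oo a = a oo adj T" if a: "a \<in> A" for a
 proof -
  have "adj (T oo adj a) = adj (adj a oo T)"
   using commutant_commute[OF T vn_adj[OF A a]] by simp
  then show ?thesis using vn_bops[OF A a] commutant_bops[OF T] by (simp add: adj_compose)
 qed
 then show ?thesis using commutant_bops[OF T] by (simp add: commutant_def)
qed

lemma
 assumes A: "von_neumann_algebra A"
 shows vn_id: "idL \<in> A"
  and vn_zero: "0 \<in> A"
  and vn_compose: "a \<in> A ==> b \<in> A ==> a oo b \<in> A"
  and vn_add: "a \<in> A ==> b \<in> A ==> a + b \<in> A"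
  and vn_diff: "a \<in> A ==> b \<in> A ==> a - b \<in> A"
  and vn_scale: "a \<in> A ==> c *\<^sub>C a \<in> A"
proof -
 show "idL \<in> A" "0 \<in> A" unfolding vn_iff[OF A] by (auto intro!: blinfun_eqI simp: blinfun.zero_right commutant_def)
 {
  assume "a \<in> A" "b \<in> A"
  then have ab: "bop a" "bop b" and T: "bop T" "a (T x) = T (a x)" "b (T x) = T (b x)"
   if "T \<in> commutant A" for T x
   using vn_iff[OF A] that commutant_bops by (auto simp flip: blinfun_apply_blinfun_compose)
  show "a oo b \<in> A" "a + b \<in> A" "a - b \<in> A"
   unfolding vn_iff[OF A] using ab \<open>a \<in> A\<close> \<open>b \<in> A\<close> vn_bops[OF A]
   by (auto intro!: blinfun_eqI simp: T blinfun.add_left blinfun.add_right blinfun.diff_left blinfun.diff_right)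
 }
 show "c *\<^sub>C a \<in> A" if "a \<in> A"
 proof -
  have "a (T x) = T (a x)" "bop T" if "T \<in> commutant A" for T x
   using vn_iff[OF A] \<open>a \<in> A\<close> that commutant_bops by (auto simp flip: blinfun_apply_blinfun_compose)
  then show ?thesis unfolding vn_iff[OF A] using vn_bops[OF A that]
   by (auto intro!: blinfun_eqI simp: bops_scaleC)
 qed
qed

lemma vn_scaleR: "von_neumann_algebra A ==> a \<in> A ==> r *\<^sub>R a \<in> A"
 by (simp add: scaleR_scaleC_blinfun vn_scale)

lemma vn_closed:
 assumes A: "von_neumann_algebra A"
 shows "closed A"
proof -
 \<comment> \<open>Complex linearity and commutation with a fixed operator are families of
   identities at points, each of which defines a norm-closed set.\<close>
 have "A = (\<Inter>x. \<Inter>y. {a. blinfun_apply a (x + y) = a x + a y}) Int (\<Inter>c. \<Inter>x. {a. blinfun_apply a (c *\<^sub>C x) = c *\<^sub>C a x}) Int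
  (\<Inter>T\<in>commutant A. \<Inter>x. {a. blinfun_apply a (blinfun_apply T x) = T (a x)})"
 proof (rule set_eqI)
  fix a
  have "(ALL T:commutant A. a oo T = T oo a) \<longleftrightarrow> (ALL T:commutant A. ALL x. blinfun_apply a (blinfun_apply T x) = T (a x))"
   by (metis blinfun_apply_blinfun_compose blinfun_eqI)
  then show "a \<in> A \<longleftrightarrow> a \<in> (\<Inter>x. \<Inter>y. {a. blinfun_apply a (x + y) = a x + a y}) Int (\<Inter>c. \<Inter>x. {a. blinfun_apply a (c *\<^sub>C x) = c *\<^sub>C a x}) Int
   (\<Inter>T\<in>commutant A. \<Inter>x. {a. blinfun_apply a (blinfun_apply T x) = T (a x)})"
   unfolding vn_iff[OF A, of a] by (auto simp: bops_def clinear_on_def)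
 qed
 moreover have "closed {a :: 'a =>L 'a. blinfun_apply a (x + y) = a x + a y}" for x y :: 'a
  by (intro closed_Collect_eq continuous_intros)
 moreover have "closed {a :: 'a =>L 'a. blinfun_apply a (c *\<^sub>C x) = c *\<^sub>C a x}" for x :: 'a and c
 proof (rule closed_Collect_eq)
  show "continuous_on UNIV (%a :: 'a =>L 'a. c *\<^sub>C blinfun_apply a x)"
   by (rule bounded_linear.continuous_on[OF bounded_linear_scaleC]) (intro continuous_intros)
 qed (intro continuous_intros)
 moreover have "closed {a :: 'a =>L 'a. blinfun_apply a (T x) = T (a x)}" for x :: 'a and T :: "'a =>L 'a"
  by (intro closed_Collect_eq continuous_intros)
 ultimately show ?thesis by (metis (no_types, lifting) closed_INT closed_Int)
qed

definition normal_hom :: "('h::chilbert =>L 'h) set => (('h =>L 'h) => 'z::chilbert =>L 'z) => bool"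
 where "normal_hom A \<phi> \<longleftrightarrow> normal_linear A \<phi> & (ALL a:A. ALL b:A. \<phi> (a oo b) = \<phi> a oo \<phi> b) &
  (ALL a:A. \<phi> (adj a) = adj (\<phi> a)) & \<phi> idL = idL"

lemma
 assumes "normal_hom A \<phi>" "a \<in> A"
 shows normal_hom_compose: "b \<in> A ==> \<phi> (a oo b) = \<phi> a oo \<phi> b"
  and normal_hom_adj: "\<phi> (adj a) = adj (\<phi> a)"
  and normal_hom_add: "b \<in> A ==> \<phi> (a + b) = \<phi> a + \<phi> b"
  and normal_hom_scale: "\<phi> (c *\<^sub>C a) = c *\<^sub>C \<phi> a"
 using assms by (auto simp: normal_hom_def normal_linear_def clinear_on_def)

lemma normal_linear_bops: "normal_linear A \<phi> ==> A <= bops ==> a \<in> A ==> \<phi> a \<in> bops"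
 unfolding normal_linear_def using continuous_map_image_subset_topspace[of "subtopology ultraweak A" ultraweak \<phi>]
 by (auto simp: image_subset_iff)

lemma normal_hom_bops: "von_neumann_algebra A ==> normal_hom A \<phi> ==> a \<in> A ==> \<phi> a \<in> bops"
 by (auto simp: normal_hom_def von_neumann_algebra_def intro: normal_linear_bops)

subsection \<open>Normal homomorphisms are spatial\<close>

lemma norm_assoc [simp]: "norm (assoc x) = norm x"
proof -
 have "ip (assoc x) (assoc x) = ip x x"
  using cinner_adj_left[OF bops_assoc, of "assoc x" x] cinner_adj_right[OF bops_assoc, of x "assoc x"] by simp
 then show ?thesis by (simp add: cinner_self power2_eq_iff_nonneg del: of_real_power)
qed

lemma ampl_assoc:
 "bop T ==> ampl T (assoc x) = assoc ((ampl (ampl T)) x)"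
 by (simp add: ampl_ampl)

text \<open>Normality at 0 bounds a \<mapsto> \<langle>\<xi>, \<phi>(a) \<xi>\<rangle> near 0 by
  finitely many amplified vector functionals; homogeneity makes the bound global, and at
  \<open>adj a oo a\<close> it becomes quadratic in a. The finitely many vectors are then stacked
  into one, labelled by the second copy of \<open>nat ell2\<close>.\<close>

lemma normal_dominated:
 fixes \<phi> :: "('h::chilbert =>L 'h) => 'z::chilbert =>L 'z"
 assumes A: "von_neumann_algebra A" and \<phi>: "normal_hom A \<phi>"
 shows "EX r :: ('h, (nat ell2, nat ell2) tensor) tensor. ALL a:A. norm (\<phi> a \<xi>) <= norm (ampl a r)"
proof -
 have sub: "A <= bops" using A by (simp add: von_neumann_algebra_def)
 have nl: "normal_linear A \<phi>" using \<phi> by (simp add: normal_hom_def)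
 note cmap = continuous_map_compose[OF nl[unfolded normal_linear_def, THEN conjunct2] continuous_vector_functional, of \<xi> \<xi>]
 have "openin (subtopology ultraweak A) {a \<in> topspace (subtopology ultraweak A). ip \<xi> (\<phi> a \<xi>) \<in> ball 0 1}"
  using openin_continuous_map_preimage[OF cmap, of "ball 0 1"] by (simp add: o_def)
 then obtain U where U: "openin ultraweak U" "{a \<in> A. ip \<xi> (\<phi> a \<xi>) \<in> ball 0 1} = U Int A"
  unfolding openin_subtopology using sub by auto
 have phi0: "\<phi> 0 = 0"
  using normal_hom_scale[OF \<phi> vn_zero[OF A], of 0] by simp
 then have "0 \<in> {a \<in> A. ip \<xi> (\<phi> a \<xi>) \<in> ball 0 1}" using vn_zero[OF A] by simp
 then have "0 \<in> U" unfolding U(2) by simp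
 then obtain P :: "(('h, nat ell2) tensor \<times> ('h, nat ell2) tensor) set" and \<delta> where P: "finite P" "\<delta> > 0"
  "ALL S:bops. (ALL p:P. cmod (ip (fst p) ((ampl (S - 0)) (snd p))) < \<delta>) --> S \<in> U"
  using ultraweak_neighbourhood[OF U(1) \<open>0 \<in> U\<close>] by (elim exE conjE)
 have bound: "cmod (ip \<xi> (\<phi> b \<xi>)) <= (\<Sum>p\<in>P. cmod (ip (fst p) (ampl b (snd p)))) / \<delta>"
  (is "_ <= ?m / \<delta>") if b: "b \<in> A" for b
 proof (rule dense_le)
  fix s assume "s < cmod (ip \<xi> (\<phi> b \<xi>))"
  show "s <= ?m / \<delta>"
  proof (rule ccontr)
   assume "\<not> s <= ?m / \<delta>"
   then have s: "?m < s * \<delta>" using P(2) by (simp add: field_simps)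
   have m0: "0 <= ?m" by (intro sum_nonneg) simp
   then have s0: "s > 0" using s P(2) by (smt (verit) mult_nonpos_nonneg)
   \<comment> \<open>If the bound failed for \<open>b\<close>, then \<open>b\<close> divided by
     \<open>s\<close> would lie in the neighbourhood \<open>U\<close>, where the functional is
     smaller than 1.\<close>
   define a where "a = complex_of_real (1 / s) *\<^sub>C b"
   have aA: "a \<in> A" by (simp add: a_def vn_scale[OF A b])
   have "cmod (ip (fst p) (ampl a (snd p))) < \<delta>" if p: "p \<in> P" for p
   proof -
    have "cmod (ip (fst p) (ampl b (snd p))) <= ?m"
     using p P(1) by (intro member_le_sum) auto
    with s have "cmod (ip (fst p) (ampl b (snd p))) < s * \<delta>" by simp
    then show ?thesis using s0 vn_bops[OF A b]
     by (simp add: a_def op_tensor_scale_left cinner_scaleC_right norm_mult norm_divide field_simps)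
   qed
   then have "a \<in> U" using P(3) aA sub by auto
   with aA have "a \<in> {a \<in> A. ip \<xi> (\<phi> a \<xi>) \<in> ball 0 1}" unfolding U(2) by simp
   then have "cmod (ip \<xi> (\<phi> a \<xi>)) < 1" by simp
   then have "cmod (ip \<xi> (\<phi> b \<xi>)) < s"
    using s0 by (simp add: a_def normal_hom_scale[OF \<phi> b] cinner_scaleC_right norm_mult norm_divide field_simps)
   with \<open>s < cmod (ip \<xi> (\<phi> b \<xi>))\<close> show False by simp
  qed
 qed
 define Q where "Q = fst ` P Un snd ` P"
 have Q: "finite Q" using P(1) by (simp add: Q_def)
 obtain h where h: "bij_betw h {0..<card Q} Q" using ex_bij_betw_nat_finite[OF Q] by blast
 \<comment> \<open>Each of the \<open>card P\<close> terms will be bounded by the full sum over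
   \<open>Q\<close>; the weight \<open>c\<close> absorbs this count together with
   \<open>\<delta>\<close>.\<close>
 define c where "c = sqrt (real (card P) / \<delta>)"
 define r0 where "r0 = complex_of_real c *\<^sub>C (\<Sum>i<card Q. h i \<otimes> (unit_vec i :: nat ell2))"
 have "norm (\<phi> a \<xi>) <= norm (ampl a (assoc r0))" if a: "a \<in> A" for a
 proof -
  have ab: "bop a" "adj a \<in> A" using vn_bops[OF A a] vn_adj[OF A a] by auto
  define f where "f q = (norm (ampl a q))\<^sup>2" for q :: "('h, nat ell2) tensor"
  have "(norm (\<phi> a \<xi>))\<^sup>2 = cmod (ip \<xi> (\<phi> (adj a oo a) \<xi>))"
   using normal_hom_bops[OF A \<phi> a] 
   by (simp add: normal_hom_compose[OF \<phi> ab(2) a] normal_hom_adj[OF \<phi> a] cinner_adj_right cinner_self norm_power)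
  also have "... <= (\<Sum>p\<in>P. cmod (ip (fst p) ((ampl (adj a oo a)) (snd p)))) / \<delta>"
   by (rule bound) (rule vn_compose[OF A ab(2) a])
  also have "(\<Sum>p\<in>P. cmod (ip (fst p) ((ampl (adj a oo a)) (snd p)))) <= (\<Sum>p\<in>P. \<Sum>q\<in>Q. f q)"
  proof (rule sum_mono)
   fix p assume p: "p \<in> P"
   let ?a = "ampl a :: ('h, nat ell2) tensor =>L _"
   have "ampl (adj a oo a) = adj ?a oo ?a"
    using ab(1) by (simp add: adj_op_tensor op_tensor_compose)
   then have "cmod (ip (fst p) ((ampl (adj a oo a)) (snd p))) = cmod (ip (?a (fst p)) (?a (snd p)))"
    using ab(1) by (simp add: cinner_adj_right)
   also have "... <= norm (?a (fst p)) * norm (?a (snd p))" by (rule cinner_CS)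
   also have "... <= max (f (fst p)) (f (snd p))"
    unfolding f_def by (cases "norm (?a (fst p)) <= norm (?a (snd p))")
     (simp_all add: power2_eq_square le_max_iff_disj mult_mono)
   also have "... <= (\<Sum>q\<in>Q. f q)"
    using p Q by (auto simp: Q_def f_def intro!: member_le_sum)
   finally show "cmod (ip (fst p) ((ampl (adj a oo a)) (snd p))) <= (\<Sum>q\<in>Q. f q)" .
  qed
  also have "(\<Sum>p\<in>P. \<Sum>q\<in>Q. f q) / \<delta> = c\<^sup>2 * (\<Sum>q\<in>Q. f q)"
   using P(2) by (simp add: c_def)
  also have "(\<Sum>q\<in>Q. f q) = (\<Sum>i<card Q. f (h i))"
   using sum.reindex_bij_betw[OF h, of f] by (simp add: atLeast0LessThan)
  also have "... = (norm (\<Sum>i<card Q. ampl a (h i) \<otimes> (unit_vec i :: nat ell2)))\<^sup>2"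
   by (subst norm_sq_orthogonal_sum) (auto simp: cinner_tens norm_tens f_def)
  also have "c\<^sup>2 * ... = (norm ((ampl (ampl a)) r0))\<^sup>2"
   using ab(1) by (simp add: r0_def bops_scaleC norm_scaleC power_mult_distrib blinfun.sum_right)
  finally have "norm (\<phi> a \<xi>) <= norm ((ampl (ampl a)) r0)"
   using P(2) by (simp add: divide_right_mono)
  then show ?thesis using ab(1) by (simp add: ampl_assoc)
 qed
 then show ?thesis by blast
qed

text \<open>
 A positive contraction \<open>T\<close> is the sum of the squares of the operators \<open>T\<^sub>n\<close> given by
 \<open>T\<^sub>0 = T\<close>, \<open>T\<^sub>n\<^sub>+\<^sub>1 = T\<^sub>n - T\<^sub>n\<^sup>2\<close>, which are polynomials in \<open>T\<close>; this replaces its square root.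
\<close>

primrec square_parts :: "('a::chilbert =>L 'a) => nat => 'a =>L 'a"
 where "square_parts T 0 = T"
 | "square_parts T (Suc n) = square_parts T n - (square_parts T n oo square_parts T n)"

lemma square_parts:
 fixes T :: "'a::chilbert =>L 'a"
 assumes T: "bop T" "adj T = T" "!!x. 0 <= Re (ip x (T x))" "!!x. Re (ip x (T x)) <= (norm x)\<^sup>2"
 shows "square_parts T n \<in> bops" "adj (square_parts T n) = square_parts T n"
  "0 <= Re (ip x (square_parts T n x))" "Re (ip x (square_parts T n x)) <= (norm x)\<^sup>2"
proof (induction n arbitrary: x)
 case (Suc n)
 define S where "S = square_parts T n"
 have S: "bop S" "adj S = S" "!!x. 0 <= Re (ip x (S x))" "!!x. Re (ip x (S x)) <= (norm x)\<^sup>2"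
  using Suc by (auto simp: S_def)
 have sa: "ip (S x) y = ip x (S y)" for x y
  using cinner_adj_left[OF S(1), of x y] by (simp add: S(2))
 { case 1 show ?case using S by (simp add: S_def[symmetric]) }
 { case 2 show ?case using S by (simp add: S_def[symmetric] adj_diff adj_compose) }
 { case 3
  \<comment> \<open>As quadratic forms, S - S^2 = S(1 - S)S + (1 - S)S(1 - S), a sum of two positive
    terms.\<close>
  have "ip x ((S - (S oo S)) x) = (ip (S x) (S x) - ip (S x) (S (S x))) + ip (x - S x) (S (x - S x))"
   by (simp add: blinfun.diff_left blinfun.diff_right cinner_simps sa)
  moreover have "0 <= Re (ip (S x) (S x) - ip (S x) (S (S x)))"
   using S(4)[of "S x"] by (simp add: norm_sq_cinner)
  ultimately show ?case using S(3)[of "x - S x"] by (simp add: S_def) }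
 { case 4
  have "ip x ((S - (S oo S)) x) = ip x (S x) - ip (S x) (S x)"
   by (simp add: blinfun.diff_left cinner_simps sa)
  then show ?case using S(4)[of x] by (simp add: S_def flip: norm_sq_cinner) (smt (verit) zero_le_power2) }
qed (use T in auto)

lemma square_parts_sum:
 "(\<Sum>k<n. square_parts T k oo square_parts T k) = T - square_parts T n"
 by (induction n) auto

lemma square_parts_commute:
 assumes "T oo S = S oo T"
 shows "square_parts T n oo S = S oo square_parts T n"
proof (induction n)
 case (Suc n)
 have "square_parts T n (S x) = S (square_parts T n x)" for x
  using Suc by (metis blinfun_apply_blinfun_compose)
 then show ?case by (intro blinfun_eqI) (simp add: blinfun.diff_left blinfun.diff_right)
qed (use assms in simp)

lemma square_parts_summable:
 assumes T: "bop T" "adj T = T" "!!x. 0 <= Re (ip x (T x))" "!!x. Re (ip x (T x)) <= (norm x)\<^sup>2"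
 shows "summable (%n. (norm (square_parts T n x))\<^sup>2)" "(%n. square_parts T n x) ----> 0"
proof -
 note sp = square_parts[OF T]
 have "(\<Sum>k<n. (norm (square_parts T k x))\<^sup>2) <= (norm x)\<^sup>2" for n
 proof -
  have "ip (square_parts T k x) (square_parts T k x) = ip x ((square_parts T k oo square_parts T k) x)" for k
   using cinner_adj_left[OF sp(1), of k x "square_parts T k x"] by (simp add: sp(2))
  then have "(\<Sum>k<n. (norm (square_parts T k x))\<^sup>2) = Re (ip x ((\<Sum>k<n. square_parts T k oo square_parts T k) x))"
   by (simp add: norm_sq_cinner blinfun.sum_left cinner_sum_right)
  also have "... = Re (ip x (T x)) - Re (ip x (square_parts T n x))"
   by (simp add: square_parts_sum blinfun.diff_left cinner_simps)
  also have "... <= (norm x)\<^sup>2" using T(4)[of x] sp(3)[where n = n and x = x] by simp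
  finally show ?thesis .
 qed
 then show s: "summable (%n. (norm (square_parts T n x))\<^sup>2)"
  by (intro summableI_nonneg_bounded) auto
 have "(%n. sqrt ((norm (square_parts T n x))\<^sup>2)) ----> sqrt 0"
  by (intro tendsto_real_sqrt summable_LIMSEQ_zero s)
 then show "(%n. square_parts T n x) ----> 0" by (simp add: tendsto_norm_zero_iff)
qed

type_synonym amp = "((nat ell2, nat ell2) tensor, nat ell2) tensor"

text \<open>By domination, B: \<pi>(a) r \<mapsto> \<phi>(a) \<xi> is a contraction intertwining
  \<pi> and \<phi>, so \<open>T = adj B oo B\<close> commutes with \<pi>(A) and represents the form
  of \<phi> at \<xi>. A square root of T applied to r would be the vector sought; the
  \<open>square_parts\<close> of T, applied to r and placed side by side with labels in a third
  \<open>nat ell2\<close>, serve the same purpose.\<close>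

lemma normal_vector:
 fixes \<phi> :: "('h::chilbert =>L 'h) => 'z::chilbert =>L 'z"
 assumes A: "von_neumann_algebra A" and \<phi>: "normal_hom A \<phi>"
 shows "EX q :: ('h, amp) tensor. ALL a:A. ALL b:A.
  ip (ampl a q) (ampl b q) = ip (\<phi> a \<xi>) (\<phi> b \<xi>)"
proof -
 obtain r :: "('h, (nat ell2, nat ell2) tensor) tensor" where
  r: "!!a. a \<in> A ==> norm (\<phi> a \<xi>) <= norm (ampl a r)"
  using normal_dominated[OF A \<phi>, of \<xi>] by blast
 define \<pi> where "\<pi> a = a ox (idL :: (nat ell2, nat ell2) tensor =>L _)" for a :: "'h =>L 'h"
 note Ab = vn_bops[OF A] and \<phi>b = normal_hom_bops[OF A \<phi>]
 have \<pi>b: "\<pi> a \<in> bops" if "a \<in> A" for a using Ab that by (simp add: \<pi>_def)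
 have \<pi>c: "\<pi> (a oo b) = \<pi> a oo \<pi> b" if "a \<in> A" "b \<in> A" for a b
  using Ab that by (simp add: \<pi>_def op_tensor_compose)
 have \<pi>a: "\<pi> (adj a) = adj (\<pi> a)" if "a \<in> A" for a using Ab that by (simp add: \<pi>_def adj_op_tensor)
 define S where "S = {(\<pi> a r, \<phi> a \<xi>) | a. a \<in> A}"
 have "EX B:bops. (ALL p:S. blinfun_apply B (fst p) = snd p) & norm B <= 1 &
  (ALL z. (ALL p:S. ip (fst p) z = 0) --> B z = 0)"
 proof (rule graph_extension)
  fix p assume "p \<in> cspan S"
  then have "p \<in> S"
  proof (induction rule: cspan_induct)
   case zero
   have "\<phi> 0 = 0" using normal_hom_scale[OF \<phi> vn_zero[OF A], of 0] by simp
   then show ?case using vn_zero[OF A] by (auto simp: S_def \<pi>_def zero_prod_def intro!: exI[of _ 0])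
  next
   case (add x y)
   then obtain a b where "a \<in> A" "b \<in> A" "x = (\<pi> a r, \<phi> a \<xi>)" "y = (\<pi> b r, \<phi> b \<xi>)" by (auto simp: S_def)
   then show ?case unfolding S_def using vn_add[OF A] Ab
    by (auto intro!: exI[of _ "a + b"] simp: \<pi>_def op_tensor_add_left blinfun.add_left normal_hom_add[OF \<phi>])
  next
   case (scale c x)
   then obtain a where "a \<in> A" "x = (\<pi> a r, \<phi> a \<xi>)" by (auto simp: S_def)
   then show ?case unfolding S_def using vn_scale[OF A] Ab
    by (auto intro!: exI[of _ "c *\<^sub>C a"] simp: \<pi>_def op_tensor_scale_left normal_hom_scale[OF \<phi>] scaleC_prod_def)
  qed auto
  then show "norm (snd p) <= 1 * norm (fst p)" using r by (auto simp: S_def \<pi>_def)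
 qed simp
 then obtain B where B: "bop B" "norm B <= 1" and BS: "ALL p:S. blinfun_apply B (fst p) = snd p"
  and B0S: "ALL z. (ALL p:S. ip (fst p) z = 0) --> B z = 0" by blast
 have Ba: "blinfun_apply B (\<pi> a r) = \<phi> a \<xi>" if "a \<in> A" for a
  using BS[rule_format, of "(\<pi> a r, \<phi> a \<xi>)"] that by (auto simp: S_def)
 have B0: "B z = 0" if "!!a. a \<in> A ==> ip (\<pi> a r) z = 0" for z
 proof -
  have "ALL p:S. ip (fst p) z = 0" using that by (auto simp: S_def)
  with B0S show ?thesis by blast
 qed
 \<comment> \<open>\<open>B\<close> vanishes on the orthogonal complement of \<pi>(A) r, so
   identities for it are checked on the two kinds of vectors in this total set.\<close>
 define D where "D = {\<pi> a r | a. a \<in> A} Un {z. ALL a:A. ip (\<pi> a r) z = 0}"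
 have D: "closure (cspan D) = UNIV"
  unfolding closure_cspan_UNIV_iff
 proof (intro allI impI)
  fix z assume z: "ALL x:D. ip x z = 0"
  then have "z \<in> D" by (auto simp: D_def)
  with z show "z = 0" by auto
 qed
 have inter: "B oo \<pi> b = \<phi> b oo B" if b: "b \<in> A" for b
 proof (rule bops_eq_on_total[OF _ _ D])
  fix x assume "x \<in> D"
  then consider a where "a \<in> A" "x = \<pi> a r" | "!!a. a \<in> A ==> ip (\<pi> a r) x = 0" by (auto simp: D_def)
  then show "(B oo \<pi> b) x = (\<phi> b oo B) x"
  proof cases
   case 1
   then show ?thesis
    using b Ba[OF vn_compose[OF A b 1(1)]] by (simp add: Ba \<pi>c normal_hom_compose[OF \<phi>])
  next
   case 2
   have "ip (\<pi> a r) (\<pi> b x) = 0" if a: "a \<in> A" for a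
   proof -
    have "ip (\<pi> a r) (\<pi> b x) = ip (\<pi> (adj b oo a) r) x"
     using a b vn_adj[OF A b] \<pi>b by (simp add: \<pi>c \<pi>a cinner_adj_left)
    then show ?thesis using 2[OF vn_compose[OF A vn_adj[OF A b] a]] by simp
   qed
   then have "B (\<pi> b x) = 0" "B x = 0" using B0 2 by auto
   then show ?thesis by simp
  qed
 qed (use B b \<pi>b \<phi>b in auto)
 define T where "T = adj B oo B"
 have TB: "ip x (T y) = ip (B x) (B y)" for x y
  by (simp add: T_def cinner_adj_right B)
 have T: "bop T" "adj T = T" "0 <= Re (ip x (T x))" "Re (ip x (T x)) <= (norm x)\<^sup>2" for x
 proof -
  show "bop T" "adj T = T" using B(1) by (auto simp: T_def adj_compose)
  have "norm (B x) <= norm x"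
   using norm_blinfun[of B x] mult_right_mono[OF B(2), of "norm x"] by simp
  then show "0 <= Re (ip x (T x))" "Re (ip x (T x)) <= (norm x)\<^sup>2"
   unfolding TB by (simp_all flip: norm_sq_cinner)
 qed
 note sp = square_parts[OF T]
 have comm: "square_parts T n oo \<pi> b = \<pi> b oo square_parts T n" if b: "b \<in> A" for n b
 proof (rule square_parts_commute)
  have "adj B oo \<phi> b = adj (adj (\<phi> b) oo B)" using B(1) \<phi>b[OF b] by (simp add: adj_compose)
  also have "adj (\<phi> b) oo B = B oo \<pi> (adj b)"
   using inter[OF vn_adj[OF A b]] by (simp add: normal_hom_adj[OF \<phi> b])
  also have "adj (B oo \<pi> (adj b)) = \<pi> b oo adj B"
   using B(1) \<pi>b[OF b] by (simp add: adj_compose \<pi>a[OF b])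
  finally have e: "adj B oo \<phi> b = \<pi> b oo adj B" .
  have "T oo \<pi> b = adj B oo (B oo \<pi> b)" by (simp add: T_def compose_assoc)
  also have "... = (adj B oo \<phi> b) oo B" by (simp add: inter[OF b] compose_assoc)
  also have "... = \<pi> b oo T" by (simp add: e T_def compose_assoc)
  finally show "T oo \<pi> b = \<pi> b oo T" .
 qed
 define \<rho> where "\<rho> n = square_parts T n r" for n
 have sum\<rho>: "summable (%n. (norm (\<rho> n))\<^sup>2)"
  unfolding \<rho>_def by (rule square_parts_summable[OF T])
 define q0 where "q0 = (\<Sum>n. \<rho> n \<otimes> (unit_vec n :: nat ell2))"
 have "ip (ampl a (assoc q0)) (ampl b (assoc q0)) = ip (\<phi> a \<xi>) (\<phi> b \<xi>)"
  if ab: "a \<in> A" "b \<in> A" for a b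
 proof (rule LIMSEQ_unique)
  have bb: "\<pi> a \<in> bops" "\<pi> b \<in> bops" using ab \<pi>b by auto
  have "(%n. ip (\<rho> n) ((adj (\<pi> a) oo \<pi> b) (\<rho> n))) sums
    ip q0 (((adj (\<pi> a) oo \<pi> b) ox idL) q0)"
   unfolding q0_def by (rule sequences_ampl[OF sum\<rho> sum\<rho>]) (use bb in auto)
  also have "ip q0 (((adj (\<pi> a) oo \<pi> b) ox idL) q0) =
    ip ((ampl (\<pi> a)) q0) ((ampl (\<pi> b)) q0)"
  proof -
   have "(adj (\<pi> a) oo \<pi> b) ox (idL :: nat ell2 =>L _) = adj (ampl (\<pi> a)) oo (ampl (\<pi> b))"
    using bb by (simp add: adj_op_tensor op_tensor_compose)
   then show ?thesis using bb by (simp add: cinner_adj_right)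
  qed
  also have "... = ip (ampl a (assoc q0)) (ampl b (assoc q0))"
  proof -
   have "ip (assoc x) (assoc y) = ip x y" for x y :: "(('h, (nat ell2, nat ell2) tensor) tensor, nat ell2) tensor"
    using cinner_adj_right[OF bops_assoc, of x "assoc y"] by simp
   then show ?thesis using ab Ab by (simp add: ampl_assoc \<pi>_def)
  qed
  finally show "(%n. \<Sum>k<n. ip (\<rho> k) ((adj (\<pi> a) oo \<pi> b) (\<rho> k))) ---->
   ip (ampl a (assoc q0)) (ampl b (assoc q0))" by (simp add: sums_def)
  have 1: "ip (\<rho> k) ((adj (\<pi> a) oo \<pi> b) (\<rho> k)) = ip (\<pi> a r) ((square_parts T k oo square_parts T k) (\<pi> b r))" for k
  proof -
   have cm: "square_parts T k (\<pi> c x) = \<pi> c (square_parts T k x)" if "c \<in> A" for c x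
    using arg_cong[OF comm[OF that], of "%S. blinfun_apply S x"] by simp
   have "ip (\<rho> k) ((adj (\<pi> a) oo \<pi> b) (\<rho> k)) = ip (square_parts T k (\<pi> a r)) (square_parts T k (\<pi> b r))"
    using bb ab by (simp add: \<rho>_def cinner_adj_right cm)
   also have "... = ip (\<pi> a r) ((square_parts T k oo square_parts T k) (\<pi> b r))"
    using cinner_adj_left[OF sp(1)[of k], of "\<pi> a r"] sp(2)[of k] by simp
   finally show ?thesis .
  qed
  \<comment> \<open>The partial sums telescope, and the remainder tends to 0 because the square
    parts do so at every vector.\<close>
  have "(\<Sum>k<n. ip (\<rho> k) ((adj (\<pi> a) oo \<pi> b) (\<rho> k))) = ip (\<phi> a \<xi>) (\<phi> b \<xi>) - ip (\<pi> a r) (square_parts T n (\<pi> b r))" for n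
  proof -
   have "(\<Sum>k<n. ip (\<rho> k) ((adj (\<pi> a) oo \<pi> b) (\<rho> k))) = ip (\<pi> a r) ((\<Sum>k<n. square_parts T k oo square_parts T k) (\<pi> b r))"
    unfolding 1 by (simp add: blinfun.sum_left cinner_sum_right)
   then show ?thesis using Ba ab
    by (simp add: square_parts_sum blinfun.diff_left cinner_diff_right TB)
  qed
  moreover have "(%n. ip (\<phi> a \<xi>) (\<phi> b \<xi>) - ip (\<pi> a r) (square_parts T n (\<pi> b r))) ---->
    ip (\<phi> a \<xi>) (\<phi> b \<xi>) - ip (\<pi> a r) 0"
   by (intro tendsto_intros square_parts_summable(2)[OF T])
  ultimately show "(%n. \<Sum>k<n. ip (\<rho> k) ((adj (\<pi> a) oo \<pi> b) (\<rho> k))) ----> ip (\<phi> a \<xi>) (\<phi> b \<xi>)"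
   by simp
 qed
 then show ?thesis by blast
qed

text \<open>Zorn's lemma for families whose cyclic subspaces are mutually orthogonal. A vector
  orthogonal to all of them can be added to a maximal family; being then a member of it, the vector
  is orthogonal to itself.\<close>

lemma exists_orthogonal_generators:
 fixes \<phi> :: "('h::chilbert =>L 'h) => 'z::chilbert =>L 'z"
 assumes A: "von_neumann_algebra A" and \<phi>: "normal_hom A \<phi>"
 shows "EX S. (\<forall>\<xi>\<in>S. \<forall>\<eta>\<in>S. \<xi> ~= \<eta> --> (ALL a:A. ip \<xi> (\<phi> a \<eta>) = 0)) &
  closure (cspan {\<phi> a \<xi> | a \<xi>. a \<in> A & \<xi> \<in> S}) = UNIV"
proof -
 define OS where "OS = {S. \<forall>\<xi>\<in>S. \<forall>\<eta>\<in>S. \<xi> ~= \<eta> --> (ALL a:A. ip \<xi> (\<phi> a \<eta>) = 0)}"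
 have "EX M:OS. ALL X:OS. M <= X --> X = M"
 proof (rule subset_Zorn')
  fix C assume C: "subset.chain OS C"
  show "\<Union>C \<in> OS"
   unfolding OS_def
  proof (intro CollectI ballI impI)
   fix e f a assume "e \<in> \<Union>C" "f \<in> \<Union>C" and ef: "e ~= f" "a \<in> A"
   then obtain X Y where XY: "X \<in> C" "e \<in> X" "Y \<in> C" "f \<in> Y" by blast
   then have "X <= Y \<or> Y <= X" using C by (auto simp: subset_chain_def)
   then obtain Z where "Z \<in> C" "e \<in> Z" "f \<in> Z" using XY by blast
   moreover have "C <= OS" using C by (auto simp: subset_chain_def)
   ultimately show "ip e (\<phi> a f) = 0" using ef by (auto simp: OS_def)
  qed
 qed
 then obtain S where S: "S \<in> OS" "!!X. X \<in> OS ==> S <= X ==> X = S" by blast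
 have "closure (cspan {\<phi> a \<xi> | a \<xi>. a \<in> A & \<xi> \<in> S}) = UNIV"
  unfolding closure_cspan_UNIV_iff
 proof (intro allI impI)
  fix z assume "ALL x:{\<phi> a \<xi> | a \<xi>. a \<in> A & \<xi> \<in> S}. ip x z = 0"
  then have z: "ip (\<phi> a \<xi>) z = 0" if "a \<in> A" "\<xi> \<in> S" for a \<xi> using that by blast
  have z': "ip \<xi> (\<phi> a z) = 0" "ip z (\<phi> a \<xi>) = 0" if "a \<in> A" "\<xi> \<in> S" for a \<xi>
  proof -
   show "ip z (\<phi> a \<xi>) = 0" using z[OF that] cinner_commute[of z] by simp
   have "ip (\<phi> (adj a) \<xi>) z = 0" using vn_adj[OF A] that z by blast
   then show "ip \<xi> (\<phi> a z) = 0"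
    using normal_hom_bops[OF A \<phi> that(1)] by (simp add: normal_hom_adj[OF \<phi> that(1)] cinner_adj_left)
  qed
  then have "insert z S \<in> OS" using S(1) by (auto simp: OS_def)
  then have "z \<in> S" using S(2)[of "insert z S"] by blast
  then show "z = 0" using z[OF vn_id[OF A], of z] \<phi> by (simp add: normal_hom_def)
 qed
 with S(1) show ?thesis unfolding OS_def by blast
qed

text \<open>Each cyclic summand is mapped by \<open>normal_vector\<close> into an amplification;
  labelling its image with the unit vector of its generator keeps different summands orthogonal. The
  Gram kernels match, so \<open>V\<close> is an isometry.\<close>

theorem normal_hom_spatial:
 fixes \<phi> :: "('h::chilbert =>L 'h) => 'z::chilbert =>L 'z"
 assumes A: "von_neumann_algebra A" and \<phi>: "normal_hom A \<phi>"
 shows "EX V :: 'z =>L ('h, (amp, 'z ell2) tensor) tensor. bop V &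
  (ALL x y. ip (V x) (V y) = ip x y) & (ALL a:A. V oo \<phi> a = ampl a oo V)"
proof -
 obtain S where S: "\<forall>\<xi>\<in>S. \<forall>\<eta>\<in>S. \<xi> ~= \<eta> --> (ALL a:A. ip \<xi> (\<phi> a \<eta>) = 0)"
  and tot: "closure (cspan {\<phi> a \<xi> | a \<xi>. a \<in> A & \<xi> \<in> S}) = UNIV"
  using exists_orthogonal_generators[OF A \<phi>] by (elim exE conjE)
 obtain q :: "'z => ('h, amp) tensor" where q: "!!\<xi> a b. a \<in> A ==> b \<in> A ==>
  ip (ampl a (q \<xi>)) (ampl b (q \<xi>)) = ip (\<phi> a \<xi>) (\<phi> b \<xi>)"
  using normal_vector[OF A \<phi>] by metis
 define x where "x = (%(a, \<xi>). \<phi> a \<xi>)"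
 define y where "y = (%(a :: 'h =>L 'h, \<xi>). assoc (ampl a (q \<xi>) \<otimes> (unit_vec \<xi> :: 'z ell2)))"
 have "EX V:bops. (ALL i:A \<times> S. blinfun_apply V (x i) = y i) & (ALL u v. ip (V u) (V v) = ip u v)"
 proof (rule isometry_extension)
  have "x ` (A \<times> S) = {\<phi> a \<xi> | a \<xi>. a \<in> A & \<xi> \<in> S}" by (force simp: x_def)
  with tot show "closure (cspan (x ` (A \<times> S))) = UNIV" by simp
  fix i j assume "i \<in> A \<times> S" "j \<in> A \<times> S"
  then obtain a \<xi> b \<eta> where ij: "i = (a, \<xi>)" "j = (b, \<eta>)" "a \<in> A" "b \<in> A" "\<xi> \<in> S" "\<eta> \<in> S" by blast
  have ac: "ip (assoc x) (assoc y) = ip x y" for x y :: "(('h, amp) tensor, 'z ell2) tensor"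
   using cinner_adj_right[OF bops_assoc, of x "assoc y"] by simp
  show "ip (y i) (y j) = ip (x i) (x j)"
  proof (cases "\<xi> = \<eta>")
   case True
   then show ?thesis using ij q by (simp add: x_def y_def ac cinner_tens)
  next
   case False
   have "ip (\<phi> a \<xi>) (\<phi> b \<eta>) = ip \<xi> (\<phi> (adj a oo b) \<eta>)"
    using ij vn_adj[OF A] normal_hom_bops[OF A \<phi>]
    by (simp add: normal_hom_compose[OF \<phi>] normal_hom_adj[OF \<phi>] cinner_adj_right)
   also have "... = 0" using S[rule_format, OF ij(5,6) False] vn_compose[OF A vn_adj[OF A]] ij by blast
   finally show ?thesis using False ij by (simp add: x_def y_def ac cinner_tens)
  qed
 qed
 then obtain V where V: "bop V" "!!u v. ip (blinfun_apply V u) (V v) = ip u v"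
  and Vx: "!!a \<xi>. a \<in> A ==> \<xi> \<in> S ==> V (\<phi> a \<xi>) = assoc (ampl a (q \<xi>) \<otimes> (unit_vec \<xi> :: 'z ell2))"
  by (auto simp: x_def y_def)
 have "V oo \<phi> b = ampl b oo V" if b: "b \<in> A" for b
 proof (rule bops_eq_on_total[OF _ _ tot])
  fix z assume "z \<in> {\<phi> a \<xi> | a \<xi>. a \<in> A & \<xi> \<in> S}"
  then obtain a \<xi> where z: "z = \<phi> a \<xi>" "a \<in> A" "\<xi> \<in> S" by blast
  have "(V oo \<phi> b) z = V (\<phi> (b oo a) \<xi>)" by (simp add: z normal_hom_compose[OF \<phi> b])
  also have "... = assoc ((ampl (b oo a)) (q \<xi>) \<otimes> (unit_vec \<xi> :: 'z ell2))"
   by (rule Vx) (use z b vn_compose[OF A] in auto)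
  also have "ampl (b oo a) = (b ox (idL :: amp =>L _)) oo (ampl a)"
   using vn_bops[OF A] b z by (simp add: op_tensor_compose)
  also have "assoc ((ampl b oo (ampl a)) (q \<xi>) \<otimes> (unit_vec \<xi> :: 'z ell2)) =
    (ampl b oo V) z"
   using vn_bops[OF A] b z by (simp add: Vx ampl_assoc)
  finally show "(V oo \<phi> b) z = (ampl b oo V) z" .
 qed (use V b normal_hom_bops[OF A \<phi>] vn_bops[OF A] in auto)
 with V show ?thesis by blast
qed

subsection \<open>Ultraweak tensor products and slices\<close>

lemma vn_tensor_left_commute:
 fixes F :: "('a::chilbert, 'h::chilbert) tensor =>L ('a, 'h) tensor"
 assumes A: "von_neumann_algebra A" and F: "F \<in> vn_tensor bops A" and T: "T \<in> commutant A"
 shows "F oo (idL ox T) = (idL ox T) oo F"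
proof (rule blinfun_eqI, rule cinner_ext)
 fix x z
 have sub: "A <= bops" "(bops :: ('a =>L 'a) set) <= bops" using A by (auto simp: von_neumann_algebra_def)
 have Tb: "bop T" using T by (rule commutant_bops)
 have "ip z (F ((idL ox T) x)) = ip (adj (idL ox T) z) (F x)"
 proof (rule vn_tensor_cinner_eqI[OF sub(2,1) F])
  fix a :: "'a =>L 'a" and b assume ab: "bop a" "b \<in> A"
  have "(a ox b) oo (idL ox T) = (idL ox T) oo (a ox b)"
   using ab Tb sub commutant_commute[OF T ab(2)] by (auto simp: op_tensor_compose)
  then show "ip z ((a ox b) ((idL ox T) x)) = ip (adj (idL ox T) z) ((a ox b) x)"
   using Tb by (simp add: cinner_adj_left flip: blinfun_apply_blinfun_compose)
 qed
 then show "ip z ((F oo (idL ox T)) x) = ip z (((idL ox T) oo F) x)"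
  using Tb by (simp add: cinner_adj_left)
qed

definition left_slice :: "'c::chilbert => 'c => (('c, 'h::chilbert) tensor =>L ('c, 'h) tensor) => 'h =>L 'h"
 where "left_slice c d F = adj (left_ket c) oo F oo left_ket d"

definition right_slice :: "'c::chilbert => 'c => (('h::chilbert, 'c) tensor =>L ('h, 'c) tensor) => 'h =>L 'h"
 where "right_slice c d G = adj (tens_ket c) oo G oo tens_ket d"

lemma bops_left_slice [simp, intro]: "bop F ==> left_slice c d F \<in> bops"
 and bops_right_slice [simp, intro]: "bop G ==> right_slice c d G \<in> bops"
 by (simp_all add: left_slice_def right_slice_def)

lemma cinner_left_slice: "ip u (left_slice c d F v) = ip (c \<otimes> u) (F (d \<otimes> v))"
 and cinner_right_slice: "ip u (right_slice c d G v) = ip (u \<otimes> c) (G (v \<otimes> d))"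
 by (simp_all add: left_slice_def right_slice_def cinner_adj_right)

lemma left_slice_mem:
 assumes A: "von_neumann_algebra A" and F: "bop F"
  and comm: "!!T. T \<in> commutant A ==> F oo (idL ox T) = (idL ox T) oo F"
 shows "left_slice c d F \<in> A"
 unfolding vn_iff[OF A]
proof (intro conjI ballI)
 fix T assume T: "T \<in> commutant A"
 then have Tb: "bop T" "adj T \<in> bops" using commutant_bops by auto
 show "left_slice c d F oo T = T oo left_slice c d F"
 proof (rule blinfun_eqI, rule cinner_ext)
  fix v u
  have "ip u (left_slice c d F (T v)) = ip (c \<otimes> u) ((F oo (idL ox T)) (d \<otimes> v))"
   using Tb by (simp add: cinner_left_slice)
  also have "... = ip (adj (idL ox T) (c \<otimes> u)) (F (d \<otimes> v))"
   using Tb by (simp add: comm[OF T] cinner_adj_left)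
  also have "... = ip u (T (left_slice c d F v))"
   using Tb F cinner_adj_left[OF Tb(1), of u "left_slice c d F v", symmetric]
   by (simp add: adj_op_tensor cinner_left_slice)
  finally show "ip u ((left_slice c d F oo T) v) = ip u ((T oo left_slice c d F) v)" by simp
 qed
qed (use F in simp)

lemma right_slice_mem:
 assumes A: "von_neumann_algebra A" and F: "bop F"
  and comm: "!!T. T \<in> commutant A ==> F oo (ampl T) = ampl T oo F"
 shows "right_slice c d F \<in> A"
 unfolding vn_iff[OF A]
proof (intro conjI ballI)
 fix T assume T: "T \<in> commutant A"
 then have Tb: "bop T" "adj T \<in> bops" using commutant_bops by auto
 show "right_slice c d F oo T = T oo right_slice c d F"
 proof (rule blinfun_eqI, rule cinner_ext)
  fix v u
  have "ip u (right_slice c d F (T v)) = ip (u \<otimes> c) ((F oo (ampl T)) (v \<otimes> d))"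
   using Tb by (simp add: cinner_right_slice)
  also have "... = ip (adj (ampl T) (u \<otimes> c)) (F (v \<otimes> d))"
   using Tb by (simp add: comm[OF T] cinner_adj_left)
  also have "... = ip u (T (right_slice c d F v))"
   using Tb F cinner_adj_left[OF Tb(1), of u "right_slice c d F v", symmetric]
   by (simp add: adj_op_tensor cinner_right_slice)
  finally show "ip u ((right_slice c d F oo T) v) = ip u ((T oo right_slice c d F) v)" by simp
 qed
qed (use F in simp)

lemma right_slices_commute:
 fixes G :: "('h::chilbert, 'c::chilbert) tensor =>L ('h, 'c) tensor"
 assumes A: "von_neumann_algebra A" and G: "bop G" and E: "closure (cspan E) = UNIV"
  and sl: "!!c d. c \<in> E ==> d \<in> E ==> right_slice c d G \<in> A" and T: "T \<in> commutant A"
 shows "G oo (ampl T) = ampl T oo G"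
proof -
 have Tb: "bop T" "adj T \<in> bops" using T commutant_bops by auto
 have tot: "closure (cspan {u \<otimes> x | u x. u \<in> UNIV & x \<in> E}) = UNIV"
  by (rule total_tens_sets[OF total_UNIV E])
 show ?thesis
 proof (rule bops_eqI[OF _ _ tot tot])
  fix x y :: "('h, 'c) tensor"
  assume "x \<in> {u \<otimes> x | u x. u \<in> UNIV & x \<in> E}" "y \<in> {u \<otimes> x | u x. u \<in> UNIV & x \<in> E}"
  then obtain u v c d where xy: "x = u \<otimes> c" "y = v \<otimes> d" "c \<in> E" "d \<in> E" by blast
  have "ip x (G (ampl T y)) = ip u ((right_slice c d G oo T) v)"
   using Tb by (simp add: xy cinner_right_slice)
  also have "right_slice c d G oo T = T oo right_slice c d G"
   using commutant_commute[OF T sl[OF xy(3,4)]] by simp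
  also have "ip u ((T oo right_slice c d G) v) = ip (adj T u) (right_slice c d G v)"
   using Tb by (simp add: cinner_adj_left)
  also have "... = ip (adj (ampl T) x) (G y)"
   using Tb by (simp add: xy cinner_right_slice adj_op_tensor)
  also have "... = ip x ((ampl T oo G) y)"
   using Tb by (simp add: cinner_adj_left)
  finally show "ip x ((G oo (ampl T)) y) = ip x ((ampl T oo G) y)" by simp
 qed (use Tb G in auto)
qed

lemma norm_op_tensor_proj:
 assumes "bop S" "bop T" "norm S <= 1" "norm T <= 1"
 shows "norm (S ox T) <= 1"
 using norm_op_tensor_le[OF assms(1,2)] mult_mono[OF assms(3,4)] by simp

text \<open>Compressing with finite-rank projections of the first factor leaves finite sums of
  \<open>ketbra e f ox left_slice e f F\<close>, which lie in the algebraic tensor product and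
  converge ultraweakly to \<open>F\<close>.\<close>

lemma left_slices_vn_tensor:
 fixes F :: "('c::chilbert, 'h::chilbert) tensor =>L ('c, 'h) tensor"
 assumes F: "bop F" and A: "A <= bops" and sl: "!!c d. left_slice c d F \<in> A"
 shows "F \<in> vn_tensor bops A"
proof -
 obtain B :: "'c set" where B: "onb B" using exists_onb by blast
 define Q where "Q S = fin_proj S ox (idL :: 'h =>L 'h)" for S :: "'c set"
 show ?thesis
  unfolding vn_tensor_def
 proof (rule closure_of_compressions[where Q = Q and F = "finite_subsets_at_top B" and L = idL])
  show "\<forall>\<^sub>F S in finite_subsets_at_top B. Q S \<in> bops &
   adj (Q S) = Q S & norm (Q S) <= 1 &
   idL oo (Q S oo F oo Q S) oo idL
    \<in> cspan {a ox b |a b. bop a & b \<in> A}"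
  proof (rule eventually_finite_subsets_at_top_weakI, intro conjI)
   fix S assume S: "finite S" "S <= B"
   show "norm (Q S) <= 1"
    unfolding Q_def by (intro norm_op_tensor_proj fin_proj_onb[OF B S] norm_blinfun_id_le) auto
   have one: "left_ket e oo X oo adj (left_ket f) = ketbra e f ox X" if "bop X" for e f :: 'c and X :: "'h =>L 'h"
    by (rule op_tensor_eqI[symmetric]) (use that in \<open>auto simp: bops_scaleC tens_scaleC_left tens_scaleC_right\<close>)
   have p: "Q S = (\<Sum>e\<in>S. left_ket e oo adj (left_ket e))"
    unfolding Q_def fin_proj_def by (subst op_tensor_sum_left) (auto simp: ketbra_ampl_left)
   have "Q S oo F oo Q S
    = (\<Sum>e\<in>S. \<Sum>f\<in>S. left_ket e oo left_slice e f F oo adj (left_ket f))"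
    unfolding p left_slice_def
    by (rule blinfun_eqI) (simp add: blinfun.sum_left blinfun.sum_right, rule sum.swap)
   also have "... = (\<Sum>e\<in>S. \<Sum>f\<in>S. ketbra e f ox left_slice e f F)" by (simp add: one F)
   also have "... \<in> cspan {a ox b |a b. bop a & b \<in> A}"
    by (intro cspan_sum(2) cspan_base(2)) (use sl in auto)
   finally show "idL oo (Q S oo F oo Q S) oo idL
    \<in> cspan {a ox b |a b. bop a & b \<in> A}" by simp
  qed (auto simp: Q_def adj_op_tensor adj_fin_proj)
  show "((%S. Q S x) ---> x) (finite_subsets_at_top B)" for x :: "('c, 'h) tensor"
   unfolding Q_def by (rule tensor_proj_tendsto_left[OF B])
 qed (use F in auto)
qed

text \<open>As for left slices, with the second factor now confined to the range of
  \<open>P\<close>; the outer compression by \<open>idL ox P\<close> restores this for each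
  approximant.\<close>

lemma right_slices_vn_tensor:
 fixes G :: "('h::chilbert, 'c::chilbert) tensor =>L ('h, 'c) tensor"
 assumes G: "bop G" and A: "A <= bops" and sl: "!!c d. right_slice c d G \<in> A"
  and P: "bop P" "adj P = P" "P oo P = P" and GP: "(idL ox P) oo G oo (idL ox P) = G"
 shows "G \<in> vn_tensor A {z \<in> bops. P oo z oo P = z}"
proof -
 obtain B :: "'c set" where B: "onb B" using exists_onb by blast
 define N where "N = {z \<in> bops. P oo z oo P = z}"
 define Q where "Q S = (idL :: 'h =>L 'h) ox fin_proj S" for S :: "'c set"
 let ?L = "idL ox P :: ('h, 'c) tensor =>L _"
 have "G \<in> ultraweak closure_of cspan {a ox b |a b. a \<in> A & b \<in> N}"
 proof (rule closure_of_compressions[where Q = Q and F = "finite_subsets_at_top B" and L = ?L])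
  show "\<forall>\<^sub>F S in finite_subsets_at_top B. Q S \<in> bops &
   adj (Q S) = Q S & norm (Q S) <= 1 &
   ?L oo (Q S oo G oo Q S) oo ?L
    \<in> cspan {a ox b |a b. a \<in> A & b \<in> N}"
  proof (rule eventually_finite_subsets_at_top_weakI, intro conjI)
   fix S assume S: "finite S" "S <= B"
   show "norm (Q S) <= 1"
    unfolding Q_def by (intro norm_op_tensor_proj fin_proj_onb[OF B S] norm_blinfun_id_le) auto
   have one: "tens_ket e oo X oo adj (tens_ket f) = X ox ketbra e f" if "bop X" for e f :: 'c and X :: "'h =>L 'h"
    by (rule op_tensor_eqI[symmetric]) (use that in \<open>auto simp: bops_scaleC tens_scaleC_left tens_scaleC_right\<close>)
   have p: "Q S = (\<Sum>e\<in>S. tens_ket e oo adj (tens_ket e))"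
    unfolding Q_def fin_proj_def by (subst op_tensor_sum_right) (auto simp: ketbra_ampl)
   have "Q S oo G oo Q S
    = (\<Sum>e\<in>S. \<Sum>f\<in>S. tens_ket e oo right_slice e f G oo adj (tens_ket f))"
    unfolding p right_slice_def
    by (rule blinfun_eqI) (simp add: blinfun.sum_left blinfun.sum_right, rule sum.swap)
   also have "... = (\<Sum>e\<in>S. \<Sum>f\<in>S. right_slice e f G ox ketbra e f)" by (simp add: one G)
   finally have "?L oo (Q S oo G oo Q S) oo ?L
    = (\<Sum>e\<in>S. \<Sum>f\<in>S. ?L oo (right_slice e f G ox ketbra e f) oo ?L)"
    by (intro blinfun_eqI) (simp add: blinfun.sum_left blinfun.sum_right)
   also have "... = (\<Sum>e\<in>S. \<Sum>f\<in>S. right_slice e f G ox (P oo ketbra e f oo P))"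
    by (simp add: op_tensor_compose P(1) G)
   also have "... \<in> cspan {a ox b |a b. a \<in> A & b \<in> N}"
   proof (intro cspan_sum(2) cspan_base(2))
    fix e f
    have "P (P x) = P x" for x using arg_cong[OF P(3), of "%S. blinfun_apply S x"] by simp
    then have "P oo (P oo ketbra e f oo P) oo P = P oo ketbra e f oo P" by (intro blinfun_eqI) simp
    then show "right_slice e f G ox (P oo ketbra e f oo P) \<in> {a ox b |a b. a \<in> A & b \<in> N}"
     using sl P(1) unfolding N_def by blast
   qed
   finally show "?L oo (Q S oo G oo Q S) oo ?L
    \<in> cspan {a ox b |a b. a \<in> A & b \<in> N}" .
  qed (auto simp: Q_def adj_op_tensor adj_fin_proj)
  show "((%S. Q S x) ---> x) (finite_subsets_at_top B)" for x :: "('h, 'c) tensor"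
   unfolding Q_def by (rule tensor_proj_tendsto[OF B])
 qed (use G GP P in \<open>auto simp: adj_op_tensor\<close>)
 then show ?thesis by (simp add: vn_tensor_def N_def)
qed

subsection \<open>Amplified homomorphisms\<close>

text \<open>\<open>V\<close> is an intertwiner from \<open>normal_hom_spatial\<close>; the map \<open>id \<otimes> \<phi>\<close> is then spatially implemented.\<close>

definition left_ampl :: "('z::chilbert =>L ('h::chilbert, 'k::chilbert) tensor) =>
  ('c::chilbert, 'z) tensor =>L (('c, 'h) tensor, 'k) tensor"
 where "left_ampl V = adj assoc oo (idL ox V)"

lemma left_ampl_isometry:
 fixes V :: "'z::chilbert =>L ('h::chilbert, 'm::chilbert) tensor"
 assumes V: "bop V" "!!x y. ip (V x) (V y) = ip x y"
 shows "bop (left_ampl V :: ('c::chilbert, 'z) tensor =>L _)"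
  and "adj (left_ampl V) oo (left_ampl V :: ('c, 'z) tensor =>L _) = idL"
proof -
 show "bop (left_ampl V :: ('c::chilbert, 'z) tensor =>L _)" using V(1) by (simp add: left_ampl_def)
 have "adj (left_ampl V) oo (left_ampl V :: ('c, 'z) tensor =>L _) = (idL ox adj V) oo (idL ox V)"
  using V(1) by (intro blinfun_eqI) (simp add: left_ampl_def adj_compose adj_op_tensor)
 also have "... = idL" using V by (simp add: op_tensor_compose adj_compose_self)
 finally show "adj (left_ampl V) oo (left_ampl V :: ('c, 'z) tensor =>L _) = idL" .
qed

text \<open>The second part says more than the formula: the range of \<open>left_ampl V\<close> is
  invariant under the amplification of \<open>F\<close>. The norm bound and the formula for squared
  norms of \<open>tilde_map\<close> are drawn from it.\<close>

lemma tilde_map_spatial: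
 fixes A :: "('h::chilbert =>L 'h) set" and j :: "('h, 'k::chilbert) map_family"
  and V :: "('h, 'k) hf =>L ('h, 'm::chilbert) tensor"
 assumes A: "von_neumann_algebra A" and j: "normal_hom A (j t)"
  and V: "bop V" "!!x y. ip (V x) (V y) = ip x y" "!!a. a \<in> A ==> V oo j t a = ampl a oo V"
  and F: "F \<in> vn_tensor bops A"
 shows "tilde_map A j t F = adj (left_ampl V) oo (ampl F) oo left_ampl V"
  and "ampl F oo left_ampl V = left_ampl V oo tilde_map A j t F"
proof -
 let ?Z = "left_ampl V :: (complex \<times> 'k, ('h, 'k) hf) tensor =>L _"
 have Zb: "bop ?Z" by (rule left_ampl_isometry(1)[OF V(1,2)])
 have sub: "A <= bops" "(bops :: ((complex \<times> 'k) =>L (complex \<times> 'k)) set) <= bops" using A by (auto simp: von_neumann_algebra_def)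
 note ZZ = left_ampl_isometry(2)[OF V(1,2), where 'c = "complex \<times> 'k"]
 have ZZ': "adj ?Z (?Z x) = x" for x using ZZ by (simp flip: blinfun_apply_blinfun_compose)
 have el: "(ampl (x ox a)) oo ?Z = ?Z oo (x ox j t a)" if xa: "bop x" "a \<in> A" for x a
 proof -
  have ab: "bop a" using xa sub by auto
  have 1: "(ampl (x ox a)) (adj assoc y) = adj assoc ((x ox (ampl a)) y)"
   for y :: "(complex \<times> 'k, ('h, 'm) tensor) tensor"
  proof -
   have "(ampl (x ox a)) oo adj assoc = adj assoc oo (x ox (a ox (idL :: 'm =>L 'm)))"
    by (rule bops_tensor3_right_eqI) (use xa ab in \<open>auto simp: adj_assoc\<close>)
   then show ?thesis by (simp flip: blinfun_apply_blinfun_compose)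
  qed
  have "(x ox (ampl a)) oo (idL ox V) = (idL ox V) oo (x ox j t a)"
   using xa ab V(1) V(3)[OF xa(2)] normal_hom_bops[OF A j xa(2)] by (simp add: op_tensor_compose)
  then have 2: "(x ox (ampl a)) ((idL ox V) y) = (idL ox V) ((x ox j t a) y)" for y
   by (simp flip: blinfun_apply_blinfun_compose)
  show ?thesis by (rule blinfun_eqI) (simp add: left_ampl_def 1 2)
 qed
 have nl: "normal_linear (vn_tensor bops A) (%F. adj ?Z oo (ampl F) oo ?Z)"
  using vn_tensor_bops by (intro normal_linear_compress) (use Zb in auto)
 have "tilde_map A j t = restrict (%F. adj ?Z oo (ampl F) oo ?Z) (vn_tensor bops A)"
  unfolding tilde_map_def
 proof (rule the_normal_extension[OF sub(2,1) nl])
  fix x :: "(complex \<times> 'k) =>L (complex \<times> 'k)" and a assume xa: "bop x" "a \<in> A"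
  have "adj ?Z oo (ampl (x ox a)) oo ?Z = (adj ?Z oo ?Z) oo (x ox j t a)"
   by (simp add: compose_assoc el[OF xa] del: ZZ)
  then show "adj ?Z oo (ampl (x ox a)) oo ?Z = x ox j t a" by (simp add: ZZ)
 qed
 then show eq: "tilde_map A j t F = adj ?Z oo (ampl F) oo ?Z" using F by simp
 show "ampl F oo ?Z = ?Z oo tilde_map A j t F"
 proof (rule blinfun_eqI, rule cinner_ext)
  fix x z
  have iso: "ip (?Z u) (?Z w) = ip u w" for u w
   using cinner_adj_right[OF Zb, of u "?Z w"] by (simp add: ZZ')
  \<comment> \<open>The two functionals agree on elementary tensors because these map the range of
    \<open>?Z\<close> into itself; normality extends this to \<open>F\<close>.\<close>
  have "ip z (ampl F (?Z x)) = ip (?Z (adj ?Z z)) (ampl F (?Z x))"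
  proof (rule vn_tensor_ampl_eqI[OF sub(2,1) F])
   fix y :: "(complex \<times> 'k) =>L (complex \<times> 'k)" and a assume ya: "bop y" "a \<in> A"
   have "(ampl (y ox a)) (?Z x) = ?Z ((y ox j t a) x)"
    using el[OF ya] by (simp flip: blinfun_apply_blinfun_compose)
   then show "ip z ((ampl (y ox a)) (?Z x)) = ip (?Z (adj ?Z z)) ((ampl (y ox a)) (?Z x))"
    using iso cinner_adj_left[OF Zb] by simp
  qed
  then show "ip z ((ampl F oo ?Z) x) = ip z ((?Z oo tilde_map A j t F) x)"
   using Zb cinner_adj_left[OF Zb, of z] cinner_adj_right[OF Zb, of "adj ?Z z"] by (simp add: eq)
 qed
qed

section \<open>Step functions and exponential vectors\<close>

definition step1 :: "real => real => 'k => real => 'k::chilbert"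
 where "step1 a b c s = (if a <= s & s < b then c else 0)"

lemma step_funs_iff: "step f \<longleftrightarrow> (EX (n::nat) a b c. (ALL i<n. 0 <= a i) & f = (%s. \<Sum>i<n. step1 (a i) (b i) (c i) s))"
 by (simp add: step_funs_def step1_def)

lemma step_funs_zero [simp]: "step (%_. 0)"
 unfolding step_funs_iff by (intro exI[of _ 0]) simp

lemma step1_step_funs [simp]: "0 <= a ==> step1 a b c \<in> step_funs"
 unfolding step_funs_iff by (intro exI[of _ 1] exI[of _ "%_. a"] exI[of _ "%_. b"] exI[of _ "%_. c"]) (auto simp: fun_eq_iff)

lemma step_funs_add:
 assumes "step f" "step g"
 shows "step (%s. f s + g s)"
proof -
 obtain n :: nat and a b c where f: "ALL i<n. 0 <= a i" "f = (%s. \<Sum>i<n. step1 (a i) (b i) (c i) s)"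
  using assms(1) unfolding step_funs_iff by blast
 obtain m :: nat and a' b' c' where g: "ALL i<m. 0 <= a' i" "g = (%s. \<Sum>i<m. step1 (a' i) (b' i) (c' i) s)"
  using assms(2) unfolding step_funs_iff by blast
 define A B C where "A i = (if i < n then a i else a' (i - n))" and "B i = (if i < n then b i else b' (i - n))"
  and "C i = (if i < n then c i else c' (i - n))" for i
 have "(\<Sum>i<n+m. step1 (A i) (B i) (C i) s) = f s + g s" for s
 proof -
  have "(\<Sum>i<n+m. step1 (A i) (B i) (C i) s) = (\<Sum>i<n. step1 (A i) (B i) (C i) s) + (\<Sum>i\<in>{n..<n+m}. step1 (A i) (B i) (C i) s)"
   using sum.atLeastLessThan_concat[of 0 n "n + m" "%i. step1 (A i) (B i) (C i) s"] by (simp add: lessThan_atLeast0)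
  also have "(\<Sum>i\<in>{n..<n+m}. step1 (A i) (B i) (C i) s) = g s"
   unfolding g(2) by (rule sum.reindex_bij_witness[of _ "%i. i + n" "%i. i - n"]) (auto simp: A_def B_def C_def)
  also have "(\<Sum>i<n. step1 (A i) (B i) (C i) s) = f s" unfolding f(2) by (simp add: A_def B_def C_def)
  finally show ?thesis .
 qed
 moreover have "ALL i<n+m. 0 <= A i" using f g by (auto simp: A_def)
 ultimately show ?thesis unfolding step_funs_iff
  by (intro exI[of _ "n + m"] exI[of _ A] exI[of _ B] exI[of _ C]) (auto simp: fun_eq_iff)
qed

lemma step_funs_induct [consumes 1, case_names zero step add]:
 assumes "step f" and "P (%_. 0)" and "!!a b c. 0 <= a ==> P (step1 a b c)"
  and "!!f g. step f ==> step g ==> P f ==> P g ==> P (%s. f s + g s)"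
 shows "P f"
proof -
 obtain n :: nat and a b c where f: "ALL i<n. 0 <= a i" "f = (%s. \<Sum>i<n. step1 (a i) (b i) (c i) s)"
  using assms(1) unfolding step_funs_iff by blast
 have "step (%s. \<Sum>i<k. step1 (a i) (b i) (c i) s) & P (%s. \<Sum>i<k. step1 (a i) (b i) (c i) s)" if "k <= n" for k
  using that
 proof (induction k)
  case (Suc k)
  then show ?case using f(1) assms(3,4) by (auto intro: step_funs_add)
 qed (simp add: assms(2))
 then show ?thesis using f(2) by blast
qed

lemma step_funs_scale:
 assumes "step f"
 shows "step (%s. z *\<^sub>C f s)"
 using assms
proof (induction rule: step_funs_induct)
 case (step a b c)
 have "(%s. z *\<^sub>C step1 a b c s) = step1 a b (z *\<^sub>C c)" by (auto simp: step1_def)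
 with step show ?case by simp
qed (auto simp: scaleC_add_right intro: step_funs_add)

lemma step_funs_restr_past [simp]:
 assumes "step f"
 shows "restr {0..<r} f \<in> step_funs"
 using assms
proof (induction rule: step_funs_induct)
 case zero
 have "restr {0..<r} (%_. 0) = (%_. 0 :: 'a)" by (auto simp: restr_def)
 then show ?case by simp
next
 case (step a b c)
 then have "restr {0..<r} (step1 a b c) = step1 a (min b r) c" by (auto simp: step1_def restr_def)
 with step show ?case by simp
next
 case (add f g)
 have "restr {0..<r} (%s. f s + g s) = (%s. restr {0..<r} f s + restr {0..<r} g s)" by (auto simp: restr_def)
 with add show ?case by (simp add: step_funs_add)
qed

lemma step_funs_restr_future [simp]:
 assumes "step f" "0 <= r"
 shows "restr {r..} f \<in> step_funs"
 using assms(1)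
proof (induction rule: step_funs_induct)
 case zero
 have "restr {r..} (%_. 0) = (%_. 0 :: 'a)" by (auto simp: restr_def)
 then show ?case by simp
next
 case (step a b c)
 then have "restr {r..} (step1 a b c) = step1 (max a r) b c" by (auto simp: step1_def restr_def)
 with step assms(2) show ?case by simp
next
 case (add f g)
 have "restr {r..} (%s. f s + g s) = (%s. restr {r..} f s + restr {r..} g s)" by (auto simp: restr_def)
 with add show ?case by (simp add: step_funs_add)
qed

lemma step_funs_shift:
 assumes "step f" "0 <= r"
 shows "step (%s. f (s - r))"
 using assms(1)
proof (induction rule: step_funs_induct)
 case (step a b c)
 have "(%s. step1 a b c (s - r)) = step1 (a + r) (b + r) c" by (auto simp: step1_def)
 with step assms(2) show ?case by simp
qed (auto intro: step_funs_add)

text \<open>The value 0 at negative times keeps the result among the step functions, which vanish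
  there.\<close>

definition lshift :: "real => (real => 'k) => real => 'k::chilbert"
 where "lshift r f s = (if 0 <= s then f (s + r) else 0)"

lemma step_funs_lshift [simp]:
 assumes "step f"
 shows "lshift r f \<in> step_funs"
 using assms
proof (induction rule: step_funs_induct)
 case zero
 have "lshift r (%_. 0) = (%_. 0 :: 'a)" by (auto simp: lshift_def)
 then show ?case by simp
next
 case (step a b c)
 have "lshift r (step1 a b c) = step1 (max (a - r) 0) (b - r) c" by (auto simp: step1_def lshift_def)
 then show ?case by simp
next
 case (add f g)
 have "lshift r (%s. f s + g s) = (%s. lshift r f s + lshift r g s)" by (auto simp: lshift_def)
 with add show ?case by (simp add: step_funs_add)
qed

lemma step_fun_neg: "step f ==> s < 0 ==> f s = 0"
 by (induction rule: step_funs_induct) (auto simp: step1_def)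

lemma step_fun_support: "step f ==> EX T. ALL s>=T. f s = 0"
proof (induction rule: step_funs_induct)
 case (step a b c)
 then show ?case by (intro exI[of _ b]) (auto simp: step1_def)
next
 case (add f g)
 then obtain T T' where "ALL s>=T. f s = 0" "ALL s>=T'. g s = 0" by blast
 then show ?case by (intro exI[of _ "max T T'"]) auto
qed simp

lemma step_fun_breaks:
 "step f ==> EX B. finite B & (ALL x y. x <= y --> {x<..y} Int B = {} --> f x = f y)"
proof (induction rule: step_funs_induct)
 case (step a b c)
 show ?case
  by (intro exI[of _ "{a, b}"]) (auto simp: step1_def)
next
 case (add f g)
 then obtain B C where "finite B" "ALL x y. x <= y --> {x<..y} Int B = {} --> f x = f y"
  and "finite C" "ALL x y. x <= y --> {x<..y} Int C = {} --> g x = g y" by blast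
 then show ?case by (intro exI[of _ "B Un C"]) (simp add: Int_Un_distrib)
qed auto

lemma finite_gap_right:
 fixes B :: "real set"
 assumes "finite B"
 shows "EX \<delta>>0. {x<..x+\<delta>} Int B = {}"
proof (cases "B Int {x<..} = {}")
 case True
 then show ?thesis by (intro exI[of _ 1]) auto
next
 case False
 define m where "m = Min (B Int {x<..})"
 have m: "m \<in> B Int {x<..}" "!!y. y \<in> B Int {x<..} ==> m <= y"
  unfolding m_def using assms False by (intro Min_in Min_le; simp)+
 have "\<not> (y \<in> {x<..x + (m - x) / 2} Int B)" for y
 proof
  assume y: "y \<in> {x<..x + (m - x) / 2} Int B"
  then have "m <= y" using m(2)[of y] by auto
  moreover have "y <= x + (m - x) / 2" "x < m" using y m(1) by auto
  ultimately show False by (simp add: field_simps)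
 qed
 then show ?thesis using m(1) by (intro exI[of _ "(m - x) / 2"]) auto
qed

lemma finite_gap_left:
 fixes B :: "real set"
 assumes "finite B"
 shows "EX \<delta>>0. {x-\<delta>..<x} Int B = {}"
proof -
 obtain \<delta> where d: "\<delta> > 0" "{-x<..-x+\<delta>} Int uminus ` B = {}"
  using finite_gap_right[of "uminus ` B" "-x"] assms by auto
 have "\<not> y \<in> {x-\<delta>..<x} Int B" for y
 proof
  assume "y \<in> {x-\<delta>..<x} Int B"
  then have "- y \<in> {-x<..-x+\<delta>} Int uminus ` B" by auto
  with d show False by blast
 qed
 with d(1) show ?thesis by blast
qed

lemma step_fun_simple_lborel: "step f ==> simple_function lborel f"
proof (induction rule: step_funs_induct)
 case (step a b c)
 have "simple_function lborel (%s. if s \<in> {a..<b} then c else 0)"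
  by (rule simple_function_If_set) auto
 then show ?case by (simp add: step1_def[abs_def])
next
 case (add f g)
 from simple_function_compose2[OF add(3,4), of "(+)"] show ?case by simp
qed simp

text \<open>Phrased for a function of two values, so that one statement serves inner products, norms
  and the density \<open>xi\<close>.\<close>

lemma integrable_step_funs:
 fixes h :: "'k::chilbert => 'k => 'z::euclidean_space"
 assumes f: "step f" and g: "step g" and h: "h 0 0 = 0"
 shows "integrable lborel (%s. h (f s) (g s))"
proof -
 have s: "simple_function lborel (%s. h (f s) (g s))"
  by (rule simple_function_compose2[OF step_fun_simple_lborel[OF f] step_fun_simple_lborel[OF g]])
 obtain T where T: "!!s. s >= T ==> f s = 0 & g s = 0"
  using step_fun_support[OF f] step_fun_support[OF g] by (metis max.bounded_iff)
 have "finite ((%s. h (f s) (g s)) ` UNIV)" using s by (simp add: simple_function_def)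
 then obtain K where K: "!!s. norm (h (f s) (g s)) <= K"
  using bounded_iff[of "(%s. h (f s) (g s)) ` UNIV"] finite_imp_bounded by fastforce
 show ?thesis
 proof (rule Bochner_Integration.integrable_bound)
  show "integrable lborel (%s. indicator {0..max 0 T} s * K)" by simp
  show "(%s. h (f s) (g s)) \<in> borel_measurable lborel" using s by (rule borel_measurable_simple_function)
  show "AE s in lborel. norm (h (f s) (g s)) <= norm (indicator {0..max 0 T} s * K)"
  proof (rule AE_I2)
   fix s
   show "norm (h (f s) (g s)) <= norm (indicator {0..max 0 T} s * K)"
   proof (cases "s \<in> {0..max 0 T}")
    case True
    then show ?thesis using K[of s] by simp
   next
    case False
    then have "f s = 0 & g s = 0" using T[of s] step_fun_neg[OF f, of s] step_fun_neg[OF g, of s] by force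
    then show ?thesis using h by simp
   qed
  qed
 qed
qed

lemma lebesgue_on_half_line:
 fixes F :: "real => 'z::euclidean_space"
 assumes F: "F \<in> borel_measurable lborel" and neg: "!!s. s < 0 ==> F s = 0"
 shows "(LINT s|lebesgue_on {0..}. F s) = (LINT s|lborel. F s)"
proof -
 have "(LINT s|lebesgue_on {0..}. F s) = (LINT s|lebesgue. indicator {0..} s *\<^sub>R F s)"
  by (rule integral_restrict_space) simp
 also have "(%s. indicator {0..} s *\<^sub>R F s) = F" using neg by (auto simp: fun_eq_iff indicator_def not_le)
 also have "(LINT s|lebesgue. F s) = (LINT s|lborel. F s)" by (rule integral_completion) (use F in simp)
 finally show ?thesis .
qed

text \<open>Integrated over time, this is the exponent of the inner product of two normalised
  exponential vectors; the normalisation makes it vanish on the diagonal.\<close>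

definition xi :: "'k::chilbert => 'k => complex"
 where "xi c d = ip c d - complex_of_real ((norm c)\<^sup>2) / 2 - complex_of_real ((norm d)\<^sup>2) / 2"

lemma xi_self [simp]: "xi c c = 0"
 by (simp add: xi_def cinner_self field_simps)

text \<open>The noise term in the derivative of \<open>future_slice\<close> comes from this defect
  of additivity at an intermediate value.\<close>

lemma xi_add: "xi c d - xi c e - xi e d = ip (c - e) (d - e)"
 by (simp add: xi_def cinner_simps cinner_self field_simps)

definition chi :: "(real => 'k::chilbert) => (real => 'k) => complex"
 where "chi f g = (LINT s|lborel. xi (f s) (g s))"

lemma integrable_xi: "step f ==> step g ==> integrable lborel (%s. xi (f s) (g s))"
 by (rule integrable_step_funs) auto

lemma cinner_expv_chi:
 fixes f g :: "real => 'k::chilbert"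
 assumes f: "step f" and g: "step g"
 shows "ip (\<varpi> f) (\<varpi> g) = exp (chi f g)"
proof -
 have i1: "integrable lborel (%s. ip (f s) (g s))" using f g by (rule integrable_step_funs) simp
 have i2: "integrable lborel (%s. (norm (h s))\<^sup>2)" if "step h" for h :: "real => 'k"
  using integrable_step_funs[OF that that, of "%x y. (norm x)\<^sup>2"] by simp
 have e1: "(LINT s|lebesgue_on {0..}. ip (f s) (g s)) = (LINT s|lborel. ip (f s) (g s))"
  by (rule lebesgue_on_half_line) (use i1 step_fun_neg[OF f] in auto)
 have e2: "(LINT s|lebesgue_on {0..}. (norm (h s))\<^sup>2) = (LINT s|lborel. (norm (h s))\<^sup>2)"
  if h: "step h" for h :: "real => 'k"
  by (rule lebesgue_on_half_line) (use borel_measurable_integrable[OF i2[OF h]] step_fun_neg[OF h] in auto)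
 have i2c: "integrable lborel (%s. complex_of_real ((norm (h s))\<^sup>2) / 2)" if "step h" for h :: "real => 'k"
  using i2[OF that] by (intro integrable_divide_zero integrable_of_real) auto
 have "chi f g = (LINT s|lborel. ip (f s) (g s)) - complex_of_real (LINT s|lborel. (norm (f s))\<^sup>2) / 2
   - complex_of_real (LINT s|lborel. (norm (g s))\<^sup>2) / 2"
  unfolding chi_def xi_def using i1 i2c[OF f] i2c[OF g]
  by (simp del: of_real_power)
 then show ?thesis
  unfolding cinner_expv[OF f g] e1 e2[OF f] e2[OF g]
  by (intro arg_cong[where f = exp]) (simp add: algebra_simps)
qed

lemma norm_expv [simp]: "step f ==> norm (\<varpi> f) = 1"
proof -
 assume f: "step f"
 have "ip (\<varpi> f) (\<varpi> f) = 1" using f by (simp add: cinner_expv_chi chi_def)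
 then show ?thesis using norm_sq_cinner[of "\<varpi> f"] norm_ge_zero[of "\<varpi> f"]
  by (simp add: power2_eq_1_iff del: norm_ge_zero)
qed

lemma cinner_expv_self [simp]: "step f ==> ip (\<varpi> f) (\<varpi> f) = 1"
 by (simp add: cinner_expv_chi chi_def)

lemma chi_split:
 assumes f: "step f" and g: "step g" and r: "0 <= r"
 shows "chi f g = chi (restr {0..<r} f) (restr {0..<r} g) + chi (restr {r..} f) (restr {r..} g)"
proof -
 have "xi (f s) (g s) = xi (restr {0..<r} f s) (restr {0..<r} g s) + xi (restr {r..} f s) (restr {r..} g s)" for s
  using step_fun_neg[OF f, of s] step_fun_neg[OF g, of s] r by (auto simp: restr_def not_le)
 then show ?thesis
  unfolding chi_def using f g r by (simp add: integrable_xi)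
qed

lemma cinner_expv_split:
 assumes "step f" "step g" "0 <= r"
 shows "ip (\<varpi> f) (\<varpi> g) = ip (\<varpi> (restr {0..<r} f)) (\<varpi> (restr {0..<r} g)) *
  ip (\<varpi> (restr {r..} f)) (\<varpi> (restr {r..} g))"
 using assms by (simp add: cinner_expv_chi chi_split[OF assms] exp_add)

lemma chi_shift: "chi (%s. f (s - r)) (%s. g (s - r)) = chi f g"
 unfolding chi_def using lborel_integral_real_affine[of 1 "%s. xi (f s) (g s)" "- r"] by simp

lemma cinner_expv_shift:
 "step f ==> step g ==> 0 <= r ==>
  ip (\<varpi> (%s. f (s - r))) (\<varpi> (%s. g (s - r))) = ip (\<varpi> f) (\<varpi> g)"
 by (simp add: cinner_expv_chi step_funs_shift chi_shift)

lemma restr_future_shift: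
 "step f ==> restr {r..} f = (%s. lshift r f (s - r))"
 by (auto simp: restr_def lshift_def fun_eq_iff)

lemma restr_restr [simp]: "restr J (restr K f) = restr (J Int K) f"
 by (auto simp: restr_def fun_eq_iff)

lemma restr_empty [simp]: "restr {} f = (%_. 0)"
 by (auto simp: restr_def)

lemma const_step [simp]: "restr {0..<h} (%_. c) \<in> step_funs"
proof -
 have "restr {0..<h} (%_. c) = step1 0 h c" by (auto simp: restr_def step1_def)
 then show ?thesis by simp
qed

lemma chi_const: "0 <= h ==> chi (restr {0..<h} (%_. c)) (restr {0..<h} (%_. d)) = of_real h * xi c d"
proof -
 assume h: "0 <= h"
 have "(%s. xi (restr {0..<h} (%_. c) s) (restr {0..<h} (%_. d) s)) = (%s. indicator {0..<h} s *\<^sub>R xi c d)"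
  by (auto simp: restr_def)
 then show ?thesis
  unfolding chi_def using h by (simp add: scaleR_conv_of_real)
qed

subsection \<open>Square-integrable functions\<close>

definition sq_int :: "(real => 'k::chilbert) => bool"
 where "sq_int f \<longleftrightarrow> strongly_measurable (lebesgue_on {0..}) f &
  (\<integral>\<^sup>+s. ennreal ((norm (f s))\<^sup>2) \<partial>lebesgue_on {0..}) < \<infinity>"

lemma sq_int_Rep [simp]: "sq_int (Rep_sqint f)"
 using Rep_sqint[of f] by (simp add: sq_int_def)

lemma Rep_Abs_sq_int: "sq_int f ==> Rep_sqint (Abs_sqint f) = f"
 by (rule Abs_sqint_inverse) (simp add: sq_int_def)

lemma sq_int_step: "step f ==> sq_int f"
 using step_fun_sqint[of f] by (simp add: sq_int_def)

lemma strongly_measurable_norm: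
 assumes "strongly_measurable (lebesgue_on {0::real..}) (f :: real => 'k::chilbert)"
 shows "(%s. norm (f s)) \<in> borel_measurable (lebesgue_on {0..})"
proof -
 have "(%s. sqrt (Re (ip (f s) (f s)))) \<in> borel_measurable (lebesgue_on {0..})"
  by (intro measurable_compose[OF _ borel_measurable_Re] measurable_compose[OF _ borel_measurable_sqrt]
   measurable_compose[OF strongly_measurable_cinner[OF half_line_sets assms assms]]) auto
 then show ?thesis by (simp flip: norm_sq_cinner)
qed

lemma strongly_measurable_compose2:
 assumes "strongly_measurable M f" "strongly_measurable M g"
  and h: "!!x y. isCont (%p. h (fst p) (snd p)) (x, y)"
 shows "strongly_measurable M (%s. h (f s) (g s))"
proof -
 obtain u v where u: "!!n. simple_function M (u n)" "AE x in M. (%n. u n x) ----> f x"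
  and v: "!!n. simple_function M (v n)" "AE x in M. (%n. v n x) ----> g x"
  using assms unfolding strongly_measurable_def by blast
 show ?thesis
  unfolding strongly_measurable_def
 proof (intro exI[of _ "%n x. h (u n x) (v n x)"] conjI allI)
  show "simple_function M (%x. h (u n x) (v n x))" for n
   by (rule simple_function_compose2[OF u(1) v(1)])
  show "AE x in M. (%n. h (u n x) (v n x)) ----> h (f x) (g x)"
   using u(2) v(2)
  proof eventually_elim
   case (elim x)
   have "(%n. (%p. h (fst p) (snd p)) (u n x, v n x)) ----> (%p. h (fst p) (snd p)) (f x, g x)"
    by (rule isCont_tendsto_compose[OF h]) (intro tendsto_Pair elim)
   then show ?case by simp
  qed
 qed
qed

lemma integrable_sq_int:
 assumes "sq_int f"
 shows "integrable (lebesgue_on {0..}) (%s. (norm (f s))\<^sup>2)"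
proof (rule integrableI_bounded)
 show "(%s. (norm (f s))\<^sup>2) \<in> borel_measurable (lebesgue_on {0..})"
  using strongly_measurable_norm[of f] assms by (simp add: sq_int_def)
 show "(\<integral>\<^sup>+s. ennreal (norm ((norm (f s))\<^sup>2)) \<partial>lebesgue_on {0..}) < \<infinity>"
  using assms by (simp add: sq_int_def)
qed

lemma sq_intI:
 assumes f: "strongly_measurable (lebesgue_on {0..}) f"
  and g: "integrable (lebesgue_on {0..}) g" and fg: "!!s. (norm (f s))\<^sup>2 <= g s"
 shows "sq_int f"
proof -
 have "(\<integral>\<^sup>+s. ennreal ((norm (f s))\<^sup>2) \<partial>lebesgue_on {0..}) <= (\<integral>\<^sup>+s. ennreal (norm (g s)) \<partial>lebesgue_on {0..})"
 proof (rule nn_integral_mono, rule ennreal_leI)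
  show "(norm (f s))\<^sup>2 <= norm (g s)" for s using order_trans[OF fg[of s] abs_ge_self] by (simp only: real_norm_def)
 qed
 also have "... < \<infinity>" using g unfolding integrable_iff_bounded by (rule conjunct2)
 finally show ?thesis using f by (simp add: sq_int_def)
qed

lemma norm_add_sq_le: "(norm (x + y))\<^sup>2 <= 2 * (norm x)\<^sup>2 + 2 * (norm (y :: 'a::real_normed_vector))\<^sup>2"
proof -
 have "(norm (x + y))\<^sup>2 <= (norm x + norm y)\<^sup>2" by (intro power_mono norm_triangle_ineq) auto
 also have "... <= 2 * (norm x)\<^sup>2 + 2 * (norm y)\<^sup>2"
  using sum_squares_bound[of "norm x" "norm y"] by (simp add: power2_sum)
 finally show ?thesis .
qed

lemma sq_int_add:
 assumes "sq_int f" "sq_int g"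
 shows "sq_int (%s. f s + g s)"
proof (rule sq_intI)
 show "strongly_measurable (lebesgue_on {0..}) (%s. f s + g s)"
  using assms by (intro strongly_measurable_compose2[where h = "(+)" and f = f and g = g])
   (auto simp: sq_int_def intro!: continuous_intros)
 show "integrable (lebesgue_on {0..}) (%s. 2 * (norm (f s))\<^sup>2 + 2 * (norm (g s))\<^sup>2)"
  using assms by (intro Bochner_Integration.integrable_add integrable_mult_right integrable_sq_int)
qed (rule norm_add_sq_le)

lemma sq_int_scale:
 assumes "sq_int f"
 shows "sq_int (%s. z *\<^sub>C f s)"
proof (rule sq_intI)
 show "strongly_measurable (lebesgue_on {0..}) (%s. z *\<^sub>C f s)"
  using assms
  by (intro strongly_measurable_compose2[where h = "%x y. z *\<^sub>C x" and f = f and g = f])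
   (auto simp: sq_int_def intro!: bounded_linear.isCont[OF bounded_linear_scaleC] continuous_intros)
 show "integrable (lebesgue_on {0..}) (%s. (cmod z)\<^sup>2 * (norm (f s))\<^sup>2)"
  using assms by (intro integrable_mult_right integrable_sq_int)
qed (simp add: norm_scaleC power_mult_distrib)

lemma sq_int_restr:
 assumes f: "sq_int f" and J: "J \<in> sets lebesgue"
 shows "sq_int (restr J f)"
proof (rule sq_intI)
 obtain u where u: "!!n. simple_function (lebesgue_on {0..}) (u n)" "AE x in lebesgue_on {0..}. (%n. u n x) ----> f x"
  using f unfolding sq_int_def strongly_measurable_def by blast
 show "strongly_measurable (lebesgue_on {0..}) (restr J f)"
  unfolding strongly_measurable_def
 proof (intro exI[of _ "%n. restr J (u n)"] conjI allI)
  show "simple_function (lebesgue_on {0..}) (restr J (u n))" for n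
   unfolding restr_def[abs_def] using J by (intro simple_function_If_set u) (auto simp: sets_restrict_space)
  show "AE x in lebesgue_on {0..}. (%n. restr J (u n) x) ----> restr J f x"
   using u(2) by eventually_elim (auto simp: restr_def)
 qed
 show "integrable (lebesgue_on {0..}) (%s. (norm (f s))\<^sup>2)" by (rule integrable_sq_int[OF f])
qed (simp add: restr_def)

lemma simple_sq_int:
 assumes s: "simple_function (lebesgue_on {0..}) s" and b: "!!x. s x ~= 0 ==> x < real n"
 shows "sq_int (s :: real => 'k::chilbert)"
proof -
 have "finite (s ` {0..})" using s by (simp add: simple_function_def)
 then obtain K where K: "!!x. x >= 0 ==> norm (s x) <= K"
  using finite_imp_bounded[of "s ` {0..}"] by (auto simp: bounded_iff)
 have "simple_function (lebesgue_on {0..}) (%x. if x \<in> {0..} then s x else 0)"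
  using s by (subst simple_function_cong[where g = s]) auto
 have sm: "strongly_measurable (lebesgue_on {0..}) s"
  unfolding strongly_measurable_def using s by (intro exI[of _ "%_. s"]) auto
 have "(\<integral>\<^sup>+x. ennreal ((norm (s x))\<^sup>2) \<partial>lebesgue_on {0..}) <= (\<integral>\<^sup>+x. ennreal (K\<^sup>2) * indicator {0..real n} x \<partial>lebesgue_on {0..})"
 proof (rule nn_integral_mono)
  fix x :: real assume "x \<in> space (lebesgue_on {0..})"
  then have x: "x >= 0" by simp
  then have "(norm (s x))\<^sup>2 <= K\<^sup>2" using K by (intro power_mono) auto
  then show "ennreal ((norm (s x))\<^sup>2) <= ennreal (K\<^sup>2) * indicator {0..real n} x"
   using b[of x] x by (cases "s x = 0") (auto simp: indicator_def intro: ennreal_leI)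
 qed
 also have "... = ennreal (K\<^sup>2) * emeasure (lebesgue_on {0..}) {0..real n}"
  by (intro nn_integral_cmult_indicator) (auto simp: sets_restrict_space)
 also have "emeasure (lebesgue_on {0..}) {0..real n} = emeasure lebesgue {0..real n}"
  by (rule emeasure_restrict_space) auto
 also have "ennreal (K\<^sup>2) * ... < \<infinity>" by (simp add: ennreal_mult_less_top)
 finally show ?thesis using sm by (simp add: sq_int_def)
qed

lemma restr_Un_disjoint: "J Int K = {} ==> restr (J Un K) f = (%s. restr J f s + restr K f s)"
 by (auto simp: restr_def fun_eq_iff)

text \<open>Step functions are dense in the square-integrable functions; this is stated for functionals.\<close>

locale l2_functional =
 fixes \<Lambda> :: "(real => 'k::chilbert) => complex" and C :: real
 assumes add: "!!f g. sq_int f ==> sq_int g ==> \<Lambda> (%s. f s + g s) = \<Lambda> f + \<Lambda> g"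
  and bound: "!!f. sq_int f ==> cmod (\<Lambda> f) <= C * sqrt (LINT s|lebesgue_on {0..}. (norm (f s))\<^sup>2)"
  and step: "!!f. step f ==> \<Lambda> f = 0"
begin

lemma diff: "sq_int f ==> sq_int g ==> \<Lambda> (%s. f s - g s) = \<Lambda> f - \<Lambda> g"
 using add[of "%s. f s - g s" g] sq_int_add[of f "%s. (-1) *\<^sub>C g s"] sq_int_scale[of g "-1"]
 by (simp add: CV.scale_minus_left)

lemma set_sq_int:
 assumes "E \<in> sets lebesgue"
 shows "sq_int (restr (E Int {0..<real n}) (%_. c :: 'k))"
proof -
 have "restr (E Int {0..<real n}) (%_. c) = restr E (restr {0..<real n} (%_. c))" by simp
 then show ?thesis using assms by (simp only:) (intro sq_int_restr sq_int_step const_step)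
qed

lemma set_bound:
 assumes "E \<in> sets lebesgue"
 shows "cmod (\<Lambda> (restr (E Int {0..<real n}) (%_. c))) <= C * (norm c * sqrt (measure lebesgue (E Int {0..<real n})))"
proof -
 have "(LINT s|lebesgue_on {0..}. (norm (restr (E Int {0..<real n}) (%_. c) s))\<^sup>2)
  = (LINT s|lebesgue_on {0..}. indicator (E Int {0..<real n}) s * (norm c)\<^sup>2)"
  by (intro Bochner_Integration.integral_cong) (auto simp: restr_def)
 also have "... = measure (lebesgue_on {0..}) (E Int {0..<real n}) * (norm c)\<^sup>2"
  using assms by (simp add: sets_restrict_space Int_absorb1 Int_absorb2 subset_iff)
 also have "measure (lebesgue_on {0..}) (E Int {0..<real n}) = measure lebesgue (E Int {0..<real n})"
  using assms by (intro measure_restrict_space) auto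
 finally show ?thesis using bound[OF set_sq_int[OF assms, of n c]] by (simp add: real_sqrt_mult mult.commute)
qed

lemma borel_zero: "E \<in> sets borel ==> \<Lambda> (restr (E Int {0..<real n}) (%_. c)) = 0"
proof -
 assume "E \<in> sets borel"
 have sb: "sets (borel :: real measure) = sigma_sets UNIV (range (%a. {x. x < a}))"
  using arg_cong[OF borel_eq_lessThan[where 'a = real], of sets] by (simp add: eucl_less_def)
 from \<open>E \<in> sets borel\<close> have "E \<in> sigma_sets UNIV (range (%a::real. {x. x < a}))"
  by (simp only: sb)
 then show ?thesis
 \<comment> \<open>Induction from the intersection-stable family of open half-lines, which cut
   \<open>{0..<real n}\<close> in intervals and so give step functions. Disjoint unions are the
   analytic case: finitely many members are handled by additivity, the tail by the bound, since its
   measure tends to 0.\<close>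
 proof (rule sigma_sets_induct_disjoint[where P = "%E. \<Lambda> (restr (E Int {0..<real n}) (%_. c)) = 0", rotated 2])
  show "Int_stable (range (%a::real. {x. x < a}))"
  proof (rule Int_stableI, clarify)
   fix a b :: real
   have "{x. x < a} Int {x. x < b} = {x. x < min a b}" by auto
   then show "{x. x < a} Int {x. x < b} \<in> range (%a. {x. x < a})" by blast
  qed
  fix A assume "A \<in> range (%a::real. {x. x < a})"
  then obtain a where "A = {x. x < a}" by blast
  then have "restr (A Int {0..<real n}) (%_. c) = restr {0..<min a (real n)} (%_. c)" by (auto simp: restr_def)
  then show "\<Lambda> (restr (A Int {0..<real n}) (%_. c)) = 0" by (simp add: step)
 next
  have "restr ({} Int {0..<real n}) (%_. c) = (%_. 0)" by simp
  then show "\<Lambda> (restr ({} Int {0..<real n}) (%_. c)) = 0" using step[OF step_funs_zero] by (simp only:)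
 next
  fix A assume A: "A \<in> sigma_sets UNIV (range (%a::real. {x. x < a}))"
   and z: "\<Lambda> (restr (A Int {0..<real n}) (%_. c)) = 0"
  then have "A \<in> sets lebesgue"
   by (intro sets_completionI_sets) (simp add: sb)
  have "restr ((UNIV - A) Int {0..<real n}) (%_. c) =
    (%s. restr {0..<real n} (%_. c) s - restr (A Int {0..<real n}) (%_. c) s)"
   by (auto simp: restr_def)
  then show "\<Lambda> (restr ((UNIV - A) Int {0..<real n}) (%_. c)) = 0"
   using diff[OF sq_int_step[OF const_step] set_sq_int[OF \<open>A \<in> sets lebesgue\<close>]] z step[OF const_step] by simp
 next
  fix A :: "nat => real set"
  assume dj: "disjoint_family A" and A: "range A <= sigma_sets UNIV (range (%a::real. {x. x < a}))"
   and z: "!!i. \<Lambda> (restr (A i Int {0..<real n}) (%_. c)) = 0"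
  have Ab: "A i \<in> sets borel" for i
   using A by (auto simp: sb)
  then have Al: "A i \<in> sets lebesgue" for i by (simp add: sets_completionI_sets)
  have fin: "\<Lambda> (restr ((\<Union>i<m. A i) Int {0..<real n}) (%_. c)) = 0" for m
  proof (induction m)
   case 0
   have "restr ((\<Union>i<0::nat. A i) Int {0..<real n}) (%_. c) = (%_. 0)" by simp
   then show ?case using step[OF step_funs_zero] by (simp only:)
  next
   case (Suc m)
   have "A m Int A i = {}" if "i < m" for i using dj that by (simp add: disjoint_family_on_def)
   then have "A m Int (\<Union>i<m. A i) = {}" by blast
   then have "restr (A m Int {0..<real n} Un (\<Union>i<m. A i) Int {0..<real n}) (%_. c) =
     (%s. restr (A m Int {0..<real n}) (%_. c) s + restr ((\<Union>i<m. A i) Int {0..<real n}) (%_. c) s)"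
    by (intro restr_Un_disjoint) blast
   also have "A m Int {0..<real n} Un (\<Union>i<m. A i) Int {0..<real n} = (\<Union>i<Suc m. A i) Int {0..<real n}"
    by (auto simp: lessThan_Suc)
   finally have "restr ((\<Union>i<Suc m. A i) Int {0..<real n}) (%_. c) =
     (%s. restr (A m Int {0..<real n}) (%_. c) s + restr ((\<Union>i<m. A i) Int {0..<real n}) (%_. c) s)" .
   then show ?case using add[OF set_sq_int[OF Al] set_sq_int[of "\<Union>i<m. A i"]] Al z Suc by simp
  qed
  define R where "R m = (\<Union>i. A i) - (\<Union>i<m. A i)" for m
  have Rl: "R m \<in> sets lebesgue" for m unfolding R_def using Al by auto
  have "(%m. measure lebesgue (R m Int {0..<real n})) ----> measure lebesgue (\<Inter>m. R m Int {0..<real n})"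
  proof (rule Lim_measure_decseq)
   show "range (%m. R m Int {0..<real n}) <= sets lebesgue" using Rl by auto
   show "decseq (%m. R m Int {0..<real n})" unfolding decseq_def R_def by fastforce
   show "emeasure lebesgue (R m Int {0..<real n}) ~= \<infinity>" for m
    using emeasure_mono[of "R m Int {0..<real n}" "{0..<real n}" lebesgue]
    by (auto simp: top_unique)
  qed
  also have "(\<Inter>m. R m Int {0..<real n}) = {}" by (auto simp: R_def)
  finally have mz: "(%m. measure lebesgue (R m Int {0..<real n})) ----> 0" by simp
  have "cmod (\<Lambda> (restr ((\<Union>i. A i) Int {0..<real n}) (%_. c))) <= C * (norm c * sqrt (measure lebesgue (R m Int {0..<real n})))" for m
  proof -
   have "restr (R m Int {0..<real n} Un (\<Union>i<m. A i) Int {0..<real n}) (%_. c) =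
     (%s. restr (R m Int {0..<real n}) (%_. c) s + restr ((\<Union>i<m. A i) Int {0..<real n}) (%_. c) s)"
    by (rule restr_Un_disjoint) (auto simp: R_def)
   also have "R m Int {0..<real n} Un (\<Union>i<m. A i) Int {0..<real n} = (\<Union>i. A i) Int {0..<real n}"
    by (auto simp: R_def)
   finally have "\<Lambda> (restr ((\<Union>i. A i) Int {0..<real n}) (%_. c)) = \<Lambda> (restr (R m Int {0..<real n}) (%_. c))"
    using add[OF set_sq_int[OF Rl] set_sq_int[of "\<Union>i<m. A i"]] Al fin by simp
   then show ?thesis using set_bound[OF Rl] by simp
  qed
  moreover have "(%m. C * (norm c * sqrt (measure lebesgue (R m Int {0..<real n})))) ----> C * (norm c * sqrt 0)"
   by (intro tendsto_intros mz)
  ultimately have "cmod (\<Lambda> (restr ((\<Union>i. A i) Int {0..<real n}) (%_. c))) <= 0"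
   by (intro LIMSEQ_le_const[where X = "%m. C * (norm c * sqrt (measure lebesgue (R m Int {0..<real n})))"]) auto
  then show "\<Lambda> (restr (\<Union> (range A) Int {0..<real n}) (%_. c)) = 0" by simp
 qed auto
qed

text \<open>A Lebesgue set differs from a Borel set by a null set, on which the bound forces the
  value 0.\<close>

lemma lebesgue_zero:
 assumes E: "E \<in> sets lebesgue"
 shows "\<Lambda> (restr (E Int {0..<real n}) (%_. c)) = 0"
proof -
 obtain S N N' where S: "E = S Un N" "N <= N'" "N' \<in> null_sets lborel" "S \<in> sets lborel"
  using sets_completionE[OF E] .
 define M where "M = E - S"
 have "M <= N'" using S by (auto simp: M_def)
 then have Mn: "M \<in> null_sets lebesgue"
  using S(3) null_sets_completion_iff2[of M lborel] by blast
 then have Ml: "M \<in> sets lebesgue" by auto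
 have Sl: "S \<in> sets lebesgue" using S(4) by (simp add: sets_completionI_sets)
 have "restr (S Int {0..<real n} Un M Int {0..<real n}) (%_. c) = (%s. restr (S Int {0..<real n}) (%_. c) s + restr (M Int {0..<real n}) (%_. c) s)"
  by (rule restr_Un_disjoint) (auto simp: M_def)
 also have "S Int {0..<real n} Un M Int {0..<real n} = E Int {0..<real n}" using S(1) by (auto simp: M_def)
 finally have "\<Lambda> (restr (E Int {0..<real n}) (%_. c)) = \<Lambda> (restr (M Int {0..<real n}) (%_. c))"
  using add[OF set_sq_int[OF Sl] set_sq_int[OF Ml]] borel_zero[of S] S(4) by simp
 moreover have "M Int {0..<real n} \<in> null_sets lebesgue"
  using Mn by (rule null_set_Int2) simp
 then have "measure lebesgue (M Int {0..<real n}) = 0" by (simp add: measure_def null_setsD1)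
 ultimately show ?thesis using set_bound[OF Ml, of n c] by simp
qed

lemma simple_zero:
 assumes s: "simple_function (lebesgue_on {0..}) s" and b: "!!x. s x ~= 0 ==> 0 <= x & x < real n"
 shows "\<Lambda> s = 0"
proof -
 have "finite (s ` {0..})" using s by (simp add: simple_function_def)
 moreover have "sq_int (%x. \<Sum>v\<in>V. restr (s -` {v} Int {0..<real n}) (%_. v) x) &
   \<Lambda> (%x. \<Sum>v\<in>V. restr (s -` {v} Int {0..<real n}) (%_. v) x) = 0" if "finite V" for V
  using that
 proof (induction V rule: finite_induct)
  case empty
  show ?case using step[OF step_funs_zero] sq_int_step[OF step_funs_zero] by simp
 next
  case (insert v V)
  have "s -` {v} Int {0..} \<in> sets (lebesgue_on {0..})"
   using simple_functionD(2)[OF s, of "{v}"] by simp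
  then have l: "s -` {v} Int {0..} \<in> sets lebesgue"
   by (subst (asm) sets_restrict_space_iff) auto
  have e: "s -` {v} Int {0..<real n} = (s -` {v} Int {0..}) Int {0..<real n}" by auto
  note 1 = set_sq_int[OF l, of n v, folded e]
  show ?case
   using insert lebesgue_zero[OF l, of n v, folded e]
    add[OF 1, of "%x. \<Sum>v\<in>V. restr (s -` {v} Int {0..<real n}) (%_. v) x"]
    sq_int_add[OF 1, of "%x. \<Sum>v\<in>V. restr (s -` {v} Int {0..<real n}) (%_. v) x"] by simp
 qed
 ultimately have "\<Lambda> (%x. \<Sum>v\<in>s ` {0..}. restr (s -` {v} Int {0..<real n}) (%_. v) x) = 0" by blast
 moreover have "(\<Sum>v\<in>s ` {0..}. restr (s -` {v} Int {0..<real n}) (%_. v) x) = s x" for x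
 proof (cases "x \<in> {0..<real n}")
  case True
  then have "(\<Sum>v\<in>s ` {0..}. restr (s -` {v} Int {0..<real n}) (%_. v) x) = (\<Sum>v\<in>s ` {0..}. if v = s x then s x else 0)"
   by (intro sum.cong) (auto simp: restr_def)
  also have "... = s x" using \<open>finite (s ` {0..})\<close> True by auto
  finally show ?thesis .
 next
  case False
  then show ?thesis using b[of x] by (cases "s x = 0") (auto simp: restr_def)
 qed
 ultimately show ?thesis by simp
qed

text \<open>Simple approximations converge almost everywhere but need not be dominated. They are cut
  down to a bounded interval and to the set where they are at most twice as large as
  \<open>f\<close>; this is eventually harmless wherever \<open>f\<close> is nonzero, and it bounds
  the squared error by 9 times that of \<open>f\<close>.\<close>

lemma functional_zero:
 assumes f: "sq_int f"
 shows "\<Lambda> f = 0"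
proof -
 obtain s where s: "!!n. simple_function (lebesgue_on {0..}) (s n)" "AE x in lebesgue_on {0..}. (%n. s n x) ----> f x"
  using f unfolding sq_int_def strongly_measurable_def by blast
 have nf: "(%x. norm (f x)) \<in> borel_measurable (lebesgue_on {0..})"
  using f by (intro strongly_measurable_norm) (simp add: sq_int_def)
 define G where "G n = {x \<in> {0..<real n}. norm (s n x) <= 2 * norm (f x)}" for n
 define g where "g n = restr (G n) (s n)" for n
 have Gm: "G n \<in> sets (lebesgue_on {0..})" for n
 proof -
  have "(%x. norm (s n x)) \<in> borel_measurable (lebesgue_on {0..})"
   by (rule borel_measurable_simple_function, rule simple_function_compose1[OF s(1)])
  then have "{x \<in> space (lebesgue_on {0..}). norm (s n x) <= 2 * norm (f x)} \<in> sets (lebesgue_on {0..})"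
   using nf by measurable
  moreover have "{0..<real n} \<in> sets (lebesgue_on {0..})" by (auto simp: sets_restrict_space)
  ultimately have "{x \<in> space (lebesgue_on {0..}). norm (s n x) <= 2 * norm (f x)} Int {0..<real n} \<in> sets (lebesgue_on {0..})"
   by (rule sets.Int)
  also have "{x \<in> space (lebesgue_on {0..}). norm (s n x) <= 2 * norm (f x)} Int {0..<real n} = G n" by (auto simp: G_def)
  finally show ?thesis .
 qed
 have gs: "simple_function (lebesgue_on {0..}) (g n)" for n
  unfolding g_def restr_def[abs_def] using Gm[of n]
  by (intro simple_function_If_set s) (auto simp: sets.Int_space_eq2)
 have g0: "\<Lambda> (g n) = 0" for n
  by (rule simple_zero[OF gs, of n]) (auto simp: g_def restr_def G_def split: if_splits)
 have gq: "sq_int (g n)" for n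
  by (rule simple_sq_int[OF gs, of n]) (auto simp: g_def restr_def G_def split: if_splits)
 have dq: "sq_int (%x. f x - g n x)" for n
  using sq_int_add[OF f sq_int_scale[OF gq[of n], of "-1"]] by simp
 have lim: "(%n. LINT x|lebesgue_on {0..}. (norm (f x - g n x))\<^sup>2) ----> (LINT x|lebesgue_on {0::real..}. (0::real))"
 proof (rule integral_dominated_convergence[where w = "%x. 9 * (norm (f x))\<^sup>2" and f = "%_. 0"
   and s = "%n x. (norm (f x - g n x))\<^sup>2"])
  show "(%x. (norm (f x - g n x))\<^sup>2) \<in> borel_measurable (lebesgue_on {0..})" for n
   using integrable_sq_int[OF dq[of n]] by (rule borel_measurable_integrable)
  show "integrable (lebesgue_on {0..}) (%x. 9 * (norm (f x))\<^sup>2)"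
   using integrable_sq_int[OF f] by simp
  show "AE x in lebesgue_on {0..}. norm ((norm (f x - g n x))\<^sup>2) <= 9 * (norm (f x))\<^sup>2" for n
  proof (rule AE_I2)
   fix x
   have "norm (g n x) <= 2 * norm (f x)" by (auto simp: g_def restr_def G_def)
   then have "norm (f x - g n x) <= 3 * norm (f x)" using norm_triangle_ineq4[of "f x" "g n x"] by simp
   from power_mono[OF this, of 2] show "norm ((norm (f x - g n x))\<^sup>2) <= 9 * (norm (f x))\<^sup>2"
    by (simp add: power_mult_distrib)
  qed
  show "AE x in lebesgue_on {0..}. (%n. (norm (f x - g n x))\<^sup>2) ----> 0"
   using s(2) AE_space
  proof eventually_elim
   case (elim x)
   have "(%n. g n x) ----> f x"
   proof (cases "f x = 0")
    case True
    then have "g n x = 0" for n by (auto simp: g_def restr_def G_def)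
    then show ?thesis using True by simp
   next
    case False
    have "(%n. norm (s n x)) ----> norm (f x)" by (intro tendsto_norm elim)
    then have "\<forall>\<^sub>F n in sequentially. norm (s n x) < 2 * norm (f x)"
     using False by (intro order_tendstoD(2)) auto
    moreover have "\<forall>\<^sub>F n in sequentially. x < real n"
     using eventually_gt_at_top[of "nat \<lceil>x\<rceil>"] by eventually_elim linarith
    ultimately have "\<forall>\<^sub>F n in sequentially. s n x = g n x"
     by eventually_elim (use elim(2) in \<open>auto simp: g_def restr_def G_def\<close>)
    with elim(1) show ?thesis by (rule Lim_transform_eventually)
   qed
   then have "(%n. (norm (f x - g n x))\<^sup>2) ----> (norm (f x - f x))\<^sup>2" by (intro tendsto_intros)
   then show ?case by simp
  qed
 qed simp
 have "cmod (\<Lambda> f) <= C * sqrt (LINT x|lebesgue_on {0..}. (norm (f x - g n x))\<^sup>2)" for n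
  using bound[OF dq[of n]] diff[OF f gq[of n]] g0[of n] by simp
 moreover have "(%n. C * sqrt (LINT x|lebesgue_on {0..}. (norm (f x - g n x))\<^sup>2)) ----> C * sqrt 0"
  using lim by (intro tendsto_intros) simp
 ultimately have "cmod (\<Lambda> f) <= 0"
  by (intro LIMSEQ_le_const[where X = "%n. C * sqrt (LINT x|lebesgue_on {0..}. (norm (f x - g n x))\<^sup>2)"]) auto
 then show ?thesis by simp
qed

end

subsection \<open>Totality of exponential vectors\<close>

definition nrm2 :: "'k::chilbert sqint => real"
 where "nrm2 f = norm (vec_of (Sym [f]))"

lemma cinner_single: "ip (vec_of (Sym [f])) (vec_of (Sym [g])) = l2_inner f g"
 using cinner_power[of 1 f 1 g] by simp

lemma l2_inner_CS: "cmod (l2_inner f g) <= nrm2 f * nrm2 g"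
 using cinner_CS[of "vec_of (Sym [f])" "vec_of (Sym [g])"] by (simp add: nrm2_def cinner_single)

lemma nrm2_Abs:
 assumes "sq_int f"
 shows "nrm2 (Abs_sqint f) = sqrt (LINT s|lebesgue_on {0..}. (norm (f s))\<^sup>2)"
proof -
 have "complex_of_real ((nrm2 (Abs_sqint f))\<^sup>2) = (LINT s|lebesgue_on {0..}. ip (f s) (f s))"
  unfolding nrm2_def norm_cinner cinner_single l2_inner_def Rep_Abs_sq_int[OF assms] ..
 also have "... = complex_of_real (LINT s|lebesgue_on {0..}. (norm (f s))\<^sup>2)"
  unfolding cinner_self by (rule integral_complex_of_real)
 finally have "(nrm2 (Abs_sqint f))\<^sup>2 = (LINT s|lebesgue_on {0..}. (norm (f s))\<^sup>2)" by (simp only: of_real_eq_iff)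
 then show ?thesis using real_sqrt_unique[of "nrm2 (Abs_sqint f)"] by (simp add: nrm2_def)
qed

lemma kern_Sym: "length xs = n ==> length hs = n ==> kern (Sym hs) (Sym xs) =
  (\<Sum>\<pi> | \<pi> permutes {..<n}. \<Prod>i<n. l2_inner (hs ! i) (xs ! \<pi> i)) / fact n"
 by (simp add: kern_sym_word_def Let_def Sym_inverse)

lemma kern_Sym_neq: "length xs ~= length hs ==> kern (Sym hs) (Sym xs) = 0"
 by (simp add: kern_sym_word_def Let_def Sym_inverse)

lemma fock_vec_eqI:
 fixes z :: "'k::chilbert fock"
 assumes "!!hs. ip (vec_of (Sym hs)) z = ip (vec_of (Sym hs)) z'"
 shows "z = z'"
proof (rule total_ext[OF total_vec_of])
 fix x assume "x \<in> range (vec_of :: 'k sym_word => _)"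
 then obtain w where "x = vec_of w" by blast
 moreover have "w = Sym (letters w)" by (simp add: letters_inverse)
 ultimately show "ip x z = ip x z'" using assms by metis
qed

lemma Sym_mset:
 assumes "mset xs = mset ys"
 shows "vec_of (Sym xs) = vec_of (Sym ys)"
proof (rule fock_vec_eqI, unfold cinner_vec_of)
 fix hs
 obtain p where p: "p permutes {..<length ys}" "permute_list p ys = xs" using mset_eq_permutation[OF assms] .
 have len: "length xs = length ys" using p(2) by auto
 show "kern (Sym hs) (Sym xs) = kern (Sym hs) (Sym ys)"
 proof (cases "length hs = length ys")
  case True
  let ?n = "length ys"
  have "(\<Sum>\<pi> | \<pi> permutes {..<?n}. \<Prod>i<?n. l2_inner (hs ! i) (ys ! \<pi> i)) =
   (\<Sum>\<pi> | \<pi> permutes {..<?n}. \<Prod>i<?n. l2_inner (hs ! i) (ys ! (p \<circ> \<pi>) i))"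
   by (rule setum_permutations_compose_left[OF p(1)])
  also have "... = (\<Sum>\<pi> | \<pi> permutes {..<?n}. \<Prod>i<?n. l2_inner (hs ! i) (xs ! \<pi> i))"
  proof (intro sum.cong prod.cong refl)
   fix \<pi> i assume "\<pi> \<in> {\<pi>. \<pi> permutes {..<?n}}" "i \<in> {..<?n}"
   then have "\<pi> i < ?n" using permutes_in_image[of \<pi> "{..<?n}" i] by simp
   then have "xs ! \<pi> i = ys ! p (\<pi> i)" using permute_list_nth[OF p(1)] p(2) by simp
   then show "l2_inner (hs ! i) (ys ! (p \<circ> \<pi>) i) = l2_inner (hs ! i) (xs ! \<pi> i)" by simp
  qed
  finally show ?thesis using True len by (simp add: kern_Sym)
 qed (use len in \<open>simp add: kern_Sym_neq\<close>)
qed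

text \<open>Summing over inverse permutations moves the permutation from the letters to the
  \<open>hs\<close>, which isolates the first letter and makes linearity in it visible.\<close>

lemma kern_Sym_Cons:
 assumes "length hs = Suc (length xs)"
 shows "kern (Sym hs) (Sym (f # xs)) = (\<Sum>\<pi> | \<pi> permutes {..<Suc (length xs)}.
  l2_inner (hs ! \<pi> 0) f * (\<Prod>k<length xs. l2_inner (hs ! \<pi> (Suc k)) (xs ! k))) / fact (Suc (length xs))"
proof -
 let ?n = "Suc (length xs)"
 have "(\<Sum>\<pi> | \<pi> permutes {..<?n}. \<Prod>i<?n. l2_inner (hs ! i) ((f # xs) ! \<pi> i))
  = (\<Sum>\<pi> | \<pi> permutes {..<?n}. \<Prod>i<?n. l2_inner (hs ! i) ((f # xs) ! inv \<pi> i))"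
  by (rule sum_permutations_inverse)
 also have "... = (\<Sum>\<pi> | \<pi> permutes {..<?n}. \<Prod>k<?n. l2_inner (hs ! \<pi> k) ((f # xs) ! k))"
 proof (intro sum.cong refl)
  fix \<pi> assume "\<pi> \<in> {\<pi>. \<pi> permutes {..<?n}}"
  then have \<pi>: "\<pi> permutes {..<?n}" by simp
  show "(\<Prod>i<?n. l2_inner (hs ! i) ((f # xs) ! inv \<pi> i)) = (\<Prod>k<?n. l2_inner (hs ! \<pi> k) ((f # xs) ! k))"
   by (subst prod.permute[OF \<pi>]) (simp add: o_def permutes_inverses[OF \<pi>])
 qed
 finally show ?thesis using assms by (simp add: kern_Sym[where n = ?n] prod.lessThan_Suc_shift del: fact_Suc prod.lessThan_Suc)
qed

text \<open>The linear relation is assumed at the level of inner products, since functions in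
  \<open>sqint\<close> are not identified almost everywhere.\<close>

lemma Sym_Cons_linear:
 assumes "!!h. l2_inner h f = l2_inner h f1 + z * l2_inner h f2"
 shows "vec_of (Sym (f # xs)) = vec_of (Sym (f1 # xs)) + z *\<^sub>C vec_of (Sym (f2 # xs))"
proof (rule fock_vec_eqI)
 fix hs
 show "ip (vec_of (Sym hs)) (vec_of (Sym (f # xs))) =
  ip (vec_of (Sym hs)) (vec_of (Sym (f1 # xs)) + z *\<^sub>C vec_of (Sym (f2 # xs)))"
 proof (cases "length hs = Suc (length xs)")
  case True
  show ?thesis
   by (simp add: cinner_simps cinner_vec_of kern_Sym_Cons[OF True] assms sum_divide_distrib sum_distrib_left
    del: fact_Suc flip: sum.distrib) (intro sum.cong refl, simp add: field_simps del: fact_Suc)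
 next
  case False
  then show ?thesis by (simp add: cinner_simps cinner_vec_of kern_Sym_neq)
 qed
qed

text \<open>Each permutation contributes at most the square of the product of the norms, and the
  number of permutations cancels the factorial in the kernel. With one letter written apart, this
  bounds a functional of that letter.\<close>

lemma norm_Sym_Cons_le: "norm (vec_of (Sym (f # xs))) <= (\<Prod>k<length xs. nrm2 (xs ! k)) * nrm2 f"
proof -
 let ?ys = "f # xs" and ?n = "Suc (length xs)"
 define P where "P = (\<Prod>i<?n. nrm2 (?ys ! i))"
 have nn: "0 <= nrm2 g" for g :: "'a sqint" by (simp add: nrm2_def)
 have P0: "0 <= P" unfolding P_def by (intro prod_nonneg ballI nn)
 have "(norm (vec_of (Sym ?ys)))\<^sup>2 = cmod (kern (Sym ?ys) (Sym ?ys))"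
  by (simp add: cinner_self norm_power flip: cinner_vec_of)
 also have "kern (Sym ?ys) (Sym ?ys) = (\<Sum>\<pi> | \<pi> permutes {..<?n}. \<Prod>i<?n. l2_inner (?ys ! i) (?ys ! \<pi> i)) / fact ?n"
  by (rule kern_Sym) auto
 also have "cmod ... = cmod (\<Sum>\<pi> | \<pi> permutes {..<?n}. \<Prod>i<?n. l2_inner (?ys ! i) (?ys ! \<pi> i)) / fact ?n"
  by (simp add: norm_divide del: fact_Suc)
 also have "... <= (\<Sum>\<pi> | \<pi> permutes {..<?n}. P * P) / fact ?n"
 proof (intro divide_right_mono order_trans[OF norm_sum] sum_mono)
  fix \<pi> assume "\<pi> \<in> {\<pi>. \<pi> permutes {..<?n}}"
  then have \<pi>: "\<pi> permutes {..<?n}" by simp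
  have "cmod (\<Prod>i<?n. l2_inner (?ys ! i) (?ys ! \<pi> i)) <= (\<Prod>i<?n. nrm2 (?ys ! i) * nrm2 (?ys ! \<pi> i))"
   unfolding prod_norm[symmetric] by (intro prod_mono conjI l2_inner_CS norm_ge_zero)
  also have "... = P * (\<Prod>i<?n. nrm2 (?ys ! \<pi> i))" by (simp add: prod.distrib P_def)
  also have "(\<Prod>i<?n. nrm2 (?ys ! \<pi> i)) = P"
   unfolding P_def using prod.permute[OF \<pi>, of "%i. nrm2 (?ys ! i)"] by (simp add: o_def)
  finally show "cmod (\<Prod>i<?n. l2_inner (?ys ! i) (?ys ! \<pi> i)) <= P * P" .
 qed simp
 also have "... = P\<^sup>2"
  using card_permutations[OF card_lessThan[of ?n] finite_lessThan] by (simp add: power2_eq_square del: fact_Suc)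
 finally have "norm (vec_of (Sym ?ys)) <= P" by (rule power2_le_imp_le[OF _ P0])
 also have "P = (\<Prod>k<length xs. nrm2 (xs ! k)) * nrm2 f"
  unfolding P_def by (simp add: prod.lessThan_Suc_shift mult.commute del: prod.lessThan_Suc)
 finally show ?thesis .
qed

text \<open>
 Polarisation: the term of first order in \<open>t\<close> of the expansion of the form at \<open>f + t g\<close> in its first \<open>j\<close>
 places is \<open>j\<close> times the form with one \<open>f\<close> replaced by \<open>g\<close>.
\<close>

lemma symmetric_form_zero:
 fixes m :: "'v list => complex" and comb :: "real => 'v => 'v => 'v"
 assumes V0: "V ~= {}"
  and sym: "!!xs ys. mset xs = mset ys ==> m xs = m ys"
  and lin: "!!t f g xs. f \<in> V ==> g \<in> V ==> m (comb t f g # xs) = m (f # xs) + of_real t * m (g # xs)"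
  and V: "!!t f g. f \<in> V ==> g \<in> V ==> comb t f g \<in> V"
  and diag: "!!f. f \<in> V ==> m (replicate n f) = 0"
  and xs: "set xs <= V" "length xs = n"
 shows "m xs = 0"
proof -
 \<comment> \<open>The remainder \<open>q\<close> is bounded uniformly for t in [0, 1], which is all
   that a comparison of first-order terms needs.\<close>
 have expand: "EX q K. ALL t. 0 <= t --> t <= 1 --> cmod (q t) <= K &
   m (replicate j (comb t f g) @ zs) = m (replicate j f @ zs) +
    of_real t * (of_nat j * m (g # replicate (j - 1) f @ zs)) + (of_real t)\<^sup>2 * q t"
  if fg: "f \<in> V" "g \<in> V" for f g j zs
 proof (induction j arbitrary: zs)
  case 0
  show ?case by (intro exI[of _ "%_. 0"] exI[of _ 0]) simp
 next
  case (Suc j)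
  obtain q1 K1 where 1: "!!t. 0 <= t ==> t <= 1 ==> cmod (q1 t) <= K1"
   "!!t. 0 <= t ==> t <= 1 ==> m (replicate j (comb t f g) @ (f # zs)) = m (replicate j f @ (f # zs)) +
    of_real t * (of_nat j * m (g # replicate (j - 1) f @ (f # zs))) + (of_real t)\<^sup>2 * q1 t"
   using Suc[of "f # zs"] by blast
  obtain q2 K2 where 2: "!!t. 0 <= t ==> t <= 1 ==> cmod (q2 t) <= K2"
   "!!t. 0 <= t ==> t <= 1 ==> m (replicate j (comb t f g) @ (g # zs)) = m (replicate j f @ (g # zs)) +
    of_real t * (of_nat j * m (g # replicate (j - 1) f @ (g # zs))) + (of_real t)\<^sup>2 * q2 t"
   using Suc[of "g # zs"] by blast
  define b where "b = of_nat j * m (g # replicate (j - 1) f @ (g # zs))"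
  define q where "q t = q1 t + b + of_real t * q2 t" for t :: real
  have "m (replicate (Suc j) (comb t f g) @ zs) = m (replicate (Suc j) f @ zs) +
    of_real t * (of_nat (Suc j) * m (g # replicate j f @ zs)) + (of_real t)\<^sup>2 * q t"
   and "cmod (q t) <= K1 + cmod b + K2" if t: "0 <= t" "t <= 1" for t
  proof -
   let ?c = "comb t f g"
   have "m (replicate (Suc j) ?c @ zs) = m (f # replicate j ?c @ zs) + of_real t * m (g # replicate j ?c @ zs)"
    using lin[OF fg] by simp
   also have "m (f # replicate j ?c @ zs) = m (replicate j ?c @ (f # zs))" by (rule sym) simp
   also have "m (g # replicate j ?c @ zs) = m (replicate j ?c @ (g # zs))" by (rule sym) simp
   also have "m (replicate j ?c @ (f # zs)) + of_real t * m (replicate j ?c @ (g # zs)) =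
    m (replicate j f @ (f # zs)) + of_real t * (of_nat j * m (g # replicate (j - 1) f @ (f # zs)) + m (replicate j f @ (g # zs)))
     + (of_real t)\<^sup>2 * q t"
    unfolding 1(2)[OF t] 2(2)[OF t] q_def b_def by (simp add: algebra_simps power2_eq_square)
   also have "m (replicate j f @ (f # zs)) = m (replicate (Suc j) f @ zs)" by (rule sym) simp
   also have "m (replicate j f @ (g # zs)) = m (g # replicate j f @ zs)" by (rule sym) simp
   also have "of_nat j * m (g # replicate (j - 1) f @ (f # zs)) = of_nat j * m (g # replicate j f @ zs)"
   proof (cases j)
    case (Suc i)
    have "m (g # replicate i f @ (f # zs)) = m (g # replicate j f @ zs)" by (rule sym) (simp add: Suc)
    then show ?thesis by (simp add: Suc)
   qed simp
   finally show "m (replicate (Suc j) ?c @ zs) = m (replicate (Suc j) f @ zs) +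
    of_real t * (of_nat (Suc j) * m (g # replicate j f @ zs)) + (of_real t)\<^sup>2 * q t"
    by (simp add: algebra_simps)
   have "cmod (of_real t * q2 t) <= 1 * K2"
    unfolding norm_mult using t 2(1)[OF t] by (intro mult_mono) auto
   then show "cmod (q t) <= K1 + cmod b + K2"
    unfolding q_def using 1(1)[OF t] by (intro norm_triangle_le add_mono) auto
  qed
  then show ?case by (intro exI[of _ q] exI[of _ "K1 + cmod b + K2"]) simp
 qed
 \<comment> \<open>Downward induction on the number \<open>k\<close> of equal entries:
   \<open>k = n\<close> is the diagonal, \<open>k = 0\<close> an arbitrary word.\<close>
 have "ALL f zs. f \<in> V --> set zs <= V --> length zs = n - k --> m (replicate k f @ zs) = 0" if "k <= n" for k
  using that
 proof (induction k rule: inc_induct)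
  case base
  then show ?case using diag by simp
 next
  case (step k)
  show ?case
  proof (intro allI impI)
   fix f zs assume f: "f \<in> V" and zs: "set zs <= V" "length zs = n - k"
   then obtain g zs' where g: "zs = g # zs'" "g \<in> V" "set zs' <= V" "length zs' = n - Suc k"
    using step(2) by (cases zs) auto
   obtain q K where q: "!!t. 0 <= t ==> t <= 1 ==> cmod (q t) <= K"
    "!!t. 0 <= t ==> t <= 1 ==> m (replicate (Suc k) (comb t f g) @ zs') = m (replicate (Suc k) f @ zs') +
     of_real t * (of_nat (Suc k) * m (g # replicate (Suc k - 1) f @ zs')) + (of_real t)\<^sup>2 * q t"
    using expand[OF f g(2), of "Suc k" zs'] by blast
   define b where "b = of_nat (Suc k) * m (g # replicate k f @ zs')"
   \<comment> \<open>The value at \<open>comb t f g\<close> and the term of order zero both vanish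
     by the induction hypothesis, so the first-order coefficient is itself of order
     \<open>t\<close>.\<close>
   have "cmod b <= t * K" if t: "0 < t" "t <= 1" for t
   proof -
    have "0 = of_real t * (b + of_real t * q t)"
     using q(2)[of t] t step(3) f g V[OF f g(2)] by (simp add: b_def algebra_simps power2_eq_square)
    then have "b = - (of_real t * q t)" using t by (simp add: add_eq_0_iff)
    then have "cmod b = t * cmod (q t)" using t by (simp add: norm_mult)
    also have "... <= t * K" using t q(1)[of t] by (intro mult_left_mono) auto
    finally show ?thesis .
   qed
   then have ev: "\<forall>\<^sub>F t in at_right 0. cmod b <= t * K"
    unfolding eventually_at_right_field by (intro exI[of _ 1]) auto
   have "((%t. t * K) ---> 0 * K) (at_right 0)" by (intro tendsto_intros)
   from tendsto_lowerbound[OF this ev] have "b = 0" by simp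
   then have "m (g # replicate k f @ zs') = 0" by (simp add: b_def del: of_nat_Suc)
   moreover have "m (replicate k f @ zs) = m (g # replicate k f @ zs')" unfolding g(1) by (rule sym) simp
   ultimately show "m (replicate k f @ zs) = 0" by simp
  qed
 qed
 from this[of 0] V0 xs show ?thesis by auto
qed

lemma l2_inner_Abs_add:
 assumes "sq_int f" "sq_int g"
 shows "l2_inner h (Abs_sqint (%s. f s + z *\<^sub>C g s)) = l2_inner h (Abs_sqint f) + z * l2_inner h (Abs_sqint g)"
proof -
 have "sq_int (%s. f s + z *\<^sub>C g s)" by (intro sq_int_add sq_int_scale assms)
 then show ?thesis
  using integrable_cinner_sqint[of h "Abs_sqint f"] integrable_cinner_sqint[of h "Abs_sqint g"]
  unfolding l2_inner_def by (simp add: Rep_Abs_sq_int assms cinner_simps)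
qed

lemma Sym_replicate_scale:
 assumes "!!h. l2_inner h f = t * l2_inner h g"
 shows "vec_of (Sym (replicate n f)) = t ^ n *\<^sub>C vec_of (Sym (replicate n g))"
proof (rule fock_vec_eqI)
 fix hs :: "'a sqint list"
 show "ip (vec_of (Sym hs)) (vec_of (Sym (replicate n f))) =
  ip (vec_of (Sym hs)) (t ^ n *\<^sub>C vec_of (Sym (replicate n g)))"
 proof (cases "length hs = n")
  case True
  have "(\<Prod>i<n. l2_inner (hs ! i) (replicate n f ! \<pi> i)) = t ^ n * (\<Prod>i<n. l2_inner (hs ! i) (replicate n g ! \<pi> i))"
   if "\<pi> permutes {..<n}" for \<pi>
  proof -
   have "\<pi> i < n" if "i < n" for i using permutes_in_image[OF \<open>\<pi> permutes _\<close>, of i] that by simp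
   then have "(\<Prod>i<n. l2_inner (hs ! i) (replicate n f ! \<pi> i)) = (\<Prod>i<n. t * l2_inner (hs ! i) (replicate n g ! \<pi> i))"
    by (intro prod.cong) (auto simp: assms)
   then show ?thesis by (simp add: prod.distrib)
  qed
  then show ?thesis using True
   by (simp add: cinner_simps cinner_vec_of kern_Sym[where n = n] sum_distrib_left[symmetric])
 next
  case False
  then show ?thesis by (simp add: cinner_simps cinner_vec_of kern_Sym_neq)
 qed
qed

text \<open>Up to the normalisation, the inner product with the exponential vector of t f is a power
  series in t whose coefficients are, up to nonzero factors, the inner products with the powers of
  f; a vanishing series has vanishing coefficients.\<close>

lemma exp_orthogonal_powers:
 fixes \<psi> :: "'k::chilbert fock"
 assumes f: "step f" and z: "!!t. ip \<psi> (\<varpi> (%s. t *\<^sub>C f s)) = 0"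
 shows "ip \<psi> (vec_of (Sym (replicate n (Abs_sqint f)))) = 0"
proof -
 let ?v = "%g n. (1 / sqrt (fact n)) *\<^sub>R (vec_of (Sym (replicate n (Abs_sqint g))) :: 'k fock)"
 define a where "a n = ip \<psi> (?v f n)" for n
 have s0: "sq_int (%_. 0 :: 'k)" using sq_int_step[OF step_funs_zero] .
 have sums: "(%n. a n * t ^ n) sums 0" for t
 proof -
  have "l2_inner h (Abs_sqint (%s. t *\<^sub>C f s)) = t * l2_inner h (Abs_sqint f)" for h
   using l2_inner_Abs_add[OF s0 sq_int_step[OF f], of h t] l2_inner_Abs_add[OF s0 s0, of h 1] by simp
  then have "ip \<psi> (?v (%s. t *\<^sub>C f s) n) = a n * t ^ n" for n
   using Sym_replicate_scale[of "Abs_sqint (%s. t *\<^sub>C f s)" t "Abs_sqint f" n]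
   by (simp add: a_def scaleR_scaleC cinner_simps)
  moreover have "(%n. ip \<psi> (?v (%s. t *\<^sub>C f s) n)) sums ip \<psi> (\<Sum>n. ?v (%s. t *\<^sub>C f s) n)"
   by (rule bounded_linear.sums[OF bounded_bilinear.bounded_linear_right[OF bounded_bilinear_cinner]
    summable_sums[OF sums_expv]])
  moreover have "ip \<psi> (\<Sum>n. ?v (%s. t *\<^sub>C f s) n) = 0"
   using z[of t] unfolding expv_def by (simp add: scaleR_scaleC cinner_simps)
  ultimately show ?thesis by simp
 qed
 have "1 <= conv_radius a"
  using conv_radius_geI[of a 1] sums_summable[OF sums[of 1]] by (simp add: one_ereal_def)
 then have "0 < conv_radius a" using less_le_trans[of 0 "1::ereal"] by simp
 then have "Abs_fps a = 0"
  using sums_unique[OF sums]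
  by (intro eval_fps_eqD) (auto simp: fps_conv_radius_def eval_fps_def)
 then have "a n = 0" by (metis fps_nth_Abs_fps fps_zero_nth)
 then show ?thesis by (simp add: a_def scaleR_scaleC cinner_simps)
qed

text \<open>Three passages: from exponentials to powers by power series, from powers to words of
  step functions by polarisation, from step functions to arbitrary letters by density, one letter at
  a time. The restriction to \<open>J\<close> makes the result apply to \<open>fock_on J\<close> as
  well as to the whole Fock space.\<close>

lemma exp_orthogonal:
 fixes \<psi> :: "'k::chilbert fock"
 assumes J: "J \<in> sets lebesgue" and st: "!!f :: real => 'k. step f ==> restr J f \<in> step_funs"
  and z: "!!f. step f ==> ip \<psi> (\<varpi> (restr J f)) = 0"
  and fs: "ALL f:set fs. ALL s. s \<notin> J --> Rep_sqint f s = 0"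
 shows "ip \<psi> (vec_of (Sym fs)) = 0"
proof -
 define m where "m xs = ip \<psi> (vec_of (Sym xs))" for xs :: "'k sqint list"
 define V :: "'k sqint set" where "V = (%f. Abs_sqint (restr J f)) ` step_funs"
 define comb where "comb t f g = Abs_sqint (%s. Rep_sqint f s + complex_of_real t *\<^sub>C Rep_sqint g s)" for t and f g :: "'k sqint"
 have sym: "m xs = m ys" if "mset xs = mset ys" for xs ys
  unfolding m_def Sym_mset[OF that] ..
 have base: "m ys = 0" if "set ys <= V" for ys
 proof (rule symmetric_form_zero[where V = V and comb = comb and n = "length ys"])
  show "V ~= {}" unfolding V_def using step_funs_zero by blast
  show "m xs = m ys" if "mset xs = mset ys" for xs ys by (rule sym[OF that])
  show "m (comb t f g # xs) = m (f # xs) + of_real t * m (g # xs)" for t f g xs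
   unfolding m_def comb_def
   by (subst Sym_Cons_linear[where ?f1.0 = f and ?f2.0 = g and z = "of_real t"])
    (simp_all add: l2_inner_Abs_add cinner_simps Rep_sqint_inverse)
  show "comb t f g \<in> V" if "f \<in> V" "g \<in> V" for t f g
  proof -
   obtain p q where pq: "f = Abs_sqint (restr J p)" "step p" "g = Abs_sqint (restr J q)" "step q"
    using \<open>f \<in> V\<close> \<open>g \<in> V\<close> unfolding V_def by blast
   have "(%s. restr J p s + complex_of_real t *\<^sub>C restr J q s) = restr J (%s. p s + complex_of_real t *\<^sub>C q s)"
    by (auto simp: restr_def)
   then have "comb t f g = Abs_sqint (restr J (%s. p s + complex_of_real t *\<^sub>C q s))"
    unfolding comb_def pq(1,3) by (simp add: Rep_Abs_step_fun st pq)
   then show ?thesis unfolding V_def using step_funs_add[OF pq(2) step_funs_scale[OF pq(4)]] by blast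
  qed
  show "m (replicate (length ys) f) = 0" if "f \<in> V" for f
  proof -
   obtain p where p: "f = Abs_sqint (restr J p)" "step p" using \<open>f \<in> V\<close> unfolding V_def by blast
   have "(%s. t *\<^sub>C restr J p s) = restr J (%s. t *\<^sub>C p s)" for t by (auto simp: restr_def)
   then show ?thesis unfolding m_def p(1)
    by (intro exp_orthogonal_powers st p) (simp add: z step_funs_scale p(2))
  qed
 qed (use that in auto)
 \<comment> \<open>\<open>xs\<close> holds arbitrary letters, \<open>ys\<close> letters already
   reduced to step functions; symmetry lets a letter move from one to the other.\<close>
 have "m (xs @ ys) = 0" if "ALL f:set xs. ALL s. s \<notin> J --> Rep_sqint f s = 0" "set ys <= V" for xs ys
  using that
 proof (induction xs arbitrary: ys)
  case Nil
  then show ?case using base by simp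
 next
  case (Cons x xs)
  let ?zs = "xs @ ys"
  interpret l2_functional "%h. m (Abs_sqint (restr J h) # ?zs)" "norm \<psi> * (\<Prod>k<length ?zs. nrm2 (?zs ! k))"
  proof
   fix f g :: "real => 'k"
   assume f: "sq_int f" and g: "sq_int g"
   have "restr J (%s. f s + g s) = (%s. restr J f s + 1 *\<^sub>C restr J g s)" by (auto simp: restr_def)
   then show "m (Abs_sqint (restr J (%s. f s + g s)) # ?zs) = m (Abs_sqint (restr J f) # ?zs) + m (Abs_sqint (restr J g) # ?zs)"
    unfolding m_def using l2_inner_Abs_add[OF sq_int_restr[OF f J] sq_int_restr[OF g J], of _ 1]
    by (subst Sym_Cons_linear[where ?f1.0 = "Abs_sqint (restr J f)" and ?f2.0 = "Abs_sqint (restr J g)" and z = 1])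
     (simp_all add: cinner_simps)
  next
   fix f :: "real => 'k"
   assume f: "sq_int f"
   have "nrm2 (Abs_sqint (restr J f)) <= sqrt (LINT s|lebesgue_on {0..}. (norm (f s))\<^sup>2)"
    unfolding nrm2_Abs[OF sq_int_restr[OF f J]] real_sqrt_le_iff
    by (rule integral_mono[OF integrable_sq_int[OF sq_int_restr[OF f J]] integrable_sq_int[OF f]])
     (auto simp: restr_def)
   moreover have "0 <= (\<Prod>k<length ?zs. nrm2 (?zs ! k))" by (intro prod_nonneg) (simp add: nrm2_def)
   ultimately have "norm \<psi> * ((\<Prod>k<length ?zs. nrm2 (?zs ! k)) * nrm2 (Abs_sqint (restr J f))) <=
     norm \<psi> * ((\<Prod>k<length ?zs. nrm2 (?zs ! k)) * sqrt (LINT s|lebesgue_on {0..}. (norm (f s))\<^sup>2))"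
    by (intro mult_left_mono) auto
   moreover have "cmod (m (Abs_sqint (restr J f) # ?zs)) <=
     norm \<psi> * ((\<Prod>k<length ?zs. nrm2 (?zs ! k)) * nrm2 (Abs_sqint (restr J f)))"
    unfolding m_def by (rule order_trans[OF cinner_CS mult_left_mono[OF norm_Sym_Cons_le norm_ge_zero]])
   ultimately show "cmod (m (Abs_sqint (restr J f) # ?zs)) <=
     norm \<psi> * (\<Prod>k<length ?zs. nrm2 (?zs ! k)) * sqrt (LINT s|lebesgue_on {0..}. (norm (f s))\<^sup>2)"
    by (simp only: mult.assoc)
  next
   fix f :: "real => 'k"
   assume f: "step f"
   have "m (Abs_sqint (restr J f) # ?zs) = m (xs @ (Abs_sqint (restr J f) # ys))" by (rule sym) simp
   also have "... = 0" using Cons.prems f by (intro Cons.IH) (auto simp: V_def)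
   finally show "m (Abs_sqint (restr J f) # ?zs) = 0" .
  qed
  have "restr J (Rep_sqint x) = Rep_sqint x" using Cons.prems by (auto simp: restr_def)
  with functional_zero[of "Rep_sqint x"] show ?case by (simp add: Rep_sqint_inverse)
 qed
 from this[of fs "[]"] fs show ?thesis by (simp add: m_def)
qed

lemma tens_scale_left: "(c *\<^sub>C x) \<otimes> y = c *\<^sub>C (x \<otimes> y)"
 and tens_scale_right: "x \<otimes> (c *\<^sub>C y) = c *\<^sub>C (x \<otimes> y)"
 using bops_scaleC[OF bops_tens_ket, of y c x] bops_scaleC[OF bops_left_ket, of x c y] by simp_all

lemma Int_future_past [simp]: "{r..} Int {0..<r} = ({} :: real set)" "{0..<r} Int {r..} = ({} :: real set)"
 by auto

lemma total_expv: "closure (cspan (\<varpi> ` step_funs)) = (UNIV :: 'k::chilbert fock set)"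
 unfolding closure_cspan_UNIV_iff
proof (intro allI impI)
 fix z :: "'k fock"
 assume z: "ALL x:\<varpi> ` step_funs. ip x z = 0"
 show "z = 0"
 proof (rule fock_vec_eqI)
  fix hs :: "'k sqint list"
  have "ip z (\<varpi> f) = 0" if "step f" for f
   using z that cinner_commute[of z "\<varpi> f"] by simp
  then have "ip z (vec_of (Sym hs)) = 0"
   by (intro exp_orthogonal[of UNIV]) (auto simp: restr_def[abs_def])
  then show "ip (vec_of (Sym hs)) z = ip (vec_of (Sym hs)) 0"
   using cinner_commute[of "vec_of (Sym hs)" z] by simp
 qed
qed

lemma total_expv_eqI:
 fixes S T :: "'k::chilbert fock =>L 'a::chilbert"
 assumes "bop S" "bop T" "!!f. step f ==> blinfun_apply S (\<varpi> f) = T (\<varpi> f)"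
 shows "S = T"
 by (rule bops_eq_on_total[OF assms(1,2) total_expv]) (use assms(3) in auto)

lemma expv_ext:
 fixes x y :: "'k::chilbert fock"
 assumes "!!f. step f ==> ip (\<varpi> f) x = ip (\<varpi> f) y"
 shows "x = y"
 by (rule total_ext[OF total_expv]) (use assms in auto)

lemma total_tens_expv:
 "closure (cspan {u ** f | (u :: 'h::chilbert) (f :: real => 'k::chilbert). step f}) = UNIV"
proof -
 have "{u ** f | (u :: 'h) (f :: real => 'k). step f} = {u \<otimes> x | u x. u \<in> UNIV & x \<in> \<varpi> ` step_funs}" by auto
 then show ?thesis by (simp only: total_tens_sets[OF total_UNIV total_expv])
qed

lemma tens_expv_eqI:
 fixes S T :: "('h::chilbert, 'k::chilbert) hf =>L 'a::chilbert"
 assumes "bop S" "bop T" "!!u f. step f ==> blinfun_apply S (u ** f) = T (u ** f)"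
 shows "S = T"
 by (rule bops_eq_on_total[OF assms(1,2) total_tens_expv]) (use assms(3) in auto)

lemma tens_expv_ext:
 fixes x y :: "('h::chilbert, 'k::chilbert) hf"
 assumes "!!u f. step f ==> ip (u ** f) x = ip (u ** f) y"
 shows "x = y"
 by (rule total_ext[OF total_tens_expv]) (use assms in auto)

lemma fock_on_mem:
 fixes f :: "real => 'k::chilbert"
 assumes f: "step f" "!!s. s \<notin> J ==> f s = 0"
 shows "\<varpi> f \<in> fock_on J"
proof -
 let ?G = "{vec_of (Sym fs) | fs :: 'k sqint list. ALL f:set fs. ALL s. s \<notin> J --> Rep_sqint f s = 0}"
 let ?v = "%n. (1 / sqrt (fact n)) *\<^sub>R (vec_of (Sym (replicate n (Abs_sqint f))) :: 'k fock)"
 have "?v n \<in> cspan ?G" for n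
  unfolding scaleR_scaleC by (intro cspan_scale cspan_base) (auto simp: Rep_Abs_step_fun f)
 then have "(\<Sum>i<n. ?v i) \<in> cspan ?G" for n by (intro cspan_sum) auto
 then have "(\<Sum>n. ?v n) \<in> closure (cspan ?G)"
  unfolding closure_sequential
  by (intro exI[of _ "%n. \<Sum>i<n. ?v i"] conjI allI summable_LIMSEQ[OF sums_expv[of "Abs_sqint f"]])
 then show ?thesis
  unfolding expv_def fock_on_def scaleR_scaleC
  using CV.subspace_scale[OF subspace_closure[OF subspace_cspan(1)]] by blast
qed

section \<open>Projections, shifts and time splitting on Fock space\<close>

lemma orthogonal_projection:
 fixes M :: "'a::chilbert set"
 assumes M: "CV.subspace M" "closed M"
 shows "EX! P :: 'a =>L 'a. bop P & P oo P = P & adj P = P & range P = M"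
proof (rule ex_ex1I)
 let ?S = "{(m, m) | m. m \<in> M}"
 have "snd p = fst p" if "p \<in> cspan ?S" for p
  using that by (induction rule: cspan_induct) (auto simp: scaleC_prod_def)
 then obtain P :: "'a =>L 'a" where P: "bop P" "!!m. m \<in> M ==> P m = m" "!!z. (!!m. m \<in> M ==> ip m z = 0) ==> P z = 0"
  using graph_extension[of ?S 1] by fastforce
 have ran: "P x \<in> M" "!!m. m \<in> M ==> ip m (x - P x) = 0" for x
 proof -
  obtain m where m: "m \<in> M" "!!y. y \<in> M ==> ip y (x - m) = 0" using projection_exists[OF M] by metis
  then have "P x = m" using P(2)[of m] P(3)[of "x - m"] by (simp add: blinfun.diff_right)
  then show "P x \<in> M" "!!m. m \<in> M ==> ip m (x - P x) = 0" using m by auto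
 qed
 have "ip (P x) (P y) = ip (P x) y" "ip (P x) (P y) = ip x (P y)" for x y
  using ran(2)[OF ran(1), of x y] ran(2)[OF ran(1), of y x] cinner_commute[of "P y" "P x"] cinner_commute[of "P y" x]
  by (simp_all add: cinner_diff_right)
 then have "adj P = P" by (intro adj_eqI P) simp
 moreover have "P oo P = P" by (rule blinfun_eqI) (simp add: P(2) ran(1))
 moreover have "range P = M" using ran(1) P(2) by (metis (no_types) image_subset_iff rangeI subsetI subset_antisym)
 ultimately show "EX P :: 'a =>L 'a. bop P & P oo P = P & adj P = P & range P = M" using P(1) by blast
next
 fix P Q :: "'a =>L 'a"
 assume P: "bop P & P oo P = P & adj P = P & range P = M" and Q: "bop Q & Q oo Q = Q & adj Q = Q & range Q = M"
 have fix1: "S m = m" if "bop S & S oo S = S & adj S = S & range S = M" "m \<in> M" for m and S :: "'a =>L 'a"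
 proof -
  have "m \<in> range S" using that by simp
  then obtain x where "m = S x" by blast
  then show ?thesis using that(1) by (metis blinfun_apply_blinfun_compose)
 qed
 show "P = Q"
 proof (rule blinfun_eqI, rule cinner_ext)
  fix z x
  have "ip z (P x) = ip (P z) x" using P cinner_adj_left[of P z x] by simp
  also have "P z = Q (P z)" using fix1[OF Q, of "P z"] P by auto
  also have "ip (Q (P z)) x = ip z (P (Q x))" using P Q cinner_adj_left[of Q "P z" x] cinner_adj_left[of P z "Q x"] by simp
  also have "P (Q x) = Q x" using fix1[OF P, of "Q x"] Q by auto
  finally show "ip z (P x) = ip z (Q x)" .
 qed
qed

lemma fock_on_subspace: "CV.subspace (fock_on J)" "closed (fock_on J)"
 unfolding fock_on_def by (simp_all add: subspace_closure subspace_cspan)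

lemma
 shows bops_fock_proj [simp, intro]: "fock_proj J \<in> bops"
  and fock_proj_idem [simp]: "fock_proj J oo fock_proj J = fock_proj J"
  and adj_fock_proj [simp]: "adj (fock_proj J) = fock_proj J"
  and range_fock_proj: "range (fock_proj J) = fock_on J"
 using theI'[OF orthogonal_projection[OF fock_on_subspace, of J]] unfolding fock_proj_def by blast+

lemma fock_proj_eqI:
 assumes y: "y \<in> fock_on J" and z: "!!m. m \<in> fock_on J ==> ip m (x - y) = 0"
 shows "fock_proj J x = y"
proof -
 have "fock_proj J (x - y) = 0"
 proof (rule cinner_ext)
  fix w
  have "ip w (fock_proj J (x - y)) = ip (fock_proj J w) (x - y)"
   using cinner_adj_left[OF bops_fock_proj, of J w "x - y"] by simp
  then show "ip w (fock_proj J (x - y)) = ip w 0" using z range_fock_proj[of J] by auto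
 qed
 moreover from y obtain w where "y = fock_proj J w" using range_fock_proj[of J] by blast
 then have "fock_proj J y = y" by (metis blinfun_apply_blinfun_compose fock_proj_idem)
 ultimately show ?thesis by (simp add: blinfun.diff_right)
qed

text \<open>The part of \<open>f\<close> outside \<open>J\<close> is projected on the vacuum, which
  leaves its inner product with the vacuum as a coefficient. Orthogonality of the rest to
  \<open>fock_on J\<close> is tested on exponential vectors by
  \<open>exp_orthogonal\<close>.\<close>

lemma fock_proj_expv:
 fixes f :: "real => 'k::chilbert"
 assumes JK: "(J = {0..<r} & K = {r..}) \<or> (J = {r..} & K = {0..<r})" and f: "step f" and r: "0 <= r"
 shows "fock_proj J (\<varpi> f) = ip (\<varpi> (%_. 0)) (\<varpi> (restr K f)) *\<^sub>C \<varpi> (restr J f)"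
proof (rule fock_proj_eqI)
 have st: "restr J g \<in> step_funs" "restr K g \<in> step_funs" if "step g" for g :: "real => 'k" using JK that r by auto
 have "\<varpi> (restr J f) \<in> fock_on J" using f st by (intro fock_on_mem) (auto simp: restr_def)
 then show "ip (\<varpi> (%_. 0)) (\<varpi> (restr K f)) *\<^sub>C \<varpi> (restr J f) \<in> fock_on J"
  by (rule CV.subspace_scale[OF fock_on_subspace(1)])
 fix m :: "'k fock"
 assume m: "m \<in> fock_on J"
 let ?\<psi> = "\<varpi> f - ip (\<varpi> (%_. 0)) (\<varpi> (restr K f)) *\<^sub>C \<varpi> (restr J f)"
 have JKe: "J Int K = {}" "K Int J = {}" using JK by auto
 have *: "ip (\<varpi> (restr J g)) ?\<psi> = 0" if g: "step g" for g
  using JK JKe cinner_expv_split[OF st(1)[OF g] f r] by (auto simp: cinner_simps mult.commute)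
 show "ip m ?\<psi> = 0"
 proof (rule cinner_cspan_zero[OF m[unfolded fock_on_def]])
  fix y :: "'k fock"
  assume "y \<in> {vec_of (Sym fs) | fs. ALL f:set fs. ALL s. s \<notin> J --> Rep_sqint f s = 0}"
  then obtain fs where fs: "y = vec_of (Sym fs)" "ALL f:set fs. ALL s. s \<notin> J --> Rep_sqint f s = 0" by blast
  have "ip ?\<psi> (vec_of (Sym fs)) = 0"
  proof (rule exp_orthogonal[OF _ st(1) _ fs(2)])
   show "J \<in> sets lebesgue" using JK by auto
   show "ip ?\<psi> (\<varpi> (restr J g)) = 0" if "step g" for g
    using *[OF that] cinner_commute[of ?\<psi> "\<varpi> (restr J g)"] by simp
  qed
  then show "ip y ?\<psi> = 0" using cinner_commute[of y ?\<psi>] fs(1) by simp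
 qed
qed

abbreviation vacuum :: "'k::chilbert fock"  (\<open>\<Omega>\<close>)
 where "\<Omega> \<equiv> \<varpi> (%_. 0)"

lemma fock_proj_past:
 "step f ==> 0 <= r ==> fock_proj {0..<r} (\<varpi> f) = ip \<Omega> (\<varpi> (restr {r..} f)) *\<^sub>C \<varpi> (restr {0..<r} f)"
 and fock_proj_future:
 "step f ==> 0 <= r ==> fock_proj {r..} (\<varpi> f) = ip \<Omega> (\<varpi> (restr {0..<r} f)) *\<^sub>C \<varpi> (restr {r..} f)"
 by (rule fock_proj_expv; simp)+

lemma
 assumes r: "0 <= r"
 shows bops_fock_shift [simp]: "bop (fock_shift r :: 'k::chilbert fock =>L 'k fock)"
  and fock_shift_expv [simp]: "step f ==> fock_shift r (\<varpi> (f :: real => 'k)) = \<varpi> (%s. f (s - r))"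
  and adj_fock_shift_fock_shift: "adj (fock_shift r) oo fock_shift r = (idL :: 'k fock =>L _)"
proof -
 obtain T :: "'k fock =>L 'k fock" where T: "bop T" "!!f. step f ==> T (\<varpi> f) = \<varpi> (%s. f (s - r))"
  "!!u v. ip (T u) (T v) = ip u v"
  using isometry_extension[of step_funs "%f. \<varpi> (%s. f (s - r))" \<varpi>] total_expv cinner_expv_shift r by metis
 have "fock_shift r = T"
  unfolding fock_shift_def using T by (intro the_equality) (auto intro!: total_expv_eqI)
 with T show "bop (fock_shift r :: 'k fock =>L 'k fock)"
  "step f ==> fock_shift r (\<varpi> (f :: real => 'k)) = \<varpi> (%s. f (s - r))"
  "adj (fock_shift r) oo fock_shift r = (idL :: 'k fock =>L _)"
  by (auto simp: adj_compose_self)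
qed

lemma restr_shift:
 "step f ==> restr {0..<r} (%s. f (s - r)) = (%_. 0)"
 "step f ==> restr {r..} (%s. f (s - r)) = (%s. f (s - r))"
 using step_fun_neg[of f] by (fastforce simp: restr_def fun_eq_iff not_le)+

lemma adj_fock_shift_expv:
 fixes f :: "real => 'k::chilbert"
 assumes f: "step f" and r: "0 <= r"
 shows "adj (fock_shift r) (\<varpi> f) = ip \<Omega> (\<varpi> (restr {0..<r} f)) *\<^sub>C \<varpi> (lshift r f)"
proof (rule expv_ext)
 fix g :: "real => 'k"
 assume g: "step g"
 have "ip (\<varpi> g) (adj (fock_shift r) (\<varpi> f)) = ip (\<varpi> (%s. g (s - r))) (\<varpi> f)"
  using r g by (simp add: cinner_adj_right)
 also have "... = ip \<Omega> (\<varpi> (restr {0..<r} f)) * ip (\<varpi> g) (\<varpi> (lshift r f))"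
  using cinner_expv_shift[OF g step_funs_lshift[OF f, of r] r]
  by (subst cinner_expv_split[OF step_funs_shift[OF g r] f r]) (simp add: restr_shift[OF g] restr_future_shift[OF f])
 finally show "ip (\<varpi> g) (adj (fock_shift r) (\<varpi> f)) =
  ip (\<varpi> g) (ip \<Omega> (\<varpi> (restr {0..<r} f)) *\<^sub>C \<varpi> (lshift r f))" by (simp add: cinner_simps)
qed

lemma fock_shift_range: "0 <= r ==> fock_shift r oo adj (fock_shift r) = (fock_proj {r..} :: 'k::chilbert fock =>L _)"
 by (rule total_expv_eqI)
  (simp_all add: adj_fock_shift_expv fock_proj_future bops_scaleC restr_future_shift)

lemma
 assumes r: "0 <= r"
 shows bops_split_at [simp]: "bop (split_at r :: ('h::chilbert, 'k::chilbert) hf =>L _)"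
  and split_at_expv [simp]: "step f ==>
   split_at r ((u :: 'h) ** (f :: real => 'k)) = (u ** (restr {0..<r} f)) ** (restr {r..} f)"
  and cinner_split_at: "ip (split_at r x) (split_at r y) = ip x (y :: ('h, 'k) hf)"
proof -
 let ?I = "UNIV \<times> step_funs :: ('h \<times> (real => 'k)) set"
 have "EX U:bops. (ALL i:?I. blinfun_apply U (fst i ** (snd i)) =
   (fst i ** (restr {0..<r} (snd i))) ** (restr {r..} (snd i))) & (ALL u v. ip (U u) (U v) = ip u v)"
 proof (rule isometry_extension)
  show "ip ((fst i ** (restr {0..<r} (snd i))) ** (restr {r..} (snd i)))
    ((fst j ** (restr {0..<r} (snd j))) ** (restr {r..} (snd j))) =
    ip (fst i ** (snd i)) (fst j ** (snd j))" if "i \<in> ?I" "j \<in> ?I" for i j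
   using that cinner_expv_split[OF _ _ r, of "snd i" "snd j"] by (auto simp: cinner_tens)
  have "(%i. fst i ** (snd i)) ` ?I = {u ** f | (u :: 'h) (f :: real => 'k). step f}" by force
  then show "closure (cspan ((%i. fst i ** (snd i)) ` ?I)) = UNIV" by (simp only: total_tens_expv)
 qed
 then obtain U :: "('h, 'k) hf =>L (('h, 'k) hf, 'k fock) tensor" where U: "bop U"
  "!!u f. step f ==> U (u ** f) = (u ** (restr {0..<r} f)) ** (restr {r..} f)"
  "!!u v. ip (U u) (U v) = ip u v" by fastforce
 have "split_at r = U"
  unfolding split_at_def using U by (intro the_equality) (auto intro!: tens_expv_eqI)
 with U show "bop (split_at r :: ('h::chilbert, 'k::chilbert) hf =>L _)" "step f ==>
   split_at r ((u :: 'h) ** (f :: real => 'k)) = (u ** (restr {0..<r} f)) ** (restr {r..} f)"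
  "ip (split_at r x) (split_at r y) = ip x (y :: ('h, 'k) hf)" by auto
qed

definition past_proj :: "real => ('h::chilbert, 'k::chilbert) hf =>L ('h, 'k) hf"
 where "past_proj r = idL ox fock_proj {0..<r}"

lemma
 shows bops_past_proj [simp]: "past_proj r \<in> bops"
  and adj_past_proj [simp]: "adj (past_proj r) = past_proj r"
  and past_proj_idem [simp]: "past_proj r oo past_proj r = past_proj r"
  and past_proj_expv: "step f ==> 0 <= r ==>
   past_proj r (u ** f) = ip \<Omega> (\<varpi> (restr {r..} f)) *\<^sub>C (u ** (restr {0..<r} f))"
 by (simp_all add: past_proj_def adj_op_tensor op_tensor_compose fock_proj_past tens_scale_right)

lemma split_at_range:
 assumes r: "0 <= r"
 shows "split_at r oo adj (split_at r) =
  (past_proj r ox fock_proj {r..} :: (('h::chilbert, 'k::chilbert) hf, 'k fock) tensor =>L _)"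
  (is "?L = ?R")
proof (rule bops_eq_on_total)
 let ?D = "{x \<otimes> y | x y. x \<in> {u ** f | (u :: 'h) (f :: real => 'k). step f} & y \<in> \<varpi> ` (step_funs :: (real => 'k) set)}"
 show "closure (cspan ?D) = UNIV" by (rule total_tens_sets[OF total_tens_expv total_expv])
 fix x assume "x \<in> ?D"
 then obtain u f g where x: "x = (u ** f) ** g" "step f" "step g" by blast
 \<comment> \<open>The step function with the past of \<open>f\<close> and the future of
   \<open>g\<close>; its exponential vector carries the image of \<open>x\<close> under the
   adjoint.\<close>
 define h where "h s = restr {0..<r} f s + restr {r..} g s" for s
 have h: "step h" unfolding h_def using step_funs_add x r by (metis step_funs_restr_past step_funs_restr_future)
 have hr: "restr {0..<r} h = restr {0..<r} f" "restr {r..} h = restr {r..} g" by (auto simp: h_def restr_def)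
 let ?c = "ip \<Omega> (\<varpi> (restr {r..} f)) * ip \<Omega> (\<varpi> (restr {0..<r} g))"
 have "adj (split_at r) x = ?c *\<^sub>C (u ** h)"
 proof (rule tens_expv_ext)
  fix v :: 'h and p :: "real => 'k"
  assume p: "step p"
  have "ip (v ** p) (adj (split_at r) x) = ip ((v ** (restr {0..<r} p)) ** (restr {r..} p)) x"
   using p r by (simp add: cinner_adj_right)
  also have "... = ip v u * (ip (\<varpi> (restr {0..<r} p)) (\<varpi> f) * ip (\<varpi> (restr {r..} p)) (\<varpi> g))"
   by (simp add: x(1) cinner_tens)
  also have "ip (\<varpi> (restr {0..<r} p)) (\<varpi> f) = ip (\<varpi> (restr {0..<r} p)) (\<varpi> (restr {0..<r} f)) * ip \<Omega> (\<varpi> (restr {r..} f))"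
   using p x r by (subst cinner_expv_split[OF _ _ r]) auto
  also have "ip (\<varpi> (restr {r..} p)) (\<varpi> g) = ip \<Omega> (\<varpi> (restr {0..<r} g)) * ip (\<varpi> (restr {r..} p)) (\<varpi> (restr {r..} g))"
   using p x r by (subst cinner_expv_split[OF _ _ r]) auto
  finally show "ip (v ** p) (adj (split_at r) x) = ip (v ** p) (?c *\<^sub>C (u ** h))"
   using cinner_expv_split[OF p h r] by (simp add: cinner_simps cinner_tens hr mult_ac)
 qed
 then show "?L x = ?R x"
  using r h x(2,3) by (simp add: bops_scaleC hr x(1) past_proj_expv fock_proj_future tens_scale_left tens_scale_right mult.commute)
qed (use r in auto)

subsection \<open>Adapted operators and the flow semigroup\<close>

text \<open>Stated for arbitrary functions, so that it covers operators defined on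
  \<open>exp_dom\<close> only as well as bounded ones.\<close>

definition adapted_at :: "real => (('h::chilbert, 'k::chilbert) hf => ('h, 'k) hf) => bool"
 where "adapted_at r X \<longleftrightarrow> (ALL f:step_funs. ALL g:step_funs. ALL u v.
  ip (u ** f) (X (v ** g)) = ip (\<varpi> (restr {r..} f)) (\<varpi> (restr {r..} g)) *
   ip (u ** (restr {0..<r} f)) (X (v ** (restr {0..<r} g))))"

lemma adaptedD: "adapted_at r X ==> step f ==> step g ==>
  ip (u ** f) (X (v ** g)) = ip (\<varpi> (restr {r..} f)) (\<varpi> (restr {r..} g)) *
   ip (u ** (restr {0..<r} f)) (X (v ** (restr {0..<r} g)))"
 unfolding adapted_at_def by blast

lemma restr_zero [simp]: "restr J (%_. 0) = (%_. 0)"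
 by (auto simp: restr_def)

lemmas compose_diff = bounded_bilinear.diff_left[OF bounded_bilinear_blinfun_compose]
 bounded_bilinear.diff_right[OF bounded_bilinear_blinfun_compose]

lemma adapted_past_proj:
 fixes X :: "('h::chilbert, 'k::chilbert) hf => ('h, 'k) hf"
 assumes X: "adapted_at r X" and g: "step g" and r: "0 <= r"
 shows "past_proj r (X (v ** (restr {0..<r} g))) = X (v ** (restr {0..<r} g))"
proof (rule tens_expv_ext)
 fix u and f :: "real => 'k" assume f: "step f"
 have "ip (u ** f) (past_proj r (X (v ** (restr {0..<r} g)))) =
   ip (past_proj r (u ** f)) (X (v ** (restr {0..<r} g)))"
  using cinner_adj_left[OF bops_past_proj, of r "u ** f"] by simp
 then show "ip (u ** f) (past_proj r (X (v ** (restr {0..<r} g)))) = ip (u ** f) (X (v ** (restr {0..<r} g)))"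
  using adaptedD[OF X f step_funs_restr_past[OF g, of r], of u v] f r cinner_commute[of "\<varpi> (restr {r..} f)" \<Omega>]
  by (simp add: past_proj_expv cinner_simps)
qed

text \<open>Adaptedness in vector form. The right-hand side, pulled back by the adjoint of
  \<open>split_at\<close>, has the matrix elements of \<open>X (v ** g)\<close>; it also lies in the
  range of \<open>split_at\<close>, so nothing is lost.\<close>

lemma adapted_split:
 fixes X :: "('h::chilbert, 'k::chilbert) hf => ('h, 'k) hf"
 assumes X: "adapted_at r X" and g: "step g" and r: "0 <= r"
 shows "split_at r (X (v ** g)) = X (v ** (restr {0..<r} g)) ** (restr {r..} g)" (is "_ = ?R")
proof -
 have "adj (split_at r) ?R = X (v ** g)"
 proof (rule tens_expv_ext)
  fix u and f :: "real => 'k" assume f: "step f"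
  show "ip (u ** f) (adj (split_at r) ?R) = ip (u ** f) (X (v ** g))"
   using adaptedD[OF X f g, of u v] f r by (simp add: cinner_adj_right cinner_tens)
 qed
 then have "split_at r (X (v ** g)) = (split_at r oo adj (split_at r)) ?R" by simp
 also have "... = ?R"
  unfolding split_at_range[OF r] using g r by (simp add: adapted_past_proj[OF X g r] fock_proj_future)
 finally show ?thesis .
qed

lemma adapted_id: "0 <= r ==> adapted_at r (%x. x)"
 unfolding adapted_at_def cinner_tens by (intro ballI allI) (subst cinner_expv_split[of _ _ r], auto)

lemma process_adapted: "op_process X ==> 0 <= t ==> adapted_at t (X t)"
 unfolding op_process_def adapted_at_def by blast

lemma exp_dom_base: "step f ==> u ** f \<in> exp_dom"
 unfolding exp_dom_def exp_space_def by (intro cspan_base) (auto intro: cspan_base)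

lemma bounded_process_adapted:
 assumes "bounded_process_in A Y" "0 <= t"
 shows "adapted_at t (blinfun_apply (Y t))"
proof -
 have "adapted_at t (as_process Y t)" using assms unfolding bounded_process_in_def by (blast intro: process_adapted)
 then have 1: "step f ==> step g ==> ip (u ** f) (Y t (v ** g)) =
   ip (\<varpi> (restr {t..} f)) (\<varpi> (restr {t..} g)) *
   ip (u ** (restr {0..<t} f)) (Y t (v ** (restr {0..<t} g)))" for f g u v
  using adaptedD[of t "as_process Y t" f g u v] by (simp add: as_process_def exp_dom_base)
 show ?thesis unfolding adapted_at_def by (intro ballI allI 1)
qed

lemma past_proj_idem_left: "past_proj r oo (past_proj r oo X) = past_proj r oo X"
 by (simp flip: compose_assoc)

lemma adapted_bounded:
 fixes X :: "('h::chilbert, 'k::chilbert) hf =>L ('h, 'k) hf"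
 assumes X: "adapted_at r (blinfun_apply X)" "bop X" and r: "0 <= r"
 shows "past_proj r oo X oo past_proj r = X oo past_proj r"
 by (rule tens_expv_eqI)
  (simp_all add: past_proj_expv bops_scaleC adapted_past_proj[OF X(1) _ r] X(2) r del: restr_restr)

text \<open>The definite description \<open>past\<close> evaluated. Existence is adaptedness;
  uniqueness holds because matrix elements between exponential vectors supported before
  \<open>r\<close> do not feel the future factor.\<close>

lemma past_eq:
 fixes X :: "('h::chilbert, 'k::chilbert) hf =>L ('h, 'k) hf"
 assumes X: "adapted_at r (blinfun_apply X)" "bop X" and r: "0 <= r"
 shows "past r X = past_proj r oo X oo past_proj r"
 unfolding past_def past_proj_def[symmetric] join_at_def
proof (rule the_equality)
 let ?Z = "past_proj r oo X oo past_proj r"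
 note tot = total_tens_expv[where 'h = 'h and 'k = 'k]
 have "ip x (blinfun_apply X y) = ip x (blinfun_apply (adj (split_at r) oo (?Z ox fock_proj {r..}) oo split_at r) y)"
  if xy: "x \<in> {u ** f | (u :: 'h) (f :: real => 'k). step f}" "y \<in> {u ** f | (u :: 'h) (f :: real => 'k). step f}" for x y
 proof -
  obtain u v f g where e: "x = u ** f" "y = v ** g" "step f" "step g" using xy by blast
  show ?thesis using adaptedD[OF X(1) e(3,4), of u v] adapted_past_proj[OF X(1) e(4) r, of v] X(2) e r
   by (simp add: cinner_adj_right cinner_tens past_proj_expv fock_proj_future)
 qed
 then have "X = adj (split_at r) oo (?Z ox fock_proj {r..}) oo split_at r"
  by (rule bops_eqI[OF _ _ tot tot, rotated 2]) (use X r in auto)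
 then show "bop ?Z & past_proj r oo ?Z oo past_proj r = ?Z & X = adj (split_at r) oo (?Z ox fock_proj {r..}) oo split_at r"
  using X(2) by (simp add: compose_assoc past_proj_idem_left)
next
 fix Z :: "('h, 'k) hf =>L ('h, 'k) hf"
 assume Z: "bop Z & past_proj r oo Z oo past_proj r = Z & X = adj (split_at r) oo (Z ox fock_proj {r..}) oo split_at r"
 note tot = total_tens_expv[where 'h = 'h and 'k = 'k]
 have "past_proj r oo X oo past_proj r = past_proj r oo Z oo past_proj r"
 proof (rule bops_eqI[OF _ _ tot tot])
  fix x y assume "x \<in> {u ** f | (u :: 'h) (f :: real => 'k). step f}" "y \<in> {u ** f | (u :: 'h) (f :: real => 'k). step f}"
  then obtain u v f g where e: "x = u ** f" "y = v ** g" "step f" "step g" by blast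
  have "ip (u ** (restr {0..<r} f)) (X (v ** (restr {0..<r} g))) =
    ip (u ** (restr {0..<r} f)) (Z (v ** (restr {0..<r} g)))"
   using Z e r by (simp add: cinner_adj_right cinner_tens fock_proj_future)
  note XZ = this
  have pBp: "ip x (blinfun_apply (past_proj r oo B oo past_proj r) y) = cnj (ip \<Omega> (\<varpi> (restr {r..} f))) *
    (ip \<Omega> (\<varpi> (restr {r..} g)) * ip (u ** (restr {0..<r} f)) (B (v ** (restr {0..<r} g))))"
   if B: "bop B" for B :: "('h, 'k) hf =>L ('h, 'k) hf"
   using cinner_adj_left[OF bops_past_proj, of r x "B (past_proj r y)"] e r B
   by (auto simp: past_proj_expv bops_scaleC cinner_simps)
  show "ip x (blinfun_apply (past_proj r oo X oo past_proj r) y) = ip x (blinfun_apply (past_proj r oo Z oo past_proj r) y)"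
   unfolding pBp[OF X(2)] pBp[OF conjunct1[OF Z]] XZ ..
 qed (use Z X in auto)
 then show "Z = past_proj r oo X oo past_proj r" using Z by simp
qed

lemma vn_tensor_right_commute:
 fixes G :: "('h::chilbert, 'c::chilbert) tensor =>L ('h, 'c) tensor"
 assumes A: "von_neumann_algebra A" and N: "N <= bops" and G: "G \<in> vn_tensor A N" and T: "T \<in> commutant A"
 shows "G oo (ampl T) = ampl T oo G"
proof (rule blinfun_eqI, rule cinner_ext)
 fix x z
 have sub: "A <= bops" using A by (auto simp: von_neumann_algebra_def)
 have Tb: "bop T" using T by (rule commutant_bops)
 have "ip z (G (ampl T x)) = ip (adj (ampl T) z) (G x)"
 proof (rule vn_tensor_cinner_eqI[OF sub N G])
  fix a b assume ab: "a \<in> A" "b \<in> N"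
  have "(a ox b) oo (ampl T) = ampl T oo (a ox b)"
   using ab Tb sub N commutant_commute[OF T ab(1)] by (auto simp: op_tensor_compose subset_iff)
  then show "ip z ((a ox b) (ampl T x)) = ip (adj (ampl T) z) ((a ox b) x)"
   using Tb by (simp add: cinner_adj_left flip: blinfun_apply_blinfun_compose)
 qed
 then show "ip z ((G oo (ampl T)) x) = ip z ((ampl T oo G) x)"
  using Tb by (simp add: cinner_adj_left)
qed

text \<open>The implementing operator for \<open>hat_map\<close>: the past of the split space is
  sent into an amplification of the initial space, and \<open>flip\<close> puts the future Fock
  space back next to the latter, leaving the multiplicity space last. On the range of
  \<open>split_at\<close> the projection acts trivially; it lets an adapted operator be replaced by
  its past part.\<close>

definition hat_ampl :: "real => (('h::chilbert, 'k::chilbert) hf =>L ('h, 'm::chilbert) tensor) =>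
  ('h, 'k) hf =>L (('h, 'k) hf, 'm) tensor"
 where "hat_ampl r V = flip oo (ampl (V oo past_proj r)) oo split_at r"

lemma flip_ampl:
 assumes "bop a" "bop z"
 shows "(ampl (a ox z)) oo flip = flip oo (ampl a ox z)"
 by (rule bops_tensor3_eqI) (use assms in auto)

lemma flip_ket:
 fixes q :: "('h::chilbert, 'm::chilbert) tensor"
 shows "flip (q \<otimes> y) = (tens_ket y ox (idL :: 'm =>L 'm)) q"
proof -
 have "flip oo tens_ket y = (tens_ket y :: 'h =>L _) ox (idL :: 'm =>L 'm)" by (rule bops_tensor_eqI) auto
 then have "(flip oo tens_ket y) q = (tens_ket y ox (idL :: 'm =>L 'm)) q" by (simp only:)
 then show ?thesis by simp
qed

lemma norm_isometry_le: "(!!u v. ip (blinfun_apply T u) (T v) = ip u v) ==> norm T <= 1"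
 by (rule norm_blinfun_bound) (auto simp: isometry_norm)

lemma norm_projection_le:
 fixes P :: "'a::chilbert =>L 'a"
 assumes P: "bop P" "adj P = P" "P oo P = P"
 shows "norm P <= 1"
proof (rule norm_blinfun_bound)
 fix x
 have "ip (P x) (P x) = ip x (P x)"
  using cinner_adj_left[OF P(1), of x "P x"] P(2) blinfun_apply_blinfun_compose[of P P x] P(3) by simp
 then have "(norm (P x))\<^sup>2 = cmod (ip x (P x))"
  using arg_cong[OF cinner_self[of "P x"], of cmod] by (simp add: norm_power)
 also have "... <= norm x * norm (P x)" by (rule cinner_CS)
 finally show "norm (P x) <= 1 * norm x" by (cases "P x = 0") (auto simp: power2_eq_square)
qed simp

section \<open>The flow semigroup in concrete form\<close>

locale qs_flow =
 fixes A :: "('h::chilbert =>L 'h) set" and j :: "('h, 'k::chilbert) map_family"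
 assumes vn: "von_neumann_algebra A" and flow: "QS_flow A j"
begin

lemma j_process: "a \<in> A ==> bounded_process_in A (%t. j t a)"
 using flow unfolding QS_flow_def QS_cocycle_def by blast

lemma j_bops: "a \<in> A ==> 0 <= t ==> j t a \<in> bops"
 using j_process[of a] unfolding bounded_process_in_def by blast

lemma j_adapted: "a \<in> A ==> 0 <= t ==> adapted_at t (blinfun_apply (j t a))"
 by (rule bounded_process_adapted[OF j_process])

lemma j_cocycle: "a \<in> A ==> 0 <= r ==> 0 <= t ==> j (r + t) a = flow_semigroup A j r (j t a)"
 using flow unfolding QS_flow_def QS_cocycle_def flow_semigroup_def by blast

lemma j_hom: "0 <= t ==> normal_hom A (j t)"
 using flow unfolding QS_flow_def QS_cocycle_def normal_hom_def by blast

lemma A_bops: "A <= bops"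
 using vn by (simp add: von_neumann_algebra_def)

lemma j_spatial:
 assumes "0 <= t"
 obtains V :: "('h, 'k) hf =>L ('h, (amp, ('h, 'k) hf ell2) tensor) tensor"
 where "bop V" "!!x y. ip (V x) (V y) = ip x y" "ALL a:A. V oo j t a = ampl a oo V"
 using normal_hom_spatial[OF vn j_hom[OF assms]] by blast

lemma norm_j_le:
 assumes a: "a \<in> A" and t: "0 <= t"
 shows "norm (j t a) <= norm a"
proof -
 obtain V :: "('h, 'k) hf =>L ('h, (amp, ('h, 'k) hf ell2) tensor) tensor"
  where V: "bop V" "!!x y. ip (V x) (V y) = ip x y" "ALL a:A. V oo j t a = ampl a oo V"
  using j_spatial[OF t] by blast
 have "norm (a ox (idL :: _ =>L (amp, ('h, 'k) hf ell2) tensor)) <= norm a * 1"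
  using a A_bops by (intro order_trans[OF norm_op_tensor_le] mult_left_mono norm_blinfun_id_le) auto
 then have "norm ((a ox (idL :: _ =>L (amp, ('h, 'k) hf ell2) tensor)) (V x)) <= norm a * norm (V x)" for x
  by (intro order_trans[OF norm_blinfun mult_right_mono]) auto
 then have "norm (V (j t a x)) <= norm a * norm (V x)" for x
  using bspec[OF V(3) a] by (simp flip: blinfun_apply_blinfun_compose)
 then show ?thesis by (intro norm_blinfun_bound) (auto simp: isometry_norm[OF V(2)])
qed

lemma fock_ops_bops: "fock_ops J <= bops"
 by (auto simp: fock_ops_def)

context
 fixes r :: real and V :: "('h, 'k) hf =>L ('h, 'm::chilbert) tensor"
 assumes r: "0 <= r" and V: "bop V" "!!x y. ip (V x) (V y) = ip x y"
  and Vall: "ALL a:A. V oo j r a = ampl a oo V"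
begin

lemma Vj: "a \<in> A ==> V oo j r a = ampl a oo V"
 using Vall by blast

abbreviation "W \<equiv> hat_ampl r V"

lemma bops_W: "bop W"
 using V r by (simp add: hat_ampl_def)

lemma norm_W: "norm W <= 1"
proof -
 have f: "norm (flip :: (('h, 'm) tensor, 'k fock) tensor =>L _) <= 1"
  by (rule norm_isometry_le) (metis adj_flip bops_flip cinner_adj_left flip_flip_apply)
 have "norm (V oo past_proj r) <= norm V * norm (past_proj r :: ('h, 'k) hf =>L _)" by (rule norm_blinfun_compose)
 also have "... <= 1 * 1"
  by (intro mult_mono norm_isometry_le norm_projection_le) (simp_all add: V)
 finally have p: "norm ((V oo past_proj r) ox (idL :: 'k fock =>L 'k fock)) <= 1"
  using V by (intro norm_op_tensor_proj norm_blinfun_id_le) auto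
 have "norm W <= norm (flip oo ((V oo past_proj r) ox (idL :: 'k fock =>L 'k fock))) *
   norm (split_at r :: ('h, 'k) hf =>L _)"
  unfolding hat_ampl_def by (rule norm_blinfun_compose)
 also have "... <= (1 * 1) * 1"
  by (intro mult_mono order_trans[OF norm_blinfun_compose] f p norm_isometry_le cinner_split_at r) auto
 finally show ?thesis by simp
qed

lemma W_adapted:
 assumes X: "adapted_at r X" and g: "step g"
 shows "W (X (v ** g)) = (tens_ket (\<varpi> (restr {r..} g)) ox idL) (V (X (v ** (restr {0..<r} g))))"
 using V g r by (simp add: hat_ampl_def adapted_split[OF X g r] adapted_past_proj[OF X g r] flip_ket)

lemma W_elementary:
 assumes a: "a \<in> A" and z: "z \<in> fock_ops {r..}"
 shows "(ampl (a ox z)) oo W = W oo join_at r (past r (j r a)) z"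
  and "adj W oo (ampl (a ox z)) oo W = join_at r (past r (j r a)) z"
proof -
 have b: "bop a" "bop z" "j r a \<in> bops" using a z A_bops fock_ops_bops j_bops[OF a r] by auto
 let ?P = "past_proj r :: ('h, 'k) hf =>L _" and ?Q = "fock_proj {r..} :: 'k fock =>L _"
 let ?U = "split_at r :: ('h, 'k) hf =>L _"
 have Pj: "?P oo (j r a oo ?P) = j r a oo ?P"
  using adapted_bounded[OF j_adapted[OF a r] b(3) r] by (simp add: compose_assoc)
 have VP: "ampl a oo (V oo ?P) = V oo (j r a oo ?P)"
  using Vj[OF a] by (simp flip: compose_assoc)
 have zz: "?Q oo z = z" using z unfolding fock_ops_def by (metis (mono_tags, lifting) compose_assoc fock_proj_idem mem_Collect_eq)
 have L: "(ampl (a ox z)) oo W = flip oo ((V oo (j r a oo ?P)) ox z) oo ?U"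
 proof -
  have "(ampl (a ox z)) oo W = ((ampl (a ox z)) oo flip) oo ((ampl (V oo ?P)) oo ?U)"
   by (simp add: hat_ampl_def compose_assoc)
  also have "... = flip oo ((ampl a ox z) oo (ampl (V oo ?P))) oo ?U"
   unfolding flip_ampl[OF b(1,2)] by (simp add: compose_assoc)
  also have "(ampl a ox z) oo (ampl (V oo ?P)) = (V oo (j r a oo ?P)) ox z"
   using b V by (simp add: op_tensor_compose VP)
  finally show ?thesis .
 qed
 have J: "join_at r (past r (j r a)) z = adj ?U oo ((j r a oo ?P) ox z) oo ?U"
  unfolding join_at_def past_eq[OF j_adapted[OF a r] b(3) r] compose_assoc Pj ..
 have "W oo join_at r (past r (j r a)) z =
   flip oo (ampl (V oo ?P)) oo ((?U oo adj ?U) oo ((j r a oo ?P) ox z)) oo ?U"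
  unfolding J hat_ampl_def by (simp only: compose_assoc)
 also have "(?U oo adj ?U) oo ((j r a oo ?P) ox z) = (j r a oo ?P) ox z"
  unfolding split_at_range[OF r] using b by (simp add: op_tensor_compose Pj zz)
 also have "flip oo (ampl (V oo ?P)) oo ((j r a oo ?P) ox z) oo ?U =
   flip oo ((ampl (V oo ?P)) oo ((j r a oo ?P) ox z)) oo ?U"
  by (simp only: compose_assoc)
 also have "(ampl (V oo ?P)) oo ((j r a oo ?P) ox z) = (V oo (j r a oo ?P)) ox z"
  using b V by (simp add: op_tensor_compose compose_assoc Pj)
 finally show 1: "(ampl (a ox z)) oo W = W oo join_at r (past r (j r a)) z" using L by simp
 have "adj W oo (flip oo ((V oo (j r a oo ?P)) ox z) oo ?U) =
   adj ?U oo ((ampl (adj (V oo ?P))) oo ((V oo (j r a oo ?P)) ox z)) oo ?U"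
  using V r by (intro blinfun_eqI) (simp add: hat_ampl_def adj_compose adj_op_tensor adj_flip)
 also have "(ampl (adj (V oo ?P))) oo ((V oo (j r a oo ?P)) ox z) = (j r a oo ?P) ox z"
 proof -
  have "adj (V oo ?P) oo (V oo (j r a oo ?P)) = ?P oo ((adj V oo V) oo (j r a oo ?P))"
   using V by (simp add: adj_compose compose_assoc)
  also have "... = j r a oo ?P" using V by (simp add: adj_compose_self Pj)
  finally show ?thesis using b V by (simp add: op_tensor_compose)
 qed
 finally show "adj W oo (ampl (a ox z)) oo W = join_at r (past r (j r a)) z"
  unfolding compose_assoc[of "adj W"] L J .
qed

lemma hat_map_spatial:
 assumes T: "T \<in> vn_tensor A (fock_ops {r..})"
 shows "hat_map A j r T = adj W oo (ampl T) oo W"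
  and "ampl T oo W = W oo hat_map A j r T"
proof -
 have nl: "normal_linear (vn_tensor A (fock_ops {r..})) (%T. adj W oo (ampl T) oo W)"
  using vn_tensor_bops bops_W by (intro normal_linear_compress) auto
 have "hat_map A j r = restrict (%T. adj W oo (ampl T) oo W) (vn_tensor A (fock_ops {r..}))"
  unfolding hat_map_def by (rule the_normal_extension[OF A_bops fock_ops_bops nl W_elementary(2)])
 then show eq: "hat_map A j r T = adj W oo (ampl T) oo W" using T by simp
 show "ampl T oo W = W oo hat_map A j r T"
 proof (rule blinfun_eqI, rule cinner_ext)
  fix x z
  have "ip z (ampl T (W x)) = ip (W (adj W z)) (ampl T (W x))"
  proof (rule vn_tensor_ampl_eqI[OF A_bops fock_ops_bops T])
   fix a b assume ab: "a \<in> A" "b \<in> (fock_ops {r..} :: ('k fock =>L 'k fock) set)"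
   have "ip (W (adj W z)) ((ampl (a ox b)) (W x)) =
     ip z (W ((adj W oo (ampl (a ox b)) oo W) x))"
    using bops_W by (simp add: cinner_adj_left flip: cinner_adj_right)
   also have "... = ip z (((ampl (a ox b)) oo W) x)"
    unfolding W_elementary[OF ab] by simp
   finally show "ip z ((ampl (a ox b)) (W x)) = ip (W (adj W z)) ((ampl (a ox b)) (W x))"
    by simp
  qed
  then show "ip z ((ampl T oo W) x) = ip z ((W oo hat_map A j r T) x)"
   unfolding eq using bops_W by (simp add: cinner_adj_left flip: cinner_adj_right)
 qed
qed

text \<open>The first part reduces \<open>hat_map\<close> to \<open>j r\<close> at a slice, the
  computational form of the cocycle identity. The second keeps the column of \<open>T\<close> at an
  exponential vector instead of the norm of \<open>T\<close>, because the growth condition controls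
  columns.\<close>

lemma hat_map_matrix:
 assumes T: "T \<in> vn_tensor A (fock_ops {r..})" and X: "adapted_at r X" and f: "step f" and g: "step g"
 shows "ip (u ** f) (hat_map A j r T (X (v ** g))) = ip (u ** (restr {0..<r} f))
   (j r (right_slice (\<varpi> (restr {r..} f)) (\<varpi> (restr {r..} g)) T) (X (v ** (restr {0..<r} g))))"
  and "norm (hat_map A j r T (X (v ** g))) <=
   norm (T oo tens_ket (\<varpi> (restr {r..} g))) * norm (X (v ** (restr {0..<r} g)))"
proof -
 let ?x = "\<varpi> (restr {r..} f)" and ?y = "\<varpi> (restr {r..} g)"
 let ?p = "u ** (restr {0..<r} f)" and ?q = "X (v ** (restr {0..<r} g))"
 have Tb: "bop T" using T by (rule vn_tensor_bops)
 have a: "right_slice ?x ?y T \<in> A"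
  by (rule right_slice_mem[OF vn Tb vn_tensor_right_commute[OF vn fock_ops_bops T]])
 have 1: "ampl T (W (X (v ** g))) = (ampl (T oo tens_ket ?y)) (V ?q)"
 proof -
  have "ampl T oo (ampl (tens_ket ?y)) = (T oo tens_ket ?y) ox (idL :: 'm =>L 'm)"
   using Tb by (simp add: op_tensor_compose)
  then have "(ampl T oo (ampl (tens_ket ?y))) (V ?q) = (ampl (T oo tens_ket ?y)) (V ?q)"
   by (simp only:)
  then show ?thesis unfolding W_adapted[OF X g] by simp
 qed
 have "ip (u ** f) (hat_map A j r T (X (v ** g))) = ip (W (u ** f)) (ampl T (W (X (v ** g))))"
  unfolding hat_map_spatial(1)[OF T] using bops_W by (simp add: cinner_adj_right)
 also have "... = ip (V ?p) (((ampl (adj (tens_ket ?x))) oo (ampl (T oo tens_ket ?y))) (V ?q))"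
  unfolding 1 W_adapted[OF adapted_id[OF r] f]
  using cinner_adj_right[of "(tens_ket ?x :: 'h =>L _) ox (idL :: 'm =>L 'm)"] by (simp add: adj_op_tensor)
 also have "(ampl (adj (tens_ket ?x))) oo (ampl (T oo tens_ket ?y)) = right_slice ?x ?y T ox (idL :: 'm =>L 'm)"
  using Tb by (simp add: op_tensor_compose right_slice_def compose_assoc)
 also have "ip (V ?p) ((right_slice ?x ?y T ox (idL :: 'm =>L 'm)) (V ?q)) = ip (V ?p) (V (j r (right_slice ?x ?y T) ?q))"
  using Vj[OF a] by (simp flip: blinfun_apply_blinfun_compose)
 finally show "ip (u ** f) (hat_map A j r T (X (v ** g))) = ip ?p (j r (right_slice ?x ?y T) ?q)"
  by (simp add: V)
 have "norm (hat_map A j r T (X (v ** g))) = norm (adj W (ampl T (W (X (v ** g)))))"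
  unfolding hat_map_spatial(1)[OF T] by simp
 also have "... <= 1 * norm (ampl T (W (X (v ** g))))"
  by (rule order_trans[OF norm_blinfun mult_right_mono]) (simp_all add: norm_adj bops_W norm_W)
 also have "... <= norm ((T oo tens_ket ?y) ox (idL :: 'm =>L 'm)) * norm (V ?q)"
  unfolding 1 using norm_blinfun by simp
 also have "... <= norm (T oo tens_ket ?y) * 1 * norm ?q"
  unfolding isometry_norm[OF V(2)] using Tb
  by (intro mult_right_mono order_trans[OF norm_op_tensor_le] mult_left_mono norm_blinfun_id_le) auto
 finally show "norm (hat_map A j r T (X (v ** g))) <= norm (T oo tens_ket ?y) * norm ?q" by simp
qed

end

text \<open>Membership in the ultraweak tensor product of \<open>A\<close> with all operators on
  Fock space, tested by slices.\<close>

definition affiliated :: "(('h, 'k) hf =>L ('h, 'k) hf) => bool"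
 where "affiliated T \<longleftrightarrow> T \<in> bops & (ALL c d. right_slice c d T \<in> A)"

lemma bounded_process_affiliated:
 assumes "bounded_process_in A Y" "0 <= t"
 shows "affiliated (Y t)"
proof -
 have Yb: "Y t \<in> bops" using assms unfolding bounded_process_in_def by blast
 have "right_slice c d (Y t) \<in> A" if "c \<in> \<varpi> ` step_funs" "d \<in> \<varpi> ` step_funs" for c d
  using that assms unfolding bounded_process_in_def right_slice_def by blast
 then have "Y t oo (ampl T) = ampl T oo Y t" if "T \<in> commutant A" for T
  by (rule right_slices_commute[OF vn Yb total_expv _ that])
 then show ?thesis unfolding affiliated_def using right_slice_mem[OF vn Yb] Yb by blast
qed

text \<open>Slices of a product are not products of slices; the passage is through commutation with
  the amplified commutant of \<open>A\<close>, for which products are harmless.\<close>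

lemma affiliated_algebra:
 shows affiliated_id: "affiliated idL"
  and affiliated_diff: "affiliated S ==> affiliated T ==> affiliated (S - T)"
  and affiliated_compose: "affiliated S ==> affiliated T ==> affiliated (S oo T)"
proof -
 have comm: "S oo (ampl B) = ampl B oo S" if "affiliated S" "B \<in> commutant A" for S B
  using that right_slices_commute[OF vn _ total_UNIV _ that(2), of S] by (simp add: affiliated_def)
 have aff: "affiliated S" if "bop S" "!!B. B \<in> commutant A ==> S oo (ampl B) = ampl B oo S" for S
  using right_slice_mem[OF vn that] that(1) by (simp add: affiliated_def)
 show "affiliated idL" by (rule aff) auto
 show "affiliated (S - T)" if "affiliated S" "affiliated T"
 proof (rule aff)
  fix B assume B: "B \<in> commutant A"
  show "(S - T) oo (ampl B) = ampl B oo (S - T)"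
   using comm[OF that(1) B] comm[OF that(2) B] by (simp add: compose_diff)
 qed (use that in \<open>auto simp: affiliated_def\<close>)
 show "affiliated (S oo T)" if "affiliated S" "affiliated T"
 proof (rule aff)
  fix B assume B: "B \<in> commutant A"
  show "(S oo T) oo (ampl B) = ampl B oo (S oo T)"
   by (simp only: compose_assoc comm[OF that(2) B]) (simp only: comm[OF that(1) B] flip: compose_assoc)
 qed (use that in \<open>auto simp: affiliated_def\<close>)
qed

lemma shift_map_mem:
 assumes T: "affiliated T" and r: "0 <= r"
 shows "\<sigma> r T \<in> vn_tensor A (fock_ops {r..})"
 unfolding fock_ops_def
proof (rule right_slices_vn_tensor)
 let ?S = "fock_shift r :: 'k fock =>L _"
 have Tb: "bop T" using T by (simp add: affiliated_def)
 show "\<sigma> r T \<in> bops" using Tb r by (simp add: shift_map_def)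
 show "right_slice c d (\<sigma> r T) \<in> A" for c d
 proof -
  have "right_slice c d (\<sigma> r T) = right_slice (adj ?S c) (adj ?S d) T"
   by (rule blinfun_eqI, rule cinner_ext)
    (use Tb r in \<open>simp add: cinner_right_slice shift_map_def adj_op_tensor flip: cinner_adj_left\<close>)
  then show ?thesis using T by (simp add: affiliated_def)
 qed
 have PS: "fock_proj {r..} oo ?S = ?S"
  using r by (simp add: compose_assoc adj_fock_shift_fock_shift flip: fock_shift_range)
 have "adj ?S oo fock_proj {r..} = adj ?S" using arg_cong[OF PS, of adj] r by (simp add: adj_compose)
 then have "((idL :: 'h =>L 'h) ox fock_proj {r..}) oo (idL ox ?S) = idL ox ?S"
  "adj (idL ox ?S) oo ((idL :: 'h =>L 'h) ox fock_proj {r..}) = adj (idL ox ?S)"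
  using r PS by (simp_all add: op_tensor_compose adj_op_tensor)
 then show "((idL :: 'h =>L 'h) ox fock_proj {r..}) oo \<sigma> r T oo (idL ox fock_proj {r..}) = \<sigma> r T"
  unfolding shift_map_def by (simp add: compose_assoc) (simp flip: compose_assoc)
qed (use A_bops in auto)

abbreviation "J \<equiv> flow_semigroup A j"

lemma shift_expv_future:
 "step f ==> 0 <= r ==> adj (fock_shift r) (\<varpi> (restr {r..} f)) = \<varpi> (lshift r f)"
proof -
 assume f: "step f" "0 <= r"
 have "lshift r (restr {r..} f) = lshift r f" by (auto simp: lshift_def restr_def)
 then show ?thesis using f by (simp add: adj_fock_shift_expv)
qed

text \<open>\<open>hat_map_matrix\<close> combined with the shift, whose adjoint acts on exponential
  vectors of the future by shifting the step function to the left.\<close>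

lemma
 assumes T: "affiliated T" and r: "0 <= r" and X: "adapted_at r X" and g: "step g"
 shows J_matrix: "step f ==> ip (u ** f) (J r T (X (v ** g))) = ip (u ** (restr {0..<r} f))
   (j r (right_slice (\<varpi> (lshift r f)) (\<varpi> (lshift r g)) T) (X (v ** (restr {0..<r} g))))"
  and norm_J_le: "norm (J r T (X (v ** g))) <=
   norm (T oo tens_ket (\<varpi> (lshift r g))) * norm (X (v ** (restr {0..<r} g)))"
proof -
 obtain V :: "('h, 'k) hf =>L ('h, (amp, ('h, 'k) hf ell2) tensor) tensor"
  where V: "bop V" "!!x y. ip (V x) (V y) = ip x y" "ALL a:A. V oo j r a = ampl a oo V"
  using j_spatial[OF r] by blast
 have Tb: "bop T" using T by (simp add: affiliated_def)
 let ?S = "fock_shift r :: 'k fock =>L _"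
 note hm = hat_map_matrix[OF r V shift_map_mem[OF T r] X _ g]
 show "ip (u ** f) (J r T (X (v ** g))) = ip (u ** (restr {0..<r} f))
   (j r (right_slice (\<varpi> (lshift r f)) (\<varpi> (lshift r g)) T) (X (v ** (restr {0..<r} g))))" if f: "step f"
 proof -
  have "right_slice (\<varpi> (restr {r..} f)) (\<varpi> (restr {r..} g)) (\<sigma> r T) = right_slice (\<varpi> (lshift r f)) (\<varpi> (lshift r g)) T"
  proof (rule blinfun_eqI, rule cinner_ext)
   fix x z
   have "ip x (right_slice (\<varpi> (restr {r..} f)) (\<varpi> (restr {r..} g)) (\<sigma> r T) z) =
     ip ((adj (idL ox ?S)) (x ** (restr {r..} f))) (T ((adj (idL ox ?S)) (z ** (restr {r..} g))))"
    using r by (simp add: cinner_right_slice shift_map_def cinner_adj_left del: op_tensor_apply)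
   then show "ip x (right_slice (\<varpi> (restr {r..} f)) (\<varpi> (restr {r..} g)) (\<sigma> r T) z) =
     ip x (right_slice (\<varpi> (lshift r f)) (\<varpi> (lshift r g)) T z)"
    using f g r by (simp add: cinner_right_slice adj_op_tensor shift_expv_future)
  qed
  then show ?thesis unfolding flow_semigroup_def hm(1)[OF f] by simp
 qed
 have "\<sigma> r T oo tens_ket (\<varpi> (restr {r..} g)) = (idL ox ?S) oo (T oo tens_ket (\<varpi> (lshift r g)))"
  using r g by (intro blinfun_eqI) (simp add: shift_map_def adj_op_tensor shift_expv_future)
 also have "norm ... <= norm ((idL :: 'h =>L 'h) ox ?S) * norm (T oo tens_ket (\<varpi> (lshift r g)))"
  by (rule norm_blinfun_compose)
 also have "... <= 1 * norm (T oo tens_ket (\<varpi> (lshift r g)))"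
 proof (intro mult_right_mono norm_op_tensor_proj norm_blinfun_id_le norm_isometry_le)
  show "ip (?S x) (?S y) = ip x y" for x y
  proof -
   have "ip (?S x) (?S y) = ip x ((adj ?S oo ?S) y)" using r by (simp add: cinner_adj_right)
   then show ?thesis by (simp only: adj_fock_shift_fock_shift[OF r] id_blinfun.rep_eq)
  qed
 qed (use r in auto)
 finally have "norm (\<sigma> r T oo tens_ket (\<varpi> (restr {r..} g))) <= norm (T oo tens_ket (\<varpi> (lshift r g)))" by simp
 then show "norm (J r T (X (v ** g))) <= norm (T oo tens_ket (\<varpi> (lshift r g))) * norm (X (v ** (restr {0..<r} g)))"
  unfolding flow_semigroup_def by (intro order_trans[OF hm(2)[OF g]] mult_right_mono) auto
qed

text \<open>Multiplicativity comes from the intertwining relation, which moves \<open>?W\<close>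
  past the second factor; compatibility with differences is immediate from the compressed
  form.\<close>

lemma
 assumes S: "affiliated S" and T: "affiliated T" and r: "0 <= r"
 shows J_compose: "J r (S oo T) = J r S oo J r T"
  and J_diff: "J r (S - T) = J r S - J r T"
  and bops_J: "J r T \<in> bops"
proof -
 obtain V :: "('h, 'k) hf =>L ('h, (amp, ('h, 'k) hf ell2) tensor) tensor"
  where V: "bop V" "!!x y. ip (V x) (V y) = ip x y" "ALL a:A. V oo j r a = ampl a oo V"
  using j_spatial[OF r] by blast
 let ?W = "hat_ampl r V" and ?S = "(idL :: 'h =>L 'h) ox (fock_shift r :: 'k fock =>L _)"
 have b: "bop S" "bop T" using S T by (auto simp: affiliated_def)
 note hS = hat_map_spatial[OF r V shift_map_mem[OF _ r]]
 have SS: "adj ?S oo ?S = idL" using r by (simp add: adj_op_tensor op_tensor_compose adj_fock_shift_fock_shift)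
 have "\<sigma> r (S oo T) = ?S oo S oo (adj ?S oo ?S) oo T oo adj ?S" by (simp add: SS shift_map_def compose_assoc)
 also have "... = \<sigma> r S oo \<sigma> r T" by (simp add: shift_map_def compose_assoc)
 finally have s: "\<sigma> r (S oo T) = \<sigma> r S oo \<sigma> r T" .
 have sb: "\<sigma> r S \<in> bops" "\<sigma> r T \<in> bops" using b r by (auto simp: shift_map_def)
 have "J r (S oo T) = adj ?W oo ((ampl (\<sigma> r S)) oo (ampl (\<sigma> r T))) oo ?W"
  unfolding flow_semigroup_def hS(1)[OF affiliated_compose[OF S T]] unfolding s using sb by (simp add: op_tensor_compose)
 also have "... = (adj ?W oo (ampl (\<sigma> r S)) oo ?W) oo J r T"
  unfolding compose_assoc hS(2)[OF T] flow_semigroup_def ..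
 finally show "J r (S oo T) = J r S oo J r T" unfolding flow_semigroup_def hS(1)[OF S] .
 have "\<sigma> r (S - T) = \<sigma> r S - \<sigma> r T"
  by (simp add: shift_map_def compose_diff)
 then show "J r (S - T) = J r S - J r T"
  unfolding flow_semigroup_def hS(1)[OF affiliated_diff[OF S T]] hS(1)[OF S] hS(1)[OF T]
  using sb by (simp add: op_tensor_diff_left compose_diff)
 show "J r T \<in> bops" unfolding flow_semigroup_def hS(1)[OF T] using sb bops_W[OF r V] by auto
qed

lemma J_id: "0 <= r ==> J r idL = idL"
proof (rule tens_expv_eqI)
 fix u :: 'h and g :: "real => 'k"
 assume r: "0 <= r" and g: "step g"
 show "J r idL (u ** g) = idL (u ** g)"
 proof (rule tens_expv_ext)
  fix w :: 'h and f :: "real => 'k"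
  assume f: "step f"
  let ?c = "ip (\<varpi> (lshift r f)) (\<varpi> (lshift r g))"
  have "right_slice (\<varpi> (lshift r f)) (\<varpi> (lshift r g)) idL = ?c *\<^sub>C (idL :: 'h =>L 'h)"
   by (rule blinfun_eqI) (simp add: right_slice_def)
  moreover have "j r (?c *\<^sub>C idL) = ?c *\<^sub>C idL"
   using normal_hom_scale[OF j_hom[OF r] vn_id[OF vn]] j_hom[OF r] by (simp add: normal_hom_def)
  ultimately show "ip (w ** f) (J r idL (u ** g)) = ip (w ** f) (idL (u ** g))"
   using f g r J_matrix[OF affiliated_id r adapted_id[OF r] g f, of w u]
   by (simp add: cinner_simps cinner_tens cinner_expv_split[OF f g r] restr_future_shift cinner_expv_shift)
 qed
qed (auto simp: bops_J[OF affiliated_id affiliated_id])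

end

subsection \<open>Differentiability of norm continuous semigroups\<close>

text \<open>Comparing \<open>f t\<close> with \<open>n\<close> copies of \<open>f h\<close>, where
  \<open>real n * h\<close> is the largest multiple of \<open>h\<close> not exceeding
  \<open>t\<close>, costs order t^2 for the defect of additivity and order h for the remainder.
  Difference quotients at small h are therefore all close to the one at t.\<close>

lemma almost_additive_derivative:
 fixes f :: "real => 'a::banach"
 assumes add: "!!s h. 0 <= s ==> 0 <= h ==> s + h <= c ==> norm (f (s + h) - f s - f h) <= L * (s * h)"
  and lip: "!!s. 0 <= s ==> s <= c ==> norm (f s) <= K * s" and c: "0 < c" and L: "0 <= L" and K: "0 <= K"
 obtains G where "((%h. f h /\<^sub>R h) ---> G) (at_right 0)"
proof -
 have f0: "f 0 = 0" using lip[of 0] c by simp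
 have mult: "norm (f (real n * h) - real n *\<^sub>R f h) <= L * (real n * h)\<^sup>2" if "0 <= h" "real n * h <= c" for n h
  using that(2)
 proof (induction n)
  case (Suc n)
  have nh: "real n * h <= c" "real n * h + h <= c" using Suc.prems that(1) by (simp_all add: algebra_simps)
  have "f (real (Suc n) * h) - real (Suc n) *\<^sub>R f h = (f (real n * h + h) - f (real n * h) - f h) + (f (real n * h) - real n *\<^sub>R f h)"
   by (simp add: algebra_simps)
  also have "norm ... <= L * (real n * h * h) + L * (real n * h)\<^sup>2"
   using that(1) nh by (intro norm_triangle_le add_mono add Suc.IH) auto
  also have "... = L * (real n * h * h + (real n * h)\<^sup>2)" by (simp add: algebra_simps)
  also have "... <= L * (real (Suc n) * h)\<^sup>2"
   using that(1) L by (intro mult_left_mono) (auto simp: power2_eq_square algebra_simps)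
  finally show ?case .
 qed (simp add: f0)
 have near: "norm (f h /\<^sub>R h - f t /\<^sub>R t) <= 2 * L * t + 2 * K * h / t" if h: "0 < h" "h <= t" "t <= c" for h t
 proof -
  define n where "n = nat \<lfloor>t / h\<rfloor>"
  have "real n = of_int \<lfloor>t / h\<rfloor>" using h by (simp add: n_def)
  then have "real n <= t / h" "t / h <= real n + 1" by linarith+
  then have n: "real n * h <= t" "t - real n * h <= h" using h by (simp_all add: field_simps)
  define r where "r = t - real n * h"
  have r: "0 <= r" "r <= h" "t = real n * h + r" using n by (auto simp: r_def)
  have "t *\<^sub>R (f h /\<^sub>R h) - f t = (r / h) *\<^sub>R f h - (f (real n * h) - real n *\<^sub>R f h) - (f t - f (real n * h) - f r) - f r"
   using h by (simp add: r(3) algebra_simps divide_inverse)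
  also have "norm ... <= 1 * (K * h) + L * (real n * h)\<^sup>2 + L * (real n * h * r) + K * h"
  proof (rule order_trans[OF norm_triangle_ineq4 add_mono[OF order_trans[OF norm_triangle_ineq4 add_mono[OF order_trans[OF norm_triangle_ineq4 add_mono]]]]])
   show "norm ((r / h) *\<^sub>R f h) <= 1 * (K * h)" using r h lip[of h] by (simp only: norm_scaleR) (intro mult_mono, auto)
   show "norm (f (real n * h) - real n *\<^sub>R f h) <= L * (real n * h)\<^sup>2" using n h by (intro mult) auto
   show "norm (f t - f (real n * h) - f r) <= L * (real n * h * r)" unfolding r(3) using r h by (intro add) auto
   show "norm (f r) <= K * h" using lip[of r] r h mult_left_mono[OF r(2) K] by simp
  qed
  also have "... <= 1 * (K * h) + L * t\<^sup>2 + L * (t * t) + K * h"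
   using n h r L by (intro add_mono order_refl mult_left_mono power_mono mult_mono) auto
  also have "... = t * (2 * L * t + 2 * K * h / t)" using less_le_trans[OF h(1,2)] by (simp add: field_simps power2_eq_square)
  finally have "norm (t *\<^sub>R (f h /\<^sub>R h) - f t) <= t * (2 * L * t + 2 * K * h / t)" .
  moreover have "t *\<^sub>R (f h /\<^sub>R h) - f t = t *\<^sub>R (f h /\<^sub>R h - f t /\<^sub>R t)" using h by (simp add: algebra_simps)
  ultimately show ?thesis using less_le_trans[OF h(1,2)] by (simp only: norm_scaleR abs_of_pos mult_le_cancel_left_pos)
 qed
 have "cauchy_filter (filtermap (%h. f h /\<^sub>R h) (at_right 0))"
  unfolding cauchy_filter_metric_filtermap
 proof (intro allI impI)
  fix e :: real assume e: "e > 0"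
  \<comment> \<open>Makes \<open>2 * L * t\<close> at most \<open>e / 8\<close>; the condition
    imposed on \<open>h\<close> below does the same for the other error term
    \<open>2 * K * h / t\<close>.\<close>
  define t where "t = min c (e / (16 * (L + 1)))"
  have t: "0 < t" "t <= c" using e c L by (auto simp: t_def)
  have "t <= e / (16 * (L + 1))" by (simp add: t_def)
  then have te: "16 * (L * t + t) <= e" using L by (simp add: pos_le_divide_eq algebra_simps)
  have d: "norm (f h /\<^sub>R h - f t /\<^sub>R t) <= e / 4" if "0 < h & h <= t & 16 * K * h <= e * t" for h
  proof -
   have "2 * K * h / t <= e / 8" using that t by (simp add: field_simps)
   moreover have "2 * L * t <= e / 8" using t te by (simp add: algebra_simps)
   ultimately show ?thesis using near[of h t] that t by simp
  qed
  show "EX P. eventually P (at_right 0) & (ALL x y. P x & P y --> dist (f x /\<^sub>R x) (f y /\<^sub>R y) < e)"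
  proof (intro exI conjI allI impI)
   have "0 < min t (e * t / (16 * K + 1))" using e t K by simp
   from eventually_at_right_real[OF this]
   show "\<forall>\<^sub>F h in at_right 0. 0 < h & h <= t & 16 * K * h <= e * t"
    by (rule eventually_mono) (use K in \<open>auto simp: field_simps\<close>)
   fix x y assume "(0 < x & x <= t & 16 * K * x <= e * t) & (0 < y & y <= t & 16 * K * y <= e * t)"
   then show "dist (f x /\<^sub>R x) (f y /\<^sub>R y) < e"
    using d[of x] d[of y] dist_triangle2[of "f x /\<^sub>R x" "f y /\<^sub>R y" "f t /\<^sub>R t"] e by (simp add: dist_norm)
  qed
 qed
 from cauchy_filter_complete_converges[OF this complete_UNIV] that show ?thesis by (auto simp: filterlim_def filtermap_bot_iff)
qed

text \<open>
 The Hoelder estimate improves to a Lipschitz estimate: \<open>R s = Q s - 1\<close> satisfies \<open>2 R s = R (2 s) - (R s)\<^sup>2\<close>, so a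
 bound \<open>K s (1 - 2 C sqrt s)\<close> passes from \<open>2 s\<close> to \<open>s\<close>.
\<close>

lemma semigroup_derivative:
 fixes Q :: "real => 'a::banach => 'a"
 assumes A: "closed A" "subspace A" and QA: "!!t x. 0 <= t ==> x \<in> A ==> Q t x \<in> A"
  and add: "!!t x y. 0 <= t ==> x \<in> A ==> y \<in> A ==> Q t (x + y) = Q t x + Q t y"
  and semi: "!!s t x. 0 <= s ==> 0 <= t ==> x \<in> A ==> Q (s + t) x = Q s (Q t x)"
  and cont: "!!t x. 0 <= t ==> t < \<delta> ==> x \<in> A ==> norm (Q t x - x) <= C * sqrt t * norm x"
  and \<delta>: "0 < \<delta>" and C: "0 <= C" and a: "a \<in> A"
 shows "EX G:A. ((%h. (Q h a - a) /\<^sub>R h) ---> G) (at_right 0)"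
proof -
 \<comment> \<open>Keeps \<open>C * sqrt s\<close> at most 1/4 for all \<open>s\<close> up to
   \<open>2 * \<tau>\<close>, and this range inside the given interval.\<close>
 define \<tau> where "\<tau> = min (\<delta> / 4) ((1 / (4 * (C + 1)))\<^sup>2 / 2)"
 have \<tau>: "0 < \<tau>" "2 * \<tau> < \<delta>" using \<delta> C by (auto simp: \<tau>_def)
 have "2 * \<tau> <= (1 / (4 * (C + 1)))\<^sup>2" unfolding \<tau>_def by linarith
 then have "sqrt (2 * \<tau>) <= 1 / (4 * (C + 1))" using C by (intro real_le_lsqrt) auto
 then have "C * sqrt (2 * \<tau>) <= C * (1 / (4 * (C + 1)))" by (rule mult_left_mono) (rule C)
 also have "... <= 1 / 4" using C by (simp add: field_simps)
 finally have \<tau>C: "C * sqrt (2 * \<tau>) <= 1 / 4" .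
 have diff: "Q s x - x \<in> A" "Q s (Q t x - x) = Q (s + t) x - Q s x" if "x \<in> A" "0 <= s" "0 <= t" for s t x
  using add[of s "Q t x - x" x] subspace_diff[OF A(2)] QA that by (auto simp: semi)
 \<comment> \<open>Chosen so that on the initial range, from \<open>\<tau>\<close> to
   \<open>2 * \<tau>\<close>, the Hoelder bound implies the claimed one:
   \<open>C * sqrt (2 * \<tau>) = K * \<tau> / 2\<close>, and the bracket is at least 1/2
   there.\<close>
 define K where "K = 2 * (C * sqrt (2 * \<tau>)) / \<tau>"
 have K: "0 <= K" using C \<tau> by (simp add: K_def)
 \<comment> \<open>\<open>n\<close> counts the halvings of the range on which the bound is known.
   The bracket absorbs the quadratic error, so that \<open>K\<close> stays the same at every
   halving.\<close>
 have dyadic: "norm (Q s x - x) <= K * s * (1 - 2 * (C * sqrt s)) * norm x" if x: "x \<in> A" and "\<tau> / 2 ^ n <= s" "s <= 2 * \<tau>" for n s x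
  using that(2,3)
 proof (induction n arbitrary: s)
  case 0
  have "C * sqrt s <= C * sqrt (2 * \<tau>)" using 0 C by (intro mult_left_mono) auto
  moreover have "C * sqrt (2 * \<tau>) = K * \<tau> * (1 / 2)" using \<tau> by (simp add: K_def)
  moreover have "K * \<tau> * (1 / 2) <= K * s * (1 - 2 * (C * sqrt s))"
   using calculation \<tau>C 0 K \<tau> by (intro mult_mono) auto
  ultimately have "C * sqrt s * norm x <= K * s * (1 - 2 * (C * sqrt s)) * norm x" by (intro mult_right_mono) auto
  then show ?case using cont[of s x] 0 \<tau> x by simp
 next
  case (Suc n)
  show ?case
  proof (cases "\<tau> / 2 ^ n <= s")
   case False
   let ?R = "Q s x - x" and ?c = "C * sqrt s"
   have "\<tau> / 2 ^ n <= \<tau>" using \<tau> by (simp add: field_simps)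
   then have s: "0 < s" "s < \<tau>" "\<tau> / 2 ^ n <= 2 * s" "2 * s <= 2 * \<tau>" using Suc.prems(1) False less_le_trans[of 0 "\<tau> / 2 ^ Suc n" s] \<tau> by auto
   \<comment> \<open>The factor 5/4, a lower bound for sqrt 2, produces 2 - 5c below, and 2 - 5c
     \<le> (2 - c)(1 - 2c) closes the induction.\<close>
   have c: "0 <= ?c" "5 / 4 * ?c <= C * sqrt (2 * s)" "?c <= 1 / 4"
   proof -
    have "sqrt ((5 / 4)\<^sup>2) <= sqrt 2" by (intro real_sqrt_le_mono) (simp add: power2_eq_square)
    then show "5 / 4 * ?c <= C * sqrt (2 * s)" using C s mult_right_mono[of "5 / 4" "sqrt 2" ?c] by (simp add: real_sqrt_mult mult_ac)
    show "?c <= 1 / 4" using \<tau>C s C by (intro order_trans[OF mult_left_mono \<tau>C]) auto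
   qed (use C s in simp)
   have "2 *\<^sub>R ?R = (Q (2 * s) x - x) - (Q s ?R - ?R)" using diff(2)[OF x, of s s] s by (simp add: scaleR_2)
   then have "2 * norm ?R <= norm (Q (2 * s) x - x) + norm (Q s ?R - ?R)"
    using norm_triangle_ineq4[of "Q (2 * s) x - x" "Q s ?R - ?R"] by (metis norm_scaleR abs_numeral)
   also have "... <= K * (2 * s) * (1 - 2 * (C * sqrt (2 * s))) * norm x + ?c * norm ?R"
    using s \<tau> x by (intro add_mono Suc.IH cont diff) auto
   also have "... <= K * (2 * s) * (1 - 2 * (5 / 4 * ?c)) * norm x + ?c * norm ?R"
    using K s c by (intro add_right_mono mult_right_mono mult_left_mono) auto
   finally have "(2 - ?c) * norm ?R <= (K * s * norm x) * (2 - 5 * ?c)" by (simp add: algebra_simps)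
   also have "... <= (K * s * norm x) * ((2 - ?c) * (1 - 2 * ?c))"
    using K s c(1) C by (intro mult_left_mono) (auto simp: algebra_simps)
   finally have "(2 - ?c) * norm ?R <= (2 - ?c) * (K * s * (1 - 2 * ?c) * norm x)" by (simp add: mult_ac)
   then show ?thesis using c by (simp add: mult_le_cancel_left)
  qed (use Suc in blast)
 qed
 have lip: "norm (Q s x - x) <= K * norm x * s" if x: "x \<in> A" and s: "0 <= s" "s <= 2 * \<tau>" for s x
 proof (cases "s = 0")
  case False
  then obtain n where "(1 / 2) ^ n < s / \<tau>" using real_arch_pow_inv[of "s / \<tau>" "1 / 2"] s \<tau> by auto
  then have "\<tau> / 2 ^ n <= s" using \<tau> by (simp add: field_simps power_one_over)
  from dyadic[OF x this s(2)] have "norm (Q s x - x) <= K * s * (1 - 2 * (C * sqrt s)) * norm x" .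
  also have "... <= K * s * 1 * norm x" using K s C by (intro mult_right_mono mult_left_mono) auto
  finally show ?thesis by (simp add: mult_ac)
 qed (use cont[of 0 x] x \<delta> in simp)
 have "norm (Q (s + h) a - a - (Q s a - a) - (Q h a - a)) <= K * K * norm a * (s * h)" if "0 <= s" "0 <= h" "s + h <= 2 * \<tau>" for s h
 proof -
  have "Q (s + h) a - a - (Q s a - a) - (Q h a - a) = Q s (Q h a - a) - (Q h a - a)" using diff(2)[OF a that(1,2)] by simp
  also have "norm ... <= K * norm (Q h a - a) * s" using that a by (intro lip diff) auto
  also have "... <= K * (K * norm a * h) * s" using that a K by (intro mult_right_mono mult_left_mono lip) auto
  finally show ?thesis by (simp add: mult_ac)
 qed
 from almost_additive_derivative[of "2 * \<tau>" "%s. Q s a - a", OF this lip[OF a]]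
 obtain G where G: "((%h. (Q h a - a) /\<^sub>R h) ---> G) (at_right 0)" using \<tau> K by auto
 have "\<forall>\<^sub>F h in at_right 0. (Q h a - a) /\<^sub>R h \<in> A"
  unfolding eventually_at_right_field by (intro exI[of _ 1]) (auto intro!: subspace_scale[OF A(2)] subspace_diff[OF A(2)] QA a)
 with G show ?thesis using Lim_in_closed_set[OF A(1)] by (metis trivial_limit_at_right_real)
qed

subsection \<open>The generator of a multiplier cocycle\<close>

text \<open>A single vector at matrix level 1 is one of the competitors in the suprema that define
  \<open>cb_norm\<close>.\<close>

lemma cb_norm_bound:
 assumes a: "a \<in> A" "norm a <= 1" and \<xi>: "norm \<xi> <= 1"
 shows "ereal (norm (blinfun_apply (\<Phi> a) \<xi>)) <= cb_norm A \<Phi>"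
proof -
 have "matrix_norm 1 (%_ _. a) <= 1"
  unfolding matrix_norm_def
 proof (rule SUP_least)
  fix \<eta> :: "nat => 'a" assume "\<eta> \<in> {\<xi>. (\<Sum>j<1. (norm (\<xi> j))\<^sup>2) <= 1}"
  then have "norm (\<eta> 0) <= 1" by (simp add: power_le_one_iff)
  then have "norm (a (\<eta> 0)) <= 1 * 1"
   using a(2) by (intro order_trans[OF norm_blinfun mult_mono]) auto
  then show "ereal (sqrt (\<Sum>i<1::nat. (norm (\<Sum>j<1. a (\<eta> j)))\<^sup>2)) <= 1" by simp
 qed
 then have "matrix_norm 1 (%i j. \<Phi> a) <= cb_norm A \<Phi>"
  unfolding cb_norm_def using a(1) by (intro SUP_upper2[of 1] SUP_upper2[of "%_ _. a"]) auto
 moreover have "ereal (sqrt (\<Sum>i<1::nat. (norm (\<Sum>j<1::nat. \<Phi> a ((%_. \<xi>) j)))\<^sup>2)) <= matrix_norm 1 (%i j. \<Phi> a)"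
  unfolding matrix_norm_def using \<xi> by (intro SUP_upper2[of "%_. \<xi>"]) (auto simp: power_le_one_iff)
 ultimately show ?thesis by simp
qed

lemma norm_le_unit_ball:
 assumes T: "bop T" and K: "!!\<xi>. norm \<xi> <= 1 ==> norm (blinfun_apply T \<xi>) <= K"
 shows "norm T <= K"
proof (rule norm_blinfun_bound)
 show "0 <= K" using K[of 0] by simp
 fix \<xi>
 show "norm (T \<xi>) <= K * norm \<xi>"
 proof (cases "\<xi> = 0")
  case False
  then show ?thesis
   using K[of "complex_of_real (1 / norm \<xi>) *\<^sub>C \<xi>"]
   by (simp add: bops_scaleC[OF T] norm_scaleC norm_divide field_simps)
 qed simp
qed

lemma expv_exp_space: "step f ==> \<varpi> f \<in> exp_space"
 unfolding exp_space_def by (rule cspan_base) simp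

text \<open>Moving \<open>j t a\<close> to the left as its adjoint, which is adapted too, leaves an
  inner product of two vectors that both split at \<open>t\<close>.\<close>

lemma (in qs_flow) j_compose_adapted:
 assumes X: "adapted_at t X" and a: "a \<in> A" and t: "0 <= t"
 shows "adapted_at t (%x. j t a (X x))"
 unfolding adapted_at_def
proof (intro ballI allI)
 fix f g :: "real => 'k" and u v :: 'h
 assume f: "step f" and g: "step g"
 note c = cinner_split_at[OF t, symmetric, where ?'h = 'h and ?'k = 'k]
 have "adj (j t a) = j t (adj a)" using normal_hom_adj[OF j_hom[OF t] a] by simp
 then have J: "adapted_at t (blinfun_apply (adj (j t a)))" using j_adapted[OF vn_adj[OF vn a] t] by simp
 have *: "ip x (j t a y) = ip (adj (j t a) x) y" for x y using cinner_adj_left[OF j_bops[OF a t]] by simp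
 show "ip (u ** f) (j t a (X (v ** g))) =
  ip (\<varpi> (restr {t..} f)) (\<varpi> (restr {t..} g)) *
  ip (u ** (restr {0..<t} f)) (j t a (X (v ** (restr {0..<t} g))))"
  unfolding *
  by (subst c) (simp add: adapted_split[OF J f t] adapted_split[OF X g t] cinner_tens)
qed

locale multiplier_flow = qs_flow A j
 for A :: "('h::chilbert =>L 'h) set" and j :: "('h, 'k::chilbert) map_family" +
 fixes Y :: "('h, 'k) bop_family"
 assumes mult: "multiplier_cocycle A j Y" and lub: "locally_uniformly_bounded Y"
  and growth: "\<forall>\<epsilon>\<in>exp_space. Limsup (at_right 0) (%t. ereal (t powr (-1/2)) *
   (cb_norm A (%a. ket_map (assoc_cocycle j Y t) \<epsilon> a - ket_map \<iota> \<epsilon> a) +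
   cb_norm A (%a. ket_map (dagger (assoc_cocycle j Y) t) \<epsilon> a - ket_map \<iota> \<epsilon> a))) < \<infinity>"
begin

lemma Y_process: "bounded_process_in A Y"
 using mult by (simp add: multiplier_cocycle_def)

lemma Y_bops: "0 <= t ==> Y t \<in> bops"
 using Y_process by (simp add: bounded_process_in_def)

lemma Y_affiliated: "0 <= t ==> affiliated (Y t)"
 by (rule bounded_process_affiliated[OF Y_process])

lemma Y_adapted: "0 <= t ==> adapted_at t (blinfun_apply (Y t))"
 by (rule bounded_process_adapted[OF Y_process])

lemma Y_zero: "Y 0 = idL"
 using mult by (simp add: multiplier_cocycle_def)

lemma Y_cocycle: "0 <= s ==> 0 <= t ==> Y (s + t) = J s (Y t) oo Y s"
 using mult unfolding multiplier_cocycle_def by blast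

lemma Y_bound: obtains M where "0 <= M" "!!t. 0 <= t ==> t <= T ==> norm (Y t) <= M"
proof -
 obtain M where M: "ALL x:(%t. norm (Y t)) ` {0..T}. x <= M" using lub unfolding locally_uniformly_bounded_def bdd_above_def by blast
 show ?thesis by (rule that[of "max M 0"]) (use M in \<open>auto simp: le_max_iff_disj\<close>)
qed

lemma j_scale: "0 <= t ==> a \<in> A ==> j t (c *\<^sub>C a) = c *\<^sub>C j t a"
 using normal_hom_scale[OF j_hom] by blast

lemma j_id: "0 <= t ==> j t idL = idL"
 using j_hom by (simp add: normal_hom_def)

text \<open>Both cb norms are nonnegative, so a bound for their sum bounds each. The first is read
  off at every \<open>a\<close>, the second at the identity, where the dagger turns it into a column
  of the adjoint of \<open>Y t\<close>.\<close>

lemma growth_ket: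
 assumes \<epsilon>: "\<epsilon> \<in> exp_space"
 obtains C \<delta> where "0 <= C" "0 < \<delta>"
  "!!t a. 0 < t ==> t < \<delta> ==> a \<in> A ==> norm (((j t a oo Y t) - \<iota> a) oo tens_ket \<epsilon>) <= C * sqrt t * norm a"
  "!!t. 0 < t ==> t < \<delta> ==> norm ((adj (Y t) - idL) oo tens_ket \<epsilon>) <= C * sqrt t"
proof -
 define \<alpha> where "\<alpha> t = cb_norm A (%a. ket_map (assoc_cocycle j Y t) \<epsilon> a - ket_map \<iota> \<epsilon> a)" for t
 define \<beta> where "\<beta> t = cb_norm A (%a. ket_map (dagger (assoc_cocycle j Y) t) \<epsilon> a - ket_map \<iota> \<epsilon> a)" for t
 have nn: "0 <= \<alpha> t" "0 <= \<beta> t" for t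
  using cb_norm_bound[OF vn_zero[OF vn], of 0 "%a. ket_map (assoc_cocycle j Y t) \<epsilon> a - ket_map \<iota> \<epsilon> a"]
   cb_norm_bound[OF vn_zero[OF vn], of 0 "%a. ket_map (dagger (assoc_cocycle j Y) t) \<epsilon> a - ket_map \<iota> \<epsilon> a"]
  by (auto simp: \<alpha>_def \<beta>_def zero_ereal_def)
 have "Limsup (at_right 0) (%t. ereal (t powr (-1/2)) * (\<alpha> t + \<beta> t)) < \<infinity>"
  using growth \<epsilon> unfolding \<alpha>_def \<beta>_def by blast
 from ereal_dense2[OF this]
 obtain C where C: "Limsup (at_right 0) (%t. ereal (t powr (-1/2)) * (\<alpha> t + \<beta> t)) < ereal C" by (elim exE conjE)
 from Limsup_lessD[OF this, unfolded eventually_at_right_field] obtain \<delta> where \<delta>0: "0 < \<delta>"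
  "ALL t>0. t < \<delta> --> ereal (t powr (-1/2)) * (\<alpha> t + \<beta> t) < ereal C"
  by (elim exE conjE)
 note \<delta> = \<delta>0(1) \<delta>0(2)[rule_format]
 have key: "\<alpha> t <= ereal (\<bar>C\<bar> * sqrt t)" "\<beta> t <= ereal (\<bar>C\<bar> * sqrt t)" if t: "0 < t" "t < \<delta>" for t
 proof -
  have p: "t powr (-1/2) = 1 / sqrt t" using t by (simp add: powr_minus_divide powr_half_sqrt)
  have "\<alpha> t + \<beta> t ~= \<infinity>" using \<delta>(2)[OF t] t unfolding p by auto
  then obtain x y where xy: "\<alpha> t = ereal x" "\<beta> t = ereal y" "0 <= x" "0 <= y"
   using nn[of t] by (cases "\<alpha> t"; cases "\<beta> t") auto
  have "(x + y) / sqrt t < C" using \<delta>(2)[OF t] unfolding p xy by simp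
  then have "x + y < C * sqrt t" using t by (simp add: field_simps)
  moreover have "C * sqrt t <= \<bar>C\<bar> * sqrt t" using t by (intro mult_right_mono) auto
  ultimately show "\<alpha> t <= ereal (\<bar>C\<bar> * sqrt t)" "\<beta> t <= ereal (\<bar>C\<bar> * sqrt t)" using xy by auto
 qed
 show ?thesis
 proof (rule that[of "\<bar>C\<bar>" \<delta>])
  fix t a assume t: "0 < t" "t < \<delta>" and a: "a \<in> A"
  have ab: "bop a" using a A_bops by auto
  show "norm (((j t a oo Y t) - \<iota> a) oo tens_ket \<epsilon>) <= \<bar>C\<bar> * sqrt t * norm a"
  proof (cases "a = 0")
   case True
   have "j t 0 = 0" using j_scale[OF less_imp_le[OF t(1)] vn_zero[OF vn], of 0] by simp
   then show ?thesis using True by (simp add: ampl_map_def)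
  next
   case False
   define \<Psi> where "\<Psi> = ((j t a oo Y t) - \<iota> a) oo tens_ket \<epsilon>"
   let ?a = "complex_of_real (1 / norm a) *\<^sub>C a"
   have a': "?a \<in> A" by (rule vn_scale[OF vn a])
   have na: "norm ?a <= 1" using False by (simp add: norm_scaleC_blinfun norm_divide)
   have \<Psi>: "ket_map (assoc_cocycle j Y t) \<epsilon> ?a - ket_map \<iota> \<epsilon> ?a = complex_of_real (1 / norm a) *\<^sub>C \<Psi>"
    using t a ab by (intro blinfun_eqI)
     (simp add: \<Psi>_def ket_map_def assoc_cocycle_def ampl_map_def j_scale op_tensor_scale_left blinfun.diff_left CV.scale_right_diff_distrib)
   have "norm (complex_of_real (1 / norm a) *\<^sub>C \<Psi>) <= \<bar>C\<bar> * sqrt t"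
   proof (rule norm_le_unit_ball)
    show "complex_of_real (1 / norm a) *\<^sub>C \<Psi> \<in> bops"
     using t ab by (simp add: \<Psi>_def j_bops[OF a] Y_bops ampl_map_def)
    fix \<xi> :: 'h assume "norm \<xi> <= 1"
    then show "norm ((complex_of_real (1 / norm a) *\<^sub>C \<Psi>) \<xi>) <= \<bar>C\<bar> * sqrt t"
     using order_trans[OF cb_norm_bound[OF a' na] key(1)[OF t, unfolded \<alpha>_def], of \<xi>] unfolding \<Psi> by simp
   qed
   then show ?thesis using False unfolding \<Psi>_def[symmetric]
    by (simp add: norm_scaleC_blinfun norm_divide field_simps)
  qed
 next
  fix t assume t: "0 < t" "t < \<delta>"
  have "dagger (assoc_cocycle j Y) t idL = adj (Y t)"
   using t j_id[of t] by (simp add: dagger_def assoc_cocycle_def)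
  then have \<Psi>: "ket_map (dagger (assoc_cocycle j Y) t) \<epsilon> idL - ket_map \<iota> \<epsilon> idL = (adj (Y t) - idL) oo tens_ket \<epsilon>"
   by (simp add: ket_map_def ampl_map_def compose_diff)
  show "norm ((adj (Y t) - idL) oo tens_ket \<epsilon>) <= \<bar>C\<bar> * sqrt t"
  proof (rule norm_le_unit_ball)
   fix \<xi> :: 'h assume "norm \<xi> <= 1"
   then show "norm (((adj (Y t) - idL) oo tens_ket \<epsilon>) \<xi>) <= \<bar>C\<bar> * sqrt t"
    using order_trans[OF cb_norm_bound[OF vn_id[OF vn] norm_blinfun_id_le] key(2)[OF t, unfolded \<beta>_def], of \<xi>]
    unfolding \<Psi> by simp
  qed (use t Y_bops in simp)
 qed (use \<delta> in auto)
qed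

text \<open>Divided by the inner product of the two exponential vectors; this removes the
  contribution of the Fock vectors themselves and makes the family a semigroup starting at the
  identity map.\<close>

definition Q :: "'k => 'k => real => ('h =>L 'h) => 'h =>L 'h"
 where "Q c d t a = exp (- (of_real t * xi c d)) *\<^sub>C
  right_slice (\<varpi> (restr {0..<t} (%_. c))) (\<varpi> (restr {0..<t} (%_. d))) (j t a oo Y t)"

lemma jY_affiliated: "a \<in> A ==> 0 <= t ==> affiliated (j t a oo Y t)"
 by (intro affiliated_compose Y_affiliated bounded_process_affiliated[OF j_process])

lemma jY_adapted: "a \<in> A ==> 0 <= t ==> adapted_at t (blinfun_apply (j t a oo Y t))"
proof -
 assume a: "a \<in> A" "0 <= t"
 have "blinfun_apply (j t a oo Y t) = (%x. j t a (Y t x))" by (rule ext) simp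
 then show ?thesis using j_compose_adapted[OF Y_adapted a] a by simp
qed

lemma Q_mem: "a \<in> A ==> 0 <= t ==> Q c d t a \<in> A"
 using jY_affiliated unfolding Q_def affiliated_def by (blast intro: vn_scale[OF vn])

lemma cinner_Q: "ip u (Q c d t a v) = exp (- (of_real t * xi c d)) *
  ip (u ** (restr {0..<t} (%_. c))) (j t a (Y t (v ** (restr {0..<t} (%_. d)))))"
 by (simp add: Q_def cinner_right_slice cinner_simps)

text \<open>By adaptedness, \<open>f\<close> and \<open>g\<close> after time \<open>t\<close> enter
  through a scalar only. This allows one fixed pair of test functions to be used for all small
  \<open>t\<close>.\<close>

lemma slice_Q:
 assumes f: "step f" "!!s. 0 <= s ==> s < t ==> f s = c" and g: "step g" "!!s. 0 <= s ==> s < t ==> g s = d"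
  and a: "a \<in> A" and t: "0 <= t"
 shows "ip (u ** f) (j t a (Y t (v ** g))) = ip (\<varpi> f) (\<varpi> g) * ip u (Q c d t a v)"
proof -
 have r: "restr {0..<t} f = restr {0..<t} (%_. c)" "restr {0..<t} g = restr {0..<t} (%_. d)"
  using f(2) g(2) by (auto simp: restr_def)
 have "ip (\<varpi> f) (\<varpi> g) = exp (of_real t * xi c d) * ip (\<varpi> (restr {t..} f)) (\<varpi> (restr {t..} g))"
  unfolding cinner_expv_split[OF f(1) g(1) t] r by (simp add: cinner_expv_chi chi_const t)
 then show ?thesis
  using adaptedD[OF jY_adapted[OF a t] f(1) g(1), of u v] unfolding r cinner_Q by (simp add: exp_minus)
qed

text \<open>The cocycle identities of \<open>j\<close> and \<open>Y\<close> combine into one for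
  \<open>j t a oo Y t\<close> because the flow semigroup is multiplicative. Slicing it against
  functions that are constant up to time \<open>s + t\<close> shifts the inner slice to the same
  constants.\<close>

lemma Q_semigroup:
 assumes s: "0 <= s" and t: "0 <= t" and a: "a \<in> A"
 shows "Q c d (s + t) a = Q c d s (Q c d t a)"
proof (rule blinfun_eqI, rule cinner_ext)
 fix v u
 let ?c = "%r. restr {0..<r} (%_. c)" and ?d = "%r. restr {0..<r} (%_. d)"
 have r: "restr {0..<s} (?c (s + t)) = ?c s" "restr {0..<s} (?d (s + t)) = ?d s"
  using t by (auto simp: restr_def)
 have l: "lshift s (?c (s + t)) = ?c t" "lshift s (?d (s + t)) = ?d t"
  using s t by (auto simp: restr_def lshift_def fun_eq_iff)
 let ?Z = "j t a oo Y t"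
 have "right_slice (\<varpi> (?c t)) (\<varpi> (?d t)) ?Z = exp (of_real t * xi c d) *\<^sub>C Q c d t a"
  by (simp add: Q_def exp_minus)
 then have jr: "j s (right_slice (\<varpi> (?c t)) (\<varpi> (?d t)) ?Z) = exp (of_real t * xi c d) *\<^sub>C j s (Q c d t a)"
  using j_scale[OF s Q_mem[OF a t]] by simp
 have "j (s + t) a oo Y (s + t) = J s ?Z oo Y s"
  unfolding j_cocycle[OF a s t] Y_cocycle[OF s t]
   J_compose[OF bounded_process_affiliated[OF j_process[OF a] t] Y_affiliated[OF t] s] by (simp only: compose_assoc)
 then have "(j (s + t) a oo Y (s + t)) x = (J s ?Z oo Y s) x" for x by (simp only:)
 then have "ip (u ** (?c (s + t))) (j (s + t) a (Y (s + t) (v ** (?d (s + t))))) =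
   ip (u ** (?c (s + t))) (J s ?Z (Y s (v ** (?d (s + t)))))" by simp
 also have "... = exp (of_real t * xi c d) * ip (u ** (?c s)) (j s (Q c d t a) (Y s (v ** (?d s))))"
  unfolding J_matrix[OF jY_affiliated[OF a t] s Y_adapted[OF s] const_step const_step] r l jr
  by (simp add: cinner_simps)
 finally have "ip u (Q c d (s + t) a v) = exp (- (of_real (s + t) * xi c d)) * (exp (of_real t * xi c d) *
   ip (u ** (?c s)) (j s (Q c d t a) (Y s (v ** (?d s)))))"
  unfolding cinner_Q[of u] by (simp only:)
 moreover have "exp (- (of_real (s + t) * xi c d)) * exp (of_real t * xi c d) = exp (- (of_real s * xi c d))"
  by (simp add: mult_exp_exp algebra_simps)
 ultimately show "ip u (Q c d (s + t) a v) = ip u (Q c d s (Q c d t a) v)"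
  unfolding cinner_Q[of u] by (simp only: mult.assoc[symmetric])
qed

lemma Q_add: "0 <= t ==> a \<in> A ==> b \<in> A ==> Q c d t (a + b) = Q c d t a + Q c d t b"
 by (rule blinfun_eqI, rule cinner_ext)
  (simp add: blinfun.add_left cinner_simps cinner_Q algebra_simps normal_hom_add[OF j_hom])

text \<open>Test functions supported on the fixed unit interval serve for all t < 1, so the growth
  condition is invoked at a single exponential vector and its constants are uniform.
  \<open>K\<close> undoes the inner product of the two test vectors.\<close>

lemma Q_continuous:
 obtains C \<delta> where "0 <= C" "0 < \<delta>"
  "!!t a. 0 <= t ==> t < \<delta> ==> a \<in> A ==> norm (Q c d t a - a) <= C * sqrt t * norm a"
proof -
 let ?c = "restr {0..<1} (%_. c)" and ?d = "restr {0..<1} (%_. d)"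
 obtain C \<delta> where C: "0 <= C" "0 < \<delta>"
  "!!t a. 0 < t ==> t < \<delta> ==> a \<in> A ==> norm (((j t a oo Y t) - \<iota> a) oo tens_ket (\<varpi> ?d)) <= C * sqrt t * norm a"
  by (rule growth_ket[OF expv_exp_space[of ?d]]) auto
 define K where "K = cmod (exp (- xi c d))"
 have xe: "ip (\<varpi> ?c) (\<varpi> ?d) = exp (xi c d)" by (simp add: cinner_expv_chi chi_const)
 show ?thesis
 proof (rule that[of "K * C" "min \<delta> 1"])
  fix t a assume t: "0 <= t" "t < min \<delta> 1" and a: "a \<in> A"
  have ab: "bop a" using a A_bops by auto
  show "norm (Q c d t a - a) <= K * C * sqrt t * norm a"
  proof (cases "t = 0")
   case True
   have e: "restr {0..<t} h = (%_. 0)" for h :: "real => 'k" using True by (auto simp: restr_def)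
   have "j 0 a = \<iota> a" using flow a unfolding QS_flow_def QS_cocycle_def by blast
   then have "ip u (Q c d 0 a v) = ip u (a v)" for u v
    by (simp add: cinner_Q Y_zero ampl_map_def ab cinner_tens)
   then have "Q c d t a = a" unfolding True by (rule blinfun_eqI[OF cinner_ext])
   then show ?thesis using C(1) t(1) by (simp add: K_def)
  next
   case False
   let ?Z = "((j t a oo Y t) - \<iota> a) oo tens_ket (\<varpi> ?d)"
   have "Q c d t a - a = exp (- xi c d) *\<^sub>C (adj (tens_ket (\<varpi> ?c)) oo ?Z)"
   proof (rule blinfun_eqI, rule cinner_ext)
    fix u v
    have "ip v ((adj (tens_ket (\<varpi> ?c)) oo ?Z) u) = exp (xi c d) * ip v ((Q c d t a - a) u)"
     using slice_Q[of ?c t c ?d d a v u] t a ab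
     by (simp add: cinner_adj_right blinfun.diff_left cinner_diff_right xe ampl_map_def cinner_tens restr_def algebra_simps)
    then show "ip v ((Q c d t a - a) u) = ip v ((exp (- xi c d) *\<^sub>C (adj (tens_ket (\<varpi> ?c)) oo ?Z)) u)"
     by (simp add: cinner_simps exp_minus)
   qed
   then have "norm (Q c d t a - a) = K * norm (adj (tens_ket (\<varpi> ?c)) oo ?Z)"
    by (simp add: norm_scaleC_blinfun K_def)
   also have "norm (adj (tens_ket (\<varpi> ?c)) oo ?Z) <= 1 * (C * sqrt t * norm a)"
   proof (rule order_trans[OF norm_blinfun_compose mult_mono])
    show "norm (adj (tens_ket (\<varpi> ?c)) :: _ =>L 'h) <= 1"
     using norm_tens_ket_le[of "\<varpi> ?c"] by (simp add: norm_adj)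
    show "norm ?Z <= C * sqrt t * norm a" using C(3) False t a by auto
   qed auto
   finally show ?thesis by (simp add: mult_ac K_def)
  qed
 qed (use C in \<open>auto simp: K_def\<close>)
qed

lemma generator_exists:
 "EX G:A. ((%h. (Q c d h idL - idL) /\<^sub>R h) ---> G) (at_right 0)"
proof -
 obtain C \<delta> where C: "0 <= C" "0 < \<delta>"
  "!!t a. 0 <= t ==> t < \<delta> ==> a \<in> A ==> norm (Q c d t a - a) <= C * sqrt t * norm a"
  using Q_continuous[of c d] by blast
 have "subspace A" unfolding subspace_def using vn_zero[OF vn] vn_add[OF vn] vn_scaleR[OF vn] by blast
 then show ?thesis
  by (rule semigroup_derivative[OF vn_closed[OF vn], where Q = "Q c d" and C = C and \<delta> = \<delta>])
   (simp_all add: Q_mem Q_add Q_semigroup C vn_id[OF vn])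
qed

definition gen :: "'k => 'k => 'h =>L 'h"
 where "gen c d = (SOME G. G \<in> A & ((%h. (Q c d h idL - idL) /\<^sub>R h) ---> G) (at_right 0))"

lemma gen_mem: "gen c d \<in> A"
 and gen_tendsto: "((%h. (Q c d h idL - idL) /\<^sub>R h) ---> gen c d) (at_right 0)"
 using someI_ex[OF generator_exists[of c d, unfolded Bex_def]] unfolding gen_def by auto

end

lemma tendsto_exp_quotient: "((%h. (exp (complex_of_real h * z) - 1) / complex_of_real h) ---> z) (at_right 0)"
proof (cases "z = 0")
 case False
 have "((%h. complex_of_real h * z) ---> complex_of_real 0 * z) (at_right 0)" by (intro tendsto_intros)
 then have "filterlim (%h. complex_of_real h * z) (at 0) (at_right 0)"
  using False by (auto simp: filterlim_at eventually_at_right_field intro!: exI[of _ 1])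
 from filterlim_compose[OF lim_exp_minus_1 this]
 have "((%h. z * ((exp (complex_of_real h * z) - 1) / (complex_of_real h * z))) ---> z * 1) (at_right 0)"
  by (intro tendsto_intros)
 then show ?thesis using False by simp
qed simp

text \<open>The exponential vector stripped of its normalisation: to first order in
  \<open>h\<close>, inner products are then 1 plus h times those in the noise space.\<close>

definition ev :: "'k::chilbert => real => 'k fock"
 where "ev c h = exp (complex_of_real (h * (norm c)\<^sup>2 / 2)) *\<^sub>C \<varpi> (restr {0..<h} (%_. c))"

lemma ev_weight: "exp (complex_of_real (h * (norm c)\<^sup>2 / 2)) * (exp (complex_of_real (h * (norm d)\<^sup>2 / 2)) *
  exp (of_real h * xi c d)) = exp (of_real h * ip c d)"
 unfolding mult_exp_exp by (rule arg_cong[where f = exp]) (simp add: xi_def algebra_simps)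

lemma cinner_ev: "0 <= h ==> ip (ev c h) (ev d h) = exp (of_real h * ip c d)"
 unfolding ev_weight[symmetric]
 by (simp add: ev_def cinner_simps cinner_expv_chi chi_const mult_ac exp_cnj)

lemma ev_zero [simp]: "ev 0 h = \<Omega>"
 by (simp add: ev_def)

text \<open>Each (w, c) is (1, c) plus a multiple of (1, 0), so nothing is lost by fixing the first
  component at 1.\<close>

lemma total_hat: "closure (cspan (range (%(c :: 'k::chilbert, u :: 'h::chilbert). (1 :: complex, c) \<otimes> u))) = UNIV"
 unfolding closure_cspan_UNIV_iff
proof (intro allI impI)
 fix z :: "(complex \<times> 'k, 'h) tensor"
 assume "ALL x:range (%(c, u). (1, c) \<otimes> u). ip x z = 0"
 then have z: "ip ((1, c) \<otimes> u) z = 0" for c u by auto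
 show "z = 0"
 proof (rule total_ext[OF total_tens])
  fix x assume "x \<in> {u \<otimes> x | (u :: complex \<times> 'k) (x :: 'h). True}"
  then obtain w c u where x: "x = (w, c) \<otimes> u" by auto
  have "(w, c) = (1, c) + (w - 1) *\<^sub>C (1, 0)" by (simp add: scaleC_prod_def scaleC_complex_def)
  then show "ip x z = ip x 0" by (simp add: x tens_add_left tens_scale_left cinner_simps z)
 qed
qed

text \<open>To first order, the increments \<open>ev (c k) h - ev 0 h\<close> have h times the Gram
  matrix of the \<open>c k\<close>: they behave like sqrt h times noise vectors. The limit is thus
  the squared norm of the noise component of \<open>X\<close>.\<close>

lemma ev_sum_tendsto:
 fixes m :: nat and u :: "nat => 'h::chilbert" and c :: "nat => 'k::chilbert"
 defines "p \<equiv> (\<Sum>k<m. u k)" and "X \<equiv> (\<Sum>k<m. (1 :: complex, c k) \<otimes> u k)"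
 shows "((%h. (norm ((\<Sum>k<m. u k \<otimes> ev (c k) h) - p \<otimes> \<Omega>))\<^sup>2 / h) ---> (norm X)\<^sup>2 - (norm p)\<^sup>2) (at_right 0)"
proof -
 have sums: "ip (\<Sum>k<m. x k) (\<Sum>k<m. x k) = (\<Sum>k<m. \<Sum>l<m. ip (x k) (x l))" for x :: "nat => 'x::chilbert"
  unfolding cinner_sum_left by (simp only: cinner_sum_right)
 let ?D = "%h. (\<Sum>k<m. u k \<otimes> ev (c k) h) - p \<otimes> \<Omega>"
 have D: "?D h = (\<Sum>k<m. u k \<otimes> (ev (c k) h - ev 0 h))" for h by (simp add: p_def tens_sum_left tens_diff_right sum_subtractf)
 have "((%h. \<Sum>k<m. \<Sum>l<m. ip (u k) (u l) * ((exp (of_real h * ip (c k) (c l)) - 1) / of_real h)) --->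
   (\<Sum>k<m. \<Sum>l<m. ip (u k) (u l) * ip (c k) (c l))) (at_right 0)"
  by (intro tendsto_intros tendsto_exp_quotient)
 also have "(\<Sum>k<m. \<Sum>l<m. ip (u k) (u l) * ip (c k) (c l)) = ip X X - ip p p"
  unfolding X_def p_def sums by (simp add: cinner_tens cinner_prod_def cinner_complex_def algebra_simps flip: sum_subtractf)
 finally have "((%h. ip (?D h) (?D h) / of_real h) ---> ip X X - ip p p) (at_right 0)"
 proof (rule Lim_transform_eventually)
  show "\<forall>\<^sub>F h in at_right 0. (\<Sum>k<m. \<Sum>l<m. ip (u k) (u l) * ((exp (of_real h * ip (c k) (c l)) - 1) / of_real h)) =
    ip (?D h) (?D h) / of_real h"
   using eventually_at_right_less[of 0]
   by eventually_elim (simp only: D sums sum_divide_distrib cinner_tens cinner_diff_left cinner_diff_right cinner_ev less_imp_le, simp)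
 qed
 from tendsto_Re[OF this] show ?thesis by (simp add: norm_sq_cinner)
qed

context multiplier_flow
begin

text \<open>The form is the limit of matrix elements of \<open>Y h - idL\<close> divided by
  \<open>h\<close>. Splitting each side into a vacuum part and an increment gives four terms.
  Increments have order sqrt h, so the mixed terms need only order sqrt h from the growth condition,
  one half of it for each side, and the last term needs only boundedness of
  \<open>Y h\<close>.\<close>

lemma gen_form_bound:
 obtains K where "0 <= K" "!!(m::nat) (n::nat) c u d v. cmod (\<Sum>k<m. \<Sum>r<n. ip (u k) (gen (c k) (d r) (v r))) <=
  K * norm (\<Sum>k<m. (1 :: complex, c k) \<otimes> u k) * norm (\<Sum>r<n. (1 :: complex, d r) \<otimes> v r)"
proof -
 obtain C \<delta> where C: "0 <= C" "0 < \<delta>"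
  "!!t a. 0 < t ==> t < \<delta> ==> a \<in> A ==> norm (((j t a oo Y t) - \<iota> a) oo tens_ket \<Omega>) <= C * sqrt t * norm a"
  "!!t. 0 < t ==> t < \<delta> ==> norm ((adj (Y t) - idL) oo tens_ket \<Omega>) <= C * sqrt t"
  using growth_ket[OF expv_exp_space[OF step_funs_zero]] by blast
 obtain M where M: "0 <= M" "!!t. 0 <= t ==> t <= \<delta> ==> norm (Y t) <= M" using Y_bound by blast
 \<comment> \<open>The summands belong, in order, to the pairs vacuum-vacuum, increment-vacuum,
   vacuum-increment and increment-increment.\<close>
 define K where "K = norm (gen 0 0) + C + C + (M + 1)"
 show ?thesis
 proof (rule that)
  show "0 <= K" using C(1) M(1) by (simp add: K_def)
  fix m n :: nat and c d :: "nat => 'k" and u v :: "nat => 'h"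
  let ?X = "norm (\<Sum>k<m. (1 :: complex, c k) \<otimes> u k)" and ?X' = "norm (\<Sum>r<n. (1 :: complex, d r) \<otimes> v r)"
  define p q where "p = (\<Sum>k<m. u k)" and "q = (\<Sum>r<n. v r)"
  define E E' where "E h = (\<Sum>k<m. u k \<otimes> ev (c k) h)" and "E' h = (\<Sum>r<n. v r \<otimes> ev (d r) h)" for h
  define D D' where "D h = E h - p \<otimes> \<Omega>" and "D' h = E' h - q \<otimes> \<Omega>" for h
  define e e' where "e h = norm (D h) / sqrt h" and "e' h = norm (D' h) / sqrt h" for h
  have lim: "((%h. norm ((\<Sum>k<m. u k \<otimes> ev (c k) h) - (\<Sum>k<m. u k) \<otimes> \<Omega>) / sqrt h) --->
    sqrt ((norm (\<Sum>k<m. (1 :: complex, c k) \<otimes> u k))\<^sup>2 - (norm (\<Sum>k<m. u k))\<^sup>2)) (at_right 0)" for m :: nat and c :: "nat => 'k" and u :: "nat => 'h"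
   using tendsto_real_sqrt[OF ev_sum_tendsto[where m = m and c = c and u = u]] by (simp add: real_sqrt_divide)
  have W: "(e ---> sqrt (?X\<^sup>2 - (norm p)\<^sup>2)) (at_right 0)" "(e' ---> sqrt (?X'\<^sup>2 - (norm q)\<^sup>2)) (at_right 0)"
   unfolding e_def e'_def D_def D'_def E_def E'_def p_def q_def by (rule lim)+
  have "norm (\<Sum>k<m. u k) <= norm (\<Sum>k<m. (1 :: complex, c k) \<otimes> u k)" for m :: nat and c :: "nat => 'k" and u :: "nat => 'h"
  proof -
   have "0 <= (norm (\<Sum>k<m. (1 :: complex, c k) \<otimes> u k))\<^sup>2 - (norm (\<Sum>k<m. u k))\<^sup>2"
    by (rule tendsto_lowerbound[OF ev_sum_tendsto]) (auto simp: eventually_at_right_field intro!: exI[of _ 1])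
   then show ?thesis unfolding diff_ge_0_iff_ge by (rule power2_le_imp_le) (rule norm_ge_zero)
  qed
  then have p: "norm p <= ?X" "norm q <= ?X'" unfolding p_def q_def by auto
  then have s: "sqrt (?X\<^sup>2 - (norm p)\<^sup>2) <= ?X" "sqrt (?X'\<^sup>2 - (norm q)\<^sup>2) <= ?X'" "0 <= ?X\<^sup>2 - (norm p)\<^sup>2" "0 <= ?X'\<^sup>2 - (norm q)\<^sup>2"
   by (auto intro: real_le_lsqrt power_mono)
  let ?g = "%c d h. (Q c d h idL - idL) /\<^sub>R h" and ?T = "%h. Y h - idL"
  let ?S = "%h. ip (E h) (?T h (E' h))"
  \<comment> \<open>Limit of the left-hand side; the weights that relate \<open>ev\<close> to
    normalised exponential vectors tend to 1.\<close>
  have "((%h. \<Sum>k<m. \<Sum>r<n. exp (of_real h * ip (c k) (d r)) * ip (u k) (?g (c k) (d r) h (v r))) --->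
    (\<Sum>k<m. \<Sum>r<n. exp (of_real 0 * ip (c k) (d r)) * ip (u k) (gen (c k) (d r) (v r)))) (at_right 0)"
   by (intro tendsto_intros blinfun.tendsto gen_tendsto)
  moreover have "\<forall>\<^sub>F h in at_right 0. (\<Sum>k<m. \<Sum>r<n. exp (of_real h * ip (c k) (d r)) * ip (u k) (?g (c k) (d r) h (v r))) = ?S h / of_real h"
   using eventually_at_right_less[of 0]
  proof eventually_elim
   case (elim h)
   have "ip (x \<otimes> ev c h) (?T h (y \<otimes> ev d h)) = exp (of_real h * ip c d) * ip x ((Q c d h idL - idL) y)" for x y c d
   proof -
    have "ip (x ** (restr {0..<h} (%_. c))) (Y h (y ** (restr {0..<h} (%_. d)))) = exp (of_real h * xi c d) * ip x (Q c d h idL y)"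
     using elim by (simp add: cinner_Q j_id exp_minus)
    then show ?thesis unfolding ev_weight[symmetric]
     using elim by (simp add: ev_def tens_scale_right bops_scaleC Y_bops cinner_simps blinfun.diff_left cinner_tens
      cinner_expv_chi chi_const algebra_simps exp_cnj)
   qed
   then show ?case unfolding E_def E'_def cinner_sum_left blinfun.sum_right
    by (simp add: cinner_sum_right blinfun.scaleR_left scaleR_scaleC cinner_simps divide_inverse mult_ac flip: sum_distrib_left)
  qed
  ultimately have "((%h. ?S h / of_real h) ---> (\<Sum>k<m. \<Sum>r<n. ip (u k) (gen (c k) (d r) (v r)))) (at_right 0)"
   (is "(_ ---> ?L) _") using Lim_transform_eventually by (simp only: of_real_0 mult_zero_left exp_zero mult_1)
  then have lim1: "((%h. cmod (?S h / of_real h)) ---> cmod ?L) (at_right 0)" by (rule tendsto_norm)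
  let ?R = "%h. norm (?g 0 0 h) * (norm p * norm q) + C * (e h * norm q) + C * (norm p * e' h) + (M + 1) * (e h * e' h)"
  have lim2: "(?R ---> norm (gen 0 0) * (norm p * norm q) + C * (sqrt (?X\<^sup>2 - (norm p)\<^sup>2) * norm q) +
    C * (norm p * sqrt (?X'\<^sup>2 - (norm q)\<^sup>2)) + (M + 1) * (sqrt (?X\<^sup>2 - (norm p)\<^sup>2) * sqrt (?X'\<^sup>2 - (norm q)\<^sup>2))) (at_right 0)"
   by (intro tendsto_intros gen_tendsto W)
  have "cmod (?S h / of_real h) <= ?R h" if h: "0 < h" "h < \<delta>" for h
  proof -
   have Tb: "?T h \<in> bops" using Y_bops h by simp
   have hh: "sqrt h * sqrt h = h" using h by simp
   have eD: "norm (D h) = e h * sqrt h" "norm (D' h) = e' h * sqrt h" using h by (simp_all add: e_def e'_def)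
   have "ip (p \<otimes> \<Omega>) (?T h (q \<otimes> \<Omega>)) = of_real h * ip p (?g 0 0 h q)"
    using h by (simp add: blinfun.diff_left blinfun.scaleR_left scaleR_scaleC cinner_simps cinner_Q j_id cinner_tens)
   also have "cmod ... <= h * (norm p * (norm (?g 0 0 h) * norm q))"
    using h by (simp only: norm_mult) (intro mult_mono order_trans[OF cinner_CS] mult_left_mono norm_blinfun, auto)
   finally have 1: "cmod (ip (p \<otimes> \<Omega>) (?T h (q \<otimes> \<Omega>))) <= h * (norm (?g 0 0 h) * (norm p * norm q))" by (simp add: mult_ac)
   have "norm (?T h (q \<otimes> \<Omega>)) <= C * sqrt h * norm (idL :: 'h =>L 'h) * norm q"
    using order_trans[OF norm_blinfun mult_right_mono[OF C(3)[OF h vn_id[OF vn]] norm_ge_zero], of q] h by (simp add: j_id ampl_map_def)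
   also have "... <= C * sqrt h * 1 * norm q"
    using C h by (intro mult_right_mono mult_left_mono norm_blinfun_id_le) auto
   finally have "cmod (ip (D h) (?T h (q \<otimes> \<Omega>))) <= e h * sqrt h * (C * sqrt h * norm q)"
    unfolding eD[symmetric] by (intro order_trans[OF cinner_CS] mult_left_mono) auto
   then have 2: "cmod (ip (D h) (?T h (q \<otimes> \<Omega>))) <= h * (C * (e h * norm q))" by (subst hh[symmetric]) (simp only: mult_ac)
   \<comment> \<open>Here the operator meets the increment on its right, so it is moved to the left
     and the dagger half of the growth condition takes over.\<close>
   have "ip (p \<otimes> \<Omega>) (?T h (D' h)) = ip (((adj (Y h) - idL) oo tens_ket \<Omega>) p) (D' h)"
    using cinner_adj_left[OF Tb, of "p \<otimes> \<Omega>"] Y_bops[of h] h by (simp add: adj_diff)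
   also have "cmod ... <= C * sqrt h * norm p * (e' h * sqrt h)"
    unfolding eD[symmetric] by (intro order_trans[OF cinner_CS] mult_right_mono order_trans[OF norm_blinfun] C h) auto
   finally have 3: "cmod (ip (p \<otimes> \<Omega>) (?T h (D' h))) <= h * (C * (norm p * e' h))" by (subst hh[symmetric]) (simp only: mult_ac)
   have "norm (?T h) <= M + 1"
    using h by (intro order_trans[OF norm_triangle_ineq4] add_mono M norm_blinfun_id_le) auto
   then have "cmod (ip (D h) (?T h (D' h))) <= e h * sqrt h * ((M + 1) * (e' h * sqrt h))"
    unfolding eD[symmetric] by (intro order_trans[OF cinner_CS] mult_left_mono order_trans[OF norm_blinfun] mult_right_mono) auto
   then have 4: "cmod (ip (D h) (?T h (D' h))) <= h * ((M + 1) * (e h * e' h))" by (subst hh[symmetric]) (simp only: mult_ac)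
   have "E h = p \<otimes> \<Omega> + D h" "E' h = q \<otimes> \<Omega> + D' h" by (simp_all add: D_def D'_def)
   then have "?S h = ip (p \<otimes> \<Omega>) (?T h (q \<otimes> \<Omega>)) + ip (D h) (?T h (q \<otimes> \<Omega>)) + ip (p \<otimes> \<Omega>) (?T h (D' h)) + ip (D h) (?T h (D' h))"
    by (simp only: blinfun.add_right cinner_add_left cinner_add_right add_ac)
   then have "cmod (?S h) <= h * ?R h" unfolding distrib_left by (simp only:) (intro norm_triangle_le add_mono 1 2 3 4)
   then show ?thesis using h by (simp only: norm_divide norm_of_real abs_of_pos pos_divide_le_eq mult.commute)
  qed
  then have "\<forall>\<^sub>F h in at_right 0. cmod (?S h / of_real h) <= ?R h"
   unfolding eventually_at_right_field using C(2) by blast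
  from tendsto_le[OF trivial_limit_at_right_real lim2 lim1 this]
  have "cmod ?L <= norm (gen 0 0) * (norm p * norm q) + C * (sqrt (?X\<^sup>2 - (norm p)\<^sup>2) * norm q) +
    C * (norm p * sqrt (?X'\<^sup>2 - (norm q)\<^sup>2)) + (M + 1) * (sqrt (?X\<^sup>2 - (norm p)\<^sup>2) * sqrt (?X'\<^sup>2 - (norm q)\<^sup>2))" .
  also have "... <= norm (gen 0 0) * (?X * ?X') + C * (?X * ?X') + C * (?X * ?X') + (M + 1) * (?X * ?X')"
   using C(1) M(1) s by (intro add_mono mult_left_mono mult_mono p s) auto
  also have "... = K * ?X * ?X'" by (simp add: K_def algebra_simps)
  finally show "cmod ?L <= K * ?X * ?X'" .
 qed
qed

text \<open>Scalars pass into the \<open>u k\<close> and \<open>v r\<close>, so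
  \<open>gen_form_bound\<close> is the hypothesis of \<open>form_extension\<close>. Membership in
  the tensor product then needs slices at all vectors, not only at those with first component
  1.\<close>

lemma generator_operator_exists: "EX F:vn_tensor bops A. ALL c d. left_slice (1 :: complex, c) (1, d) F = gen c d"
proof -
 obtain K where K: "0 <= K" "!!(m::nat) (n::nat) c u d v. cmod (\<Sum>k<m. \<Sum>r<n. ip (u k) (gen (c k) (d r) (v r))) <=
   K * norm (\<Sum>k<m. (1 :: complex, c k) \<otimes> u k) * norm (\<Sum>r<n. (1 :: complex, d r) \<otimes> v r)"
  by (rule gen_form_bound) blast
 let ?x = "%(c :: 'k, u :: 'h). (1 :: complex, c) \<otimes> u"
 have "EX F:bops. (ALL i l. ip (?x i) (blinfun_apply F (?x l)) = ip (snd i) (gen (fst i) (fst l) (snd l))) & norm F <= K"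
 proof (rule form_extension[OF _ K(1) total_hat])
  fix m n :: nat and a b and i l :: "nat => 'k \<times> 'h"
  show "cmod (\<Sum>k<m. \<Sum>r<n. cnj (a k) * b r * ip (snd (i k)) (gen (fst (i k)) (fst (l r)) (snd (l r)))) <=
    K * norm (\<Sum>k<m. a k *\<^sub>C ?x (i k)) * norm (\<Sum>r<n. b r *\<^sub>C ?x (l r))"
   using K(2)[of "%k. a k *\<^sub>C snd (i k)" "%k. fst (i k)" "%r. fst (l r)" "%r. b r *\<^sub>C snd (l r)" n m]
   by (simp add: case_prod_beta tens_scale_right cinner_simps bops_scaleC[OF vn_bops[OF vn gen_mem]] mult_ac)
 qed
 then obtain F :: "(complex \<times> 'k, 'h) tensor =>L (complex \<times> 'k, 'h) tensor" where F: "bop F"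
  "!!c u d v. ip ((1, c) \<otimes> u) (F ((1, d) \<otimes> v)) = ip u (gen c d v)" by fastforce
 have sl: "left_slice (1, c) (1, d) F = gen c d" for c d
  by (rule blinfun_eqI, rule cinner_ext) (simp add: cinner_left_slice F)
 have "left_slice x y F \<in> A" for x y
 proof -
  obtain w c z d where xy: "x = (w, c)" "y = (z, d)" by fastforce
  \<comment> \<open>The decomposition behind \<open>total_hat\<close>; all slices become linear
    combinations of the operators \<open>gen\<close>.\<close>
  have e: "(w, c) = (1, c) + (w - 1) *\<^sub>C (1, 0)" "(z, d) = (1, d) + (z - 1) *\<^sub>C (1, 0)"
   by (simp_all add: scaleC_prod_def scaleC_complex_def)
  have "left_slice ((1, c) + p *\<^sub>C (1, 0)) ((1, d) + q *\<^sub>C (1, 0)) F =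
    gen c d + q *\<^sub>C gen c 0 + cnj p *\<^sub>C (gen 0 d + q *\<^sub>C gen 0 0)" for p q
   by (rule blinfun_eqI, rule cinner_ext)
    (simp add: cinner_left_slice tens_add_left tens_scale_left blinfun.add_right blinfun.add_left bops_scaleC[OF F(1)]
     cinner_simps F(2) algebra_simps)
  then have "left_slice x y F = gen c d + (z - 1) *\<^sub>C gen c 0 + cnj (w - 1) *\<^sub>C (gen 0 d + (z - 1) *\<^sub>C gen 0 0)"
   unfolding xy e .
  then show ?thesis using vn_add[OF vn] vn_scale[OF vn] gen_mem by simp
 qed
 from left_slices_vn_tensor[OF F(1) A_bops this] sl show ?thesis by (intro bexI[of _ F] allI)
qed

end

subsection \<open>Piecewise continuous functions\<close>

text \<open>Reduces to \<open>tendsto_on_total\<close> by viewing a vector as the functional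
  \<open>adj (left_ket (f i))\<close>, with the complex numbers as second tensor factor; conjugation
  restores the side of the inner product.\<close>

lemma weak_tendsto_total:
 fixes f :: "'i => 'a::chilbert"
 assumes b: "\<forall>\<^sub>F i in F. norm (f i) <= C" and D: "closure (cspan D) = UNIV"
  and lim: "!!w. w \<in> D ==> ((%i. ip w (f i)) ---> ip w x) F"
 shows "((%i. ip w (f i)) ---> ip w x) F"
proof -
 have "((%i. adj (left_ket (f i)) (w \<otimes> (1 :: complex))) ---> adj (left_ket x) (w \<otimes> (1 :: complex))) F"
 proof (rule tendsto_on_total[OF _ _ total_tens_sets[OF D total_UNIV]])
  show "\<forall>\<^sub>F i in F. bop (adj (left_ket (f i)) :: _ =>L complex) & norm (adj (left_ket (f i)) :: _ =>L complex) <= C"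
   using b by eventually_elim (auto simp: norm_adj intro: order_trans[OF norm_left_ket_le])
  fix y assume "y \<in> {u \<otimes> z | u z. u \<in> D & z \<in> (UNIV :: complex set)}"
  then obtain u z where y: "y = u \<otimes> z" "u \<in> D" by blast
  have "((%i. cnj (ip u (f i))) ---> cnj (ip u x)) F" by (intro tendsto_intros lim y)
  then have "((%i. ip (f i) u) ---> ip x u) F"
   unfolding cinner_commute[of _ u] .
  then show "((%i. adj (left_ket (f i)) y) ---> adj (left_ket x) y) F"
   unfolding y by (simp add: scaleC_complex_def tendsto_mult_right)
 qed simp
 then have "((%i. ip (f i) w) ---> ip x w) F" by (simp add: scaleC_complex_def)
 from tendsto_cnj[OF this] show ?thesis unfolding cinner_commute[of w] .
qed

text \<open>Continuity outside a finite set together with local boundedness: stable under bounded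
  bilinear maps, satisfied by functions of step functions, and sufficient for strong measurability
  and local integrability without separability.\<close>

definition piecewise :: "(real => 'a::real_normed_vector) => bool"
 where "piecewise f \<longleftrightarrow> (EX B. finite B & (ALL s>=0. s \<notin> B --> (f ---> f s) (at s within {0..}))) &
  (ALL T. EX M. ALL s:{0..T}. norm (f s) <= M)"

lemma piecewise_bilinear:
 assumes h: "bounded_bilinear h" and f: "piecewise f" and g: "piecewise g"
 shows "piecewise (%s. h (f s) (g s))"
proof -
 obtain B B' where B: "finite B" "ALL s>=0. s \<notin> B --> (f ---> f s) (at s within {0..})"
  "finite B'" "ALL s>=0. s \<notin> B' --> (g ---> g s) (at s within {0..})" using f g unfolding piecewise_def by blast
 have "EX M. ALL s:{0..T}. norm (h (f s) (g s)) <= M" for T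
 proof -
  obtain M M' where M: "!!s. s \<in> {0..T} ==> norm (f s) <= M" "!!s. s \<in> {0..T} ==> norm (g s) <= M'"
   using f g unfolding piecewise_def by meson
  obtain K where K: "0 < K" "!!x y. norm (h x y) <= norm x * norm y * K" using bounded_bilinear.pos_bounded[OF h] by blast
  have "norm (h (f s) (g s)) <= \<bar>M\<bar> * \<bar>M'\<bar> * K" if "s \<in> {0..T}" for s
   using M(1)[OF that] M(2)[OF that] K(1) by (intro order_trans[OF K(2)] mult_right_mono mult_mono) auto
  then show ?thesis by blast
 qed
 moreover have "ALL s>=0. s \<notin> B Un B' --> ((%s. h (f s) (g s)) ---> h (f s) (g s)) (at s within {0..})"
  using B bounded_bilinear.tendsto[OF h] by blast
 ultimately show ?thesis unfolding piecewise_def using finite_UnI[OF B(1,3)] by blast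
qed

lemma piecewise_linear:
 assumes h: "bounded_linear h" and f: "piecewise f"
 shows "piecewise (%s. h (f s))"
proof -
 have "piecewise (%_. 1 :: real)" unfolding piecewise_def by (auto intro!: exI[of _ "{}"] exI[of _ 1])
 then have "piecewise (%s. 1 *\<^sub>R h (f s))"
  by (rule piecewise_bilinear[OF bounded_bilinear.comp[OF bounded_bilinear_scaleR bounded_linear_ident h] _ f])
 then show ?thesis by simp
qed

lemma piecewise_add:
 assumes f: "piecewise f" and g: "piecewise g"
 shows "piecewise (%s. f s + g s)"
proof -
 obtain B B' where B: "finite B" "ALL s>=0. s \<notin> B --> (f ---> f s) (at s within {0..})"
  "finite B'" "ALL s>=0. s \<notin> B' --> (g ---> g s) (at s within {0..})" using f g unfolding piecewise_def by blast
 have "EX M. ALL s:{0..T}. norm (f s + g s) <= M" for T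
 proof -
  obtain M M' where M: "!!s. s \<in> {0..T} ==> norm (f s) <= M" "!!s. s \<in> {0..T} ==> norm (g s) <= M'"
   using f g unfolding piecewise_def by meson
  then have "ALL s:{0..T}. norm (f s + g s) <= M + M'" by (auto intro!: norm_triangle_le add_mono)
  then show ?thesis by blast
 qed
 moreover have "ALL s>=0. s \<notin> B Un B' --> ((%s. f s + g s) ---> f s + g s) (at s within {0..})"
  using B tendsto_add by blast
 ultimately show ?thesis unfolding piecewise_def using finite_UnI[OF B(1,3)] by blast
qed

lemma piecewise_continuous: "continuous_on {0..} f ==> piecewise f"
proof -
 assume f: "continuous_on {0..} f"
 have "EX M. ALL s:{0..T}. norm (f s) <= M" for T
  using compact_imp_bounded[OF compact_continuous_image[OF continuous_on_subset[OF f] compact_Icc[of 0 T]]]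
  by (auto simp: bounded_iff)
 then show ?thesis using f unfolding piecewise_def continuous_on_def by (auto intro!: exI[of _ "{}"])
qed

lemma tendsto_eventually_gap:
 fixes f :: "real => 'a::topological_space"
 assumes B: "finite B" "s \<notin> B" and gap: "!!x y. 0 <= x ==> x <= y ==> {x<..y} Int B = {} ==> f x = f y" and s: "0 <= s"
 shows "(f ---> f s) (at s within {0..})"
proof (rule tendsto_eventually)
 obtain \<delta> where \<delta>: "\<delta> > 0" "{s<..s+\<delta>} Int B = {}" using finite_gap_right[OF B(1)] by blast
 obtain \<delta>' where \<delta>': "\<delta>' > 0" "{s-\<delta>'..<s} Int B = {}" using finite_gap_left[OF B(1)] by blast
 show "\<forall>\<^sub>F x in at s within {0..}. f x = f s"
  unfolding eventually_at
 proof (intro exI[of _ "min \<delta> \<delta>'"] conjI ballI impI)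
  fix x assume x: "x \<in> {0..}" "x ~= s & dist x s < min \<delta> \<delta>'"
  show "f x = f s"
  proof (cases "s <= x")
   case True
   have "{s<..x} <= {s<..s+\<delta>}" using x by (auto simp: dist_real_def)
   then have "{s<..x} Int B = {}" using \<delta>(2) by blast
   then show ?thesis using gap[of s x] s True by auto
  next
   case False
   have "{x<..s} <= insert s {s-\<delta>'..<s}" using x False by (auto simp: dist_real_def)
   then have "{x<..s} Int B = {}" using \<delta>'(2) B(2) by blast
   then show ?thesis using gap[of x s] x False by auto
  qed
 qed (use \<delta> \<delta>' in auto)
qed

lemma step_funs_finite_range: "step f ==> finite (range f)"
 using simple_functionD(1)[OF step_fun_simple_lborel] by simp

lemma piecewise_step:
 fixes f :: "real => 'k::chilbert"
 assumes f: "step f"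
 shows "piecewise (%s. h (f s) :: 'a::real_normed_vector)"
proof -
 obtain B where B: "finite B" "ALL x y. x <= y --> {x<..y} Int B = {} --> f x = f y" using step_fun_breaks[OF f] by blast
 have "((%s. h (f s)) ---> h (f s)) (at s within {0..})" if "s >= 0" "s \<notin> B" for s
  by (rule tendsto_eventually_gap[OF B(1) that(2) _ that(1)]) (use B(2) in metis)
 moreover have "EX M. ALL s:{0..T}. norm (h (f s)) <= M" for T
 proof -
  have "finite ((%s. norm (h (f s))) ` UNIV)"
   using finite_imageI[OF step_funs_finite_range[OF f], of "%x. norm (h x)"] by (simp add: image_image)
  then show ?thesis by (intro exI[of _ "Max (range (%s. norm (h (f s))))"]) (auto intro: Max_ge)
 qed
 ultimately show ?thesis unfolding piecewise_def using B(1) by blast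
qed

text \<open>The function is sampled at the grid point below its argument: finitely many values on a
  bounded interval, hence simple functions, which converge at every point of continuity.\<close>

lemma piecewise_measurable:
 fixes f :: "real => 'a::chilbert"
 assumes f: "piecewise f"
 shows "strongly_measurable (lebesgue_on {0..T}) f"
 unfolding strongly_measurable_def
proof (intro exI conjI allI)
 define d where "d n t = real_of_int \<lfloor>real (Suc n) * t\<rfloor> / real (Suc n)" for n t
 fix n
 have "d n ` {0..T} <= (%i. real_of_int i / real (Suc n)) ` {0..\<lfloor>real (Suc n) * T\<rfloor>}"
  by (auto simp: d_def intro!: imageI floor_mono mult_left_mono)
 then have "finite (d n ` {0..T})" by (rule finite_subset) simp
 moreover have "d n \<in> borel_measurable (lebesgue_on {0..T})"
  unfolding d_def by (intro measurable_restrict_space1 measurable_completion) measurable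
 ultimately have "simple_function (lebesgue_on {0..T}) (d n)" by (intro simple_function_borel_measurable) auto
 then show "simple_function (lebesgue_on {0..T}) (%t. f (d n t))" by (rule simple_function_compose1)
next
 define d where "d n t = real_of_int \<lfloor>real (Suc n) * t\<rfloor> / real (Suc n)" for n t
 obtain B where B: "finite B" "ALL s>=0. s \<notin> B --> (f ---> f s) (at s within {0..})" using f unfolding piecewise_def by blast
 have d: "(%n. d n t) ----> t" for t
 proof (rule Lim_null[THEN iffD2], rule Lim_null_comparison[OF _ LIMSEQ_inverse_real_of_nat])
  have "norm (d n t - t) <= inverse (real (Suc n))" for n
  proof -
   have "d n t - t = (real_of_int \<lfloor>real (Suc n) * t\<rfloor> - real (Suc n) * t) / real (Suc n)"
    by (simp add: d_def diff_divide_distrib)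
   moreover have "\<bar>real_of_int \<lfloor>real (Suc n) * t\<rfloor> - real (Suc n) * t\<bar> <= 1" by linarith
   ultimately show ?thesis by (simp add: divide_inverse abs_mult)
  qed
  then show "\<forall>\<^sub>F n in sequentially. norm (d n t - t) <= inverse (real (Suc n))" by simp
 qed
 have "(%n. f (d n t)) ----> f t" if t: "0 <= t" "t \<notin> B" for t
 proof -
  have "continuous (at t within {0..}) f" using B(2) t by (simp add: continuous_within)
  moreover have "0 <= d n t" for n using t by (simp add: d_def)
  ultimately show ?thesis using d[of t] unfolding continuous_within_sequentially by (auto simp: o_def)
 qed
 moreover have "AE t in lebesgue. t \<notin> B"
  by (intro AE_not_in null_sets_completionI finite_imp_null_set_lborel B)
 ultimately show "AE t in lebesgue_on {0..T}. (%n. f (d n t)) ----> f t"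
  by (subst AE_restrict_space_iff) (auto elim!: eventually_mono)
qed

lemma piecewise_nn_integral:
 fixes f :: "real => 'a::real_normed_vector"
 assumes "piecewise f"
 shows "(\<integral>\<^sup>+s. ennreal (norm (f s) ^ n) \<partial>lebesgue_on {0..T}) < \<infinity>"
proof -
 obtain M where M: "ALL s:{0..T}. norm (f s) <= M" using assms unfolding piecewise_def by blast
 have "(\<integral>\<^sup>+s. ennreal (norm (f s) ^ n) \<partial>lebesgue_on {0..T}) <= (\<integral>\<^sup>+s. ennreal (\<bar>M\<bar> ^ n) \<partial>lebesgue_on {0..T})"
 proof (intro nn_integral_mono ennreal_leI power_mono)
  fix s assume "s \<in> space (lebesgue_on {0..T})"
  then have "norm (f s) <= M" using M by simp
  then show "norm (f s) <= \<bar>M\<bar>" by linarith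
 qed simp
 also have "... < \<infinity>" by (simp add: emeasure_restrict_space emeasure_lborel_Icc_eq ennreal_mult_less_top)
 finally show ?thesis .
qed

lemma locally_integrable_piecewise:
 "piecewise f ==> locally_integrable f" "piecewise f ==> locally_square_integrable f"
 unfolding locally_integrable_def locally_square_integrable_def
 using piecewise_measurable piecewise_nn_integral[where n = 1] piecewise_nn_integral[where n = 2] by auto

lemma integrable_piecewise:
 fixes f :: "real => complex"
 assumes f: "piecewise f"
 shows "integrable (lebesgue_on {0..T}) f"
proof (rule integrableI_bounded)
 have "strongly_measurable (lebesgue_on {0..T}) (%_. 1 :: complex)" unfolding strongly_measurable_def
  by (intro exI[of _ "%_ _. 1"]) auto
 from strongly_measurable_cinner[OF _ this piecewise_measurable[OF f]]
 show "f \<in> borel_measurable (lebesgue_on {0..T})" by (simp add: cinner_complex_def)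
 show "(\<integral>\<^sup>+s. ennreal (norm (f s)) \<partial>lebesgue_on {0..T}) < \<infinity>" using piecewise_nn_integral[OF f, where n = 1] by simp
qed

lemma eventually_gap:
 fixes s :: real
 assumes B: "finite B" and d: "d > 0"
 shows "\<forall>\<^sub>F y in at s within S. {min s y<..<max s y} Int B = {} & \<bar>y - s\<bar> < d & y \<in> S & y ~= s"
proof -
 obtain \<delta> where \<delta>: "\<delta> > 0" "{s<..s+\<delta>} Int B = {}" using finite_gap_right[OF B] by blast
 obtain \<delta>' where \<delta>': "\<delta>' > 0" "{s-\<delta>'..<s} Int B = {}" using finite_gap_left[OF B] by blast
 show ?thesis unfolding eventually_at
 proof (intro exI[of _ "min (min \<delta> \<delta>') d"] conjI ballI impI)
  fix y assume y: "y \<in> S" "y ~= s & dist y s < min (min \<delta> \<delta>') d"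
  then have "{min s y<..<max s y} <= {s<..s+\<delta>} Un {s-\<delta>'..<s}" by (auto simp: dist_real_def)
  then show "{min s y<..<max s y} Int B = {}" using \<delta>(2) \<delta>'(2) by blast
  show "\<bar>y - s\<bar> < d" "y \<in> S" "y ~= s" using y by (simp_all add: dist_real_def)
 qed (use \<delta> \<delta>' d in auto)
qed

text \<open>Near any point there are no other break points, and the point itself is an end point of
  the intervals considered, which the open interval in the condition omits.\<close>

lemma continuous_from_gaps:
 fixes \<Phi> :: "real => 'a::real_normed_vector"
 assumes B: "finite B" and incr: "!!T. EX K \<delta>. \<delta> > 0 & (ALL x:S. ALL y:S. x <= y --> y <= T --> y - x < \<delta> -->
  {x<..<y} Int B = {} --> norm (\<Phi> y - \<Phi> x) <= K * sqrt (y - x))"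
 shows "continuous_on S \<Phi>"
 unfolding continuous_on_def
proof
 fix s assume s: "s \<in> S"
 from incr[of "s + 1"] obtain K \<delta> where K: "\<delta> > 0" "ALL x:S. ALL y:S. x <= y --> y <= s + 1 --> y - x < \<delta> -->
  {x<..<y} Int B = {} --> norm (\<Phi> y - \<Phi> x) <= K * sqrt (y - x)" by (elim exE conjE)
 have "0 < min \<delta> 1" using K(1) by simp
 from eventually_gap[OF B this, of s S] have "\<forall>\<^sub>F y in at s within S. norm (\<Phi> y - \<Phi> s) <= K * sqrt \<bar>y - s\<bar>"
 proof eventually_elim
  case (elim y)
  show ?case
  proof (cases "s <= y")
   case True
   then show ?thesis using K(2)[rule_format, of s y] elim s by auto
  next
   case False
   then show ?thesis using K(2)[rule_format, of y s] elim s by (auto simp: norm_minus_commute)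
  qed
 qed
 moreover have "((%y. K * sqrt \<bar>y - s\<bar>) ---> K * sqrt \<bar>s - s\<bar>) (at s within S)" by (intro tendsto_intros)
 then have "((%y. K * sqrt \<bar>y - s\<bar>) ---> 0) (at s within S)" by simp
 ultimately have "((%y. \<Phi> y - \<Phi> s) ---> 0) (at s within S)" by (rule Lim_null_comparison)
 then show "(\<Phi> ---> \<Phi> s) (at s within S)" by (rule Lim_null[THEN iffD2])
qed

text \<open>Increments of \<open>\<Phi>\<close> are compared with \<open>\<phi>\<close> at the left
  end point, uniformly over short intervals that avoid \<open>B\<close>. This yields continuity of
  \<open>\<Phi>\<close>, and the derivative wherever \<open>\<phi>\<close> is continuous.\<close>

lemma piecewise_ftc:
 fixes \<Phi> \<phi> :: "real => complex"
 assumes B: "finite B" and \<phi>: "piecewise \<phi>" and T: "0 <= T"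
  and incr: "!!e. e > 0 ==> EX \<delta>>0. ALL x y. 0 <= x --> x <= y --> y <= T --> y - x < \<delta> --> {x<..<y} Int B = {} -->
   norm (\<Phi> y - \<Phi> x - (y - x) *\<^sub>R \<phi> x) <= e * (y - x)"
 shows "(LINT s|lebesgue_on {0..T}. \<phi> s) = \<Phi> T - \<Phi> 0"
proof -
 obtain B' where B': "finite B'" "ALL s>=0. s \<notin> B' --> (\<phi> ---> \<phi> s) (at s within {0..})" using \<phi> unfolding piecewise_def by blast
 obtain M where M: "ALL s:{0..T}. norm (\<phi> s) <= M" using \<phi> unfolding piecewise_def by blast
 note near = eventually_gap[OF B, where S = "{0..T}"]
 have cont: "continuous_on {0..T} \<Phi>"
 proof (rule continuous_from_gaps[OF B])
  from incr[of 1] obtain \<delta> where \<delta>: "\<delta> > 0" "ALL x y. 0 <= x --> x <= y --> y <= T --> y - x < \<delta> --> {x<..<y} Int B = {} -->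
   norm (\<Phi> y - \<Phi> x - (y - x) *\<^sub>R \<phi> x) <= 1 * (y - x)" by auto
  have "norm (\<Phi> y - \<Phi> x) <= (1 + \<bar>M\<bar>) * sqrt (y - x)"
   if "0 <= x" "x <= y" "y <= T" "y - x < min \<delta> 1" "{x<..<y} Int B = {}" for x y
  proof -
   have "norm (\<Phi> y - \<Phi> x) <= norm (\<Phi> y - \<Phi> x - (y - x) *\<^sub>R \<phi> x) + norm ((y - x) *\<^sub>R \<phi> x)"
    using norm_triangle_ineq[of "\<Phi> y - \<Phi> x - (y - x) *\<^sub>R \<phi> x" "(y - x) *\<^sub>R \<phi> x"] by simp
   also have "... <= 1 * (y - x) + (y - x) * \<bar>M\<bar>"
   proof (rule add_mono)
    have "norm (\<phi> x) <= \<bar>M\<bar>" using M that by (auto intro: order_trans[OF _ abs_ge_self])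
    then show "norm ((y - x) *\<^sub>R \<phi> x) <= (y - x) * \<bar>M\<bar>" using that by (simp add: mult_left_mono)
   qed (use \<delta>(2) that in auto)
   also have "... = (1 + \<bar>M\<bar>) * (y - x)" by (simp add: algebra_simps)
   also have "... <= (1 + \<bar>M\<bar>) * sqrt (y - x)"
    using that by (intro mult_left_mono) (auto simp: real_le_rsqrt power2_eq_square mult_left_le)
   finally show ?thesis .
  qed
  then show "EX K \<delta>. \<delta> > 0 & (ALL x:{0..T}. ALL y:{0..T}. x <= y --> y <= T' --> y - x < \<delta> -->
   {x<..<y} Int B = {} --> norm (\<Phi> y - \<Phi> x) <= K * sqrt (y - x))" for T'
   using \<delta>(1) by (intro exI[of _ "1 + \<bar>M\<bar>"] exI[of _ "min \<delta> 1"]) auto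
 qed
 have "(\<phi> has_integral \<Phi> T - \<Phi> 0) {0..T}"
 proof (rule fundamental_theorem_of_calculus_interior_strong[OF B'(1) T _ cont])
  fix s assume s: "s \<in> {0<..<T} - B'"
  have at: "at s within {0..T} = at s" using s by (intro at_within_interior) auto
  have at0: "at s within {0..} = at s" using s by (intro at_within_interior) auto
  show "(\<Phi> has_vector_derivative \<phi> s) (at s)"
   unfolding has_vector_derivative_def has_derivative_at_within at[symmetric]
  proof (intro conjI bounded_linear_scaleR_left tendstoI)
   fix e :: real assume e: "e > 0"
   from incr[of "e / 4"] e obtain \<delta> where \<delta>: "\<delta> > 0" "ALL x y. 0 <= x --> x <= y --> y <= T --> y - x < \<delta> --> {x<..<y} Int B = {} -->
    norm (\<Phi> y - \<Phi> x - (y - x) *\<^sub>R \<phi> x) <= e / 4 * (y - x)" by auto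
   have "(\<phi> ---> \<phi> s) (at s within {0..T})" using B'(2) s unfolding at at0[symmetric] by auto
   then have "\<forall>\<^sub>F y in at s within {0..T}. dist (\<phi> y) (\<phi> s) < e / 4" using e by (intro tendstoD) auto
   then show "\<forall>\<^sub>F y in at s within {0..T}. dist ((\<Phi> y - \<Phi> s - (y - s) *\<^sub>R \<phi> s) /\<^sub>R norm (y - s)) 0 < e"
    using near[OF \<delta>(1), of s]
   proof eventually_elim
    case (elim y)
    have "norm (\<Phi> y - \<Phi> s - (y - s) *\<^sub>R \<phi> s) <= e / 2 * \<bar>y - s\<bar>"
    proof (cases "s <= y")
     case True
     then have "norm (\<Phi> y - \<Phi> s - (y - s) *\<^sub>R \<phi> s) <= e / 4 * (y - s)" using \<delta>(2)[rule_format, of s y] elim s by auto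
     also have "... <= e / 2 * (y - s)" using e True by (intro mult_right_mono) auto
     finally show ?thesis using True by simp
    next
     \<comment> \<open>To the left of \<open>s\<close> the base point is \<open>y\<close>;
       continuity of \<open>\<phi>\<close> at \<open>s\<close> exchanges its value at
       \<open>y\<close> for the one at \<open>s\<close>.\<close>
     case False
     have "norm (\<Phi> s - \<Phi> y - (s - y) *\<^sub>R \<phi> y) <= e / 4 * (s - y)" using \<delta>(2)[rule_format, of y s] elim s False by auto
     moreover have "norm ((s - y) *\<^sub>R (\<phi> y - \<phi> s)) <= (s - y) * (e / 4)"
      using elim(1) False by (simp add: dist_norm)
     moreover have "\<Phi> y - \<Phi> s - (y - s) *\<^sub>R \<phi> s = - (\<Phi> s - \<Phi> y - (s - y) *\<^sub>R \<phi> y) - (s - y) *\<^sub>R (\<phi> y - \<phi> s)"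
      by (simp add: algebra_simps)
     then have "norm (\<Phi> y - \<Phi> s - (y - s) *\<^sub>R \<phi> s) <= norm (\<Phi> s - \<Phi> y - (s - y) *\<^sub>R \<phi> y) + norm ((s - y) *\<^sub>R (\<phi> y - \<phi> s))"
      using norm_triangle_ineq4[of "- (\<Phi> s - \<Phi> y - (s - y) *\<^sub>R \<phi> y)" "(s - y) *\<^sub>R (\<phi> y - \<phi> s)"] by (simp only: norm_minus_cancel)
     ultimately have "norm (\<Phi> y - \<Phi> s - (y - s) *\<^sub>R \<phi> s) <= e / 4 * (s - y) + (s - y) * (e / 4)" by linarith
     then show ?thesis using False by (simp add: algebra_simps)
    qed
    then have "norm (\<Phi> y - \<Phi> s - (y - s) *\<^sub>R \<phi> s) / \<bar>y - s\<bar> <= e / 2" using elim(2) by (simp add: pos_divide_le_eq)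
    then have "norm (\<Phi> y - \<Phi> s - (y - s) *\<^sub>R \<phi> s) / \<bar>y - s\<bar> < e" using e by linarith
    then show ?case
     by (simp only: dist_norm diff_0_right norm_scaleR abs_inverse real_norm_def abs_abs divide_inverse mult.commute)
   qed
  qed
 qed
 then show ?thesis using lebesgue_integral_eq_integral[OF integrable_piecewise[OF \<phi>, of T]] by (simp add: integral_unique)
qed

subsection \<open>The operators of the quantum stochastic differential equation\<close>

lemma adj_assoc_ket:
 fixes q :: "('h::chilbert, 'm::chilbert) tensor"
 shows "adj assoc (d \<otimes> q) = (left_ket d ox (idL :: 'm =>L 'm)) q"
proof -
 have "adj assoc oo left_ket d = (left_ket d :: 'h =>L _) ox (idL :: 'm =>L 'm)"
  by (rule bops_tensor_eqI) (auto simp: adj_assoc)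
 then have "(adj assoc oo left_ket d) q = (left_ket d ox (idL :: 'm =>L 'm)) q" by (simp only:)
 then show ?thesis by simp
qed

text \<open>The algebraic counterpart of \<open>graph_extension\<close>, phrased as the unique
  existence that the definite descriptions of \<open>nabla\<close> and \<open>tilde_op\<close> call
  for.\<close>

lemma linear_extension:
 fixes S :: "('a::chilbert \<times> 'b::chilbert) set"
 assumes z: "!!p. p \<in> cspan S ==> fst p = 0 ==> snd p = 0"
 shows "EX! L. L \<in> extensional (cspan (fst ` S)) & clinear_on (cspan (fst ` S)) L & (ALL p:S. L (fst p) = snd p)"
proof (rule ex_ex1I)
 let ?D = "cspan (fst ` S)"
 have ex: "EX y. (x, y) \<in> cspan S" if "x \<in> ?D" for x
  using that
 proof (induction rule: cspan_induct)
  case (base x)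
  then show ?case using cspan_base(1)[of _ S] by fastforce
 next
  case zero
  show ?case using cspan_zero(1)[of S] by (auto simp: zero_prod_def)
 next
  case (add x y)
  then show ?case using cspan_add(1)[of _ S] by (metis add_Pair)
 next
  case (scale c x)
  then show ?case using cspan_scale(1)[of _ S c] by (fastforce simp: scaleC_prod_def)
 qed
 have un: "y = y'" if "(x, y) \<in> cspan S" "(x, y') \<in> cspan S" for x y y'
  using z[OF CV.subspace_diff[OF subspace_cspan(1) that]] by simp
 define L where "L = restrict (%x. THE y. (x, y) \<in> cspan S) ?D"
 have L: "L x = y" if "(x, y) \<in> cspan S" "x \<in> ?D" for x y
  unfolding L_def using that un by (auto intro!: the_equality)
 have Lm: "(x, L x) \<in> cspan S" if "x \<in> ?D" for x using ex[OF that] L that by metis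
 have "clinear_on ?D L"
  unfolding clinear_on_def
 proof (intro conjI ballI allI)
  fix x y assume "x \<in> ?D" "y \<in> ?D"
  then show "L (x + y) = L x + L y" using cspan_add(1)[OF Lm Lm] by (intro L cspan_add(1)) auto
 next
  fix c x assume "x \<in> ?D"
  then show "L (c *\<^sub>C x) = c *\<^sub>C L x" using cspan_scale(1)[OF Lm, of x c] by (intro L cspan_scale(1)) (auto simp: scaleC_prod_def)
 qed
 moreover have "L (fst p) = snd p" if "p \<in> S" for p
  by (rule L) (use that in \<open>auto intro!: cspan_base(1)\<close>)
 ultimately show "EX L. L \<in> extensional ?D & clinear_on ?D L & (ALL p:S. L (fst p) = snd p)"
  by (intro exI[of _ L]) (auto simp: L_def)
next
 fix L L' assume L: "L \<in> extensional (cspan (fst ` S)) & clinear_on (cspan (fst ` S)) L & (ALL p:S. L (fst p) = snd p)"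
  and L': "L' \<in> extensional (cspan (fst ` S)) & clinear_on (cspan (fst ` S)) L' & (ALL p:S. L' (fst p) = snd p)"
 have "L x = L' x" if "x \<in> cspan (fst ` S)" for x
  using that
 proof (induction rule: cspan_induct)
  case zero
  have M: "M 0 = 0" if "clinear_on (cspan (fst ` S)) M" for M :: "'a => 'b"
   using that cspan_zero(1)[of "fst ` S"] unfolding clinear_on_def by (metis CV.scale_zero_left)
  show ?case using M[of L] M[of L'] L L' by simp
 next
  case (base x)
  then obtain p where "p \<in> S" "x = fst p" by blast
  then show ?case using L L' by simp
 qed (use L L' in \<open>auto simp: clinear_on_def\<close>)
 then show "L = L'" using L L' by (intro extensionalityI[of L "cspan (fst ` S)" L']) auto
qed

lemma exp_dom_cspan: "exp_dom = cspan {u ** f | (u :: 'h::chilbert) (f :: real => 'k::chilbert). step f}" (is "_ = cspan ?S")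
proof
 show "cspan ?S <= exp_dom" unfolding exp_dom_def by (intro cspan_mono(1)) (auto intro: expv_exp_space)
 have "u \<otimes> \<epsilon> \<in> cspan ?S" if "\<epsilon> \<in> exp_space" for u \<epsilon>
  using that unfolding exp_space_def
 proof (induction rule: cspan_induct)
  case (add x y)
  have "u \<otimes> (x + y) = u \<otimes> x + u \<otimes> y" by (rule linear_add[OF bounded_linear.linear[OF bounded_linear_tens_right]])
  then show ?case using cspan_add(1)[OF add(3,4)] by simp
 qed (auto simp: tens_scale_right intro!: cspan_base(1) cspan_zero(1) cspan_scale(1))
 then show "exp_dom <= cspan ?S"
  unfolding exp_dom_def by (intro CV.span_minimal[folded cspan_def]) (auto intro: subspace_cspan)
qed

lemma exp_dom_closed [simp]: "0 \<in> exp_dom" "x \<in> exp_dom ==> y \<in> exp_dom ==> x + y \<in> exp_dom" "x \<in> exp_dom ==> c *\<^sub>C x \<in> exp_dom"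
 unfolding exp_dom_cspan by (auto intro: cspan_zero(1) cspan_add(1) cspan_scale(1))

lemma exp_dom_induct [consumes 1, case_names base zero add scale]:
 assumes "\<zeta> \<in> exp_dom" "!!u f. step f ==> P (u ** f)" "P 0"
  "!!x y. x \<in> exp_dom ==> y \<in> exp_dom ==> P x ==> P y ==> P (x + y)" "!!c x. x \<in> exp_dom ==> P x ==> P (c *\<^sub>C x)"
 shows "P \<zeta>"
 using assms(1) unfolding exp_dom_cspan
 by (induction rule: cspan_induct) (use assms in \<open>auto simp: exp_dom_cspan\<close>)

text \<open>
 The values of \<open>nabla s\<close> on exponential vectors are limits of difference quotients of vectors in the domain, up to a
 term of order zero; hence they respect linear relations.
\<close>

lemma nabla_welldefined:
 fixes p :: "('h::chilbert, 'k::chilbert) hf \<times> (complex \<times> 'k, ('h, 'k) hf) tensor"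
 assumes p: "p \<in> cspan {(u ** f, (1, f s) \<otimes> u ** f) | u f. step f}" and p0: "fst p = 0" and s: "0 <= s"
 shows "snd p = 0"
proof -
 have "ip ((z, c) \<otimes> w ** h) (snd p) = 0" if h: "step h" for z c w h
 proof -
  define e where "e = h s + c"
  define k where "k \<delta> r = h r + step1 s (s + \<delta>) c r" for \<delta> r
  \<comment> \<open>Cancels the change of normalisation between \<open>h\<close> and
    \<open>k \<delta>\<close> and supplies the component \<open>z\<close>, leaving
    \<open>cnj z + ip c (f s)\<close> as the limiting factor.\<close>
  define \<kappa> where "\<kappa> = complex_of_real (((norm e)\<^sup>2 - (norm (h s))\<^sup>2) / 2) + cnj z"
  let ?q = "%\<delta> x. (ip (w ** (k \<delta>)) x - ip (w ** h) x) / complex_of_real \<delta> + \<kappa> * ip (w ** h) x"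
  have k: "k \<delta> \<in> step_funs" for \<delta> unfolding k_def using step_funs_add[OF h step1_step_funs[OF s]] .
  have "((%\<delta>. ?q \<delta> (fst p)) ---> ip ((z, c) \<otimes> w ** h) (snd p)) (at_right 0)"
   using p
  proof (induction rule: cspan_induct)
   case (base p)
   then obtain u f where p: "p = (u ** f, (1, f s) \<otimes> u ** f)" and f: "step f" by blast
   let ?x = "xi e (f s) - xi (h s) (f s)"
   obtain B where B: "finite B" "ALL x y. x <= y --> {x<..y} Int B = {} --> f x = f y" using step_fun_breaks[OF f] by blast
   obtain B' where B': "finite B'" "ALL x y. x <= y --> {x<..y} Int B' = {} --> h x = h y" using step_fun_breaks[OF h] by blast
   obtain d where d: "d > 0" "{s<..s+d} Int (B Un B') = {}" using finite_gap_right[of "B Un B'" s] B B' by blast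
   have ex: "ip (\<varpi> (k \<delta>)) (\<varpi> f) = ip (\<varpi> h) (\<varpi> f) * exp (of_real \<delta> * ?x)" if \<delta>: "0 < \<delta>" "\<delta> < d" for \<delta>
   proof -
    have const: "f r = f s" "h r = h s" if "r \<in> {s..<s + \<delta>}" for r
    proof -
     have "{s<..r} Int B = {}" "{s<..r} Int B' = {}" using d(2) that \<delta> by fastforce+
     then show "f r = f s" "h r = h s" using B(2) B'(2) that by (metis atLeastLessThan_iff)+
    qed
    have "xi (k \<delta> r) (f r) = xi (h r) (f r) + indicator {s..<s + \<delta>} r *\<^sub>R ?x" for r
     using const[of r] by (auto simp: k_def step1_def e_def)
    then have "chi (k \<delta>) f = chi h f + (LINT r|lborel. indicator {s..<s + \<delta>} r *\<^sub>R ?x)"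
     unfolding chi_def using integrable_xi[OF h f]
     by (simp, intro Bochner_Integration.integral_add integrable_scaleR_left integrable_real_indicator) (use \<delta> in auto)
    also have "(LINT r|lborel. indicator {s..<s + \<delta>} r *\<^sub>R ?x) = of_real \<delta> * ?x"
     using \<delta> by (simp add: scaleR_conv_of_real)
    finally show ?thesis by (simp add: cinner_expv_chi k f h exp_add)
   qed
   let ?N = "ip w u * ip (\<varpi> h) (\<varpi> f)"
   have "((%\<delta>. ?N * ((exp (of_real \<delta> * ?x) - 1) / of_real \<delta>) + \<kappa> * ?N) ---> ?N * ?x + \<kappa> * ?N) (at_right 0)"
    by (intro tendsto_intros tendsto_exp_quotient)
   moreover have "\<forall>\<^sub>F \<delta> in at_right 0. ?N * ((exp (of_real \<delta> * ?x) - 1) / of_real \<delta>) + \<kappa> * ?N = ?q \<delta> (fst p)"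
    unfolding eventually_at_right_field
    by (intro exI[of _ d]) (use d(1) in \<open>auto simp: p cinner_tens ex algebra_simps diff_divide_distrib\<close>)
   ultimately have "((%\<delta>. ?q \<delta> (fst p)) ---> ?N * ?x + \<kappa> * ?N) (at_right 0)" by (rule Lim_transform_eventually)
   moreover have "?N * ?x + \<kappa> * ?N = ip ((z, c) \<otimes> w ** h) (snd p)"
    by (simp add: p cinner_tens cinner_prod_def cinner_complex_def xi_def e_def \<kappa>_def cinner_add_left algebra_simps)
     (simp add: field_simps)
   ultimately show ?case by simp
  next
   case (add x y)
   from tendsto_add[OF add(3,4)] show ?case
    by (simp add: cinner_add_right algebra_simps diff_divide_distrib add_divide_distrib)
  next
   case (scale a x)
   from tendsto_mult_left[OF scale(2), of a] show ?case
    by (simp add: cinner_scaleC_right scaleC_prod_def algebra_simps diff_divide_distrib)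
  qed simp
  then have "((%\<delta>::real. 0) ---> ip ((z, c) \<otimes> w ** h) (snd p)) (at_right 0)" by (simp add: p0)
  then show ?thesis using tendsto_unique[OF trivial_limit_at_right_real _ tendsto_const] by blast
 qed
 then show ?thesis
  by (intro total_ext[OF total_tens_sets[OF total_UNIV total_tens_expv[where 'h = 'h and 'k = 'k]], where z' = 0]) auto
qed

lemma
 assumes s: "0 <= s"
 shows nabla_linear: "clinear_on exp_dom (nabla s :: ('h::chilbert, 'k::chilbert) hf => _)"
  and nabla_expv: "step f ==> nabla s ((u :: 'h) ** (f :: real => 'k)) = (1, f s) \<otimes> u ** f"
proof -
 let ?S = "{(u ** f, (1 :: complex, f s) \<otimes> u ** f) | (u :: 'h) (f :: real => 'k). step f}"
 have "fst ` ?S = {u ** f | (u :: 'h) (f :: real => 'k). step f}" by force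
 then have D: "cspan (fst ` ?S) = exp_dom" by (simp only: exp_dom_cspan)
 have "EX! L. L \<in> extensional exp_dom & clinear_on exp_dom L & (ALL p:?S. L (fst p) = snd p)"
  unfolding D[symmetric] by (rule linear_extension[OF nabla_welldefined[OF _ _ s]])
 moreover have "(ALL p:?S. L (fst p) = snd p) \<longleftrightarrow> (ALL u. ALL f:step_funs. L (u ** f) = (1, f s) \<otimes> u ** f)"
  for L :: "('h, 'k) hf => (complex \<times> 'k, ('h, 'k) hf) tensor" by fastforce
 ultimately have "EX! L. L \<in> extensional exp_dom & clinear_on exp_dom L &
   (ALL (u :: 'h). \<forall>(f :: real => 'k)\<in>step_funs. L (u ** f) = (1 :: complex, f s) \<otimes> u ** f)" by simp
 from theI'[OF this, folded nabla_def]
 show "clinear_on exp_dom (nabla s :: ('h::chilbert, 'k::chilbert) hf => _)"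
  "step f ==> nabla s ((u :: 'h) ** (f :: real => 'k)) = (1, f s) \<otimes> u ** f" by blast+
qed

lemma
 fixes X :: "('h::chilbert, 'k::chilbert) hf => ('h, 'k) hf"
 assumes X: "clinear_on exp_dom X"
 shows tilde_op_linear: "clinear_on hat_dom (tilde_op X)"
  and tilde_op_tens: "\<zeta> \<in> exp_dom ==> tilde_op X (c \<otimes> \<zeta>) = c \<otimes> X \<zeta>"
proof -
 let ?S = "{(c \<otimes> \<zeta>, c \<otimes> X \<zeta>) | (c :: complex \<times> 'k) \<zeta>. \<zeta> \<in> exp_dom}"
 have X0: "X 0 = 0" using X exp_dom_closed(1) unfolding clinear_on_def by (metis CV.scale_zero_left)
 have "fst ` ?S = {c \<otimes> \<zeta> | (c :: complex \<times> 'k) (\<zeta> :: ('h, 'k) hf). \<zeta> \<in> exp_dom}" by force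
 then have D: "cspan (fst ` ?S) = hat_dom" by (simp only: hat_dom_def)
 have "snd p = 0" if p: "p \<in> cspan ?S" and p0: "fst p = 0" for p
 proof -
  \<comment> \<open>Slicing the first factor commutes with \<open>X\<close>, so a combination that
    vanishes has an image all of whose slices vanish.\<close>
  have 1: "adj (left_ket x) (fst p) \<in> exp_dom & adj (left_ket x) (snd p) = X (adj (left_ket x) (fst p))" for x
   using p by (induction rule: cspan_induct)
    (use X X0 in \<open>auto simp: clinear_on_def blinfun.add_right bops_scaleC scaleC_prod_def\<close>)
  have "ip (x \<otimes> \<eta>) (snd p) = 0" for x \<eta>
   using 1[of x] cinner_adj_right[OF bops_left_ket, of \<eta> x "snd p"] by (simp add: p0 X0)
  then show ?thesis by (intro total_ext[OF total_tens, where z' = 0]) auto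
 qed
 then have "EX! L. L \<in> extensional hat_dom & clinear_on hat_dom L & (ALL p:?S. L (fst p) = snd p)"
  unfolding D[symmetric] by (rule linear_extension)
 moreover have "(ALL p:?S. L (fst p) = snd p) \<longleftrightarrow> (ALL c. \<forall>\<zeta>\<in>exp_dom. L (c \<otimes> \<zeta>) = c \<otimes> X \<zeta>)"
  for L :: "(complex \<times> 'k, ('h, 'k) hf) tensor => (complex \<times> 'k, ('h, 'k) hf) tensor" by fastforce
 ultimately have "EX! L. L \<in> extensional hat_dom & clinear_on hat_dom L & (ALL c. \<forall>\<zeta>\<in>exp_dom. L (c \<otimes> \<zeta>) = c \<otimes> X \<zeta>)" by simp
 from theI'[OF this, folded tilde_op_def]
 show "clinear_on hat_dom (tilde_op X)" "\<zeta> \<in> exp_dom ==> tilde_op X (c \<otimes> \<zeta>) = c \<otimes> X \<zeta>" by blast+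
qed

lemma piecewise_cong: "(!!s. 0 <= s ==> f s = g s) ==> piecewise f ==> piecewise g"
proof -
 assume e: "!!s. 0 <= s ==> f s = g s" and f: "piecewise f"
 obtain B where B: "finite B" "ALL s>=0. s \<notin> B --> (f ---> f s) (at s within {0..})" using f unfolding piecewise_def by blast
 have "(g ---> g s) (at s within {0..})" if "0 <= s" "s \<notin> B" for s
  using B(2)[rule_format, OF that] e that by (auto elim!: Lim_transform_within[where d = 1])
 moreover have "EX M. ALL s:{0..T}. norm (g s) <= M" for T
  using f e unfolding piecewise_def by (metis atLeastAtMost_iff)
 ultimately show ?thesis unfolding piecewise_def using B(1) by blast
qed

context qs_flow
begin

text \<open>Everything follows from the intertwining of \<open>F\<close> with its image. The squared
  norm is a matrix element of \<open>j\<close> at a slice of \<open>adj F oo F\<close>, again an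
  element of \<open>A\<close>; its continuity in time later upgrades weak continuity to
  strong.\<close>

lemma
 assumes F: "F \<in> vn_tensor bops A" and t: "0 <= t"
 shows bops_tilde: "tilde_map A j t F \<in> bops"
  and norm_tilde_le: "norm (tilde_map A j t F x) <= norm F * norm x"
  and cinner_tilde: "ip (c \<otimes> \<xi>) (tilde_map A j t F (d \<otimes> \<eta>)) = ip \<xi> (j t (left_slice c d F) \<eta>)"
  and norm_tilde_sq: "complex_of_real ((norm (tilde_map A j t F (d \<otimes> \<eta>)))\<^sup>2) = ip \<eta> (j t (left_slice d d (adj F oo F)) \<eta>)"
  and left_slice_tilde: "left_slice c d F \<in> A" "left_slice c d (adj F oo F) \<in> A"
proof -
 obtain V :: "('h, 'k) hf =>L ('h, (amp, ('h, 'k) hf ell2) tensor) tensor"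
  where V: "bop V" "!!x y. ip (V x) (V y) = ip x y" "ALL a:A. V oo j t a = ampl a oo V"
  using j_spatial[OF t] by blast
 let ?Z = "left_ampl V :: (complex \<times> 'k, ('h, 'k) hf) tensor =>L _" and ?T = "tilde_map A j t F"
 let ?i = "idL :: (amp, ('h, 'k) hf ell2) tensor =>L _"
 note iso = left_ampl_isometry[OF V(1,2), where 'c = "complex \<times> 'k"]
 note sp = tilde_map_spatial[where j = j and t = t, OF vn j_hom[OF t] V(1,2) bspec[OF V(3)] F]
 have Fb: "bop F" using F by (rule vn_tensor_bops)
 have cZ: "ip (?Z x) (?Z y) = ip x y" for x y
  using cinner_adj_right[OF iso(1), of x "?Z y"] arg_cong[OF iso(2), of "%S. blinfun_apply S y"] by simp
 have ZT: "?Z (?T x) = (F ox ?i) (?Z x)" for x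
  using arg_cong[OF sp(2), of "%S. blinfun_apply S x"] by simp
 show Tb: "bop ?T" by (subst sp(1)) (use Fb iso(1) in auto)
 have "norm (?T x) = norm ((F ox ?i) (?Z x))" using ZT isometry_norm[OF cZ] by metis
 also have "... <= (norm F * 1) * norm (?Z x)"
  using Fb by (intro order_trans[OF norm_blinfun] mult_right_mono order_trans[OF norm_op_tensor_le] mult_left_mono norm_blinfun_id_le) auto
 finally show "norm (?T x) <= norm F * norm x" by (simp add: isometry_norm[OF cZ])
 have comm: "F oo (idL ox T) = (idL ox T) oo F" if "T \<in> commutant A" for T
  by (rule vn_tensor_left_commute[OF vn F that])
 show sl: "left_slice c d F \<in> A" for c d by (rule left_slice_mem[OF vn Fb comm])
 have "(adj F oo F) oo (idL ox T) = (idL ox T) oo (adj F oo F)" if T: "T \<in> commutant A" for T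
 proof -
  have Tb: "bop T" using T by (rule commutant_bops)
  have aF: "adj F oo (idL ox T) = (idL ox T) oo adj F"
   using arg_cong[OF comm[OF commutant_adj[OF vn T]], of adj] Fb Tb by (simp add: adj_compose adj_op_tensor)
  show ?thesis by (simp only: compose_assoc comm[OF T]) (simp only: aF flip: compose_assoc)
 qed
 then show sl2: "left_slice c d (adj F oo F) \<in> A" for c d using Fb by (intro left_slice_mem[OF vn]) auto
 have el: "ip (?Z (c \<otimes> \<xi>)) ((G ox ?i) (?Z (d \<otimes> \<eta>))) = ip \<xi> (j t (left_slice c d G) \<eta>)"
  if G: "bop G" "left_slice c d G \<in> A" for G c d \<xi> \<eta>
 proof -
  have Zt: "?Z (x \<otimes> y) = (left_ket x ox ?i) (V y)" for x y using V(1) by (simp add: left_ampl_def adj_assoc_ket)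
  have "ip (?Z (c \<otimes> \<xi>)) ((G ox ?i) (?Z (d \<otimes> \<eta>))) =
    ip (V \<xi>) (((adj (left_ket c) ox ?i) oo ((G ox ?i) oo (left_ket d ox ?i))) (V \<eta>))"
   unfolding Zt using cinner_adj_right[of "(left_ket c :: 'h =>L _) ox ?i"] by (simp add: adj_op_tensor)
  also have "(adj (left_ket c) ox ?i) oo ((G ox ?i) oo (left_ket d ox ?i)) = left_slice c d G ox ?i"
   using G by (simp add: op_tensor_compose left_slice_def compose_assoc)
  also have "(left_slice c d G ox ?i) (V \<eta>) = V (j t (left_slice c d G) \<eta>)"
   using arg_cong[OF bspec[OF V(3) G(2)], of "%S. blinfun_apply S \<eta>"] by simp
  finally show ?thesis by (simp add: V(2))
 qed
 show "ip (c \<otimes> \<xi>) (?T (d \<otimes> \<eta>)) = ip \<xi> (j t (left_slice c d F) \<eta>)"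
  using el[OF Fb sl] cZ[of "c \<otimes> \<xi>" "?T (d \<otimes> \<eta>)"] by (simp add: ZT)
 have "complex_of_real ((norm (?T (d \<otimes> \<eta>)))\<^sup>2) = ip ((F ox ?i) (?Z (d \<otimes> \<eta>))) ((F ox ?i) (?Z (d \<otimes> \<eta>)))"
  unfolding norm_cinner ZT[symmetric] cZ ..
 also have "... = ip (?Z (d \<otimes> \<eta>)) (((adj F ox ?i) oo (F ox ?i)) (?Z (d \<otimes> \<eta>)))"
  using cinner_adj_right[of "F ox ?i" "?Z (d \<otimes> \<eta>)"] Fb by (simp add: adj_op_tensor)
 also have "(adj F ox ?i) oo (F ox ?i) = (adj F oo F) ox ?i" using Fb by (simp add: op_tensor_compose)
 finally show "complex_of_real ((norm (?T (d \<otimes> \<eta>)))\<^sup>2) = ip \<eta> (j t (left_slice d d (adj F oo F)) \<eta>)"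
  using el[OF _ sl2] Fb by simp
qed

lemma j_weakly_continuous: "a \<in> A ==> continuous_on {0..} (%s. ip \<xi> (j s a \<eta>))"
proof -
 assume a: "a \<in> A"
 have "continuous_map (top_of_set {0..}) ultraweak (%t. j t a)" using flow a unfolding QS_flow_def by blast
 from continuous_map_compose[OF this continuous_vector_functional[of \<xi> \<eta>]]
 show ?thesis by (simp add: o_def)
qed

end

lemma bounded_bilinear_tens: "bounded_bilinear (tens :: 'a::chilbert => 'b::chilbert => _)"
proof
 show "EX K. ALL (a :: 'a) (b :: 'b). norm (a \<otimes> b) <= norm a * norm b * K" by (intro exI[of _ 1]) (simp add: norm_tens)
qed (auto simp: tens_add_left scaleR_scaleC tens_scale_left tens_scale_right
 linear_add[OF bounded_linear.linear[OF bounded_linear_tens_right]])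

context qs_flow
begin

text \<open>Continuity of the flow gives weak convergence, and applied to a slice of
  \<open>adj F oo F\<close> it gives convergence of the squared norms; in a Hilbert space the two
  together give convergence in norm.\<close>

lemma tilde_continuous:
 assumes F: "F \<in> vn_tensor bops A"
 shows "continuous_on {0..} (%s. tilde_map A j s F (d \<otimes> \<eta>))"
 unfolding continuous_on_def
proof
 fix s :: real assume "s \<in> {0..}"
 then have s: "0 <= s" by simp
 let ?T = "%s. tilde_map A j s F (d \<otimes> \<eta>)" and ?at = "at s within {0..}"
 have ev: "\<forall>\<^sub>F r in ?at. 0 <= r" unfolding eventually_at_filter by simp
 have j: "((%r. ip \<xi> (j r a \<eta>)) ---> ip \<xi> (j s a \<eta>)) ?at" if "a \<in> A" for a \<xi>
  using j_weakly_continuous[OF that] s by (simp add: continuous_on_def)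
 have weak: "((%r. ip w (?T r)) ---> ip w (?T s)) ?at" for w
 proof (rule weak_tendsto_total[OF _ total_tens])
  show "\<forall>\<^sub>F r in ?at. norm (?T r) <= norm F * norm (d \<otimes> \<eta>)"
   using ev by eventually_elim (rule norm_tilde_le[OF F])
  fix w assume "w \<in> {u \<otimes> x | (u :: complex \<times> 'k) (x :: ('h, 'k) hf). True}"
  then obtain c \<xi> where w: "w = c \<otimes> \<xi>" by blast
  have "\<forall>\<^sub>F r in ?at. ip \<xi> (j r (left_slice c d F) \<eta>) = ip w (?T r)"
   using ev by eventually_elim (simp add: w cinner_tilde[OF F])
  from Lim_transform_eventually[OF j[OF left_slice_tilde(1)[OF F s]] this]
  show "((%r. ip w (?T r)) ---> ip w (?T s)) ?at" by (simp add: w cinner_tilde[OF F s])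
 qed
 have "\<forall>\<^sub>F r in ?at. Re (ip \<eta> (j r (left_slice d d (adj F oo F)) \<eta>)) = (norm (?T r))\<^sup>2"
  using ev by eventually_elim (simp flip: norm_tilde_sq[OF F])
 from Lim_transform_eventually[OF tendsto_Re[OF j[OF left_slice_tilde(2)[OF F s]]] this]
 have "((%r. (norm (?T r))\<^sup>2) ---> (norm (?T s))\<^sup>2) ?at" by (simp flip: norm_tilde_sq[OF F s])
 then have "((%r. (norm (?T s))\<^sup>2 + (norm (?T r))\<^sup>2 - 2 * Re (ip (?T s) (?T r))) --->
   (norm (?T s))\<^sup>2 + (norm (?T s))\<^sup>2 - 2 * Re (ip (?T s) (?T s))) ?at"
  by (rule tendsto_diff[OF tendsto_add[OF tendsto_const] tendsto_mult[OF tendsto_const tendsto_Re[OF weak]]])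
 then have "((%r. (norm (?T s - ?T r))\<^sup>2) ---> 0) ?at"
  unfolding norm_diff_sq[symmetric] by (simp add: cinner_self)
 from tendsto_real_sqrt[OF this] have "((%r. norm (?T s - ?T r)) ---> 0) ?at" by simp
 then have "((%r. norm (?T r - ?T s)) ---> 0) ?at" by (simp only: norm_minus_commute)
 then show "(?T ---> ?T s) ?at" by (rule Lim_null[THEN iffD2, OF tendsto_norm_zero_cancel])
qed

lemma tilde_tendsto:
 assumes F: "F \<in> vn_tensor bops A" and s: "0 <= s" and z: "(z ---> d \<otimes> \<eta>) (at s within {0..})"
 shows "((%r. tilde_map A j r F (z r)) ---> tilde_map A j s F (d \<otimes> \<eta>)) (at s within {0..})"
proof -
 have "((%r. norm F * norm (z r - d \<otimes> \<eta>)) ---> norm F * norm (d \<otimes> \<eta> - d \<otimes> \<eta>)) (at s within {0..})"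
  by (intro tendsto_intros z)
 then have "((%r. norm F * norm (z r - d \<otimes> \<eta>)) ---> 0) (at s within {0..})" by simp
 then have "((%r. tilde_map A j r F (z r - d \<otimes> \<eta>)) ---> 0) (at s within {0..})"
  by (rule Lim_null_comparison[rotated]) (auto simp: eventually_at_filter intro!: always_eventually norm_tilde_le[OF F])
 from tendsto_add[OF this tilde_continuous[OF F, unfolded continuous_on_def, rule_format, of s d \<eta>]] s
 show ?thesis by (simp add: blinfun.diff_right)
qed

lemma piecewise_tilde:
 fixes y :: "real => ('h, 'k) hf"
 assumes F: "F \<in> vn_tensor bops A" and y: "continuous_on {0..} y" and g: "step g"
 shows "piecewise (%s. tilde_map A j s F ((1, g s) \<otimes> y s))"
proof -
 have "piecewise (%s. (1 :: complex, g s) \<otimes> y s)"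
  using piecewise_bilinear[OF bounded_bilinear_tens piecewise_step[OF g, of "Pair (1 :: complex)"] piecewise_continuous[OF y]] .
 then obtain B where B: "finite B" "ALL s>=0. s \<notin> B --> ((%s. (1 :: complex, g s) \<otimes> y s) ---> (1, g s) \<otimes> y s) (at s within {0..})"
  and M: "ALL T. EX M. ALL s:{0..T}. norm ((1 :: complex, g s) \<otimes> y s) <= M" unfolding piecewise_def by blast
 have "EX M. ALL s:{0..T}. norm (tilde_map A j s F ((1, g s) \<otimes> y s)) <= M" for T
 proof -
  obtain M where "ALL s:{0..T}. norm ((1 :: complex, g s) \<otimes> y s) <= M" using M by blast
  then show ?thesis by (intro exI[of _ "norm F * M"] ballI order_trans[OF norm_tilde_le[OF F]] mult_left_mono) auto
 qed
 moreover have "ALL s>=0. s \<notin> B --> ((%s. tilde_map A j s F ((1, g s) \<otimes> y s)) ---> tilde_map A j s F ((1, g s) \<otimes> y s)) (at s within {0..})"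
  by (intro allI impI tilde_tendsto[OF F] B(2)[rule_format])
 ultimately show ?thesis unfolding piecewise_def using B(1) by (intro conjI exI[of _ B]) auto
qed

lemma nabla_hat_dom: "0 <= s ==> \<zeta> \<in> exp_dom ==> (nabla s \<zeta> :: (complex \<times> 'k, ('h, 'k) hf) tensor) \<in> hat_dom"
proof -
 assume s: "0 <= s"
 have n: "nabla s (x + y) = nabla s x + nabla s y" "nabla s (c *\<^sub>C x) = c *\<^sub>C nabla s x"
  if "x \<in> exp_dom" "y \<in> exp_dom" for c and x y :: "('h, 'k) hf"
  using nabla_linear[OF s] that unfolding clinear_on_def by blast+
 assume "\<zeta> \<in> exp_dom"
 then show ?thesis
 proof (induction rule: exp_dom_induct)
  case (base u f)
  then show ?case unfolding hat_dom_def by (intro cspan_base(1)) (auto simp: nabla_expv s intro: exp_dom_base)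
 next
  case zero
  show ?case using n(2)[of 0 0 0] by (simp add: hat_dom_def cspan_zero)
 qed (auto simp: n hat_dom_def intro: cspan_add cspan_scale)
qed

abbreviation "tilde_integrand F Z s \<zeta> \<equiv> tilde_map A j s F (tilde_op (Z s) (nabla s \<zeta>))"

context
 fixes F :: "(complex \<times> 'k, 'h) tensor =>L (complex \<times> 'k, 'h) tensor" and Z :: "('h, 'k) op_family"
 assumes F: "F \<in> vn_tensor bops A" and Z: "op_process Z"
begin

lemma process_linear: "0 <= s ==> clinear_on exp_dom (Z s)"
 using Z unfolding op_process_def by blast

lemma integrand_linear: "0 <= s ==> clinear_on exp_dom (tilde_integrand F Z s)"
 using tilde_op_linear[OF process_linear, of s] nabla_linear[of s, where 'h = 'h and 'k = 'k] nabla_hat_dom[of s] bops_tilde[OF F, of s]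
 unfolding clinear_on_def by (simp add: blinfun.add_right bops_scaleC)

lemma integrand_expv: "0 <= s ==> step g ==>
  tilde_integrand F Z s (v ** g) = tilde_map A j s F ((1, g s) \<otimes> Z s (v ** g))"
 by (simp add: nabla_expv tilde_op_tens[OF process_linear] exp_dom_base)

lemma integrand_adapted:
 assumes t: "0 <= t" and f: "step f" and g: "step g"
 shows "ip ((1, f t) \<otimes> u ** f) (tilde_map A j t F (tilde_op (Z t) ((1, g t) \<otimes> v ** g))) =
   ip (\<varpi> (restr {t..} f)) (\<varpi> (restr {t..} g)) * ip ((1, f t) \<otimes> u ** (restr {0..<t} f))
    (tilde_map A j t F (tilde_op (Z t) ((1, g t) \<otimes> v ** (restr {0..<t} g))))"
 using adaptedD[OF j_compose_adapted[OF process_adapted[OF Z t] left_slice_tilde(1)[OF F t] t] f g, of u _ _ v]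
 by (simp add: tilde_op_tens[OF process_linear[OF t]] exp_dom_base f g t cinner_tilde[OF F t])

end

end

section \<open>From exponential vectors to the exponential domain\<close>

lemma clinear_onD:
 fixes L :: "'a::chilbert => 'b::chilbert"
 assumes "clinear_on V L"
 shows "x \<in> V ==> y \<in> V ==> L (x + y) = L x + L y" "x \<in> V ==> L (c *\<^sub>C x) = c *\<^sub>C L x" "0 \<in> V ==> L 0 = 0"
 using assms unfolding clinear_on_def by (blast, blast, metis CV.scale_zero_left)

lemma piecewise_on_exp_dom:
 fixes L :: "real => ('h::chilbert, 'k::chilbert) hf => 'b::chilbert"
 assumes L: "!!s. 0 <= s ==> clinear_on exp_dom (L s)" and base: "!!u f. step f ==> piecewise (%s. L s (u ** f))"
  and "\<zeta> \<in> exp_dom"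
 shows "piecewise (%s. L s \<zeta>)"
 using assms(3)
proof (induction rule: exp_dom_induct)
 case zero
 show ?case by (rule piecewise_cong[OF _ piecewise_continuous[OF continuous_on_const]]) (simp add: clinear_onD(3)[OF L])
next
 case (add x y)
 show ?case by (rule piecewise_cong[OF _ piecewise_add[OF add(3,4)]]) (simp add: clinear_onD(1)[OF L] add(1,2))
next
 case (scale c x)
 show ?case by (rule piecewise_cong[OF _ piecewise_linear[OF bounded_linear_scaleC[of c] scale(2)]]) (simp add: clinear_onD(2)[OF L] scale(1))
qed (rule base)

lemma exp_dom_linear_eq:
 assumes "clinear_on exp_dom L" "clinear_on exp_dom L'" "!!u f. step f ==> L (u ** f) = L' (u ** f)" "\<zeta> \<in> exp_dom"
 shows "L \<zeta> = (L' \<zeta> :: 'b::chilbert)"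
 using assms(4) by (induction rule: exp_dom_induct) (simp_all add: clinear_onD[OF assms(1)] clinear_onD[OF assms(2)] assms(3))

lemma piecewise_nabla: "\<zeta> \<in> exp_dom ==> piecewise (%s. nabla s \<zeta> :: (complex \<times> 'k::chilbert, ('h::chilbert, 'k fock) tensor) tensor)"
proof (rule piecewise_on_exp_dom[OF nabla_linear])
 fix u f assume f: "f \<in> (step_funs :: (real => 'k) set)"
 show "piecewise (%s. nabla s ((u :: 'h) ** f) :: (complex \<times> 'k, ('h, 'k) hf) tensor)"
  by (rule piecewise_cong[OF _ piecewise_step[OF f, of "%c. (1, c) \<otimes> u ** f"]]) (simp add: nabla_expv f)
qed

lemma clinear_on_integral:
 fixes \<phi> :: "real => 'a::chilbert => complex"
 assumes L: "!!s. 0 <= s ==> clinear_on V (\<phi> s)" and int: "!!x. x \<in> V ==> integrable (lebesgue_on {0..t}) (%s. \<phi> s x)"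
 shows "clinear_on V (%x. LINT s|lebesgue_on {0..t}. \<phi> s x)"
 unfolding clinear_on_def
proof (intro conjI ballI allI)
 fix x y assume xy: "x \<in> V" "y \<in> V"
 have "(LINT s|lebesgue_on {0..t}. \<phi> s (x + y)) = (LINT s|lebesgue_on {0..t}. \<phi> s x + \<phi> s y)"
  by (rule Bochner_Integration.integral_cong) (auto simp: clinear_onD(1)[OF L] xy)
 then show "(LINT s|lebesgue_on {0..t}. \<phi> s (x + y)) = (LINT s|lebesgue_on {0..t}. \<phi> s x) + (LINT s|lebesgue_on {0..t}. \<phi> s y)"
  using int xy by simp
next
 fix c x assume x: "x \<in> V"
 have "(LINT s|lebesgue_on {0..t}. \<phi> s (c *\<^sub>C x)) = (LINT s|lebesgue_on {0..t}. c * \<phi> s x)"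
  by (rule Bochner_Integration.integral_cong) (auto simp: clinear_onD(2)[OF L x] scaleC_complex_def)
 then show "(LINT s|lebesgue_on {0..t}. \<phi> s (c *\<^sub>C x)) = c *\<^sub>C (LINT s|lebesgue_on {0..t}. \<phi> s x)"
  by (simp add: scaleC_complex_def)
qed

context qs_flow
begin

context
 fixes F :: "(complex \<times> 'k, 'h) tensor =>L (complex \<times> 'k, 'h) tensor" and Z :: "('h, 'k) op_family"
 assumes F: "F \<in> vn_tensor bops A" and Z: "op_process Z" and cont: "!!\<zeta>. \<zeta> \<in> exp_dom ==> continuous_on {0..} (%t. Z t \<zeta>)"
begin

lemma piecewise_integrand: "\<zeta> \<in> exp_dom ==> piecewise (%s. tilde_integrand F Z s \<zeta>)"
proof (rule piecewise_on_exp_dom[OF integrand_linear[OF F Z]])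
 fix u f assume f: "f \<in> (step_funs :: (real => 'k) set)"
 show "piecewise (%s. tilde_integrand F Z s (u ** f))"
  by (rule piecewise_cong[OF _ piecewise_tilde[OF F cont[OF exp_dom_base[OF f]] f]]) (simp add: integrand_expv[OF F Z] f)
qed

abbreviation "flow_form s \<zeta> \<eta> \<equiv> ip (nabla s \<zeta>) (tilde_integrand F Z s \<eta>)"

lemma integrable_flow_form: "\<zeta> \<in> exp_dom ==> \<eta> \<in> exp_dom ==> integrable (lebesgue_on {0..t}) (%s. flow_form s \<zeta> \<eta>)"
 by (intro integrable_piecewise piecewise_bilinear[OF bounded_bilinear_cinner] piecewise_nabla piecewise_integrand)

text \<open>Both sides are sesquilinear, so the equation extends from exponential vectors to
  \<open>exp_dom\<close> in one argument at a time, the left one through conjugation. Continuity of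
  \<open>Z\<close> makes the integrand piecewise continuous, from which integrability
  follows.\<close>

lemma strong_solutionI:
 assumes eq: "!!t u f v g. 0 <= t ==> step f ==> step g ==> ip (u ** f) (Z t (v ** g)) =
  ip (u ** f) (v ** g) +
  (LINT s|lebesgue_on {0..t}. ip ((1, f s) \<otimes> u ** f) (tilde_map A j s F ((1, g s) \<otimes> Z s (v ** g))))"
 shows "strong_solution A j F Z"
proof -
 let ?X = "%t. restrict (%\<zeta>. Z t \<zeta> - \<zeta>) exp_dom"
 note lin = process_linear[OF F Z]
 have int: "ip \<zeta>' (Z t \<zeta> - \<zeta>) = (LINT s|lebesgue_on {0..t}. flow_form s \<zeta>' \<zeta>)"
  if t: "0 <= t" and z': "\<zeta>' \<in> exp_dom" and z: "\<zeta> \<in> exp_dom" for t \<zeta>' \<zeta>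
 proof -
  let ?I = "%\<zeta>' \<zeta>. LINT s|lebesgue_on {0..t}. flow_form s \<zeta>' \<zeta>"
  have lin2: "clinear_on exp_dom (?I \<zeta>')" "clinear_on exp_dom (%\<zeta>. ip \<zeta>' (Z t \<zeta> - \<zeta>))" if "\<zeta>' \<in> exp_dom" for \<zeta>'
  proof -
   have "clinear_on exp_dom (flow_form s \<zeta>')" if "0 <= s" for s
    by (simp add: clinear_on_def scaleC_complex_def cinner_simps clinear_onD[OF integrand_linear[OF F Z that]])
   then show "clinear_on exp_dom (?I \<zeta>')" by (rule clinear_on_integral[OF _ integrable_flow_form[OF that]])
   show "clinear_on exp_dom (%\<zeta>. ip \<zeta>' (Z t \<zeta> - \<zeta>))"
    by (simp add: clinear_on_def scaleC_complex_def cinner_simps clinear_onD[OF lin[OF t]] algebra_simps)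
  qed
  have "clinear_on exp_dom (%\<zeta>'. ip (tilde_integrand F Z s \<zeta>) (nabla s \<zeta>'))" if "0 <= s" for s
   by (simp add: clinear_on_def scaleC_complex_def cinner_simps clinear_onD[OF nabla_linear[OF that]])
  then have lin1: "clinear_on exp_dom (%\<zeta>'. LINT s|lebesgue_on {0..t}. ip (tilde_integrand F Z s \<zeta>) (nabla s \<zeta>'))"
   by (rule clinear_on_integral[OF _ integrable_piecewise[OF piecewise_bilinear[OF bounded_bilinear_cinner piecewise_integrand[OF z] piecewise_nabla]]])
  have cI: "(LINT s|lebesgue_on {0..t}. ip (tilde_integrand F Z s \<zeta>) (nabla s \<zeta>')) = cnj (?I \<zeta>' \<zeta>)" for \<zeta>'
   unfolding cinner_commute[of "tilde_integrand F Z _ \<zeta>"] by (rule Bochner_Integration.integral_cnj)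
  have "ip (Z t \<zeta> - \<zeta>) \<zeta>' = (LINT s|lebesgue_on {0..t}. ip (tilde_integrand F Z s \<zeta>) (nabla s \<zeta>'))"
  proof (rule exp_dom_linear_eq[OF _ lin1 _ z'])
   fix u f assume f: "f \<in> (step_funs :: (real => 'k) set)"
   have "ip (u ** f) (Z t \<zeta> - \<zeta>) = ?I (u ** f) \<zeta>"
   proof (rule exp_dom_linear_eq[OF lin2(2,1)[OF exp_dom_base[OF f]] _ z])
    fix v g assume g: "g \<in> (step_funs :: (real => 'k) set)"
    show "ip (u ** f) (Z t (v ** g) - v ** g) = ?I (u ** f) (v ** g)"
     unfolding cinner_diff_right eq[OF t f g]
     by (simp, intro Bochner_Integration.integral_cong) (auto simp: nabla_expv tilde_op_tens[OF process_linear[OF F Z]] exp_dom_base f g)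
   qed
   then show "ip (Z t \<zeta> - \<zeta>) (u ** f) = (LINT s|lebesgue_on {0..t}. ip (tilde_integrand F Z s \<zeta>) (nabla s (u ** f)))"
    unfolding cI cinner_commute[of "Z t \<zeta> - \<zeta>"] by simp
  qed (simp add: clinear_on_def scaleC_complex_def cinner_simps algebra_simps)
  then show ?thesis unfolding cI cinner_commute[of "Z t \<zeta> - \<zeta>"] by simp
 qed
 have X: "op_process ?X"
  unfolding op_process_def
 proof (intro conjI allI impI ballI)
  fix t :: real assume t: "0 <= t"
  show "clinear_on exp_dom (?X t)"
   using lin[OF t] by (auto simp: clinear_on_def CV.scale_right_diff_distrib)
  fix f g :: "real => 'k" and u v :: 'h assume f: "step f" and g: "step g"
  show "ip (u ** f) (?X t (v ** g)) = ip (\<varpi> (restr {t..} f)) (\<varpi> (restr {t..} g)) *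
    ip (u ** (restr {0..<t} f)) (?X t (v ** (restr {0..<t} g)))"
   using adaptedD[OF process_adapted[OF Z t] f g, of u v] adaptedD[OF adapted_id[OF t] f g, of u v] t f g
   by (simp add: exp_dom_base cinner_diff_right right_diff_distrib)
 next
  fix \<zeta> \<eta> :: "('h, 'k) hf" assume z: "\<zeta> \<in> exp_dom"
  have "(%t. ip \<eta> (Z t \<zeta>)) \<in> borel_measurable (lebesgue_on {0..})" using Z z unfolding op_process_def by blast
  then show "(%t. ip \<eta> (?X t \<zeta>)) \<in> borel_measurable (lebesgue_on {0..})" using z by (simp add: cinner_diff_right)
 qed auto
 have "is_QS_integral (%s \<xi>. tilde_map A j s F (tilde_op (Z s) \<xi>)) ?X"
  unfolding is_QS_integral_def using X int cont by (auto intro!: continuous_intros)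
 moreover have "QS_integrable (%_. hat_dom) (%s \<xi>. tilde_map A j s F (tilde_op (Z s) \<xi>))"
  unfolding QS_integrable_def
 proof (intro conjI ballI allI impI nabla_hat_dom integrand_adapted[OF F Z])
  fix \<zeta> :: "('h, 'k) hf" assume "\<zeta> \<in> exp_dom"
  note p = piecewise_linear[OF blinfun.bounded_linear_right piecewise_integrand[OF this]]
  show "locally_integrable (%s. (ampl (idL - Delta)) (tilde_integrand F Z s \<zeta>))"
   "locally_square_integrable (%s. ampl Delta (tilde_integrand F Z s \<zeta>))"
   by (rule locally_integrable_piecewise[OF p])+
 qed
 ultimately show ?thesis
  unfolding strong_solution_def Let_def using Z by (intro conjI exI[of _ ?X]) auto
qed

end

lemma strong_solutionD:
 assumes F: "F \<in> vn_tensor bops A" and sol: "strong_solution A j F Z"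
 shows strong_solution_process: "op_process Z"
  and strong_solution_continuous: "\<zeta> \<in> exp_dom ==> continuous_on {0..} (%t. Z t \<zeta>)"
  and strong_solution_equation: "0 <= t ==> step f ==> step g ==> ip (u ** f) (Z t (v ** g)) =
  ip (u ** f) (v ** g) +
  (LINT s|lebesgue_on {0..t}. ip ((1, f s) \<otimes> u ** f) (tilde_map A j s F ((1, g s) \<otimes> Z s (v ** g))))"
proof -
 show Z: "op_process Z" using sol by (simp add: strong_solution_def)
 obtain X where X: "is_QS_integral (%s \<xi>. tilde_map A j s F (tilde_op (Z s) \<xi>)) X"
  and ZX: "!!t \<zeta>. 0 <= t ==> \<zeta> \<in> exp_dom ==> Z t \<zeta> = \<zeta> + X t \<zeta>"
  using sol unfolding strong_solution_def Let_def by blast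
 show "continuous_on {0..} (%t. Z t \<zeta>)" if "\<zeta> \<in> exp_dom"
  using X that by (subst continuous_on_cong[OF refl ZX]) (auto simp: is_QS_integral_def intro!: continuous_intros)
 assume t: "0 <= t" and f: "step f" and g: "step g"
 have "ip (u ** f) (X t (v ** g)) = (LINT s|lebesgue_on {0..t}. ip (nabla s (u ** f)) (tilde_integrand F Z s (v ** g)))"
  using X t exp_dom_base[OF f] exp_dom_base[OF g] unfolding is_QS_integral_def by blast
 also have "... = (LINT s|lebesgue_on {0..t}. ip ((1, f s) \<otimes> u ** f) (tilde_map A j s F ((1, g s) \<otimes> Z s (v ** g))))"
  by (intro Bochner_Integration.integral_cong) (auto simp: nabla_expv tilde_op_tens[OF process_linear[OF F Z]] exp_dom_base f g)
 finally show "ip (u ** f) (Z t (v ** g)) = ip (u ** f) (v ** g) +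
  (LINT s|lebesgue_on {0..t}. ip ((1, f s) \<otimes> u ** f) (tilde_map A j s F ((1, g s) \<otimes> Z s (v ** g))))"
  using ZX[OF t exp_dom_base[OF g]] by (simp add: cinner_add_right)
qed

end

section \<open>The multiplier cocycle as a strong solution\<close>

lemma adapted_diff:
 assumes "adapted_at r X" "adapted_at r X'"
 shows "adapted_at r (%x. X x - X' x)"
 unfolding adapted_at_def cinner_diff_right right_diff_distrib
 by (intro ballI allI arg_cong2[where f = minus] adaptedD assms)

lemma norm_adapted: "adapted_at r X ==> step g ==> 0 <= r ==> norm (X (v ** g)) = norm (X (v ** (restr {0..<r} g)))"
 using isometry_norm[OF cinner_split_at, of r "X (v ** g)"] by (simp add: adapted_split norm_tens)

lemma step_fun_gap_const:
 assumes "step f"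
 obtains B where "finite B" "!!x y s. {x<..<y} Int B = {} ==> x <= s ==> s < y ==> f s = f x"
proof -
 obtain B where B: "finite B" "ALL x y. x <= y --> {x<..y} Int B = {} --> f x = f y" using step_fun_breaks[OF assms] by blast
 show ?thesis
 proof (rule that[OF B(1)])
  fix x y s assume g: "{x<..<y} Int B = {}" "x <= s" "s < y"
  have "{x<..s} Int B = {}" using g by fastforce
  with B(2) g(2) show "f s = f x" by metis
 qed
qed

context multiplier_flow
begin

text \<open>Before time \<open>h\<close> only the value \<open>d\<close> of \<open>g\<close>
  matters, and by adaptedness the rest does not change norms, so the growth condition at one fixed
  exponential vector covers all such \<open>g\<close> with the same constants.\<close>

lemma Y_growth:
 obtains C \<delta> where "0 <= C" "0 < \<delta>"
  "!!h u g. 0 <= h ==> h < \<delta> ==> step g ==> (!!s. 0 <= s ==> s < h ==> g s = d) ==>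
   norm ((Y h - idL) oo tens_ket (\<varpi> g)) <= C * sqrt h"
proof -
 let ?d = "restr {0..<1} (%_. d)"
 obtain C \<delta> where C: "0 <= C" "0 < \<delta>"
  "!!t a. 0 < t ==> t < \<delta> ==> a \<in> A ==> norm (((j t a oo Y t) - \<iota> a) oo tens_ket (\<varpi> ?d)) <= C * sqrt t * norm a"
  by (rule growth_ket[OF expv_exp_space[of ?d]]) auto
 show ?thesis
 proof (rule that[of C "min \<delta> 1"])
  fix h g assume h: "0 <= h" "h < min \<delta> 1" and g: "step g" "!!s. 0 <= s ==> s < h ==> g s = d"
  show "norm ((Y h - idL) oo tens_ket (\<varpi> g)) <= C * sqrt h"
  proof (cases "h = 0")
   case False
   have ad: "adapted_at h (%x. (Y h - idL) x)"
    using adapted_diff[OF Y_adapted adapted_id] h by (simp add: blinfun.diff_left)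
   have r: "restr {0..<h} g = restr {0..<h} ?d" using g(2) h by (auto simp: restr_def)
   have "norm ((Y h - idL) oo tens_ket (\<varpi> ?d)) <= C * sqrt h * norm (idL :: 'h =>L 'h)"
    using C(3)[of h idL] h False by (simp add: j_id ampl_map_def vn_id[OF vn])
   also have "... <= C * sqrt h * 1" using C h by (intro mult_left_mono norm_blinfun_id_le) auto
   finally have "norm ((Y h - idL) (u ** ?d)) <= C * sqrt h * norm u" for u
    by (intro order_trans[OF norm_blinfun[of "(Y h - idL) oo tens_ket (\<varpi> ?d)" u, simplified]] mult_right_mono) auto
   then show ?thesis
    using C(1) h by (intro norm_blinfun_bound)
     (simp_all add: norm_adapted[OF ad g(1) h(1)] r norm_adapted[OF ad const_step h(1), symmetric] del: restr_restr)
  qed (simp add: Y_zero)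
 qed (use C in auto)
qed

text \<open>The cocycle identity writes the increment as \<open>J x (Y h - idL)\<close> applied to
  \<open>Y x (v ** g)\<close>, and \<open>norm_J_le\<close> leaves the column at the shifted
  function, where the growth condition applies.\<close>

lemma Y_increment:
 assumes x: "0 <= x" and h: "0 <= h" and g: "step g"
 shows "norm (Y (x + h) (v ** g) - Y x (v ** g)) <= norm ((Y h - idL) oo tens_ket (\<varpi> (lshift x g))) * norm (Y x (v ** g))"
proof -
 have "Y (x + h) (v ** g) - Y x (v ** g) = J x (Y h - idL) (Y x (v ** g))"
  unfolding Y_cocycle[OF x h] J_diff[OF Y_affiliated[OF h] affiliated_id x] by (simp add: J_id[OF x] blinfun.diff_left)
 then show ?thesis
  using norm_J_le[OF affiliated_diff[OF Y_affiliated[OF h] affiliated_id] x Y_adapted[OF x] g, of v]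
   norm_adapted[OF Y_adapted[OF x] g x] by simp
qed

lemma Y_expv_continuous:
 assumes g: "step g"
 shows "continuous_on {0..} (%t. Y t (v ** g))"
proof -
 obtain B where B: "finite B" "!!x y s. {x<..<y} Int B = {} ==> x <= s ==> s < y ==> g s = g x" using step_fun_gap_const[OF g] by blast
 have "ALL d. EX C \<delta>. 0 <= C & 0 < \<delta> & (ALL h g. 0 <= h --> h < \<delta> --> step g --> (ALL s. 0 <= s --> s < h --> g s = d) -->
   norm ((Y h - idL) oo tens_ket (\<varpi> g)) <= C * sqrt h)"
  using Y_growth by metis
 then obtain C \<delta> where C: "!!d. 0 <= C d" "!!d. 0 < \<delta> d" "!!d h g. 0 <= h ==> h < \<delta> d ==> step g ==> ALL s. 0 <= s --> s < h --> g s = d ==>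
   norm ((Y h - idL) oo tens_ket (\<varpi> g)) <= C d * sqrt h" by metis
 \<comment> \<open>The constants depend on the value of \<open>g\<close>, and a step function has
   finitely many values.\<close>
 let ?C = "Max (range (%s. C (g s)))" and ?\<delta> = "Min (range (%s. \<delta> (g s)))"
 have fin: "finite (range (%s. C (g s)))" "finite (range (%s. \<delta> (g s)))"
  using finite_imageI[OF step_funs_finite_range[OF g]] by (simp_all add: image_image)
 show ?thesis
 proof (rule continuous_from_gaps[OF B(1)])
  fix T
  obtain M where M: "0 <= M" "!!t. 0 <= t ==> t <= T ==> norm (Y t) <= M" using Y_bound by blast
  have "norm (Y y (v ** g) - Y x (v ** g)) <= ?C * (M * norm v) * sqrt (y - x)"
   if "0 <= x" "x <= y" "y <= T" "y - x < ?\<delta>" "{x<..<y} Int B = {}" for x y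
  proof -
   have "y - x < \<delta> (g x)" using that(4) fin(2) by (auto simp: Min_gr_iff)
   moreover have "ALL s. 0 <= s --> s < y - x --> lshift x g s = g x" by (auto simp: lshift_def intro!: B(2)[OF that(5)])
   ultimately have "norm ((Y (y - x) - idL) oo tens_ket (\<varpi> (lshift x g))) <= C (g x) * sqrt (y - x)"
    using that g by (intro C(3)) auto
   also have "... <= ?C * sqrt (y - x)" using fin(1) that by (intro mult_right_mono Max_ge) auto
   finally have "norm (Y (x + (y - x)) (v ** g) - Y x (v ** g)) <= ?C * sqrt (y - x) * norm (Y x (v ** g))"
    using that g by (intro order_trans[OF Y_increment mult_right_mono]) auto
   also have "... <= ?C * sqrt (y - x) * (M * norm v)"
   proof (rule mult_left_mono)
    show "norm (Y x (v ** g)) <= M * norm v"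
     using M(2)[of x] that g by (intro order_trans[OF norm_blinfun]) (auto simp: norm_tens mult_right_mono)
    have "C (g 0) <= ?C" using fin(1) by (intro Max_ge) auto
    then show "0 <= ?C * sqrt (y - x)" using C(1)[of "g 0"] that by simp
   qed
   finally show ?thesis using that by (simp add: mult_ac)
  qed
  moreover have "0 < ?\<delta>" using fin(2) C(2) by (subst Min_gr_iff) auto
  ultimately show "EX K \<delta>. \<delta> > 0 & (ALL x:{0..}. ALL y:{0..}. x <= y --> y <= T --> y - x < \<delta> -->
   {x<..<y} Int B = {} --> norm (Y y (v ** g) - Y x (v ** g)) <= K * sqrt (y - x))"
   by (intro exI[of _ "?C * (M * norm v)"] exI[of _ ?\<delta>]) auto
 qed
qed

lemma Y_continuous: "\<zeta> \<in> exp_dom ==> continuous_on {0..} (%t. Y t \<zeta>)"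
proof (induction rule: exp_dom_induct)
 case (scale c x)
 show ?case
  by (subst continuous_on_cong[OF refl bops_scaleC[OF Y_bops]])
   (auto intro: bounded_linear.continuous_on[OF bounded_linear_scaleC] scale(2))
qed (simp_all add: Y_expv_continuous blinfun.add_right continuous_on_add)

text \<open>Over an interval without jumps, the increment is governed by \<open>j x\<close> at
  \<open>Q c d h idL - idL\<close>. Replacing this by \<open>h\<close> times the generator leaves an
  error whose norm \<open>j x\<close> does not increase.\<close>

lemma Y_matrix_increment:
 assumes x: "0 <= x" and h: "0 <= h" and f: "step f" "!!s. x <= s ==> s < x + h ==> f s = c"
  and g: "step g" "!!s. x <= s ==> s < x + h ==> g s = d"
 shows "cmod (ip (u ** f) (Y (x + h) (v ** g)) - ip (u ** f) (Y x (v ** g)) -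
  h *\<^sub>R ip (u ** f) (j x (gen c d) (Y x (v ** g)))) <=
  norm u * (norm (Q c d h idL - idL - h *\<^sub>R gen c d) * norm (Y x (v ** g)))"
proof -
 let ?a = "Q c d h idL - idL - h *\<^sub>R gen c d"
 note I = vn_id[OF vn] and hom = j_hom[OF x]
 have QA: "Q c d h idL \<in> A" by (rule Q_mem[OF I h])
 have aA: "?a \<in> A" by (intro vn_diff[OF vn] vn_scaleR[OF vn] QA I gen_mem)
 have jQ: "j x (Q c d h idL) = j x ?a + (idL + complex_of_real h *\<^sub>C j x (gen c d))"
 proof -
  have "j x (?a + (idL + h *\<^sub>R gen c d)) = j x ?a + (j x idL + j x (h *\<^sub>R gen c d))"
   by (simp only: normal_hom_add[OF hom aA vn_add[OF vn I vn_scaleR[OF vn gen_mem]]] normal_hom_add[OF hom I vn_scaleR[OF vn gen_mem]])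
  also have "j x (h *\<^sub>R gen c d) = complex_of_real h *\<^sub>C j x (gen c d)" by (simp add: scaleR_scaleC_blinfun j_scale[OF x gen_mem])
  finally show ?thesis by (simp add: j_id[OF x])
 qed
 have sl: "right_slice (\<varpi> (lshift x f)) (\<varpi> (lshift x g)) (Y h) = ip (\<varpi> (restr {x..} f)) (\<varpi> (restr {x..} g)) *\<^sub>C Q c d h idL"
 proof (rule blinfun_eqI, rule cinner_ext)
  fix z w
  have "ip (w ** (lshift x f)) (Y h (z ** (lshift x g))) = ip (\<varpi> (lshift x f)) (\<varpi> (lshift x g)) * ip w (Q c d h idL z)"
   using slice_Q[of "lshift x f" h c "lshift x g" d idL w z] f g h I by (auto simp: lshift_def j_id)
  then show "ip w (right_slice (\<varpi> (lshift x f)) (\<varpi> (lshift x g)) (Y h) z) =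
    ip w ((ip (\<varpi> (restr {x..} f)) (\<varpi> (restr {x..} g)) *\<^sub>C Q c d h idL) z)"
   by (simp add: cinner_right_slice cinner_simps restr_future_shift f(1) g(1) cinner_expv_shift x)
 qed
 let ?p = "u ** (restr {0..<x} f)" and ?q = "Y x (v ** (restr {0..<x} g))"
  and ?\<kappa> = "ip (\<varpi> (restr {x..} f)) (\<varpi> (restr {x..} g))"
 have e: "ip ?p (j x (Q c d h idL) ?q) = ip ?p (j x ?a ?q) + (ip ?p ?q + complex_of_real h * ip ?p (j x (gen c d) ?q))"
  by (simp only: jQ blinfun.add_left cinner_add_right scaleC_blinfun_apply cinner_scaleC_right id_blinfun.rep_eq)
 have "ip (u ** f) (Y (x + h) (v ** g)) = ip (u ** f) (J x (Y h) (Y x (v ** g)))"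
  unfolding Y_cocycle[OF x h] by simp
 also have "... = ?\<kappa> * ip ?p (j x (Q c d h idL) ?q)"
  unfolding J_matrix[OF Y_affiliated[OF h] x Y_adapted[OF x] g(1) f(1)] sl by (simp add: j_scale[OF x QA] cinner_simps)
 finally have d: "ip (u ** f) (Y (x + h) (v ** g)) - ip (u ** f) (Y x (v ** g)) -
   h *\<^sub>R ip (u ** f) (j x (gen c d) (Y x (v ** g))) = ?\<kappa> * ip ?p (j x ?a ?q)"
  unfolding e by (simp only: adaptedD[OF Y_adapted[OF x] f(1) g(1), of u v] scaleR_conv_of_real
   adaptedD[OF j_compose_adapted[OF Y_adapted[OF x] gen_mem x] f(1) g(1), of u c d v]) (simp only: algebra_simps)
 have "cmod (?\<kappa> * ip ?p (j x ?a ?q)) <= 1 * (norm ?p * (norm ?a * norm ?q))"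
  unfolding norm_mult
 proof (rule mult_mono)
  show "cmod ?\<kappa> <= 1" using cinner_CS[of "\<varpi> (restr {x..} f)" "\<varpi> (restr {x..} g)"] f(1) g(1) x by simp
  have n: "norm (j x ?a ?q) <= norm ?a * norm ?q" by (rule order_trans[OF norm_blinfun mult_right_mono[OF norm_j_le[OF aA x] norm_ge_zero]])
  show "cmod (ip ?p (j x ?a ?q)) <= norm ?p * (norm ?a * norm ?q)"
   by (rule order_trans[OF cinner_CS mult_left_mono[OF n norm_ge_zero]])
 qed (rule zero_le_one norm_ge_zero)+
 then show ?thesis unfolding d norm_adapted[OF Y_adapted[OF x] g(1) x, of v] norm_tens norm_expv[OF step_funs_restr_past[OF f(1)]] mult_1 mult_1_right .
qed

text \<open>\<open>gen_tendsto\<close> makes the error in \<open>Y_matrix_increment\<close> a small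
  multiple of the length of the interval; only finitely many pairs of values of \<open>f\<close> and
  \<open>g\<close> occur, so the estimate is uniform and \<open>piecewise_ftc\<close>
  applies.\<close>

lemma flow_equation:
 assumes F: "F \<in> vn_tensor bops A" and sl: "!!c d. left_slice (1, c) (1, d) F = gen c d"
  and t: "0 <= t" and f: "step f" and g: "step g"
 shows "ip (u ** f) (Y t (v ** g)) = ip (u ** f) (v ** g) +
  (LINT s|lebesgue_on {0..t}. ip ((1, f s) \<otimes> u ** f) (tilde_map A j s F ((1, g s) \<otimes> Y s (v ** g))))"
proof -
 let ?\<phi> = "%s. ip ((1, f s) \<otimes> u ** f) (tilde_map A j s F ((1, g s) \<otimes> Y s (v ** g)))"
 let ?\<Phi> = "%s. ip (u ** f) (Y s (v ** g))"
 obtain B where B: "finite B" "!!x y s. {x<..<y} Int B = {} ==> x <= s ==> s < y ==> f s = f x" using step_fun_gap_const[OF f] by blast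
 obtain B' where B': "finite B'" "!!x y s. {x<..<y} Int B' = {} ==> x <= s ==> s < y ==> g s = g x" using step_fun_gap_const[OF g] by blast
 obtain M where M: "0 <= M" "!!s. 0 <= s ==> s <= t ==> norm (Y s) <= M" using Y_bound by blast
 have pw: "piecewise ?\<phi>"
  by (rule piecewise_bilinear[OF bounded_bilinear_cinner piecewise_step[OF f, of "%c. (1, c) \<otimes> u ** f"]
   piecewise_tilde[OF F Y_expv_continuous[OF g] g]])
 have "(LINT s|lebesgue_on {0..t}. ?\<phi> s) = ?\<Phi> t - ?\<Phi> 0"
 proof (rule piecewise_ftc[OF finite_UnI[OF B(1) B'(1)] pw t])
  fix e :: real assume e: "e > 0"
  define K where "K = norm u * (M * norm v) + 1"
  have K: "K > 0" using M(1) by (simp add: K_def add_nonneg_pos)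
  have "EX \<delta>>0. ALL h>0. h < \<delta> --> dist ((Q c d h idL - idL) /\<^sub>R h) (gen c d) < e / K" for c d
   using tendstoD[OF gen_tendsto[of c d], of "e / K"] e K unfolding eventually_at_right_field by auto
  then obtain \<delta> where \<delta>: "!!c d. \<delta> c d > 0" "!!c d h. 0 < h ==> h < \<delta> c d ==>
    dist ((Q c d h idL - idL) /\<^sub>R h) (gen c d) < e / K" by metis
  let ?S = "(%(c, d). \<delta> c d) ` (range f \<times> range g)"
  have S: "finite ?S" "?S ~= {}" using step_funs_finite_range f g by auto
  show "EX \<delta>>0. ALL x y. 0 <= x --> x <= y --> y <= t --> y - x < \<delta> --> {x<..<y} Int (B Un B') = {} -->
    norm (?\<Phi> y - ?\<Phi> x - (y - x) *\<^sub>R ?\<phi> x) <= e * (y - x)"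
  proof (intro exI[of _ "Min ?S"] conjI allI impI)
   show "0 < Min ?S" using S \<delta>(1) by (subst Min_gr_iff) auto
   fix x y assume xy: "0 <= x" "x <= y" "y <= t" "y - x < Min ?S" "{x<..<y} Int (B Un B') = {}"
   show "norm (?\<Phi> y - ?\<Phi> x - (y - x) *\<^sub>R ?\<phi> x) <= e * (y - x)"
   proof (cases "x = y")
   case False
   define h where "h = y - x"
   have y: "y = x + h" and h: "0 < h" using xy(2) False by (simp_all add: h_def)
   have gap: "{x<..<x + h} Int B = {}" "{x<..<x + h} Int B' = {}" using xy(5) unfolding y by auto
   let ?a = "Q (f x) (g x) h idL - idL - h *\<^sub>R gen (f x) (g x)"
   have a: "norm ?a <= h * (e / K)"
   proof -
    have "h < \<delta> (f x) (g x)" using xy(4) S by (auto simp: h_def)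
    then have "norm ((Q (f x) (g x) h idL - idL) /\<^sub>R h - gen (f x) (g x)) <= e / K"
     using \<delta>(2)[of h "f x" "g x"] h by (simp add: dist_norm)
    moreover have "?a = h *\<^sub>R ((Q (f x) (g x) h idL - idL) /\<^sub>R h - gen (f x) (g x))"
     using h by (simp add: scaleR_diff_right)
    ultimately show ?thesis using h by (simp only: norm_scaleR) (intro mult_mono, auto)
   qed
   have Yx: "norm (Y x (v ** g)) <= M * norm v"
    using M(2)[of x] xy g by (intro order_trans[OF norm_blinfun]) (auto simp: norm_tens mult_right_mono)
   have "norm (?\<Phi> y - ?\<Phi> x - (y - x) *\<^sub>R ?\<phi> x) =
     cmod (?\<Phi> (x + h) - ?\<Phi> x - h *\<^sub>R ip (u ** f) (j x (gen (f x) (g x)) (Y x (v ** g))))"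
    by (simp add: y cinner_tilde[OF F xy(1)] sl)
   also have "... <= norm u * (norm ?a * norm (Y x (v ** g)))"
    by (rule Y_matrix_increment[OF xy(1) less_imp_le[OF h] f B(2)[OF gap(1)] g B'(2)[OF gap(2)]])
   also have "... <= norm u * (h * (e / K) * (M * norm v))"
    using e K h by (intro mult_left_mono mult_mono a Yx) auto
   also have "... = (e * h) * ((norm u * (M * norm v)) / K)" by (simp add: mult_ac)
   also have "... <= (e * h) * 1" using K e h by (intro mult_left_mono) (auto simp: K_def)
   finally show ?thesis by (simp add: h_def)
   qed simp
  qed
 qed
 then show ?thesis by (simp add: Y_zero)
qed

lemma flow_strong_solution:
 assumes F: "F \<in> vn_tensor bops A" and sl: "!!c d. left_slice (1, c) (1, d) F = gen c d"
 shows "strong_solution A j F (as_process Y)"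
proof (rule strong_solutionI[OF F])
 show "op_process (as_process Y)" using Y_process by (simp add: bounded_process_in_def)
 show "\<zeta> \<in> exp_dom ==> continuous_on {0..} (%t. as_process Y t \<zeta>)" for \<zeta> by (simp add: as_process_def Y_continuous)
qed (simp add: as_process_def exp_dom_base flow_equation[OF F sl])

end

subsection \<open>Uniqueness of strong solutions\<close>

abbreviation "chi_past f g s \<equiv> chi (restr {0..<s} f) (restr {0..<s} g)"

lemma chi_past_gap:
 assumes f: "step f" and g: "step g" and xy: "0 <= x" "x <= y"
  and const: "!!s. x <= s ==> s < y ==> f s = c" "!!s. x <= s ==> s < y ==> g s = d"
 shows "chi_past f g y = chi_past f g x + of_real (y - x) * xi c d"
proof -
 have "restr {x..} (restr {0..<y} h) = (%s. restr {0..<y - x} (%_. e) (s - x))"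
  if "!!s. x <= s ==> s < y ==> h s = e" for h :: "real => 'a" and e using that xy by (auto simp: restr_def fun_eq_iff)
 note r = this[OF const(1)] this[OF const(2)]
 have i: "{0..<x} Int {0..<y} = {0..<x}" using xy by auto
 show ?thesis
  using chi_split[of "restr {0..<y} f" "restr {0..<y} g" x] f g xy by (simp add: r chi_shift chi_const i del: restr_restr) (simp add: i)
qed

lemma chi_past_derivative:
 assumes f: "step f" and g: "step g"
 obtains B where "finite B" "continuous_on {0..} (chi_past f g)"
  "!!s. 0 < s ==> s \<notin> B ==> (chi_past f g has_vector_derivative xi (f s) (g s)) (at s)"
proof -
 obtain B where B: "finite B" "ALL x y. x <= y --> {x<..y} Int B = {} --> f x = f y" using step_fun_breaks[OF f] by blast
 obtain B' where B': "finite B'" "ALL x y. x <= y --> {x<..y} Int B' = {} --> g x = g y" using step_fun_breaks[OF g] by blast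
 have gap: "chi_past f g y - chi_past f g x = of_real (y - x) * xi (f x) (g x)" if "0 <= x" "x <= y" "{x<..<y} Int (B Un B') = {}" for x y
 proof -
  have "f s = f x" "g s = g x" if s: "x <= s" "s < y" for s
  proof -
   have "{x<..s} Int (B Un B') = {}" using \<open>{x<..<y} Int (B Un B') = {}\<close> s by fastforce
   then show "f s = f x" "g s = g x" using B(2)[rule_format, OF s(1)] B'(2)[rule_format, OF s(1)] by (simp_all add: Int_Un_distrib)
  qed
  from chi_past_gap[OF f g that(1,2) this] show ?thesis by simp
 qed
 show ?thesis
 proof (rule that[of "B Un B'"])
  let ?R = "(%(c, d). cmod (xi c d)) ` (range f \<times> range g)"
  have R: "finite ?R" using step_funs_finite_range f g by auto
  have "norm (chi_past f g y - chi_past f g x) <= Max ?R * sqrt (y - x)"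
   if "0 <= x" "x <= y" "y - x < 1" "{x<..<y} Int (B Un B') = {}" for x y
  proof -
   have "norm (chi_past f g y - chi_past f g x) = cmod (xi (f x) (g x)) * (y - x)" unfolding gap[OF that(1,2,4)] norm_mult norm_of_real using that by (simp add: mult.commute)
   also have "... <= Max ?R * sqrt (y - x)"
    using that R by (intro mult_mono' Max_ge) (auto simp: real_le_rsqrt power2_eq_square mult_left_le intro!: image_eqI[of _ _ "(f x, g x)"])
   finally show ?thesis .
  qed
  then show "continuous_on {0..} (chi_past f g)"
   by (intro continuous_from_gaps[OF finite_UnI[OF B(1) B'(1)]] exI[of _ "Max ?R"] exI[of _ 1]) auto
  fix s :: real assume s: "0 < s" "s \<notin> B Un B'"
  have "((%y. (chi_past f g y - chi_past f g s - (y - s) *\<^sub>R xi (f s) (g s)) /\<^sub>R norm (y - s)) ---> 0) (at s)"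
  proof (rule tendsto_eventually)
   show "\<forall>\<^sub>F y in at s. (chi_past f g y - chi_past f g s - (y - s) *\<^sub>R xi (f s) (g s)) /\<^sub>R norm (y - s) = 0"
    using eventually_gap[OF finite_UnI[OF B(1) B'(1)] s(1), of s UNIV]
   proof eventually_elim
    case (elim y)
    show ?case
    proof (cases "s <= y")
     case True
     then show ?thesis using gap[of s y] s elim by (simp add: scaleR_conv_of_real)
    next
     case False
     then have "{y<..s} Int (B Un B') = {}" using elim s(2) by (auto simp: order_le_less)
     then have "f y = f s" "g y = g s" using B(2)[rule_format, of y s] B'(2)[rule_format, of y s] False by (simp_all add: Int_Un_distrib)
     then show ?thesis using gap[of y s] False elim by (simp add: scaleR_conv_of_real algebra_simps)
    qed
   qed
  qed
  then show "(chi_past f g has_vector_derivative xi (f s) (g s)) (at s)"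
   unfolding has_vector_derivative_def has_derivative_at_within by (simp add: bounded_linear_scaleR_left)
 qed (use B B' in auto)
qed

text \<open>Conditioning on the future being described by \<open>g\<close>: the Fock space after
  \<open>s\<close> is contracted against the exponential vector of \<open>g\<close>.\<close>

definition future_slice :: "(real => 'k) => real => ('h::chilbert, 'k::chilbert) hf =>L ('h, 'k) hf"
 where "future_slice g s = adj (tens_ket (\<varpi> (restr {s..} g))) oo split_at s"

lemma future_slice_expv:
 assumes "step g" "step f" "0 <= s"
 shows "future_slice g s (u ** f) = ip (\<varpi> (restr {s..} g)) (\<varpi> (restr {s..} f)) *\<^sub>C (u ** (restr {0..<s} f))"
 using assms by (simp add: future_slice_def)

lemma norm_future_slice_le:
 fixes z :: "('h::chilbert, 'k::chilbert) hf"
 assumes g: "step g" and s: "0 <= s"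
 shows "norm (future_slice g s z) <= norm z"
proof -
 have "norm (future_slice g s z) <= norm (adj (tens_ket (\<varpi> (restr {s..} g))) :: _ =>L ('h, 'k) hf) * norm (split_at s z)"
  unfolding future_slice_def by (simp add: norm_blinfun)
 also have "... <= 1 * norm z"
  using order_trans[OF norm_tens_ket_le, of "\<varpi> (restr {s..} g)" 1] g s isometry_norm[OF cinner_split_at[OF s], of z]
  by (intro mult_mono) (simp_all add: norm_adj)
 finally show ?thesis by simp
qed

text \<open>Only the pasts before \<open>s\<close> are paired with each other; after
  \<open>s\<close> each vector is paired with \<open>g\<close>. Written through
  \<open>chi_past\<close>, the exponent can be differentiated in \<open>s\<close>.\<close>

lemma cinner_future_slice:
 fixes g f f' :: "real => 'k::chilbert"
 assumes g: "step g" and f: "step f" and f': "step f'" and s: "0 <= s"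
 shows "ip (future_slice g s (u ** f)) (future_slice g s (u' ** f')) =
  ip u u' * exp (chi_past f f' s + (chi f g - chi_past f g s) + (chi g f' - chi_past g f' s))"
proof -
 have c: "chi h h' - chi_past h h' s = chi (restr {s..} h) (restr {s..} h')" if "step h" "step h'" for h h' :: "real => 'k"
  using chi_split[OF that s] by simp
 show ?thesis unfolding c[OF f g] c[OF g f']
  using cinner_commute[of "\<varpi> (restr {s..} g)" "\<varpi> (restr {s..} f)"] f f' g s
  by (simp add: future_slice_expv cinner_simps cinner_tens cinner_expv_chi exp_add mult_ac flip: exp_cnj)
qed

text \<open>The exponent has derivative
  \<open>xi (f s) (f' s) - xi (f s) (g s) - xi (g s) (f' s)\<close>, which \<open>xi_add\<close>
  turns into an inner product of increments relative to \<open>g\<close>.\<close>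

lemma future_slice_derivative:
 assumes g: "step g" and f: "step f" and f': "step f'"
 obtains B where "finite B" "continuous_on {0..} (%s. ip (future_slice g s (u ** f)) (future_slice g s (u' ** f')))"
  "!!s. 0 < s ==> s \<notin> B ==> ((%s. ip (future_slice g s (u ** f)) (future_slice g s (u' ** f'))) has_vector_derivative
   ip ((0 :: complex, f s - g s) \<otimes> future_slice g s (u ** f)) ((0, f' s - g s) \<otimes> future_slice g s (u' ** f'))) (at s)"
proof -
 let ?E = "%s. chi_past f f' s + (chi f g - chi_past f g s) + (chi g f' - chi_past g f' s)"
 let ?c = "%s. ip (future_slice g s (u ** f)) (future_slice g s (u' ** f'))"
 obtain B1 where B1: "finite B1" "continuous_on {0..} (chi_past f f')"
  "!!s. 0 < s ==> s \<notin> B1 ==> (chi_past f f' has_vector_derivative xi (f s) (f' s)) (at s)" using chi_past_derivative[OF f f'] by blast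
 obtain B2 where B2: "finite B2" "continuous_on {0..} (chi_past f g)"
  "!!s. 0 < s ==> s \<notin> B2 ==> (chi_past f g has_vector_derivative xi (f s) (g s)) (at s)" using chi_past_derivative[OF f g] by blast
 obtain B3 where B3: "finite B3" "continuous_on {0..} (chi_past g f')"
  "!!s. 0 < s ==> s \<notin> B3 ==> (chi_past g f' has_vector_derivative xi (g s) (f' s)) (at s)" using chi_past_derivative[OF g f'] by blast
 note c = cinner_future_slice[OF g f f', of _ u u']
 show ?thesis
 proof (rule that[of "B1 Un B2 Un B3"])
  show "continuous_on {0..} ?c"
   by (subst continuous_on_cong[OF refl c]) (auto intro!: continuous_intros B1 B2 B3)
  fix s :: real assume s: "0 < s" "s \<notin> B1 Un B2 Un B3"
  have "(?E has_vector_derivative xi (f s) (f' s) + (0 - xi (f s) (g s)) + (0 - xi (g s) (f' s))) (at s)"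
   using s by (intro has_vector_derivative_add has_vector_derivative_diff has_vector_derivative_const B1(3) B2(3) B3(3)) auto
  then have "(?E has_vector_derivative ip (f s - g s) (f' s - g s)) (at s)" unfolding xi_add[symmetric] by simp
  from field_vector_diff_chain_at[OF this DERIV_exp]
  have "((%s. ip u u' * exp (?E s)) has_vector_derivative ip u u' * (ip (f s - g s) (f' s - g s) * exp (?E s))) (at s)"
   by (intro has_vector_derivative_mult_right) (simp add: o_def mult.commute)
  then have "(?c has_vector_derivative ip u u' * (ip (f s - g s) (f' s - g s) * exp (?E s))) (at s)"
   by (rule has_vector_derivative_transform_within_open[of _ _ _ "{0<..}"]) (use s in \<open>auto simp: c\<close>)
  then show "(?c has_vector_derivative ip ((0 :: complex, f s - g s) \<otimes> future_slice g s (u ** f)) ((0, f' s - g s) \<otimes> future_slice g s (u' ** f'))) (at s)"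
   using s(1) by (simp add: cinner_tens cinner_prod_def cinner_complex_def c mult_ac)
 qed (use B1 B2 B3 in auto)
qed

lemma exp_dom_sum:
 assumes "\<zeta> \<in> (exp_dom :: ('h::chilbert, 'k::chilbert) hf set)"
 obtains n :: nat and u f where "!!i. f i \<in> step_funs" "\<zeta> = (\<Sum>i<n. u i ** (f i))"
proof -
 let ?S = "{u ** f | (u :: 'h) (f :: real => 'k). step f}"
 have "c *\<^sub>C x \<in> ?S" if "x \<in> ?S" for c x using that by (force simp flip: tens_scale_left)
 from cspan_closed_scale_sum[OF assms[unfolded exp_dom_cspan] this]
 obtain n :: nat and y where y: "ALL i<n. y i \<in> ?S" "\<zeta> = (\<Sum>i<n. y i)" by blast
 then have "ALL i. EX u f. step f & (i < n --> y i = u ** f)" using step_funs_zero by blast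
 then obtain u f where uf: "!!i. f i \<in> step_funs" "!!i. i < n ==> y i = u i ** (f i)" by metis
 show ?thesis by (rule that[where f = f and n = n and u = u]) (use uf y in auto)
qed

lemma norm_le_exp_dom:
 fixes x :: "('h::chilbert, 'k::chilbert) hf"
 assumes C: "!!\<zeta>. \<zeta> \<in> exp_dom ==> norm \<zeta> <= 1 ==> cmod (ip \<zeta> x) <= C"
 shows "norm x <= C"
proof (rule norm_le_cinner)
 show C0: "0 <= C" using C[of 0] by simp
 have dense: "closure (exp_dom :: ('h, 'k) hf set) = UNIV" unfolding exp_dom_cspan by (rule total_tens_expv)
 have cl: "closed {z. cmod (ip z x) <= C * norm z}"
  by (intro closed_Collect_le continuous_intros)
 have "exp_dom <= {z. cmod (ip z x) <= C * norm z}"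
 proof
  fix z :: "('h, 'k) hf" assume z: "z \<in> exp_dom"
  show "z \<in> {z. cmod (ip z x) <= C * norm z}"
  proof (cases "z = 0")
   case False
   then show ?thesis using C[of "complex_of_real (1 / norm z) *\<^sub>C z"] z
    by (simp add: norm_scaleC norm_divide cinner_simps norm_mult field_simps)
  qed simp
 qed
 from closure_minimal[OF this cl] show "cmod (ip z x) <= C * norm z" for z unfolding dense by auto
qed

text \<open>
 The derivative of the squared norm of the future slice is the squared norm of the integrand of a Clark-Ocone
 representation; this bounds the noise part of a quantum stochastic integral.
\<close>

lemma norm_future_slice_derivative:
 fixes n :: nat and u :: "nat => 'h::chilbert" and f :: "nat => real => 'k::chilbert"
 assumes g: "step g" and f: "!!i. f i \<in> step_funs"
 defines "\<zeta> \<equiv> (\<Sum>i<n. u i ** (f i))"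
 obtains B where "finite B" "continuous_on {0..} (%s. (norm (future_slice g s \<zeta>))\<^sup>2)"
  "!!s. 0 < s ==> s \<notin> B ==> ((%s. (norm (future_slice g s \<zeta>))\<^sup>2) has_vector_derivative
   (norm (\<Sum>i<n. (0 :: complex, f i s - g s) \<otimes> future_slice g s (u i ** (f i))))\<^sup>2) (at s)"
proof -
 let ?x = "%i. u i ** (f i)"
 let ?c = "%i k s. ip (future_slice g s (?x i)) (future_slice g s (?x k))"
 let ?w = "%s i. (0 :: complex, f i s - g s) \<otimes> future_slice g s (?x i)"
 let ?P = "%i k B. finite B & continuous_on {0..} (?c i k) &
   (ALL s. 0 < s --> s \<notin> B --> (?c i k has_vector_derivative ip (?w s i) (?w s k)) (at s))"
 define B where "B i k = (SOME B. ?P i k B)" for i k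
 have "?P i k (B i k)" for i k
  unfolding B_def
  by (rule someI_ex, rule future_slice_derivative[OF g f[of i] f[of k], of "u i" "u k"], rule exI, intro conjI allI impI; assumption?)
 note B = this[THEN conjunct1] this[THEN conjunct2, THEN conjunct1] this[THEN conjunct2, THEN conjunct2, rule_format]
 have e: "(norm (\<Sum>i<n. z i))\<^sup>2 = Re (\<Sum>i<n. \<Sum>k<n. ip (z i) (z k))" for z :: "nat => 'b::chilbert"
  unfolding norm_sq_cinner cinner_sum_left by (simp only: cinner_sum_right)
 show ?thesis
 proof (rule that[of "\<Union>i<n. \<Union>k<n. B i k"])
  show "continuous_on {0..} (%s. (norm (future_slice g s \<zeta>))\<^sup>2)"
   unfolding \<zeta>_def blinfun.sum_right e by (intro continuous_intros B)
  fix s :: real assume s: "0 < s" "s \<notin> (\<Union>i<n. \<Union>k<n. B i k)"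
  show "((%s. (norm (future_slice g s \<zeta>))\<^sup>2) has_vector_derivative (norm (\<Sum>i<n. ?w s i))\<^sup>2) (at s)"
   unfolding \<zeta>_def blinfun.sum_right e
   by (intro bounded_linear.has_vector_derivative[OF bounded_linear_Re] has_vector_derivative_sum B(3)) (use s in auto)
 qed (use B(1) in auto)
qed

context qs_flow
begin

text \<open>An exponentially weighted maximum argument. At the maximising time, a test vector splits
  the integrand into drift, where \<open>f i s\<close> is replaced by \<open>g s\<close>, and noise,
  which by adaptedness sees only the future slice of the test vector. The noise factor of the test
  vector has square integral at most 1, whatever its representation as a sum; a large weight then
  makes the total at most half of the maximum.\<close>

lemma solution_difference_zero:
 fixes D :: "('h, 'k) op_family"
 assumes F: "F \<in> vn_tensor bops A" and D: "!!s. 0 <= s ==> adapted_at s (D s)" and g: "step g"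
  and cont: "continuous_on {0..} (%s. D s (v ** g))" and T: "0 <= T"
  and eq: "!!t u f. 0 <= t ==> step f ==> ip (u ** f) (D t (v ** g)) =
   (LINT s|lebesgue_on {0..t}. ip ((1, f s) \<otimes> u ** f) (tilde_map A j s F ((1, g s) \<otimes> D s (v ** g))))"
 shows "D T (v ** g) = 0"
proof -
 define x where "x s = D s (v ** g)" for s
 define L where "L = Max (range (%s. norm (1 :: complex, g s)))"
 have L: "norm (1 :: complex, g s) <= L" for s
  unfolding L_def using finite_imageI[OF step_funs_finite_range[OF g], of "%c. norm (1 :: complex, c)"] by (intro Max_ge) (auto simp: image_image)
 have L0: "0 <= L" by (rule order_trans[OF norm_ge_zero L])
 define K where "K = norm F * L"
 have K: "0 <= K" using L0 by (simp add: K_def)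
 \<comment> \<open>Large enough for the final factor \<open>2 * K * (L + 1) / \<nu>\<close> to be at
   most 1; being at least 1, it satisfies \<nu> \<le> \<nu>^2.\<close>
 define \<nu> where "\<nu> = max 1 (2 * K * (L + 1))"
 have \<nu>: "1 <= \<nu>" "2 * K * (L + 1) <= \<nu>" "0 < \<nu>" by (auto simp: \<nu>_def)
 let ?e = "%s. exp (\<nu>\<^sup>2 * s)"
 have "continuous_on {0..T} (%s. norm (x s) / ?e s)"
  unfolding x_def by (intro continuous_intros continuous_on_subset[OF cont]) auto
 from continuous_attains_sup[OF compact_Icc _ this] T
 obtain t where t: "0 <= t" "t <= T" "!!s. 0 <= s ==> s <= T ==> norm (x s) / ?e s <= norm (x t) / ?e t" by auto
 define m where "m = norm (x t) / ?e t"
 have xm: "norm (x s) <= m * ?e s" if "0 <= s" "s <= T" for s using t(3)[OF that] by (simp add: m_def field_simps)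
 have m0: "0 <= m" by (simp add: m_def)
 \<comment> \<open>The left-hand side equals \<open>m * ?e t\<close>, so this estimate forces
   \<open>m = 0\<close>.\<close>
 have "norm (x t) <= m * ?e t / 2"
 proof (rule norm_le_exp_dom)
  fix \<zeta> :: "('h, 'k) hf" assume "\<zeta> \<in> exp_dom" and \<zeta>1: "norm \<zeta> <= 1"
  then obtain n :: nat and u f where f: "!!i. f i \<in> step_funs" and \<zeta>: "\<zeta> = (\<Sum>i<n. u i ** (f i))" using exp_dom_sum by blast
  define w where "w s = (\<Sum>i<n. (0 :: complex, f i s - g s) \<otimes> future_slice g s (u i ** (f i)))" for s
  define N where "N = (%s. (norm (future_slice g s \<zeta>))\<^sup>2)"
  have "EX B. finite B & continuous_on {0..} N & (ALL s. 0 < s --> s \<notin> B --> (N has_vector_derivative (norm (w s))\<^sup>2) (at s))"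
   unfolding N_def w_def \<zeta>
   by (rule norm_future_slice_derivative[where f = f and n = n and u = u, OF g f], rule exI, intro conjI allI impI; assumption?)
  then obtain B where B: "finite B" "continuous_on {0..} N" "ALL s. 0 < s --> s \<notin> B --> (N has_vector_derivative (norm (w s))\<^sup>2) (at s)"
   by (elim exE conjE)
  have N: "0 <= N s" "0 <= s ==> N s <= 1" for s
   using norm_future_slice_le[OF g, of s \<zeta>] \<zeta>1 by (auto simp: N_def power_le_one)
  define y where "y s z = tilde_map A j s F ((1, g s) \<otimes> D s (v ** z))" for s z
  define \<phi> where "\<phi> s = (\<Sum>i<n. ip ((1, f i s) \<otimes> u i ** (f i)) (y s g))" for s
  have pw: "piecewise (%s. ip ((1, f i s) \<otimes> u i ** (f i)) (y s g))" for i
   unfolding y_def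
   by (rule piecewise_bilinear[OF bounded_bilinear_cinner piecewise_step[OF f, of "%c. (1, c) \<otimes> u i ** (f i)"] piecewise_tilde[OF F cont g]])
  have int: "integrable (lebesgue_on {0..t}) \<phi>" unfolding \<phi>_def by (intro Bochner_Integration.integrable_sum integrable_piecewise pw)
  have "ip \<zeta> (x t) = (LINT s|lebesgue_on {0..t}. \<phi> s)"
   unfolding \<phi>_def \<zeta> cinner_sum_left x_def Bochner_Integration.integral_sum[OF integrable_piecewise[OF pw]] by (simp add: eq t f y_def)
  also have "... = integral {0..t} \<phi>" using int by (rule lebesgue_integral_eq_integral) simp
  finally have xt: "ip \<zeta> (x t) = integral {0..t} \<phi>" .
  \<comment> \<open>\<open>?\<psi>\<close> is the pointwise bound, its noise term split by a
    weighted arithmetic-geometric mean. \<open>?\<Psi>\<close> is an antiderivative of it, since the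
    derivative of \<open>N\<close> is the squared norm of \<open>w\<close>.\<close>
  let ?\<psi> = "%s. K * m * (L * ?e s + ?e t * (norm (w s))\<^sup>2 / (2 * \<nu>) + \<nu> * (?e s)\<^sup>2 / (2 * ?e t))"
  let ?\<Psi> = "%s. K * m * (L * ?e s / \<nu>\<^sup>2 + ?e t * N s / (2 * \<nu>) + (?e s)\<^sup>2 / (4 * \<nu> * ?e t))"
  have bound: "cmod (\<phi> s) <= ?\<psi> s" if s: "s \<in> {0..t}" for s
  proof -
   let ?g = "restr {0..<s} g"
   have s0: "0 <= s" "s <= T" using s t by auto
   \<comment> \<open>Drift plus noise relative to \<open>g\<close>. In the noise term the future
     factor of the matrix element is moved to the left, where it turns the test vector into its
     future slice.\<close>
   have "ip ((1, f i s) \<otimes> u i ** (f i)) (y s g) = ip ((1, g s) \<otimes> u i ** (f i)) (y s g) +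
     ip ((0, f i s - g s) \<otimes> future_slice g s (u i ** (f i))) (y s ?g)" for i
   proof -
    have "(1 :: complex, f i s) = (1, g s) + (0, f i s - g s)" by simp
    then have "ip ((1, f i s) \<otimes> u i ** (f i)) (y s g) = ip ((1, g s) \<otimes> u i ** (f i)) (y s g) +
      ip ((0, f i s - g s) \<otimes> u i ** (f i)) (y s g)" by (simp only: tens_add_left cinner_add_left)
    also have "ip ((0, f i s - g s) \<otimes> u i ** (f i)) (y s g) = ip ((0, f i s - g s) \<otimes> future_slice g s (u i ** (f i))) (y s ?g)"
     using adaptedD[OF j_compose_adapted[OF D[OF s0(1)] left_slice_tilde(1)[OF F s0(1)] s0(1)] f g, of "u i" i _ _ v]
      cinner_commute[of "\<varpi> (restr {s..} (f i))" "\<varpi> (restr {s..} g)"]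
     by (simp add: y_def cinner_tilde[OF F s0(1)] future_slice_expv f g s0 cinner_simps)
    finally show ?thesis .
   qed
   then have "\<phi> s = ip ((1, g s) \<otimes> \<zeta>) (y s g) + ip (w s) (y s ?g)"
    unfolding \<phi>_def \<zeta> w_def by (simp add: sum.distrib cinner_sum_left linear_sum[OF bounded_linear.linear[OF bounded_linear_tens_right]])
   moreover have y: "norm (y s z) <= K * (m * ?e s)" if "z = g \<or> z = ?g" for z
   proof -
    have "norm (y s z) <= norm F * (norm (1 :: complex, g s) * norm (x s))"
     using norm_tilde_le[OF F s0(1), of "(1, g s) \<otimes> D s (v ** z)"] norm_adapted[OF D[OF s0(1)] g s0(1), of v] that
     by (auto simp: y_def norm_tens x_def)
    also have "... <= norm F * (L * (m * ?e s))" by (intro mult_left_mono mult_mono L xm s0 L0) auto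
    finally show ?thesis by (simp add: K_def)
   qed
   have "cmod (ip ((1, g s) \<otimes> \<zeta>) (y s g)) <= (L * 1) * (K * (m * ?e s))"
    using L0 by (intro order_trans[OF cinner_CS] mult_mono y) (auto simp only: norm_tens intro!: mult_mono L \<zeta>1 mult_nonneg_nonneg norm_ge_zero zero_le_one)
   moreover have "cmod (ip (w s) (y s ?g)) <= norm (w s) * (K * (m * ?e s))"
    by (intro order_trans[OF cinner_CS] mult_left_mono y) auto
   ultimately have "cmod (\<phi> s) <= (L * 1) * (K * (m * ?e s)) + norm (w s) * (K * (m * ?e s))"
    by (simp only:) (rule norm_triangle_le, rule add_mono)
   also have "... = K * m * (L * ?e s + ?e s * norm (w s))" by (simp add: algebra_simps)
   also have "... <= K * m * (L * ?e s + (?e t * (norm (w s))\<^sup>2 / (2 * \<nu>) + \<nu> * (?e s)\<^sup>2 / (2 * ?e t)))"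
   proof (intro mult_left_mono add_left_mono)
    have "0 <= (?e t * norm (w s) - \<nu> * ?e s)\<^sup>2 / (2 * \<nu> * ?e t)" using \<nu> by simp
    also have "... = ?e t * (norm (w s))\<^sup>2 / (2 * \<nu>) + \<nu> * (?e s)\<^sup>2 / (2 * ?e t) - ?e s * norm (w s)"
     using \<nu> by (simp add: field_simps power2_eq_square)
    finally show "?e s * norm (w s) <= ?e t * (norm (w s))\<^sup>2 / (2 * \<nu>) + \<nu> * (?e s)\<^sup>2 / (2 * ?e t)" by simp
   qed (use K m0 in simp)
   finally show ?thesis by (simp add: add_ac)
  qed
  have hi: "(?\<psi> has_integral ?\<Psi> t - ?\<Psi> 0) {0..t}"
  proof (rule fundamental_theorem_of_calculus_interior_strong[OF B(1) t(1)])
   show "continuous_on {0..t} ?\<Psi>" using \<nu> by (intro continuous_intros continuous_on_subset[OF B(2)]) auto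
   fix s assume s: "s \<in> {0<..<t} - B"
   have "(N has_real_derivative (norm (w s))\<^sup>2) (at s)"
    using B(3)[rule_format, of s] s by (simp add: has_real_derivative_iff_has_vector_derivative)
   then have "(?\<Psi> has_real_derivative ?\<psi> s) (at s)"
    using \<nu> by (auto intro!: derivative_eq_intros simp: field_simps power2_eq_square)
   then show "(?\<Psi> has_vector_derivative ?\<psi> s) (at s)" by (simp add: has_real_derivative_iff_has_vector_derivative)
  qed
  have "cmod (ip \<zeta> (x t)) <= ?\<Psi> t - ?\<Psi> 0"
   unfolding xt integral_unique[OF hi, symmetric]
   by (rule integral_norm_bound_integral[OF integrable_on_lebesgue_on[OF int] has_integral_integrable[OF hi] bound]) auto
  also have "... <= ?\<Psi> t" using K m0 L0 N(1)[of 0] \<nu> by simp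
  also have "... <= K * m * (L * ?e t / \<nu> + ?e t * 1 / (2 * \<nu>) + ?e t / (4 * \<nu>))"
  proof (intro mult_left_mono add_mono divide_right_mono)
   have "\<nu> * 1 <= \<nu> * \<nu>" using \<nu> by (intro mult_left_mono) auto
   then show "L * ?e t / \<nu>\<^sup>2 <= L * ?e t / \<nu>" using \<nu> L0 by (intro divide_left_mono) (auto simp: power2_eq_square)
   show "(?e t)\<^sup>2 / (4 * \<nu> * ?e t) <= ?e t / (4 * \<nu>)" using \<nu> by (simp add: power2_eq_square)
  qed (use N(2)[OF t(1)] K m0 \<nu> in auto)
  also have "... <= K * m * (?e t * (L + 1) / \<nu>)"
   using K m0 L0 \<nu> by (intro mult_left_mono) (auto simp: field_simps)
  also have "... = (m * ?e t) * (2 * K * (L + 1) / \<nu>) / 2" by simp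
  also have "... <= (m * ?e t) * 1 / 2" using \<nu> m0 by (intro divide_right_mono mult_left_mono) auto
  finally show "cmod (ip \<zeta> (x t)) <= m * ?e t / 2" by simp
 qed
 then have "norm (x t) <= 0" by (simp add: m_def)
 then have "m = 0" by (simp add: m_def)
 then show ?thesis using xm[OF T order_refl] by (simp add: x_def)
qed

end

section \<open>Uniqueness of the solution and of its coefficient\<close>

context qs_flow
begin

lemma strong_solution_unique:
 assumes F: "F \<in> vn_tensor bops A" and Z: "strong_solution A j F Z" and Z': "strong_solution A j F Z'" and t: "0 <= t"
 shows "Z t = Z' t"
proof -
 note p = strong_solution_process[OF F Z] strong_solution_process[OF F Z']
 note c = strong_solution_continuous[OF F Z] strong_solution_continuous[OF F Z']
 have base: "Z t (v ** g) = Z' t (v ** g)" if g: "step g" for v g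
 proof -
  let ?D = "%s x. Z s x - Z' s x"
  have "?D t (v ** g) = 0"
  proof (rule solution_difference_zero[OF F _ g _ t, where D = ?D])
   show "adapted_at s (?D s)" if "0 <= s" for s by (intro adapted_diff process_adapted p that)
   show "continuous_on {0..} (%s. ?D s (v ** g))" by (intro continuous_intros c exp_dom_base g)
   fix t :: real and u f assume t: "0 <= t" and f: "f \<in> (step_funs :: (real => 'k) set)"
   have pw: "integrable (lebesgue_on {0..t}) (%s. ip ((1, f s) \<otimes> u ** f) (tilde_map A j s F ((1, g s) \<otimes> X s)))"
    if "continuous_on {0..} X" for X :: "real => ('h, 'k) hf"
    by (rule integrable_piecewise[OF piecewise_bilinear[OF bounded_bilinear_cinner
     piecewise_step[OF f, of "%c. (1, c) \<otimes> u ** f"] piecewise_tilde[OF F that g]]])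
   show "ip (u ** f) (?D t (v ** g)) =
     (LINT s|lebesgue_on {0..t}. ip ((1, f s) \<otimes> u ** f) (tilde_map A j s F ((1, g s) \<otimes> ?D s (v ** g))))"
    unfolding cinner_diff_right strong_solution_equation[OF F Z t f g] strong_solution_equation[OF F Z' t f g]
     tens_diff_right blinfun.diff_right Bochner_Integration.integral_diff[OF pw[OF c(1)[OF exp_dom_base[OF g]]] pw[OF c(2)[OF exp_dom_base[OF g]]]]
    by simp
  qed
  then show ?thesis by simp
 qed
 have "Z t \<zeta> = Z' t \<zeta>" if "\<zeta> \<in> exp_dom" for \<zeta>
  by (rule exp_dom_linear_eq[of "Z t" "Z' t", OF _ _ base that]) (use p t in \<open>auto simp: op_process_def\<close>)
 then show ?thesis using p t by (intro extensionalityI[of _ exp_dom]) (auto simp: op_process_def)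
qed

text \<open>The test functions are constant near 0, so the integrand of the equation is continuous
  there, and its value at 0 is a matrix element of \<open>F\<close> times a nonzero factor from the
  exponential vectors.\<close>

lemma strong_solution_generator:
 assumes F: "F \<in> vn_tensor bops A" and Z: "strong_solution A j F Z" and zero: "!!\<zeta>. \<zeta> \<in> exp_dom ==> Z 0 \<zeta> = \<zeta>"
 shows "((%t. ip (u ** (restr {0..<1} (%_. c))) (Z t (v ** (restr {0..<1} (%_. d))))) has_vector_derivative
  ip ((1, c) \<otimes> u) (F ((1, d) \<otimes> v)) * exp (xi c d)) (at 0 within {0..1/2})"
proof -
 let ?f = "restr {0..<1} (%_. c)" and ?g = "restr {0..<1} (%_. d)"
 let ?\<phi> = "%s. ip ((1, c) \<otimes> u ** ?f) (tilde_map A j s F ((1, d) \<otimes> Z s (v ** ?g)))"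
 have st: "step ?f" "step ?g" by simp_all
 have "continuous_on {0..} (%s. tilde_map A j s F ((1, d) \<otimes> Z s (v ** ?g)))"
  unfolding continuous_on_def
  by (intro ballI tilde_tendsto[OF F] bounded_linear.tendsto[OF bounded_linear_tens_right]
   strong_solution_continuous[OF F Z, unfolded continuous_on_def, rule_format] exp_dom_base st) auto
 then have cont: "continuous_on {0..} ?\<phi>" by (rule bounded_bilinear.continuous_on[OF bounded_bilinear_cinner continuous_on_const])
 have "((%t. integral {0..t} ?\<phi>) has_vector_derivative ?\<phi> 0) (at 0 within {0..1/2})"
  by (rule integral_has_vector_derivative[OF continuous_on_subset[OF cont]]) auto
 then have "((%t. ip (u ** ?f) (v ** ?g) + integral {0..t} ?\<phi>) has_vector_derivative 0 + ?\<phi> 0) (at 0 within {0..1/2})"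
  by (intro has_vector_derivative_add has_vector_derivative_const)
 then have "((%t. ip (u ** ?f) (Z t (v ** ?g))) has_vector_derivative 0 + ?\<phi> 0) (at 0 within {0..1/2})"
 proof (rule has_vector_derivative_transform[rotated 2])
  fix t :: real assume t: "t \<in> {0..1/2}"
  have "(LINT s|lebesgue_on {0..t}. ip ((1, ?f s) \<otimes> u ** ?f) (tilde_map A j s F ((1, ?g s) \<otimes> Z s (v ** ?g)))) =
    (LINT s|lebesgue_on {0..t}. ?\<phi> s)"
   using t by (intro Bochner_Integration.integral_cong) (auto simp: restr_def)
  also have "... = integral {0..t} ?\<phi>"
   by (rule lebesgue_integral_eq_integral[OF integrable_piecewise[OF piecewise_continuous[OF cont]]]) simp
  finally show "ip (u ** ?f) (Z t (v ** ?g)) = ip (u ** ?f) (v ** ?g) + integral {0..t} ?\<phi>"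
   using strong_solution_equation[OF F Z _ st, of t u v] t by simp
 qed simp
 moreover have "j 0 (left_slice (1, c) (1, d) F) = \<iota> (left_slice (1, c) (1, d) F)"
  using flow left_slice_tilde(1)[OF F order_refl] unfolding QS_flow_def QS_cocycle_def by blast
 ultimately show ?thesis
  using vn_tensor_bops[OF F] by (simp add: zero exp_dom_base cinner_tilde[OF F] ampl_map_def cinner_tens cinner_left_slice cinner_expv_chi chi_const)
qed

lemma generator_unique:
 assumes F: "F \<in> vn_tensor bops A" "strong_solution A j F Z" and F': "F' \<in> vn_tensor bops A" "strong_solution A j F' Z"
  and zero: "!!\<zeta>. \<zeta> \<in> exp_dom ==> Z 0 \<zeta> = \<zeta>"
 shows "F = F'"
proof (rule bops_eq_on_total[OF _ _ total_hat])
 show "bop F" "bop F'" using F(1) F'(1) vn_tensor_bops by auto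
 fix x assume "x \<in> range (%(c :: 'k, u :: 'h). (1 :: complex, c) \<otimes> u)"
 then obtain d v where x: "x = (1, d) \<otimes> v" by auto
 show "F x = F' x"
 proof (rule total_ext[OF total_hat])
  fix z assume "z \<in> range (%(c :: 'k, u :: 'h). (1 :: complex, c) \<otimes> u)"
  then obtain c u where z: "z = (1, c) \<otimes> u" by auto
  have "ip z (F x) * exp (xi c d) = ip z (F' x) * exp (xi c d)"
   unfolding x z
   by (rule vector_derivative_unique_within[OF _ strong_solution_generator[OF F zero] strong_solution_generator[OF F' zero]])
    (auto simp: trivial_limit_within islimpt_Icc)
  then show "ip z (F x) = ip z (F' x)" by simp
 qed
qed

end

theorem theorem6p2:
  fixes A :: "('h::chilbert \<Rightarrow>\<^sub>L 'h) set"
    and j k :: "('h, 'k::chilbert) map_family"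
    and Y :: "('h, 'k) bop_family"
  assumes "von_neumann_algebra A"
    and "QS_flow A j"
    and "multiplier_cocycle A j Y"
    and "locally_uniformly_bounded Y"
    and "k = assoc_cocycle j Y"
    and "\<forall>\<epsilon>\<in>exp_space. Limsup (at_right 0) (\<lambda>t. ereal (t powr (-1/2)) *
      (cb_norm A (\<lambda>a. ket_map (k t) \<epsilon> a - ket_map \<iota> \<epsilon> a) +
       cb_norm A (\<lambda>a. ket_map (dagger k t) \<epsilon> a - ket_map \<iota> \<epsilon> a))) < \<infinity>"
  shows "\<exists>!F. F \<in> vn_tensor bops A \<and> is_perturbation_process A j F (as_process Y)"
proof -
 interpret multiplier_flow A j Y
  using assms by unfold_locales auto
 obtain F where F: "F \<in> vn_tensor bops A" "!!c d. left_slice (1 :: complex, c) (1, d) F = gen c d"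
  using generator_operator_exists by blast
 note sol = flow_strong_solution[OF F]
 show ?thesis
 proof (rule ex1I[of _ F])
  show "F \<in> vn_tensor bops A & is_perturbation_process A j F (as_process Y)"
   unfolding is_perturbation_process_def using F(1) sol strong_solution_unique[OF F(1) _ sol] by blast
  fix F' assume F': "F' \<in> vn_tensor bops A & is_perturbation_process A j F' (as_process Y)"
  show "F' = F"
   by (rule generator_unique[OF _ _ F(1) sol]) (use F' in \<open>auto simp: is_perturbation_process_def as_process_def Y_zero\<close>)
 qed
qed

end
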